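(* Let $\mathbb K$ be an algebraically closed field of characteristic $3$. Let $\mathfrak e_7=\mathfrak g(A)$ with purely even Cartan matrix $$A=\begin{pmatrix}2&0&-1&0&0&0&0\\0&2&0&-1&0&0&0\\-1&0&2&-1&0&0&0\\0&-1&-1&2&-1&0&0\\0&0&0&-1&2&-1&0\\0&0&0&0&-1&2&-1\\0&0&0&0&0&-1&2\end{pmatrix}.$$ Let $\mathfrak g(4,6)=\mathfrak g(\widetilde A)$ be the Elduque and Cunha Lie superalgebra with Cartan matrix $$\widetilde A=\begin{pmatrix}2&0&-1&0&0&0\\0&0&-1&0&0&0\\-1&-1&2&-1&0&0\\0&0&-1&2&-1&0\\0&0&0&-1&2&-1\\0&0&0&0&-1&2\end{pmatrix}$$ in which index $2$ is odd and the others are even. Then the semisimplification of $\mathfrak e_7$, as an object in $\mathrm{Rep}\,\alpha_3$ under the adjoint action of $e_1$, is (isomorphic as a Lie superalgebra to) $\mathfrak g(4,6)$.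
   Context: **Contragredient Lie superalgebras.** Lie superalgebras in characteristic $3$ are required to satisfy $[x,[x,x]]=0$ for odd $x$. Let $A=(a_{ij})$ be an $n\times n$ integer matrix (a Cartan matrix) with a parity $\mathrm{par}(i)\in\mathbb Z/2$ for each index; let $\overline A=(\overline a_{ij})$ be its reduction mod $3$, of rank $s$. Let $\widetilde{\mathfrak h}$ be a $\mathbb K$-vector space of dimension $2n-s$ with linearly independent $h_1,\dots,h_n\in\widetilde{\mathfrak h}$ and linearly independent $\alpha_1,\dots,\alpha_n\in\widetilde{\mathfrak h}^*$ such that $\alpha_j(h_i)=\overline a_{ij}$. $\widetilde{\mathfrak g}(A)$ is the Lie superalgebra generated by $\widetilde{\mathfrak h}$ (even) and $e_i,f_i$ ($1\le i\le n$) of parity $\mathrm{par}(i)$, with relations $[e_i,f_j]=\delta_{ij}h_i$, $[h,e_j]=\alpha_j(h)e_j$, $[h,f_j]=-\alpha_j(h)f_j$, $[\widetilde{\mathfrak h},\widetilde{\mathfrak h}]=0$. It is graded by the free abelian group $Q=\bigoplus_k\mathbb Z\alpha_k$ with $\deg e_i=\alpha_i$, $\deg f_i=-\alpha_i$, $\deg h=0$. $\mathfrak g(A)=\widetilde{\mathfrak g}(A)/\mathfrak r$, where $\mathfrak r$ is the largest $Q$-graded ideal meeting $\widetilde{\mathfrak h}$ trivially; images of $e_i,f_i,h_i$ keep their names. If all parities are $0$, $\mathfrak g(A)$ is a Lie algebra. **Semisimplification.** $\mathrm{Rep}\,\alpha_3$ (representations of the Frobenius kernel of $\mathbb G_a$)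 is the symmetric tensor category of finite-dimensional $\mathbb K[t]/(t^3)$-modules, with $t$ acting on $V\otimes W$ by $t\otimes1+1\otimes t$ and the flip as braiding. Its indecomposables are $J_1,J_2,J_3$, where $t$ acts on $J_n=\mathbb K^n$ as one nilpotent Jordan block. A Lie algebra $\mathfrak g$ with a derivation $d$, $d^3=0$, is a Lie algebra in $\mathrm{Rep}\,\alpha_3$ with $t$ acting by $d$; "under the adjoint action of $x$" means $d=\mathrm{ad}\,x$. The semisimplification functor $V\mapsto\overline V$ is the quotient of $\mathrm{Rep}\,\alpha_3$ by negligible morphisms ($u:V\to W$ with $\mathrm{tr}(u\circ v)=0$ for all $v:W\to V$), with target the Verlinde category $\mathrm{Ver}_3$, whose simple objects are $L_1=\overline{J_1}$, $L_2=\overline{J_2}$ ($\overline{J_3}=0$); $\mathrm{Ver}_3$ is identified with super vector spaces, $L_1$ being an even line and $L_2$ an odd line, so $\overline{\mathfrak g}$ is a Lie superalgebra. Explicitly, decompose $\mathfrak g$ into Jordan blocks $x_i$ ($i\le n_1$), $x_i\mapsto x_i'$ ($n_1<i\le n_1+n_2$), and blocks $x_i\mapsto x_i'\mapsto x_i''$ (arrows are the action of $d$). Then $\overline{\mathfrak g}$ has basis $y_i$ ($i\le n_1+n_2$), even for $i\le n_1$ and odd for $i>n_1$; the coefficient of $y_k$ in $[y_i,y_j]$ is the coefficient of $x_k$ in $[x_i,x_j]$ if the parities of $y_i,y_j,y_k$ are compatible and $y_i,y_j$ are not both odd; it is the coefficient of $x_k$ in $-[x_i,x_j']+[x_i',x_j]$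 if $i,j>n_1$, $k\le n_1$; and $0$ otherwise. *)

theory Defs
  imports
    "HOL-Analysis.Cartesian_Space"
    "HOL-Analysis.Determinants"
    "HOL-Algebra.Algebraic_Closure_Type"
    "HOL-Library.Poly_Mapping"
    "HOL-Library.Numeral_Type"
begin

text \<open>
  The ground field is a type of class \<^class>\<open>field\<close>, turned into a ring record by
  \<^const>\<open>ring_of_type_algebra\<close>, so that vector spaces with carriers are the modules of
  HOL-Algebra.
\<close>

abbreviation scalars :: "'k::field ring" where
  "scalars \<equiv> ring_of_type_algebra"

section \<open>Lie superalgebras in characteristic 3\<close>

text \<open>
  The field \<^const>\<open>monoid.mult\<close> is the (super)bracket and \<^const>\<open>monoid.one\<close> is meaningless.
  \<open>part L False\<close> and \<open>part L True\<close> are the even and the odd part; parities add by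
  \<open>\<noteq>\<close>.
\<close>

record ('k, 'a) superalgebra = "('k, 'a) module" +
  part :: "bool \<Rightarrow> 'a set"

definition koszul :: "bool \<Rightarrow> bool \<Rightarrow> 'k::field" where
  "koszul p q = (if p \<and> q then - 1 else 1)"

locale lie_superalgebra =
  Module.module "scalars :: 'k ring" L for L :: "('k::field, 'a, 'm) superalgebra_scheme" +
  assumes part_submodule: "submodule (part L p) (scalars :: 'k ring) L"
    and part_Int: "part L False \<inter> part L True = {\<zero>\<^bsub>L\<^esub>}"
    and part_sum: "carrier L = part L False <+>\<^bsub>L\<^esub> part L True"
    and bracket_closed: "\<lbrakk>x \<in> carrier L; y \<in> carrier L\<rbrakk> \<Longrightarrow> x \<otimes>\<^bsub>L\<^esub> y \<in> carrier L"
    and bracket_add_left: "\<lbrakk>x \<in> carrier L; y \<in> carrier L; z \<in> carrier L\<rbrakk> \<Longrightarrow>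
      (x \<oplus>\<^bsub>L\<^esub> y) \<otimes>\<^bsub>L\<^esub> z = (x \<otimes>\<^bsub>L\<^esub> z) \<oplus>\<^bsub>L\<^esub> (y \<otimes>\<^bsub>L\<^esub> z)"
    and bracket_add_right: "\<lbrakk>x \<in> carrier L; y \<in> carrier L; z \<in> carrier L\<rbrakk> \<Longrightarrow>
      x \<otimes>\<^bsub>L\<^esub> (y \<oplus>\<^bsub>L\<^esub> z) = (x \<otimes>\<^bsub>L\<^esub> y) \<oplus>\<^bsub>L\<^esub> (x \<otimes>\<^bsub>L\<^esub> z)"
    and bracket_smult_left: "\<lbrakk>x \<in> carrier L; y \<in> carrier L\<rbrakk> \<Longrightarrow>
      (c \<odot>\<^bsub>L\<^esub> x) \<otimes>\<^bsub>L\<^esub> y = c \<odot>\<^bsub>L\<^esub> (x \<otimes>\<^bsub>L\<^esub> y)"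
    and bracket_smult_right: "\<lbrakk>x \<in> carrier L; y \<in> carrier L\<rbrakk> \<Longrightarrow>
      x \<otimes>\<^bsub>L\<^esub> (c \<odot>\<^bsub>L\<^esub> y) = c \<odot>\<^bsub>L\<^esub> (x \<otimes>\<^bsub>L\<^esub> y)"
    and bracket_part: "\<lbrakk>x \<in> part L p; y \<in> part L q\<rbrakk> \<Longrightarrow> x \<otimes>\<^bsub>L\<^esub> y \<in> part L (p \<noteq> q)"
    and super_skew: "\<lbrakk>x \<in> part L p; y \<in> part L q\<rbrakk> \<Longrightarrow>
      x \<otimes>\<^bsub>L\<^esub> y = \<ominus>\<^bsub>L\<^esub> (koszul p q \<odot>\<^bsub>L\<^esub> (y \<otimes>\<^bsub>L\<^esub> x))"
    and super_jacobi: "\<lbrakk>x \<in> part L p; y \<in> part L q; z \<in> part L r\<rbrakk> \<Longrightarrow>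
      x \<otimes>\<^bsub>L\<^esub> (y \<otimes>\<^bsub>L\<^esub> z) =
        ((x \<otimes>\<^bsub>L\<^esub> y) \<otimes>\<^bsub>L\<^esub> z) \<oplus>\<^bsub>L\<^esub> (koszul p q \<odot>\<^bsub>L\<^esub> (y \<otimes>\<^bsub>L\<^esub> (x \<otimes>\<^bsub>L\<^esub> z)))"
    and odd_cube: "x \<in> part L True \<Longrightarrow> x \<otimes>\<^bsub>L\<^esub> (x \<otimes>\<^bsub>L\<^esub> x) = \<zero>\<^bsub>L\<^esub>"

definition superalgebra_iso ::
    "('k, 'a, 'm) superalgebra_scheme \<Rightarrow> ('k, 'b, 'n) superalgebra_scheme \<Rightarrow> bool"
    (infix "\<cong>\<^sub>s" 50) where
  "L \<cong>\<^sub>s M \<longleftrightarrow> (\<exists>\<phi>. bij_betw \<phi> (carrier L) (carrier M) \<and>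
     (\<forall>x\<in>carrier L. \<forall>y\<in>carrier L.
        \<phi> (x \<oplus>\<^bsub>L\<^esub> y) = \<phi> x \<oplus>\<^bsub>M\<^esub> \<phi> y \<and> \<phi> (x \<otimes>\<^bsub>L\<^esub> y) = \<phi> x \<otimes>\<^bsub>M\<^esub> \<phi> y) \<and>
     (\<forall>c. \<forall>x\<in>carrier L. \<phi> (c \<odot>\<^bsub>L\<^esub> x) = c \<odot>\<^bsub>M\<^esub> \<phi> x) \<and>
     (\<forall>p. \<phi> ` part L p = part M p))"

definition bracket_ideal :: "('k::field, 'a, 'm) superalgebra_scheme \<Rightarrow> 'a set \<Rightarrow> bool" where
  "bracket_ideal L I \<longleftrightarrow> submodule I (scalars :: 'k ring) L \<and>
     (\<forall>x\<in>carrier L. \<forall>y\<in>I. x \<otimes>\<^bsub>L\<^esub> y \<in> I \<and> y \<otimes>\<^bsub>L\<^esub> x \<in> I)"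

definition parity_graded :: "('k, 'a, 'm) superalgebra_scheme \<Rightarrow> 'a set \<Rightarrow> bool" where
  "parity_graded L I \<longleftrightarrow> I = (I \<inter> part L False) <+>\<^bsub>L\<^esub> (I \<inter> part L True)"

definition superquotient :: "('k, 'a, 'm) superalgebra_scheme \<Rightarrow> 'a set \<Rightarrow> ('k, 'a set) superalgebra"
  where "superquotient L I =
    \<lparr>carrier = a_rcosets\<^bsub>L\<^esub> I, monoid.mult = rcoset_mult L I, one = undefined,
     ring.zero = I, add = set_add L,
     module.smult = (\<lambda>c A. \<Union>x\<in>A. I +>\<^bsub>L\<^esub> (c \<odot>\<^bsub>L\<^esub> x)),
     part = (\<lambda>p. (\<lambda>x. I +>\<^bsub>L\<^esub> x) ` part L p)\<rparr>"

section \<open>Generators and relations\<close>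

datatype 'x magma = Gen 'x | Br "'x magma" "'x magma"

primrec magma_eval :: "('x \<Rightarrow> 'b) \<Rightarrow> ('b \<Rightarrow> 'b \<Rightarrow> 'b) \<Rightarrow> 'x magma \<Rightarrow> 'b" where
  "magma_eval f m (Gen x) = f x"
| "magma_eval f m (Br s t) = m (magma_eval f m s) (magma_eval f m t)"

definition fscale :: "'k::field \<Rightarrow> ('x magma \<Rightarrow>\<^sub>0 'k) \<Rightarrow> ('x magma \<Rightarrow>\<^sub>0 'k)" where
  "fscale c a = Poly_Mapping.map ((*) c) a"

definition fbracket :: "('x magma \<Rightarrow>\<^sub>0 'k::field) \<Rightarrow> ('x magma \<Rightarrow>\<^sub>0 'k) \<Rightarrow> ('x magma \<Rightarrow>\<^sub>0 'k)" where
  "fbracket a b = (\<Sum>s\<in>Poly_Mapping.keys a. \<Sum>t\<in>Poly_Mapping.keys b.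
     Poly_Mapping.single (Br s t) (Poly_Mapping.lookup a s * Poly_Mapping.lookup b t))"

definition free_superalgebra ::
    "('x \<Rightarrow> bool) \<Rightarrow> ('k::field, 'x magma \<Rightarrow>\<^sub>0 'k) superalgebra" where
  "free_superalgebra par =
    \<lparr>carrier = UNIV, monoid.mult = fbracket, one = undefined, ring.zero = 0, add = (+),
     module.smult = fscale,
     part = (\<lambda>p. {a. \<forall>t\<in>Poly_Mapping.keys a. magma_eval par (\<noteq>) t = p})\<rparr>"

text \<open>
  The smallest ideal containing \<open>Rel\<close> modulo which the free nonassociative superalgebra becomes a
  Lie superalgebra; the quotient is the Lie superalgebra presented by \<open>Rel\<close>.
\<close>

definition presentation_ideal ::
    "('x \<Rightarrow> bool) \<Rightarrow> ('x magma \<Rightarrow>\<^sub>0 'k::field) set \<Rightarrow> ('x magma \<Rightarrow>\<^sub>0 'k) set" where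
  "presentation_ideal par Rel =
     \<Inter> {I. bracket_ideal (free_superalgebra par) I \<and> parity_graded (free_superalgebra par) I \<and>
         lie_superalgebra (superquotient (free_superalgebra par) I) \<and> Rel \<subseteq> I}"

definition presented_lie_superalgebra ::
    "('x \<Rightarrow> bool) \<Rightarrow> ('x magma \<Rightarrow>\<^sub>0 'k::field) set \<Rightarrow> ('k, ('x magma \<Rightarrow>\<^sub>0 'k) set) superalgebra"
  where "presented_lie_superalgebra par Rel =
     superquotient (free_superalgebra par) (presentation_ideal par Rel)"

definition presented_class ::
    "('x \<Rightarrow> bool) \<Rightarrow> ('x magma \<Rightarrow>\<^sub>0 'k::field) set \<Rightarrow> ('x magma \<Rightarrow>\<^sub>0 'k) \<Rightarrow> ('x magma \<Rightarrow>\<^sub>0 'k) set"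
  where "presented_class par Rel a = presentation_ideal par Rel +>\<^bsub>free_superalgebra par\<^esub> a"

section \<open>Contragredient Lie superalgebras\<close>

text \<open>
  The type \<open>'h\<close> is the vector space usually written h with a tilde, and the finite type \<open>'n\<close>
  indexes the rows and columns of the Cartan matrix.
\<close>

record ('k, 'h, 'n) realization =
  hscale :: "'k \<Rightarrow> 'h \<Rightarrow> 'h"
  coroot :: "'n \<Rightarrow> 'h"
  simple_root :: "'n \<Rightarrow> 'h \<Rightarrow> 'k"

text \<open>
  \<open>dim UNIV\<close> is \<open>0\<close> in the infinite-dimensional case, and the required dimension is positive, so
  the dimension condition includes finite-dimensionality.
\<close>

definition is_realization ::
    "int ^ 'n ^ 'n \<Rightarrow> ('k::field, 'h::ab_group_add, 'n::finite) realization \<Rightarrow> bool" where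
  "is_realization A R \<longleftrightarrow>
     vector_space (hscale R) \<and>
     vector_space.dim (hscale R) (UNIV :: 'h set) =
       2 * CARD('n) - rank (\<chi> i j. of_int (A $ i $ j) :: 'k ^ 'n ^ 'n) \<and>
     inj (coroot R) \<and> \<not> module.dependent (hscale R) (range (coroot R)) \<and>
     (\<forall>j. Vector_Spaces.linear (hscale R) (*) (simple_root R j)) \<and>
     (\<forall>c :: 'n \<Rightarrow> 'k. (\<forall>x. (\<Sum>j\<in>UNIV. c j * simple_root R j x) = 0) \<longrightarrow> (\<forall>j. c j = 0)) \<and>
     (\<forall>i j. simple_root R j (coroot R i) = of_int (A $ i $ j))"

datatype ('h, 'n) generator = GenH 'h | GenE 'n | GenF 'n

primrec gen_parity :: "('n \<Rightarrow> bool) \<Rightarrow> ('h, 'n) generator \<Rightarrow> bool" where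
  "gen_parity par (GenH x) = False"
| "gen_parity par (GenE i) = par i"
| "gen_parity par (GenF i) = par i"

text \<open>
  Weights lie in \<open>int ^ 'n\<close>, the free abelian group on the simple roots \<open>axis k 1\<close>; they are not
  the functionals \<open>simple_root R k\<close>.
\<close>

primrec gen_weight :: "('h, 'n::finite) generator \<Rightarrow> int ^ 'n" where
  "gen_weight (GenH x) = 0"
| "gen_weight (GenE i) = axis i 1"
| "gen_weight (GenF i) = - axis i 1"

definition gen :: "'x \<Rightarrow> ('x magma \<Rightarrow>\<^sub>0 'k::field)" where
  "gen x = Poly_Mapping.single (Gen x) 1"

text \<open>
  The first two families of relations make the vector space operations of \<open>'h\<close> those of the
  algebra.
\<close>

definition chevalley_relations ::
    "('k::field, 'h::ab_group_add, 'n) realization \<Rightarrow> (('h, 'n) generator magma \<Rightarrow>\<^sub>0 'k) set" where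
  "chevalley_relations R =
     {gen (GenH (x + y)) - (gen (GenH x) + gen (GenH y)) | x y. True} \<union>
     {gen (GenH (hscale R c x)) - fscale c (gen (GenH x)) | c x. True} \<union>
     {fbracket (gen (GenE i)) (gen (GenF j)) - (if i = j then gen (GenH (coroot R i)) else 0)
        | i j. True} \<union>
     {fbracket (gen (GenH x)) (gen (GenE j)) - fscale (simple_root R j x) (gen (GenE j)) | x j. True} \<union>
     {fbracket (gen (GenH x)) (gen (GenF j)) + fscale (simple_root R j x) (gen (GenF j)) | x j. True} \<union>
     {fbracket (gen (GenH x)) (gen (GenH y)) | x y. True}"

definition contragredient_tilde ::
    "('n \<Rightarrow> bool) \<Rightarrow> ('k::field, 'h::ab_group_add, 'n) realization \<Rightarrow>
     ('k, (('h, 'n) generator magma \<Rightarrow>\<^sub>0 'k) set) superalgebra" where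
  "contragredient_tilde par R =
     presented_lie_superalgebra (gen_parity par) (chevalley_relations R)"

definition tilde_class ::
    "('n \<Rightarrow> bool) \<Rightarrow> ('k::field, 'h::ab_group_add, 'n) realization \<Rightarrow>
     (('h, 'n) generator magma \<Rightarrow>\<^sub>0 'k) \<Rightarrow> (('h, 'n) generator magma \<Rightarrow>\<^sub>0 'k) set" where
  "tilde_class par R a = presented_class (gen_parity par) (chevalley_relations R) a"

definition tilde_cartan ::
    "('n \<Rightarrow> bool) \<Rightarrow> ('k::field, 'h::ab_group_add, 'n) realization \<Rightarrow>
     (('h, 'n) generator magma \<Rightarrow>\<^sub>0 'k) set set" where
  "tilde_cartan par R = range (\<lambda>x. tilde_class par R (gen (GenH x)))"

definition tilde_weight_space ::
    "('n \<Rightarrow> bool) \<Rightarrow> ('k::field, 'h::ab_group_add, 'n::finite) realization \<Rightarrow> int ^ 'n \<Rightarrow>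
     (('h, 'n) generator magma \<Rightarrow>\<^sub>0 'k) set set" where
  "tilde_weight_space par R \<beta> =
     tilde_class par R ` {a. \<forall>t\<in>Poly_Mapping.keys a. magma_eval gen_weight (+) t = \<beta>}"

definition weight_graded ::
    "('n \<Rightarrow> bool) \<Rightarrow> ('k::field, 'h::ab_group_add, 'n::finite) realization \<Rightarrow>
     (('h, 'n) generator magma \<Rightarrow>\<^sub>0 'k) set set \<Rightarrow> bool" where
  "weight_graded par R J \<longleftrightarrow>
     (\<forall>x\<in>J. \<exists>B y. finite B \<and> y \<in> (\<Pi> \<beta>\<in>B. J \<inter> tilde_weight_space par R \<beta>) \<and>
        x = finsum (contragredient_tilde par R) y B)"

definition maximal_ideal_r ::
    "('n \<Rightarrow> bool) \<Rightarrow> ('k::field, 'h::ab_group_add, 'n::finite) realization \<Rightarrow>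
     (('h, 'n) generator magma \<Rightarrow>\<^sub>0 'k) set set" where
  "maximal_ideal_r par R =
     (GREATEST J. bracket_ideal (contragredient_tilde par R) J \<and> weight_graded par R J \<and>
        J \<inter> tilde_cartan par R = {\<zero>\<^bsub>contragredient_tilde par R\<^esub>})"

definition contragredient ::
    "('n \<Rightarrow> bool) \<Rightarrow> ('k::field, 'h::ab_group_add, 'n::finite) realization \<Rightarrow>
     ('k, (('h, 'n) generator magma \<Rightarrow>\<^sub>0 'k) set set) superalgebra" where
  "contragredient par R = superquotient (contragredient_tilde par R) (maximal_ideal_r par R)"

definition chevalley_e ::
    "('n \<Rightarrow> bool) \<Rightarrow> ('k::field, 'h::ab_group_add, 'n::finite) realization \<Rightarrow> 'n \<Rightarrow>
     (('h, 'n) generator magma \<Rightarrow>\<^sub>0 'k) set set" where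
  "chevalley_e par R i =
     maximal_ideal_r par R +>\<^bsub>contragredient_tilde par R\<^esub> tilde_class par R (gen (GenE i))"

definition ad :: "('k, 'a, 'm) superalgebra_scheme \<Rightarrow> 'a \<Rightarrow> 'a \<Rightarrow> 'a" where
  "ad L x y = x \<otimes>\<^bsub>L\<^esub> y"

section \<open>Representations of the Frobenius kernel and negligible morphisms\<close>

text \<open>An object is a vector space \<open>V\<close> together with an operator \<open>t\<close> on it.\<close>

definition linear_maps ::
    "('k, 'a, 'm) module_scheme \<Rightarrow> ('k, 'b, 'n) module_scheme \<Rightarrow> ('a \<Rightarrow> 'b) set" where
  "linear_maps V W = {u \<in> carrier V \<rightarrow>\<^sub>E carrier W.
     (\<forall>x\<in>carrier V. \<forall>y\<in>carrier V. u (x \<oplus>\<^bsub>V\<^esub> y) = u x \<oplus>\<^bsub>W\<^esub> u y) \<and>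
     (\<forall>c. \<forall>x\<in>carrier V. u (c \<odot>\<^bsub>V\<^esub> x) = c \<odot>\<^bsub>W\<^esub> u x)}"

definition rep_hom ::
    "('k, 'a, 'm) module_scheme \<Rightarrow> ('a \<Rightarrow> 'a) \<Rightarrow> ('k, 'b, 'n) module_scheme \<Rightarrow> ('b \<Rightarrow> 'b) \<Rightarrow>
     ('a \<Rightarrow> 'b) set" where
  "rep_hom V t W s = {u \<in> linear_maps V W. \<forall>x\<in>carrier V. u (t x) = s (u x)}"

definition dual_bases ::
    "('k::field, 'a, 'm) module_scheme \<Rightarrow> nat \<Rightarrow> (nat \<Rightarrow> 'a) \<Rightarrow> (nat \<Rightarrow> 'a \<Rightarrow> 'k) \<Rightarrow> bool" where
  "dual_bases V n b \<xi> \<longleftrightarrow>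
     (\<forall>i<n. b i \<in> carrier V \<and>
        (\<forall>x\<in>carrier V. \<forall>y\<in>carrier V. \<xi> i (x \<oplus>\<^bsub>V\<^esub> y) = \<xi> i x + \<xi> i y) \<and>
        (\<forall>c. \<forall>x\<in>carrier V. \<xi> i (c \<odot>\<^bsub>V\<^esub> x) = c * \<xi> i x)) \<and>
     (\<forall>i<n. \<forall>j<n. \<xi> i (b j) = (if i = j then 1 else 0)) \<and>
     (\<forall>x\<in>carrier V. x = finsum V (\<lambda>i. \<xi> i x \<odot>\<^bsub>V\<^esub> b i) {..<n})"

definition finite_dim :: "('k::field, 'a, 'm) module_scheme \<Rightarrow> bool" where
  "finite_dim V \<longleftrightarrow> (\<exists>n b \<xi>. dual_bases V n b \<xi>)"

definition lin_trace :: "('k::field, 'a, 'm) module_scheme \<Rightarrow> ('a \<Rightarrow> 'a) \<Rightarrow> 'k" where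
  "lin_trace V u = (THE c. \<exists>n b \<xi>. dual_bases V n b \<xi> \<and> c = (\<Sum>i<n. \<xi> i (u (b i))))"

definition negligible ::
    "('k::field, 'a, 'm) module_scheme \<Rightarrow> ('a \<Rightarrow> 'a) \<Rightarrow> ('k, 'b, 'n) module_scheme \<Rightarrow> ('b \<Rightarrow> 'b) \<Rightarrow>
     ('a \<Rightarrow> 'b) \<Rightarrow> bool" where
  "negligible V t W s u \<longleftrightarrow> u \<in> rep_hom V t W s \<and>
     (\<forall>v\<in>rep_hom W s V t. lin_trace W (\<lambda>x. u (v x)) = 0)"

text \<open>
  The Jordan block \<open>J\<^sub>n\<close> is \<open>K\<^sup>n\<close>, realised as the functions vanishing outside \<open>{..<n}\<close>, with
  \<open>jvec 0 \<mapsto> jvec 1 \<mapsto> \<dots> \<mapsto> jvec (n - 1) \<mapsto> 0\<close> under \<open>jordan_shift n\<close>.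
\<close>

definition jordan :: "nat \<Rightarrow> ('k::field, nat \<Rightarrow> 'k) module" where
  "jordan n = \<lparr>carrier = {v. \<forall>i\<ge>n. v i = 0}, monoid.mult = undefined, one = undefined,
     ring.zero = (\<lambda>_. 0), add = (\<lambda>v w i. v i + w i), module.smult = (\<lambda>c v i. c * v i)\<rparr>"

definition jordan_shift :: "nat \<Rightarrow> (nat \<Rightarrow> 'k::field) \<Rightarrow> (nat \<Rightarrow> 'k)" where
  "jordan_shift n v = (\<lambda>i. if 0 < i \<and> i < n then v (i - 1) else 0)"

definition jvec :: "nat \<Rightarrow> nat \<Rightarrow> 'k::field" where
  "jvec i = (\<lambda>j. if j = i then 1 else 0)"

section \<open>Semisimplification\<close>

definition lie_algebra_in_Rep_alpha3 ::
    "('k::field, 'a, 'm) superalgebra_scheme \<Rightarrow> ('a \<Rightarrow> 'a) \<Rightarrow> bool" where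
  "lie_algebra_in_Rep_alpha3 L d \<longleftrightarrow>
     lie_superalgebra L \<and> part L True = {\<zero>\<^bsub>L\<^esub>} \<and> finite_dim L \<and>
     restrict d (carrier L) \<in> linear_maps L L \<and>
     (\<forall>x\<in>carrier L. \<forall>y\<in>carrier L. d (x \<otimes>\<^bsub>L\<^esub> y) = (d x \<otimes>\<^bsub>L\<^esub> y) \<oplus>\<^bsub>L\<^esub> (x \<otimes>\<^bsub>L\<^esub> d y)) \<and>
     (\<forall>x\<in>carrier L. d (d (d x)) = \<zero>\<^bsub>L\<^esub>)"

text \<open>
  An object \<open>X\<close> of the Verlinde category is identified with the superspace with even part
  \<open>Hom(L\<^sub>1, X)\<close> and odd part \<open>Hom(L\<^sub>2, X)\<close>.  For the image \<open>X\<close> of \<open>(L, d)\<close> these are the spaces of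
  morphisms from \<open>J\<^sub>1\<close> and \<open>J\<^sub>2\<close> to \<open>L\<close>, modulo negligible ones.  The superspace of morphisms
  is defined first.

  The bracket of \<open>u\<close> and \<open>w\<close>, defined on \<open>J\<^sub>p\<close> and \<open>J\<^sub>q\<close>, is the composite of \<open>u \<otimes> w\<close> and the bracket
  of \<open>L\<close> with the following morphism to \<open>J\<^sub>p \<otimes> J\<^sub>q\<close>, whose image in the Verlinde category is an
  isomorphism (\<open>b0 = jvec 0\<close>, \<open>b1 = jvec 1\<close>):
  \<open>b0 \<mapsto> b0 \<otimes> b0\<close> if \<open>p = q = 1\<close>;
  \<open>x \<mapsto> b0 \<otimes> x\<close> or \<open>x \<mapsto> x \<otimes> b0\<close> (on \<open>J\<^sub>2\<close>) if exactly one of \<open>p, q\<close> is \<open>2\<close>;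
  \<open>b0 \<mapsto> b1 \<otimes> b0 - b0 \<otimes> b1\<close> if \<open>p = q = 2\<close>.
  With \<open>x\<^sub>i = u (b0)\<close>, \<open>x\<^sub>i' = u (b1)\<close>, \<open>x\<^sub>j = w (b0)\<close>, \<open>x\<^sub>j' = w (b1)\<close> the
  last case is \<open>- [x\<^sub>i, x\<^sub>j'] + [x\<^sub>i', x\<^sub>j]\<close>.
\<close>

definition hom_superalgebra ::
    "('k::field, 'a, 'm) superalgebra_scheme \<Rightarrow> ('a \<Rightarrow> 'a) \<Rightarrow>
     ('k, ((nat \<Rightarrow> 'k) \<Rightarrow> 'a) \<times> ((nat \<Rightarrow> 'k) \<Rightarrow> 'a)) superalgebra" where
  "hom_superalgebra L d =
    (let H1 = rep_hom (jordan 1) (jordan_shift 1) L d;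
         H2 = rep_hom (jordan 2) (jordan_shift 2) L d;
         z1 = (\<lambda>x\<in>carrier (jordan 1). \<zero>\<^bsub>L\<^esub>); z2 = (\<lambda>x\<in>carrier (jordan 2). \<zero>\<^bsub>L\<^esub>)
     in \<lparr>carrier = H1 \<times> H2,
         monoid.mult = (\<lambda>(f, u) (g, w).
           (\<lambda>x\<in>carrier (jordan 1). x 0 \<odot>\<^bsub>L\<^esub>
              ((f (jvec 0) \<otimes>\<^bsub>L\<^esub> g (jvec 0)) \<oplus>\<^bsub>L\<^esub>
              ((\<ominus>\<^bsub>L\<^esub> (u (jvec 0) \<otimes>\<^bsub>L\<^esub> w (jvec 1))) \<oplus>\<^bsub>L\<^esub> (u (jvec 1) \<otimes>\<^bsub>L\<^esub> w (jvec 0)))),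
            \<lambda>x\<in>carrier (jordan 2). (f (jvec 0) \<otimes>\<^bsub>L\<^esub> w x) \<oplus>\<^bsub>L\<^esub> (u x \<otimes>\<^bsub>L\<^esub> g (jvec 0)))),
         one = undefined,
         ring.zero = (z1, z2),
         add = (\<lambda>(f, u) (g, w).
           (\<lambda>x\<in>carrier (jordan 1). f x \<oplus>\<^bsub>L\<^esub> g x,
            \<lambda>x\<in>carrier (jordan 2). u x \<oplus>\<^bsub>L\<^esub> w x)),
         module.smult = (\<lambda>c (f, u).
           (\<lambda>x\<in>carrier (jordan 1). c \<odot>\<^bsub>L\<^esub> f x,
            \<lambda>x\<in>carrier (jordan 2). c \<odot>\<^bsub>L\<^esub> u x)),
         part = (\<lambda>p. if p then {z1} \<times> H2 else H1 \<times> {z2})\<rparr>)"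

definition semisimplification ::
    "('k::field, 'a, 'm) superalgebra_scheme \<Rightarrow> ('a \<Rightarrow> 'a) \<Rightarrow>
     ('k, (((nat \<Rightarrow> 'k) \<Rightarrow> 'a) \<times> ((nat \<Rightarrow> 'k) \<Rightarrow> 'a)) set) superalgebra" where
  "semisimplification L d = superquotient (hom_superalgebra L d)
     {(f, u). negligible (jordan 1) (jordan_shift 1) L d f \<and>
             negligible (jordan 2) (jordan_shift 2) L d u}"

section \<open>The two Cartan matrices\<close>

text \<open>
  The entries of \<^const>\<open>vector\<close> have indices \<open>1, 2, \<dots>\<close>; the last index is \<open>7 = 0\<close> in the type
  \<open>7\<close> and \<open>6 = 0\<close> in the type \<open>6\<close>.
\<close>

definition cartan_e7 :: "int ^ 7 ^ 7" where
  "cartan_e7 = vector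
    [vector [ 2,  0, -1,  0,  0,  0,  0],
     vector [ 0,  2,  0, -1,  0,  0,  0],
     vector [-1,  0,  2, -1,  0,  0,  0],
     vector [ 0, -1, -1,  2, -1,  0,  0],
     vector [ 0,  0,  0, -1,  2, -1,  0],
     vector [ 0,  0,  0,  0, -1,  2, -1],
     vector [ 0,  0,  0,  0,  0, -1,  2]]"

definition cartan_g46 :: "int ^ 6 ^ 6" where
  "cartan_g46 = vector
    [vector [ 2,  0, -1,  0,  0,  0],
     vector [ 0,  0, -1,  0,  0,  0],
     vector [-1, -1,  2, -1,  0,  0],
     vector [ 0,  0, -1,  2, -1,  0],
     vector [ 0,  0,  0, -1,  2, -1],
     vector [ 0,  0,  0,  0, -1,  2]]"

end

theory Submission
  imports Defs
begin

text \<open>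
  A Lie superalgebra with a weight decomposition that is generated by elements satisfying the
  Chevalley relations is \<open>g(A)\<close> as soon as every nonzero vector of weight \<open>\<beta> \<noteq> 0\<close> has a nonzero
  bracket with some vector of weight \<open>- \<beta>\<close>, since this forces the graded ideals that miss the Cartan
  subalgebra to vanish.  In this way \<open>g(A)\<close> for E7 is the Lie algebra on a Cartan subalgebra and the
  roots of the lattice E7, with signs from a bimultiplicative cocycle.

  Pairing with \<open>\<alpha>\<^sub>1\<close> grades this algebra by \<open>-2, \<dots>, 2\<close>, and \<open>d = ad e\<^sub>1\<close> has degree 2.  Its Jordan blocks of
  size 3 span the \<open>sl\<^sub>2\<close> of \<open>\<alpha>\<^sub>1\<close>, those of size 2 are \<open>x \<mapsto> d x\<close> for \<open>x\<close> of degree \<open>-1\<close>, and those of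
  size 1 span the centralizer of the \<open>sl\<^sub>2\<close>.  So the semisimplification is this centralizer plus
  the component of degree \<open>-1\<close>, now odd, with bracket \<open>[d x, y] - [x, d y]\<close>.  It is generated by the
  root vectors of the nodes other than \<open>1\<close> and their opposites, the only odd node being the
  neighbour of node 1, and the same recognition criterion identifies it with \<open>g(4,6)\<close>: modulo 3
  its Cartan matrix has the entries \<open>a\<^sub>i\<^sub>j + a\<^sub>i\<^sub>1 a\<^sub>1\<^sub>j\<close>.
\<close>

text \<open>Both sides of the isomorphism are quotients of quotients of a free nonassociative
  algebra, so nothing can be computed in them directly. Everything goes through surjections onto
  algebras with a known basis. The delicate point is that a graded ideal missing the Cartan
  subalgebra lies in the kernel: the weight 0 part of the presented algebra must be no larger than
  the Cartan subalgebra, which is the triangular decomposition.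

  The new Cartan matrix is an orthogonal projection away from \<alpha>_1: the projected entries are
  a_ij - a_i1 a_1j / 2, and -1/2 = 1 modulo 3. Characteristic 3 enters three more times. The Cartan
  elements that pair opposite weights must be nonzero modulo 3; they come from lattice vectors of
  half norm 1 or 3, not divisible by 9. The Jacobi identity for three odd elements holds only up to
  multiples of 3. And [x,[x,x]] = 0 for odd x does not follow from it, so it is checked on root
  vectors. Finally, the image of a Jordan block need not be homogeneous in the grading, so brackets
  are compared on components of lowest degree.\<close>

no_notation fps_nth (infixl \<open>$\<close> 75)

section \<open>Quotients by kernels\<close>

text \<open>The source is a bare record on which no algebra laws are assumed; they are recovered
  from the target. \<open>solvable\<close> stands in for subtraction, which has no meaning until the
  source is known to be an abelian group.\<close>

locale super_epi =
  fixes \<phi> :: "'a \<Rightarrow> 'b" and D :: "('k::field, 'a, 'm) superalgebra_scheme"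
    and Y :: "('k, 'b, 'n) superalgebra_scheme"
  assumes zero_mem: "\<zero>\<^bsub>D\<^esub> \<in> carrier D" and map_zero: "\<phi> \<zero>\<^bsub>D\<^esub> = \<zero>\<^bsub>Y\<^esub>"
    and add_closed: "\<lbrakk>x \<in> carrier D; y \<in> carrier D\<rbrakk> \<Longrightarrow> x \<oplus>\<^bsub>D\<^esub> y \<in> carrier D"
    and map_add: "\<lbrakk>x \<in> carrier D; y \<in> carrier D\<rbrakk> \<Longrightarrow> \<phi> (x \<oplus>\<^bsub>D\<^esub> y) = \<phi> x \<oplus>\<^bsub>Y\<^esub> \<phi> y"
    and mult_closed: "\<lbrakk>x \<in> carrier D; y \<in> carrier D\<rbrakk> \<Longrightarrow> x \<otimes>\<^bsub>D\<^esub> y \<in> carrier D"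
    and map_mult: "\<lbrakk>x \<in> carrier D; y \<in> carrier D\<rbrakk> \<Longrightarrow> \<phi> (x \<otimes>\<^bsub>D\<^esub> y) = \<phi> x \<otimes>\<^bsub>Y\<^esub> \<phi> y"
    and scale_closed: "x \<in> carrier D \<Longrightarrow> c \<odot>\<^bsub>D\<^esub> x \<in> carrier D"
    and map_smult: "x \<in> carrier D \<Longrightarrow> \<phi> (c \<odot>\<^bsub>D\<^esub> x) = c \<odot>\<^bsub>Y\<^esub> \<phi> x"
    and map_carrier: "\<phi> ` carrier D = carrier Y"
    and part_subset: "part D p \<subseteq> carrier D"
    and map_part: "\<phi> ` part D p = part Y p"
    and solvable: "\<lbrakk>x \<in> carrier D; y \<in> carrier D\<rbrakk> \<Longrightarrow> \<exists>i\<in>carrier D. i \<oplus>\<^bsub>D\<^esub> y = x"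
begin

definition ker :: "'a set" where "ker = {x \<in> carrier D. \<phi> x = \<zero>\<^bsub>Y\<^esub>}"

definition quotient_map :: "'a set \<Rightarrow> 'b" where "quotient_map A = the_elem (\<phi> ` A)"

lemma map_in: "x \<in> carrier D \<Longrightarrow> \<phi> x \<in> carrier Y"
  using map_carrier by blast

end

locale super_epi_lie = super_epi \<phi> D Y + Y?: lie_superalgebra Y
  for \<phi> :: "'a \<Rightarrow> 'b" and D :: "('k::field, 'a, 'm) superalgebra_scheme"
    and Y :: "('k, 'b, 'n) superalgebra_scheme"
begin

text \<open>An element with the same image differs from \<open>x\<close> by some \<open>i\<close>,
  by \<open>solvable\<close>, and cancelling in \<open>Y\<close> puts \<open>i\<close> in the
  kernel. Once cosets are fibres, all operations on the quotient can be read off in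
  \<open>Y\<close>.\<close>

lemma coset_eq_fibre:
  assumes x: "x \<in> carrier D"
  shows "ker +>\<^bsub>D\<^esub> x = {y \<in> carrier D. \<phi> y = \<phi> x}"
proof (intro equalityI subsetI)
  fix y assume "y \<in> ker +>\<^bsub>D\<^esub> x"
  then obtain i where "i \<in> carrier D" "\<phi> i = \<zero>\<^bsub>Y\<^esub>" "y = i \<oplus>\<^bsub>D\<^esub> x"
    by (auto simp: a_r_coset_def' ker_def)
  then show "y \<in> {y \<in> carrier D. \<phi> y = \<phi> x}" using x by (simp add: add_closed map_add map_in)
next
  fix y assume y: "y \<in> {y \<in> carrier D. \<phi> y = \<phi> x}"
  obtain i where i: "i \<in> carrier D" "i \<oplus>\<^bsub>D\<^esub> x = y" using solvable[of y x] x y by auto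
  have "\<phi> i \<oplus>\<^bsub>Y\<^esub> \<phi> x = \<phi> x" using map_add[OF i(1) x] i y by simp
  then have "\<phi> i = \<zero>\<^bsub>Y\<^esub>" using map_in[OF i(1)] map_in[OF x]
    by (metis Y.M.add.r_cancel Y.M.l_zero Y.M.zero_closed)
  then show "y \<in> ker +>\<^bsub>D\<^esub> x" using i by (auto simp: a_r_coset_def' ker_def)
qed

abbreviation Q where "Q \<equiv> superquotient D ker"

abbreviation cl where "cl x \<equiv> ker +>\<^bsub>D\<^esub> x"

lemma cl_eq_iff: "\<lbrakk>x \<in> carrier D; y \<in> carrier D\<rbrakk> \<Longrightarrow> cl x = cl y \<longleftrightarrow> \<phi> x = \<phi> y"
  by (auto simp: coset_eq_fibre)

lemma carrier_Q: "carrier Q = cl ` carrier D"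
  by (auto simp: superquotient_def A_RCOSETS_def' )

lemma quotient_map_cl: "x \<in> carrier D \<Longrightarrow> quotient_map (cl x) = \<phi> x"
proof -
  assume x: "x \<in> carrier D"
  then have "\<phi> ` cl x = {\<phi> x}" by (auto simp: coset_eq_fibre)
  then show ?thesis by (simp add: quotient_map_def)
qed

lemma zero_Q: "\<zero>\<^bsub>Q\<^esub> = cl \<zero>\<^bsub>D\<^esub>"
  using zero_mem by (simp add: superquotient_def coset_eq_fibre map_zero) (simp add: ker_def)

lemma add_Q:
  assumes "x \<in> carrier D" "y \<in> carrier D"
  shows "cl x \<oplus>\<^bsub>Q\<^esub> cl y = cl (x \<oplus>\<^bsub>D\<^esub> y)"
proof -
  have "cl x <+>\<^bsub>D\<^esub> cl y = cl (x \<oplus>\<^bsub>D\<^esub> y)"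
  proof (intro equalityI subsetI)
    fix z assume "z \<in> cl (x \<oplus>\<^bsub>D\<^esub> y)"
    then have z: "z \<in> carrier D" "\<phi> z = \<phi> x \<oplus>\<^bsub>Y\<^esub> \<phi> y"
      using assms by (auto simp: coset_eq_fibre add_closed map_add)
    obtain a where a: "a \<in> carrier D" "a \<oplus>\<^bsub>D\<^esub> y = z" using solvable z(1) assms(2) by blast
    have "\<phi> a = \<phi> x" using a z assms by (metis map_add map_in Y.M.add.r_cancel)
    then show "z \<in> cl x <+>\<^bsub>D\<^esub> cl y" using a assms
      by (auto simp: coset_eq_fibre set_add_def')
  qed (use assms in \<open>auto simp: coset_eq_fibre add_closed map_add set_add_def'\<close>)
  then show ?thesis by (simp add: superquotient_def)
qed

lemma mult_Q:
  assumes "x \<in> carrier D" "y \<in> carrier D"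
  shows "cl x \<otimes>\<^bsub>Q\<^esub> cl y = cl (x \<otimes>\<^bsub>D\<^esub> y)"
proof -
  have "cl (a \<otimes>\<^bsub>D\<^esub> b) = cl (x \<otimes>\<^bsub>D\<^esub> y)" if "a \<in> cl x" "b \<in> cl y" for a b
    using that assms by (subst cl_eq_iff) (auto simp: coset_eq_fibre mult_closed map_mult)
  moreover have "x \<in> cl x" "y \<in> cl y" using assms by (auto simp: coset_eq_fibre)
  ultimately have "(\<Union>a\<in>cl x. \<Union>b\<in>cl y. cl (a \<otimes>\<^bsub>D\<^esub> b)) = cl (x \<otimes>\<^bsub>D\<^esub> y)" by blast
  then show ?thesis by (simp add: superquotient_def rcoset_mult_def)
qed

lemma smult_Q:
  assumes "x \<in> carrier D"
  shows "c \<odot>\<^bsub>Q\<^esub> cl x = cl (c \<odot>\<^bsub>D\<^esub> x)"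
proof -
  have "cl (c \<odot>\<^bsub>D\<^esub> a) = cl (c \<odot>\<^bsub>D\<^esub> x)" if "a \<in> cl x" for a
    using that assms by (subst cl_eq_iff) (auto simp: coset_eq_fibre scale_closed map_smult)
  moreover have "x \<in> cl x" using assms by (auto simp: coset_eq_fibre)
  ultimately have "(\<Union>a\<in>cl x. cl (c \<odot>\<^bsub>D\<^esub> a)) = cl (c \<odot>\<^bsub>D\<^esub> x)" by blast
  then show ?thesis by (simp add: superquotient_def)
qed

lemma part_Q: "part Q p = cl ` part D p"
  by (simp add: superquotient_def)

lemma inj_quotient_map: "inj_on quotient_map (carrier Q)"
  by (auto simp: inj_on_def carrier_Q quotient_map_cl cl_eq_iff)

lemma super_epi_quotient_map: "super_epi quotient_map Q Y"
proof
  fix p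
  show "quotient_map ` part Q p = part Y p"
    unfolding part_Q image_image map_part[symmetric] using part_subset
    by (intro image_cong) (auto intro: quotient_map_cl)
  show "part Q p \<subseteq> carrier Q" using part_subset by (auto simp: part_Q carrier_Q)
next
  fix x y assume "x \<in> carrier Q" "y \<in> carrier Q"
  then obtain a b where a: "a \<in> carrier D" "x = cl a" and b: "b \<in> carrier D" "y = cl b"
    by (auto simp: carrier_Q)
  obtain i where "i \<in> carrier D" "i \<oplus>\<^bsub>D\<^esub> b = a" using solvable a b by blast
  then show "\<exists>i\<in>carrier Q. i \<oplus>\<^bsub>Q\<^esub> y = x" using a b
    by (auto simp: carrier_Q add_Q)
qed (use map_carrier in \<open>auto simp: carrier_Q add_Q mult_Q smult_Q zero_Q quotient_map_cl add_closed mult_closed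
      scale_closed map_add map_mult map_smult zero_mem map_zero image_image\<close>)

end

locale super_iso = super_epi_lie \<phi> D Y
  for \<phi> :: "'a \<Rightarrow> 'b" and D :: "('k::field, 'a, 'm) superalgebra_scheme"
    and Y :: "('k, 'b, 'n) superalgebra_scheme" +
  assumes inj: "inj_on \<phi> (carrier D)"
begin

lemma eq_iff: "\<lbrakk>x \<in> carrier D; y \<in> carrier D\<rbrakk> \<Longrightarrow> x = y \<longleftrightarrow> \<phi> x = \<phi> y"
  using inj by (auto simp: inj_on_def)

text \<open>By injectivity each law in \<open>D\<close> may be tested after applying \<phi>, where
  it is a law of \<open>Y\<close>. The Lie axioms below are transported by the same
  principle.\<close>

lemma module_D: "Module.module (scalars :: 'k ring) D"
proof -
  note [simp] = map_in zero_mem add_closed mult_closed scale_closed map_zero map_add map_mult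
    map_smult
  have ab: "abelian_group D"
  proof (rule abelian_groupI)
    fix x assume x: "x \<in> carrier D"
    then show "\<exists>y\<in>carrier D. y \<oplus>\<^bsub>D\<^esub> x = \<zero>\<^bsub>D\<^esub>" by (intro solvable) simp_all
  next
    fix x y z assume "x \<in> carrier D" "y \<in> carrier D" "z \<in> carrier D"
    then show "x \<oplus>\<^bsub>D\<^esub> y \<oplus>\<^bsub>D\<^esub> z = x \<oplus>\<^bsub>D\<^esub> (y \<oplus>\<^bsub>D\<^esub> z)"
      by (simp add: eq_iff Y.M.a_assoc)
  next
    fix x y assume "x \<in> carrier D" "y \<in> carrier D"
    then show "x \<oplus>\<^bsub>D\<^esub> y = y \<oplus>\<^bsub>D\<^esub> x"
      by (simp add: eq_iff Y.M.a_comm)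
  qed (simp_all add: eq_iff)
  show ?thesis
  proof (rule moduleI)
    fix a b x assume "a \<in> carrier (scalars :: 'k ring)" "b \<in> carrier (scalars :: 'k ring)" "x \<in> carrier D"
    then show "(a \<oplus>\<^bsub>scalars\<^esub> b) \<odot>\<^bsub>D\<^esub> x = a \<odot>\<^bsub>D\<^esub> x \<oplus>\<^bsub>D\<^esub> b \<odot>\<^bsub>D\<^esub> x"
      "(a \<otimes>\<^bsub>scalars\<^esub> b) \<odot>\<^bsub>D\<^esub> x = a \<odot>\<^bsub>D\<^esub> (b \<odot>\<^bsub>D\<^esub> x)"
      by (simp_all add: eq_iff Y.smult_l_distr Y.smult_assoc1)
  next
    fix a x y assume "a \<in> carrier (scalars :: 'k ring)" "x \<in> carrier D" "y \<in> carrier D"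
    then show "a \<odot>\<^bsub>D\<^esub> (x \<oplus>\<^bsub>D\<^esub> y) = a \<odot>\<^bsub>D\<^esub> x \<oplus>\<^bsub>D\<^esub> a \<odot>\<^bsub>D\<^esub> y"
      by (simp add: eq_iff Y.smult_r_distr)
  next
    fix x assume "x \<in> carrier D"
    then show "\<one>\<^bsub>(scalars :: 'k ring)\<^esub> \<odot>\<^bsub>D\<^esub> x = x" by (simp add: eq_iff)
  qed (simp_all add: ab Module.module.axioms(1)[OF Y.module_axioms])
qed

lemma map_a_inv:
  assumes "x \<in> carrier D"
  shows "\<phi> (\<ominus>\<^bsub>D\<^esub> x) = \<ominus>\<^bsub>Y\<^esub> \<phi> x"
proof -
  interpret D: Module.module "scalars :: 'k ring" D by (rule module_D)
  have "\<phi> (\<ominus>\<^bsub>D\<^esub> x) \<oplus>\<^bsub>Y\<^esub> \<phi> x = \<zero>\<^bsub>Y\<^esub>"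
    using assms by (simp add: map_add[symmetric] map_zero D.M.l_neg)
  from Y.M.minus_equality[OF this] assms show ?thesis
    by (simp add: map_in)
qed

lemma mem_part_iff: "x \<in> carrier D \<Longrightarrow> x \<in> part D p \<longleftrightarrow> \<phi> x \<in> part Y p"
  using map_part[of p] part_subset[of p] inj by (auto simp: inj_on_def)

lemma lie_superalgebra_D: "lie_superalgebra D"
proof -
  interpret D: Module.module "scalars :: 'k ring" D by (rule module_D)
  note [simp] = map_in zero_mem add_closed mult_closed scale_closed map_zero map_add map_mult
    map_smult map_a_inv
  note psub = subsetD[OF part_subset]
  note pm = mem_part_iff[OF psub, THEN iffD1]
  have Ysub: "subgroup (part Y p) (add_monoid Y)" for p
    using Y.part_submodule[of p] by (simp add: submodule_def)
  show ?thesis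
  proof (intro lie_superalgebra.intro lie_superalgebra_axioms.intro module_D)
    fix p
    show "submodule (part D p) (scalars :: 'k ring) D"
    proof (rule D.submoduleI)
      show "part D p \<subseteq> carrier D" by (rule part_subset)
      show "\<zero>\<^bsub>D\<^esub> \<in> part D p" using subgroup.one_closed[OF Ysub[of p]] by (simp add: mem_part_iff)
    next
      fix a assume a: "a \<in> part D p"
      have "\<ominus>\<^bsub>Y\<^esub> \<phi> a \<in> part Y p" using subgroup.m_inv_closed[OF Ysub, OF pm, OF a a]
        by (simp add: a_inv_def)
      then show "\<ominus>\<^bsub>D\<^esub> a \<in> part D p" using psub[OF a] by (simp add: mem_part_iff)
    next
      fix a b assume a: "a \<in> part D p" "b \<in> part D p"
      have "\<phi> a \<oplus>\<^bsub>Y\<^esub> \<phi> b \<in> part Y p" using subgroup.m_closed[OF Ysub, OF pm pm, OF a(1) a(1) a(2) a(2)]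
        by simp
      then show "a \<oplus>\<^bsub>D\<^esub> b \<in> part D p" using psub[OF a(1)] psub[OF a(2)] by (simp add: mem_part_iff)
    next
      fix c x assume "c \<in> carrier (scalars :: 'k ring)" "x \<in> part D p"
      then have "c \<odot>\<^bsub>Y\<^esub> \<phi> x \<in> part Y p"
        by (intro submodule.smult_closed[OF Y.part_submodule]) (auto intro: pm)
      then show "c \<odot>\<^bsub>D\<^esub> x \<in> part D p"
        using psub[OF \<open>x \<in> part D p\<close>] by (simp add: mem_part_iff)
    qed
  next
    show "part D False \<inter> part D True = {\<zero>\<^bsub>D\<^esub>}"
    proof (intro equalityI subsetI)
      fix x assume x: "x \<in> part D False \<inter> part D True"
      then have "\<phi> x \<in> {\<zero>\<^bsub>Y\<^esub>}" unfolding Y.part_Int[symmetric] using pm by blast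
      moreover have "x \<in> carrier D" using x psub by blast
      ultimately show "x \<in> {\<zero>\<^bsub>D\<^esub>}" by (simp add: eq_iff)
    next
      fix x assume "x \<in> {\<zero>\<^bsub>D\<^esub>}"
      moreover have "\<zero>\<^bsub>Y\<^esub> \<in> part Y False \<inter> part Y True" by (simp add: Y.part_Int)
      ultimately show "x \<in> part D False \<inter> part D True" by (simp add: mem_part_iff)
    qed
  next
    show "carrier D = part D False <+>\<^bsub>D\<^esub> part D True"
    proof (intro equalityI subsetI)
      fix x assume x: "x \<in> carrier D"
      then have "\<phi> x \<in> part Y False <+>\<^bsub>Y\<^esub> part Y True"
        unfolding Y.part_sum[symmetric] by (rule map_in)
      then obtain a' b' where "a' \<in> part Y False" "b' \<in> part Y True" "\<phi> x = a' \<oplus>\<^bsub>Y\<^esub> b'"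
        unfolding set_add_def' by blast
      then obtain a b where "a \<in> part D False" "b \<in> part D True" "\<phi> x = \<phi> a \<oplus>\<^bsub>Y\<^esub> \<phi> b"
        unfolding map_part[symmetric] by blast
      moreover from this have "x = a \<oplus>\<^bsub>D\<^esub> b" using x psub by (simp add: eq_iff)
      ultimately show "x \<in> part D False <+>\<^bsub>D\<^esub> part D True" unfolding set_add_def' by blast
    next
      fix x assume "x \<in> part D False <+>\<^bsub>D\<^esub> part D True"
      then obtain a b where "a \<in> part D False" "b \<in> part D True" "x = a \<oplus>\<^bsub>D\<^esub> b"
        unfolding set_add_def' by blast
      then show "x \<in> carrier D" using psub by simp
    qed
  next
    fix x y p q assume "x \<in> part D p" "y \<in> part D q"
    then have *: "x \<in> carrier D" "y \<in> carrier D" "\<phi> x \<in> part Y p" "\<phi> y \<in> part Y q"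
      using psub pm by blast+
    show "x \<otimes>\<^bsub>D\<^esub> y \<in> part D (p \<noteq> q)"
      using Y.bracket_part[OF *(3,4)] *(1,2) by (simp add: mem_part_iff)
    show "x \<otimes>\<^bsub>D\<^esub> y = \<ominus>\<^bsub>D\<^esub> (koszul p q \<odot>\<^bsub>D\<^esub> (y \<otimes>\<^bsub>D\<^esub> x))"
      using Y.super_skew[OF *(3,4)] *(1,2) by (simp add: eq_iff)
  next
    fix x y z p q r assume "x \<in> part D p" "y \<in> part D q" "z \<in> part D r"
    then have *: "x \<in> carrier D" "y \<in> carrier D" "z \<in> carrier D"
      "\<phi> x \<in> part Y p" "\<phi> y \<in> part Y q" "\<phi> z \<in> part Y r"
      using psub pm by blast+
    from Y.super_jacobi[OF *(4-6)] *(1-3)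
    show "x \<otimes>\<^bsub>D\<^esub> (y \<otimes>\<^bsub>D\<^esub> z) =
        ((x \<otimes>\<^bsub>D\<^esub> y) \<otimes>\<^bsub>D\<^esub> z) \<oplus>\<^bsub>D\<^esub> (koszul p q \<odot>\<^bsub>D\<^esub> (y \<otimes>\<^bsub>D\<^esub> (x \<otimes>\<^bsub>D\<^esub> z)))"
      by (simp add: eq_iff)
  next
    fix x assume "x \<in> part D True"
    then show "x \<otimes>\<^bsub>D\<^esub> (x \<otimes>\<^bsub>D\<^esub> x) = \<zero>\<^bsub>D\<^esub>"
      using Y.odd_cube[OF pm, of x] psub[of x] by (simp add: eq_iff)
  qed (simp_all add: eq_iff Y.bracket_add_left Y.bracket_add_right Y.bracket_smult_left Y.bracket_smult_right)
qed

end

text \<open>First isomorphism theorem. Combined with \<open>lie_superalgebra_D\<close> it makes the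
  quotient by the kernel a Lie superalgebra although the source need not be one.\<close>

lemma (in super_epi_lie) super_iso_quotient_map: "super_iso quotient_map Q Y"
  by (intro super_iso.intro super_epi_lie.intro super_epi_quotient_map super_iso_axioms.intro
      inj_quotient_map Y.lie_superalgebra_axioms)

section \<open>Linear and bilinear extension\<close>

abbreviation lookup where "lookup \<equiv> Poly_Mapping.lookup"
abbreviation keys where "keys \<equiv> Poly_Mapping.keys"
abbreviation single where "single \<equiv> Poly_Mapping.single"

text \<open>Same operation as \<open>fscale\<close>, but for an arbitrary index type: the free
  algebra on a magma and the lattice algebras then share one linear algebra.\<close>

definition pscale :: "'k::field \<Rightarrow> ('i \<Rightarrow>\<^sub>0 'k) \<Rightarrow> ('i \<Rightarrow>\<^sub>0 'k)" where
  "pscale c a = Poly_Mapping.map ((*) c) a"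

lemma lookup_pscale [simp]: "lookup (pscale c a) i = c * lookup a i"
  by (simp add: pscale_def Poly_Mapping.map.rep_eq when_def)

lemma fscale_eq: "fscale = pscale"
  by (intro ext) (simp add: fscale_def pscale_def)

global_interpretation pm: vector_space pscale
  by unfold_locales (auto intro!: poly_mapping_eqI simp: lookup_add algebra_simps)

lemma pscale_single [simp]: "pscale c (single i d) = single i (c * d)"
  by (intro poly_mapping_eqI) (simp add: lookup_single when_def)

lemma keys_pscale: "keys (pscale c a) \<subseteq> keys a"
  by (auto simp: in_keys_iff)

definition supported :: "'i set \<Rightarrow> ('i \<Rightarrow>\<^sub>0 'k::field) set" where
  "supported S = {a. keys a \<subseteq> S}"

lemma supported_iff: "a \<in> supported S \<longleftrightarrow> (\<forall>i. i \<notin> S \<longrightarrow> lookup a i = 0)"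
  by (auto simp: supported_def in_keys_iff)

lemma subspace_supported: "pm.subspace (supported S)"
  by (auto simp: pm.subspace_def supported_iff lookup_add)

lemma single_in_supported [simp]: "i \<in> S \<Longrightarrow> single i c \<in> supported S"
  by (auto simp: supported_iff lookup_single when_def)

lemma supported_UNIV [simp]: "supported UNIV = UNIV"
  by (simp add: supported_def)

lemma pm_expand:
  assumes "finite S" "a \<in> supported S"
  shows "a = (\<Sum>i\<in>S. single i (lookup a i))"
proof (rule poly_mapping_eqI)
  fix j
  have "(\<Sum>i\<in>S. lookup (single i (lookup a i)) j) = (\<Sum>i\<in>S. if i = j then lookup a j else 0)"
    by (intro sum.cong) (auto simp: lookup_single when_def)
  also have "\<dots> = lookup a j" using assms by (auto simp: supported_iff)
  finally show "lookup a j = lookup (\<Sum>i\<in>S. single i (lookup a i)) j"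
    by (simp add: lookup_sum)
qed

lemma keys_supported: "a \<in> supported (keys a)"
  by (simp add: supported_def)

lemma supported_induct [consumes 1, case_names zero add single]:
  assumes "a \<in> supported S" "P 0" "\<And>a b. P a \<Longrightarrow> P b \<Longrightarrow> P (a + b)"
    "\<And>i c. i \<in> S \<Longrightarrow> P (single i c)"
  shows "P a"
proof -
  have "P (\<Sum>i\<in>T. single i (lookup a i))" if "finite T" "T \<subseteq> S" for T
    using that by (induction T) (auto intro: assms)
  from this[of "keys a"] show ?thesis
    using assms(1) pm_expand[OF finite_keys keys_supported, of a] by (simp add: supported_def)
qed

definition lext :: "('i \<Rightarrow> 'j \<Rightarrow>\<^sub>0 'k) \<Rightarrow> ('i \<Rightarrow>\<^sub>0 'k::field) \<Rightarrow> ('j \<Rightarrow>\<^sub>0 'k)" where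
  "lext f a = (\<Sum>i\<in>keys a. pscale (lookup a i) (f i))"

lemma lext_eq_sum:
  assumes "finite S" "keys a \<subseteq> S"
  shows "lext f a = (\<Sum>i\<in>S. pscale (lookup a i) (f i))"
  unfolding lext_def using assms by (intro sum.mono_neutral_left) (auto simp: in_keys_iff)

lemma lext_zero [simp]: "lext f 0 = 0"
  by (simp add: lext_def)

lemma lext_add: "lext f (a + b) = lext f a + lext f b"
proof -
  have "keys (a + b) \<subseteq> keys a \<union> keys b" by (rule keys_add)
  then show ?thesis
    by (simp add: lext_eq_sum[where S = "keys a \<union> keys b"] lookup_add pm.scale_left_distrib sum.distrib)
qed

lemma lext_scale: "lext f (pscale c a) = pscale c (lext f a)"
  using keys_pscale[of c a]
  by (simp add: lext_eq_sum[where S = "keys a"] pm.scale_sum_right)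

lemma lext_single [simp]: "lext f (single i c) = pscale c (f i)"
  by (simp add: lext_eq_sum[where S = "{i}"])

lemma lext_uminus: "lext f (- a) = - lext f a"
  using lext_scale[of f "-1" a] by simp

lemma lext_diff: "lext f (a - b) = lext f a - lext f b"
  using lext_add[of f a "- b"] by (simp add: lext_uminus)

lemma lext_sum: "lext f (\<Sum>i\<in>S. a i) = (\<Sum>i\<in>S. lext f (a i))"
  by (induction S rule: infinite_finite_induct) (auto simp: lext_add)

lemma lext_in_subspace:
  assumes "pm.subspace T" "\<And>i. i \<in> keys a \<Longrightarrow> f i \<in> T"
  shows "lext f a \<in> T"
  unfolding lext_def using assms by (intro pm.subspace_sum) (auto intro: pm.subspace_scale)

lemma lext_identity: "lext (\<lambda>i. single i 1) a = a"
  using pm_expand[OF finite_keys keys_supported, of a] by (simp add: lext_def)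

definition prj :: "'i set \<Rightarrow> ('i \<Rightarrow>\<^sub>0 'k::field) \<Rightarrow> ('i \<Rightarrow>\<^sub>0 'k)" where
  "prj S = lext (\<lambda>i. if i \<in> S then single i 1 else 0)"

lemma lookup_prj [simp]: "lookup (prj S a) i = (if i \<in> S then lookup a i else 0)"
proof -
  have "lookup (prj S a) i = (\<Sum>j\<in>keys a. if j = i then (if i \<in> S then lookup a i else 0) else 0)"
    unfolding prj_def lext_def lookup_sum
    by (intro sum.cong) (auto simp: lookup_single when_def)
  then show ?thesis by (auto simp: in_keys_iff)
qed

lemma prj_add: "prj S (a + b) = prj S a + prj S b"
  by (simp add: prj_def lext_add)

lemma prj_scale: "prj S (pscale c a) = pscale c (prj S a)"
  by (simp add: prj_def lext_scale)

lemma prj_supported: "prj S a \<in> supported S"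
  by (simp add: supported_iff)

lemma prj_split: "a = prj S a + prj (- S) a"
  by (intro poly_mapping_eqI) (simp add: lookup_add)

definition bext :: "('i \<Rightarrow> 'i \<Rightarrow> 'i \<Rightarrow>\<^sub>0 'k) \<Rightarrow> ('i \<Rightarrow>\<^sub>0 'k::field) \<Rightarrow> ('i \<Rightarrow>\<^sub>0 'k) \<Rightarrow> ('i \<Rightarrow>\<^sub>0 'k)" where
  "bext m a b = lext (\<lambda>s. lext (m s) b) a"

locale bilinear_bracket =
  fixes br :: "('i \<Rightarrow>\<^sub>0 'k::field) \<Rightarrow> ('i \<Rightarrow>\<^sub>0 'k) \<Rightarrow> ('i \<Rightarrow>\<^sub>0 'k)"
  assumes add_left: "br (x + y) z = br x z + br y z"
    and add_right: "br x (y + z) = br x y + br x z"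
    and scale_left: "br (pscale c x) y = pscale c (br x y)"
    and scale_right: "br x (pscale c y) = pscale c (br x y)"
begin

lemma zero_left [simp]: "br 0 x = 0"
  using add_left[of 0 0 x] by simp

lemma zero_right [simp]: "br x 0 = 0"
  using add_right[of x 0 0] by simp

lemma uminus_left: "br (- x) y = - br x y"
  using scale_left[of "-1" x y] by simp

lemma uminus_right: "br x (- y) = - br x y"
  using scale_right[of x "-1" y] by simp

lemma diff_left: "br (x - y) z = br x z - br y z"
  using add_left[of x "- y" z] by (simp add: uminus_left)

lemma diff_right: "br x (y - z) = br x y - br x z"
  using add_right[of x y "- z"] by (simp add: uminus_right)

lemma sum_left: "br (\<Sum>i\<in>S. f i) y = (\<Sum>i\<in>S. br (f i) y)"
  by (induction S rule: infinite_finite_induct) (auto simp: add_left)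

lemma sum_right: "br y (\<Sum>i\<in>S. f i) = (\<Sum>i\<in>S. br y (f i))"
  by (induction S rule: infinite_finite_induct) (auto simp: add_right)

lemmas linear_simps = add_left add_right scale_left scale_right uminus_left uminus_right
  diff_left diff_right

end

lemma lext_fun_add: "lext (\<lambda>s. f s + g s) a = lext f a + lext g a"
  by (simp add: lext_def pm.scale_right_distrib sum.distrib)

lemma lext_fun_scale: "lext (\<lambda>s. pscale c (f s)) a = pscale c (lext f a)"
  by (simp add: lext_def pm.scale_sum_right mult.commute)

lemma bilinear_bext: "bilinear_bracket (bext m)"
  by unfold_locales (simp_all add: bext_def lext_add lext_scale lext_fun_add lext_fun_scale)

lemma bext_single [simp]:
  "bext m (single i c) (single j d) = pscale (c * d) (m i j)"
  by (simp add: bext_def mult.commute)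

lemma fbracket_eq: "fbracket = bext (\<lambda>s t. single (Br s t) 1)"
  by (intro ext) (simp add: fbracket_def bext_def lext_def pm.scale_sum_right)

global_interpretation fb: bilinear_bracket fbracket
  unfolding fbracket_eq by (rule bilinear_bext)

lemma fbracket_single:
  "fbracket (single s c) (single t d) = single (Br s t) (c * d)"
  by (simp add: fbracket_eq)

text \<open>Universal property of the free nonassociative algebra: both sides are bilinear and agree
  on monomials.\<close>

lemma (in bilinear_bracket) lext_magma_fbracket:
  "lext (magma_eval g br) (fbracket a b) = br (lext (magma_eval g br) a) (lext (magma_eval g br) b)"
proof -
  have "a \<in> supported UNIV" "b \<in> supported UNIV" by simp_all
  from this(1) show ?thesis
  proof (induction rule: supported_induct)
    case (single s c)
    from \<open>b \<in> supported UNIV\<close> show ?case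
      by (induction rule: supported_induct)
        (simp_all add: fb.add_right lext_add add_right fbracket_single scale_left scale_right mult.commute)
  qed (simp_all add: fb.add_left lext_add add_left)
qed

section \<open>Superalgebras carried by spaces of finitely supported functions\<close>

text \<open>Wraps spaces whose operations come from type classes into the
  \<open>superalgebra\<close> record. Its submodules are the subspaces for \<open>pscale\<close>
  inside the carrier, so laws can be checked as identities on the type.\<close>

definition model_alg :: "('i \<Rightarrow>\<^sub>0 'k) set \<Rightarrow> (('i \<Rightarrow>\<^sub>0 'k) \<Rightarrow> ('i \<Rightarrow>\<^sub>0 'k) \<Rightarrow> ('i \<Rightarrow>\<^sub>0 'k)) \<Rightarrow>
    (bool \<Rightarrow> ('i \<Rightarrow>\<^sub>0 'k) set) \<Rightarrow> ('k::field, 'i \<Rightarrow>\<^sub>0 'k) superalgebra" where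
  "model_alg C br P = \<lparr>carrier = C, monoid.mult = br, one = undefined, ring.zero = 0, add = (+),
     module.smult = pscale, part = P\<rparr>"

lemma model_alg_simps [simp]:
  "carrier (model_alg C br P) = C" "x \<otimes>\<^bsub>model_alg C br P\<^esub> y = br x y"
  "\<zero>\<^bsub>model_alg C br P\<^esub> = 0" "x \<oplus>\<^bsub>model_alg C br P\<^esub> y = x + y"
  "c \<odot>\<^bsub>model_alg C br P\<^esub> x = pscale c x" "part (model_alg C br P) = P"
  by (simp_all add: model_alg_def)

lemma scalars_simps [simp]:
  "carrier scalars = UNIV" "x \<oplus>\<^bsub>scalars\<^esub> y = x + y" "x \<otimes>\<^bsub>scalars\<^esub> y = x * y"
  "\<one>\<^bsub>scalars\<^esub> = 1" "\<zero>\<^bsub>scalars\<^esub> = 0"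
  by (simp_all add: ring_of_type_algebra_def)

lemma module_model_alg:
  assumes C: "pm.subspace C"
  shows "Module.module scalars (model_alg C br P)"
proof (rule moduleI)
  show "abelian_group (model_alg C br P)"
  proof (rule abelian_groupI)
    fix x assume "x \<in> carrier (model_alg C br P)"
    then show "\<exists>y\<in>carrier (model_alg C br P). y \<oplus>\<^bsub>model_alg C br P\<^esub> x = \<zero>\<^bsub>model_alg C br P\<^esub>"
      using pm.subspace_neg[OF C, of x] by (intro bexI[of _ "- x"]) auto
  qed (use C in \<open>auto simp: pm.subspace_def add.assoc add.commute\<close>)
qed (use C cring_from_type_algebra in \<open>auto simp: pm.subspace_def pm.scale_left_distrib pm.scale_right_distrib\<close>)

lemma a_inv_model_alg:
  assumes "pm.subspace C" "x \<in> C"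
  shows "\<ominus>\<^bsub>model_alg C br P\<^esub> x = - x"
proof -
  interpret Module.module scalars "model_alg C br P" using assms by (intro module_model_alg)
  show ?thesis using assms by (intro M.minus_equality) (auto intro: pm.subspace_neg)
qed

lemma submodule_model_alg_iff:
  assumes C: "pm.subspace C"
  shows "submodule I scalars (model_alg C br P) \<longleftrightarrow> pm.subspace I \<and> I \<subseteq> C"
proof -
  interpret Module.module scalars "model_alg C br P" using assms by (intro module_model_alg)
  show ?thesis
  proof
    assume I: "submodule I scalars (model_alg C br P)"
    have "0 \<in> I" using subgroup.one_closed[of I "add_monoid (model_alg C br P)"] I
      by (simp add: submodule_def)
    then show "pm.subspace I \<and> I \<subseteq> C"
      using submoduleE[OF I] by (auto simp: pm.subspace_def)
  next
    assume I: "pm.subspace I \<and> I \<subseteq> C"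
    then show "submodule I scalars (model_alg C br P)"
      by (intro submoduleI) (auto simp: pm.subspace_def a_inv_model_alg[OF C] subset_iff
          intro: pm.subspace_neg)
  qed
qed

lemma (in bilinear_bracket) lie_superalgebra_model_alg:
  assumes C: "pm.subspace C" and P: "\<And>p. pm.subspace (P p)"
    and Int: "P False \<inter> P True \<subseteq> {0}"
    and sum: "\<And>x. x \<in> C \<longleftrightarrow> (\<exists>a\<in>P False. \<exists>b\<in>P True. x = a + b)"
    and part: "\<And>x y p q. \<lbrakk>x \<in> P p; y \<in> P q\<rbrakk> \<Longrightarrow> br x y \<in> P (p \<noteq> q)"
    and skew: "\<And>x y p q. \<lbrakk>x \<in> P p; y \<in> P q\<rbrakk> \<Longrightarrow> br x y = - pscale (koszul p q) (br y x)"
    and jacobi: "\<And>x y z p q r. \<lbrakk>x \<in> P p; y \<in> P q; z \<in> P r\<rbrakk> \<Longrightarrow>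
      br x (br y z) = br (br x y) z + pscale (koszul p q) (br y (br x z))"
    and cube: "\<And>x. x \<in> P True \<Longrightarrow> br x (br x x) = 0"
  shows "lie_superalgebra (model_alg C br P)"
proof (intro lie_superalgebra.intro lie_superalgebra_axioms.intro module_model_alg C)
  have PC: "x \<in> C" if "x \<in> P p" for x p
    using that sum[of x] P[of "\<not> p"] by (cases p) (force simp: pm.subspace_def)+
  have closed: "br x y \<in> C" if "x \<in> C" "y \<in> C" for x y
  proof -
    obtain a b a' b' where ab: "a \<in> P False" "b \<in> P True" "x = a + b"
      "a' \<in> P False" "b' \<in> P True" "y = a' + b'"
      using \<open>x \<in> C\<close> \<open>y \<in> C\<close> sum by blast
    have "br x y = (br a a' + br b a') + (br a b' + br b b')" by (simp add: linear_simps ab)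
    also have "\<dots> \<in> C"
      by (intro pm.subspace_add[OF C] PC[OF part[OF ab(1,4)]] PC[OF part[OF ab(2,4)]]
          PC[OF part[OF ab(1,5)]] PC[OF part[OF ab(2,5)]])
    finally show ?thesis .
  qed
  show "submodule (part (model_alg C br P) p) scalars (model_alg C br P)" for p
    using P PC by (auto simp: submodule_model_alg_iff[OF C])
  show "part (model_alg C br P) False \<inter> part (model_alg C br P) True = {\<zero>\<^bsub>model_alg C br P\<^esub>}"
    using Int P by (auto simp: pm.subspace_def)
  show "carrier (model_alg C br P) =
      part (model_alg C br P) False <+>\<^bsub>model_alg C br P\<^esub> part (model_alg C br P) True"
    using sum by (auto simp: set_add_def')
  fix x y z p q r
  show "x \<otimes>\<^bsub>model_alg C br P\<^esub> y \<in> carrier (model_alg C br P)"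
    if "x \<in> carrier (model_alg C br P)" "y \<in> carrier (model_alg C br P)"
    using that closed by simp
  assume "x \<in> part (model_alg C br P) p" "y \<in> part (model_alg C br P) q"
  then have xy: "x \<in> P p" "y \<in> P q" by simp_all
  show "x \<otimes>\<^bsub>model_alg C br P\<^esub> y =
        \<ominus>\<^bsub>model_alg C br P\<^esub> (koszul p q \<odot>\<^bsub>model_alg C br P\<^esub> (y \<otimes>\<^bsub>model_alg C br P\<^esub> x))"
  proof -
    have "pscale (koszul p q) (br y x) \<in> C"
      by (intro pm.subspace_scale[OF C] closed PC[OF xy(1)] PC[OF xy(2)])
    then show ?thesis using skew[OF xy] by (simp only: a_inv_model_alg[OF C] model_alg_simps)
  qed
  show "x \<otimes>\<^bsub>model_alg C br P\<^esub> y \<in> part (model_alg C br P) (p \<noteq> q)"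
    using part[OF xy] by simp
  assume "z \<in> part (model_alg C br P) r"
  then show "x \<otimes>\<^bsub>model_alg C br P\<^esub> (y \<otimes>\<^bsub>model_alg C br P\<^esub> z) =
      ((x \<otimes>\<^bsub>model_alg C br P\<^esub> y) \<otimes>\<^bsub>model_alg C br P\<^esub> z) \<oplus>\<^bsub>model_alg C br P\<^esub>
        (koszul p q \<odot>\<^bsub>model_alg C br P\<^esub> (y \<otimes>\<^bsub>model_alg C br P\<^esub> (x \<otimes>\<^bsub>model_alg C br P\<^esub> z)))"
    unfolding model_alg_simps using xy by (intro jacobi)
next
  fix x assume "x \<in> part (model_alg C br P) True"
  then show "x \<otimes>\<^bsub>model_alg C br P\<^esub> (x \<otimes>\<^bsub>model_alg C br P\<^esub> x) = \<zero>\<^bsub>model_alg C br P\<^esub>"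
    unfolding model_alg_simps by (rule cube)
qed (simp_all only: linear_simps model_alg_simps)

lemma free_superalgebra_eq: "free_superalgebra par =
    model_alg UNIV fbracket (\<lambda>p. supported {t. magma_eval par (\<noteq>) t = p})"
  by (auto simp: free_superalgebra_def model_alg_def fscale_eq supported_def)

section \<open>Presentations\<close>

definition coset :: "('i \<Rightarrow>\<^sub>0 'k::field) set \<Rightarrow> ('i \<Rightarrow>\<^sub>0 'k) \<Rightarrow> ('i \<Rightarrow>\<^sub>0 'k) set" where
  "coset I a = (\<lambda>i. i + a) ` I"

lemma a_r_coset_model_alg [simp]: "I +>\<^bsub>model_alg C br P\<^esub> a = coset I a"
  by (auto simp: a_r_coset_def' coset_def)

lemma coset_0: "coset I 0 = I"
  by (simp add: coset_def)

lemma coset_eq_iff: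
  assumes I: "pm.subspace I"
  shows "coset I a = coset I b \<longleftrightarrow> a - b \<in> I"
proof
  assume "coset I a = coset I b"
  moreover have "a \<in> coset I a" using I by (auto simp: coset_def pm.subspace_def image_iff)
  ultimately show "a - b \<in> I" by (auto simp: coset_def)
next
  assume ab: "a - b \<in> I"
  have "coset I x \<subseteq> coset I y" if "x - y \<in> I" for x y
  proof
    fix z assume "z \<in> coset I x"
    then obtain i where i: "i \<in> I" "z = i + x" by (auto simp: coset_def)
    then have "z = (i + (x - y)) + y" "i + (x - y) \<in> I"
      using pm.subspace_add[OF I i(1) that] by simp_all
    then show "z \<in> coset I y" unfolding coset_def by blast
  qed
  from this[OF ab] this[of b a] pm.subspace_neg[OF I ab] show "coset I a = coset I b" by simp
qed

locale ideal_quotient = bilinear_bracket br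
  for br :: "('i \<Rightarrow>\<^sub>0 'k::field) \<Rightarrow> ('i \<Rightarrow>\<^sub>0 'k) \<Rightarrow> ('i \<Rightarrow>\<^sub>0 'k)" +
  fixes I :: "('i \<Rightarrow>\<^sub>0 'k) set" and P :: "bool \<Rightarrow> ('i \<Rightarrow>\<^sub>0 'k) set"
  assumes subspace_I: "pm.subspace I"
    and ideal: "y \<in> I \<Longrightarrow> br x y \<in> I" "y \<in> I \<Longrightarrow> br y x \<in> I"
begin

abbreviation Q where "Q \<equiv> superquotient (model_alg UNIV br P) I"

abbreviation cl where "cl \<equiv> coset I"

lemmas cl_eq = coset_eq_iff[OF subspace_I]

lemma mem_cl_iff: "x \<in> cl a \<longleftrightarrow> x - a \<in> I"
  by (auto simp: coset_def image_iff intro: bexI[of _ "x - a"])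

lemma carrier_Q: "carrier Q = range cl"
  by (auto simp: superquotient_def A_RCOSETS_def')

lemma zero_Q: "\<zero>\<^bsub>Q\<^esub> = cl 0"
  by (simp add: superquotient_def coset_0)

lemma add_Q: "cl x \<oplus>\<^bsub>Q\<^esub> cl y = cl (x + y)"
proof -
  have "z \<in> cl x <+>\<^bsub>model_alg UNIV br P\<^esub> cl y \<longleftrightarrow> z \<in> cl (x + y)" for z
  proof
    assume "z \<in> cl x <+>\<^bsub>model_alg UNIV br P\<^esub> cl y"
    then obtain a b where *: "a - x \<in> I" "b - y \<in> I" "z = a + b"
      by (auto simp: set_add_def' mem_cl_iff)
    from pm.subspace_add[OF subspace_I *(1,2)] show "z \<in> cl (x + y)"
      by (simp add: *(3) mem_cl_iff algebra_simps)
  next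
    assume "z \<in> cl (x + y)"
    then have "z - y \<in> cl x" "y \<in> cl y" "z = (z - y) + y"
      using pm.subspace_0[OF subspace_I] by (simp_all add: mem_cl_iff algebra_simps)
    then show "z \<in> cl x <+>\<^bsub>model_alg UNIV br P\<^esub> cl y"
      unfolding set_add_def' model_alg_simps by blast
  qed
  then show ?thesis by (auto simp: superquotient_def)
qed

lemma mult_Q: "cl x \<otimes>\<^bsub>Q\<^esub> cl y = cl (br x y)"
proof -
  have *: "cl (br a b) = cl (br x y)" if "a \<in> cl x" "b \<in> cl y" for a b
  proof -
    have "br a b - br x y = br (a - x) b + br x (b - y)" by (simp add: linear_simps)
    then show ?thesis using that unfolding mem_cl_iff cl_eq
      by (simp add: ideal pm.subspace_add[OF subspace_I])
  qed
  have "x \<in> cl x" "y \<in> cl y" using pm.subspace_0[OF subspace_I] by (simp_all add: mem_cl_iff)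
  then have "(\<Union>a\<in>cl x. \<Union>b\<in>cl y. cl (br a b)) = cl (br x y)" using * by blast
  then show ?thesis by (simp add: superquotient_def rcoset_mult_def)
qed

lemma smult_Q: "c \<odot>\<^bsub>Q\<^esub> cl x = cl (pscale c x)"
proof -
  have *: "cl (pscale c a) = cl (pscale c x)" if "a \<in> cl x" for a
    using that pm.subspace_scale[OF subspace_I, of "a - x" c] unfolding mem_cl_iff cl_eq
    by (simp add: pm.scale_right_diff_distrib)
  have "x \<in> cl x" using pm.subspace_0[OF subspace_I] by (simp_all add: mem_cl_iff)
  then have "(\<Union>a\<in>cl x. cl (pscale c a)) = cl (pscale c x)" using * by blast
  then show ?thesis by (simp add: superquotient_def)
qed

lemma part_Q: "part Q p = cl ` P p"
  by (simp add: superquotient_def)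

lemma abelian_group_Q: "abelian_group Q"
proof (rule abelian_groupI)
  fix x assume "x \<in> carrier Q"
  then obtain a where "x = cl a" by (auto simp: carrier_Q)
  then have "cl (- a) \<in> carrier Q" "cl (- a) \<oplus>\<^bsub>Q\<^esub> x = \<zero>\<^bsub>Q\<^esub>"
    by (simp_all add: carrier_Q add_Q zero_Q)
  then show "\<exists>y\<in>carrier Q. y \<oplus>\<^bsub>Q\<^esub> x = \<zero>\<^bsub>Q\<^esub>" by blast
qed (auto simp: carrier_Q add_Q zero_Q ac_simps)

lemma a_inv_Q: "\<ominus>\<^bsub>Q\<^esub> cl x = cl (- x)"
  by (intro abelian_group.minus_equality[OF abelian_group_Q]) (simp_all add: add_Q zero_Q carrier_Q)

lemma finsum_Q: "finite B \<Longrightarrow> finsum Q (\<lambda>i. cl (f i)) B = cl (\<Sum>i\<in>B. f i)"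
proof (induction B rule: finite_induct)
  case empty
  then show ?case using abelian_group_Q
    by (simp add: abelian_monoid.finsum_empty abelian_group.axioms zero_Q)
next
  case (insert x B)
  interpret abelian_group Q by (rule abelian_group_Q)
  show ?case using insert by (simp add: carrier_Q add_Q)
qed

end

lemma bracket_ideal_model_alg_iff:
  "bracket_ideal (model_alg UNIV br P) I \<longleftrightarrow> pm.subspace I \<and> (\<forall>x. \<forall>y\<in>I. br x y \<in> I \<and> br y x \<in> I)"
  by (simp add: bracket_ideal_def submodule_model_alg_iff)

locale lie_ideal_quotient = ideal_quotient br I P
  for br :: "('i \<Rightarrow>\<^sub>0 'k::field) \<Rightarrow> ('i \<Rightarrow>\<^sub>0 'k) \<Rightarrow> ('i \<Rightarrow>\<^sub>0 'k)"
    and I :: "('i \<Rightarrow>\<^sub>0 'k) set" and P :: "bool \<Rightarrow> ('i \<Rightarrow>\<^sub>0 'k) set" +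
  assumes lie: "lie_superalgebra Q"
begin

text \<open>Phrased as membership in \<open>I\<close> instead of an equation in the quotient, the
  Lie axioms pass to intersections of such ideals.\<close>

lemma skew_mod:
  assumes "x \<in> P p" "y \<in> P q"
  shows "br x y + pscale (koszul p q) (br y x) \<in> I"
proof -
  interpret Q: lie_superalgebra Q by (rule lie)
  have "cl x \<otimes>\<^bsub>Q\<^esub> cl y = \<ominus>\<^bsub>Q\<^esub> (koszul p q \<odot>\<^bsub>Q\<^esub> (cl y \<otimes>\<^bsub>Q\<^esub> cl x))"
    using assms by (intro Q.super_skew) (auto simp: part_Q)
  then show ?thesis by (simp add: mult_Q smult_Q a_inv_Q cl_eq)
qed

lemma jacobi_mod:
  assumes "x \<in> P p" "y \<in> P q" "z \<in> P r"
  shows "br x (br y z) - (br (br x y) z + pscale (koszul p q) (br y (br x z))) \<in> I"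
proof -
  interpret Q: lie_superalgebra Q by (rule lie)
  have "cl x \<otimes>\<^bsub>Q\<^esub> (cl y \<otimes>\<^bsub>Q\<^esub> cl z) =
      ((cl x \<otimes>\<^bsub>Q\<^esub> cl y) \<otimes>\<^bsub>Q\<^esub> cl z) \<oplus>\<^bsub>Q\<^esub> (koszul p q \<odot>\<^bsub>Q\<^esub> (cl y \<otimes>\<^bsub>Q\<^esub> (cl x \<otimes>\<^bsub>Q\<^esub> cl z)))"
    using assms by (intro Q.super_jacobi[of _ p _ q _ r]) (auto simp: part_Q)
  then show ?thesis by (simp add: mult_Q smult_Q add_Q cl_eq)
qed

end

section \<open>Recognising a contragredient Lie superalgebra\<close>

text \<open>The principal grading. It separates products of raising generators from products of
  lowering ones.\<close>

definition height :: "('h, 'n::finite) generator magma \<Rightarrow> int" where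
  "height t = (\<Sum>i\<in>UNIV. magma_eval gen_weight (+) t $ i)"

lemma height_Br [simp]: "height (Br s t) = height s + height t"
  by (simp add: height_def sum.distrib)

lemma height_Gen [simp]: "height (Gen (GenH x)) = 0" "height (Gen (GenE i)) = 1"
  "height (Gen (GenF i)) = - 1"
  by (simp_all add: height_def axis_def sum_negf)

text \<open>The flag lets one proof serve the raising half (\<open>True\<close>) and the lowering
  half (\<open>False\<close>) of the triangular decomposition.\<close>

definition xgen :: "bool \<Rightarrow> 'n \<Rightarrow> ('h, 'n) generator" where
  "xgen s i = (if s then GenE i else GenF i)"

definition xsign :: "bool \<Rightarrow> int" where "xsign s = (if s then 1 else - 1)"

primrec pure :: "bool \<Rightarrow> ('h, 'n) generator magma \<Rightarrow> bool" where
  "pure s (Gen x) \<longleftrightarrow> (\<exists>i. x = xgen s i)"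
| "pure s (Br t u) \<longleftrightarrow> pure s t \<and> pure s u"

lemma height_xgen [simp]: "height (Gen (xgen s i)) = xsign s"
  by (simp add: xgen_def xsign_def)

lemma pure_height: "pure s t \<Longrightarrow> xsign s * height t \<ge> 1"
  by (induction t) (auto simp: xsign_def)

lemma pure_height_0: "pure s t \<Longrightarrow> height t \<noteq> 0"
  using pure_height[of s t] by auto

lemma gen_eq: "gen x = single (Gen x) 1"
  by (simp add: gen_def)

text \<open>Data of the recognition criterion. \<open>W_indep\<close> gives independence of the
  weight spaces, and that they span \<open>C\<close> follows from \<open>generated\<close>, since
  iterated brackets of the generators are weight vectors. \<open>W_0\<close> and
  \<open>inj_hm\<close> identify the weight 0 space with the realization space.\<close>

locale contragredient_model = bilinear_bracket br
  for br :: "('j \<Rightarrow>\<^sub>0 'k::field) \<Rightarrow> ('j \<Rightarrow>\<^sub>0 'k) \<Rightarrow> ('j \<Rightarrow>\<^sub>0 'k)" +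
  fixes par :: "'n::finite \<Rightarrow> bool" and R :: "('k, 'h::ab_group_add, 'n) realization"
    and C :: "('j \<Rightarrow>\<^sub>0 'k) set" and P :: "bool \<Rightarrow> ('j \<Rightarrow>\<^sub>0 'k) set"
    and W :: "int ^ 'n \<Rightarrow> ('j \<Rightarrow>\<^sub>0 'k) set"
    and hm :: "'h \<Rightarrow> ('j \<Rightarrow>\<^sub>0 'k)" and e f :: "'n \<Rightarrow> ('j \<Rightarrow>\<^sub>0 'k)"
  assumes subspace_C: "pm.subspace C"
    and lie: "lie_superalgebra (model_alg C br P)"
    and W_0: "W 0 = range hm" and inj_hm: "inj hm"
    and hm_add: "hm (x + y) = hm x + hm y" and hm_scale: "hm (hscale R c x) = pscale c (hm x)"
    and e_W: "e i \<in> W (axis i 1)" and f_W: "f i \<in> W (- axis i 1)"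
    and W_subspace: "pm.subspace (W \<beta>)" and W_C: "W \<beta> \<subseteq> C"
    and W_br: "\<lbrakk>v \<in> W \<beta>; w \<in> W \<gamma>\<rbrakk> \<Longrightarrow> br v w \<in> W (\<beta> + \<gamma>)"
    and W_indep: "\<lbrakk>finite B; \<And>\<beta>. \<beta> \<in> B \<Longrightarrow> u \<beta> \<in> W \<beta>; (\<Sum>\<beta>\<in>B. u \<beta>) = 0; \<beta> \<in> B\<rbrakk> \<Longrightarrow> u \<beta> = 0"
    and e_P: "e i \<in> P (par i)" and f_P: "f i \<in> P (par i)" and hm_P: "hm x \<in> P False"
    and ef: "br (e i) (f j) = (if i = j then hm (coroot R i) else 0)"
    and he: "br (hm x) (e j) = pscale (simple_root R j x) (e j)"
    and hf: "br (hm x) (f j) = - pscale (simple_root R j x) (f j)"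
    and hh: "br (hm x) (hm y) = 0"
    and generated: "\<lbrakk>pm.subspace T; \<And>x. hm x \<in> T; \<And>i. e i \<in> T; \<And>i. f i \<in> T;
      \<And>v w. v \<in> T \<Longrightarrow> w \<in> T \<Longrightarrow> br v w \<in> T\<rbrakk> \<Longrightarrow> C \<subseteq> T"
    and nondegenerate: "\<lbrakk>v \<in> W \<beta>; v \<noteq> 0; \<beta> \<noteq> 0\<rbrakk> \<Longrightarrow> \<exists>z\<in>W (- \<beta>). br z v \<noteq> 0"
begin

interpretation L: lie_superalgebra "model_alg C br P" by (rule lie)

lemma P_subspace: "pm.subspace (P p)" and P_C: "P p \<subseteq> C"
  using L.part_submodule[of p] by (simp_all add: submodule_model_alg_iff[OF subspace_C])

lemma P_Int: "x \<in> P p \<Longrightarrow> x \<in> P (\<not> p) \<Longrightarrow> x = 0"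
  using L.part_Int by (cases p) auto

lemma P_br: "x \<in> P p \<Longrightarrow> y \<in> P q \<Longrightarrow> br x y \<in> P (p \<noteq> q)"
  using L.bracket_part[of x p y q] by simp

definition gval :: "('h, 'n) generator \<Rightarrow> ('j \<Rightarrow>\<^sub>0 'k)" where
  "gval = case_generator hm e f"

definition phi :: "(('h, 'n) generator magma \<Rightarrow>\<^sub>0 'k) \<Rightarrow> ('j \<Rightarrow>\<^sub>0 'k)" where
  "phi = lext (magma_eval gval br)"

abbreviation gpar where "gpar \<equiv> gen_parity par"

definition FP :: "bool \<Rightarrow> (('h, 'n) generator magma \<Rightarrow>\<^sub>0 'k) set" where
  "FP = (\<lambda>p. supported {t. magma_eval gpar (\<noteq>) t = p})"

abbreviation F :: "('k, ('h, 'n) generator magma \<Rightarrow>\<^sub>0 'k) superalgebra" where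
  "F \<equiv> model_alg UNIV fbracket FP"

lemma phi_linear: "phi (a + b) = phi a + phi b" "phi (a - b) = phi a - phi b"
  "phi (- a) = - phi a" "phi 0 = 0" "phi (pscale c a) = pscale c (phi a)"
  "phi (\<Sum>i\<in>S. g i) = (\<Sum>i\<in>S. phi (g i))"
  by (simp_all add: phi_def lext_add lext_diff lext_uminus lext_scale lext_sum)

lemma phi_br: "phi (fbracket a b) = br (phi a) (phi b)"
  by (simp add: phi_def lext_magma_fbracket)

lemma phi_gen: "phi (gen x) = gval x"
  by (simp add: phi_def gen_def)

lemma magma_W: "magma_eval gval br t \<in> W (magma_eval gen_weight (+) t)"
proof (induction t)
  case (Gen x)
  then show ?case by (cases x) (auto simp: gval_def W_0 e_W f_W)
qed (auto intro: W_br)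

lemma magma_P: "magma_eval gval br t \<in> P (magma_eval gpar (\<noteq>) t)"
proof (induction t)
  case (Gen x)
  then show ?case by (cases x) (auto simp: gval_def hm_P e_P f_P)
next
  case (Br t u)
  then show ?case using P_br by simp
qed

lemma phi_P: "a \<in> FP p \<Longrightarrow> phi a \<in> P p"
  unfolding phi_def by (rule lext_in_subspace[OF P_subspace]) (use magma_P in \<open>auto simp: supported_def FP_def\<close>)

lemma phi_W: "a \<in> supported {t. magma_eval gen_weight (+) t = \<beta>} \<Longrightarrow> phi a \<in> W \<beta>"
  unfolding phi_def by (rule lext_in_subspace[OF W_subspace]) (use magma_W in \<open>auto simp: supported_def\<close>)

lemma phi_C: "phi a \<in> C"
  unfolding phi_def using magma_W W_C by (intro lext_in_subspace[OF subspace_C]) blast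

lemma range_phi: "range phi = C"
proof
  have "pm.subspace (range phi)"
  proof (rule pm.subspaceI)
    show "0 \<in> range phi" by (rule range_eqI[of _ _ 0]) (simp add: phi_linear)
  qed (auto simp flip: phi_linear(1,5))
  then show "C \<subseteq> range phi"
  proof (rule generated)
    show "hm x \<in> range phi" for x using phi_gen[of "GenH x"] by (metis gval_def generator.case rangeI)
    show "e x \<in> range phi" for x using phi_gen[of "GenE x"] by (metis gval_def generator.case rangeI)
    show "f x \<in> range phi" for x using phi_gen[of "GenF x"] by (metis gval_def generator.case rangeI)
  qed (auto simp flip: phi_br)
qed (use phi_C in auto)

lemma FP_split: obtains a1 a2 where "a1 \<in> FP p" "a2 \<in> FP (\<not> p)" "a = a1 + a2"
proof
  let ?S = "{t. magma_eval gpar (\<noteq>) t = p}"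
  show "prj ?S a \<in> FP p" unfolding FP_def by (rule prj_supported)
  show "prj (- ?S) a \<in> FP (\<not> p)" using prj_supported[of "- ?S" a] by (simp add: Compl_eq FP_def)
  show "a = prj ?S a + prj (- ?S) a" by (rule prj_split)
qed

text \<open>Split a preimage of \<open>y\<close> by parity: the image of the wrong part then has
  both parities, hence vanishes, and the right part is still a preimage.\<close>

lemma phi_part: "phi ` FP p = P p"
proof (intro equalityI subsetI)
  fix y assume y: "y \<in> P p"
  then obtain a where a: "y = phi a" using P_C range_phi by blast
  obtain a1 a2 where *: "a1 \<in> FP p" "a2 \<in> FP (\<not> p)" "a = a1 + a2" by (rule FP_split)
  have "phi a2 = y - phi a1" by (simp add: a *(3) phi_linear)
  then have "phi a2 \<in> P p" using pm.subspace_diff[OF P_subspace y phi_P[OF *(1)]] by simp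
  then have "phi a2 = 0" using phi_P[OF *(2)] P_Int by blast
  then show "y \<in> phi ` FP p" using * a by (auto simp: phi_linear)
qed (use phi_P in auto)

sublocale epi: super_epi_lie phi F "model_alg C br P"
proof (intro super_epi_lie.intro lie super_epi.intro)
  fix x y :: "('h, 'n) generator magma \<Rightarrow>\<^sub>0 'k"
  show "\<exists>i\<in>carrier F. i \<oplus>\<^bsub>F\<^esub> y = x" by (intro bexI[of _ "x - y"]) simp_all
qed (simp_all add: phi_linear phi_br range_phi phi_part)

lemma ker_iff: "a \<in> epi.ker \<longleftrightarrow> phi a = 0"
  by (simp add: epi.ker_def)

abbreviation Rel :: "(('h, 'n) generator magma \<Rightarrow>\<^sub>0 'k) set" where "Rel \<equiv> chevalley_relations R"

lemma bracket_ideal_ker: "bracket_ideal F epi.ker"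
  by (auto simp: bracket_ideal_model_alg_iff ker_iff phi_linear phi_br pm.subspace_def)

lemma parity_graded_ker: "parity_graded F epi.ker"
  unfolding parity_graded_def
proof (intro equalityI subsetI)
  fix a assume a: "a \<in> epi.ker"
  obtain a1 a2 where *: "a1 \<in> FP False" "a2 \<in> FP (\<not> False)" "a = a1 + a2" by (rule FP_split)
  have "phi a1 = - phi a2" using a by (simp add: ker_iff *(3) phi_linear eq_neg_iff_add_eq_0)
  then have "phi a1 \<in> P True"
    using phi_P[OF *(2)] pm.subspace_neg[OF P_subspace] by simp
  then have "phi a1 = 0" using phi_P[OF *(1)] P_Int[of "phi a1" False] by simp
  then have "a1 \<in> epi.ker" "a2 \<in> epi.ker" using a * by (simp_all add: ker_iff phi_linear)
  then show "a \<in> (epi.ker \<inter> part F False) <+>\<^bsub>F\<^esub> (epi.ker \<inter> part F True)"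
    using * unfolding set_add_def' by auto
qed (auto simp: set_add_def' ker_iff phi_linear)

lemma Rel_ker: "Rel \<subseteq> epi.ker"
  unfolding chevalley_relations_def
  by (auto simp: ker_iff phi_linear phi_br phi_gen gval_def fscale_eq hm_add hm_scale ef he hf hh
      if_distrib[of phi] split del: if_split cong: if_cong)

definition PI where "PI = presentation_ideal gpar Rel"

definition ideals where "ideals =
  {I. bracket_ideal F I \<and> parity_graded F I \<and> lie_superalgebra (superquotient F I) \<and> Rel \<subseteq> I}"

lemma PI_eq: "PI = \<Inter> ideals"
  by (simp only: PI_def presentation_ideal_def ideals_def free_superalgebra_eq FP_def)

text \<open>The quotient by the kernel is a copy of \<open>C\<close> and thus Lie, so the kernel
  takes part in the intersection that defines the presentation ideal. Hence \<open>PI\<close> lies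
  in the kernel and \<open>phi\<close> descends to the presented algebra.\<close>

lemma ker_ideals: "epi.ker \<in> ideals"
  using bracket_ideal_ker parity_graded_ker Rel_ker
    super_iso.lie_superalgebra_D[OF epi.super_iso_quotient_map]
  by (simp add: ideals_def)

lemma PI_ker: "PI \<subseteq> epi.ker" using ker_ideals by (auto simp: PI_eq)

lemma phi_PI: "a \<in> PI \<Longrightarrow> phi a = 0" using PI_ker by (auto simp: ker_iff)

lemma Rel_PI: "a \<in> Rel \<Longrightarrow> a \<in> PI" by (auto simp: PI_eq ideals_def)

lemma ideals_quotient: "I \<in> ideals \<Longrightarrow> lie_ideal_quotient fbracket I FP"
  unfolding ideals_def bracket_ideal_model_alg_iff
  by (intro lie_ideal_quotient.intro ideal_quotient.intro ideal_quotient_axioms.intro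
      lie_ideal_quotient_axioms.intro fb.bilinear_bracket_axioms) blast+

sublocale pq: ideal_quotient fbracket PI FP
proof
  have I: "pm.subspace I" "\<And>x y. y \<in> I \<Longrightarrow> fbracket x y \<in> I \<and> fbracket y x \<in> I" if "I \<in> ideals" for I
    using that unfolding ideals_def bracket_ideal_model_alg_iff by blast+
  show "pm.subspace PI" unfolding PI_eq by (intro pm.subspace_Inter ballI I(1))
  show "fbracket x y \<in> PI" "fbracket y x \<in> PI" if "y \<in> PI" for x y
    using that I(2) unfolding PI_eq by blast+
qed

lemma PI_skew:
  "\<lbrakk>x \<in> FP p; y \<in> FP q\<rbrakk> \<Longrightarrow> fbracket x y + pscale (koszul p q) (fbracket y x) \<in> PI"
  unfolding PI_eq by (intro InterI lie_ideal_quotient.skew_mod[OF ideals_quotient]) auto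

lemma PI_jacobi: "\<lbrakk>x \<in> FP p; y \<in> FP q; z \<in> FP r\<rbrakk> \<Longrightarrow>
    fbracket x (fbracket y z) -
      (fbracket (fbracket x y) z + pscale (koszul p q) (fbracket y (fbracket x z))) \<in> PI"
  unfolding PI_eq by (intro InterI lie_ideal_quotient.jacobi_mod[OF ideals_quotient]) auto

end

lemma (in bilinear_bracket) subspace_left: "pm.subspace T \<Longrightarrow> pm.subspace {m. br m v \<in> T}"
  by (auto simp: pm.subspace_def linear_simps)

lemma (in bilinear_bracket) subspace_right: "pm.subspace T \<Longrightarrow> pm.subspace {m. br v m \<in> T}"
  by (auto simp: pm.subspace_def linear_simps)

lemma subspace_diff_iff: "pm.subspace T \<Longrightarrow> x - y \<in> T \<Longrightarrow> x \<in> T \<longleftrightarrow> y \<in> T"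
  using pm.subspace_add[of T "x - y" y] pm.subspace_diff[of T x "x - y"] by auto

lemma generator_cases:
  obtains x where "g = GenH x" | i s where "g = xgen s i"
proof (cases g)
  case (GenE i)
  then show ?thesis using that(2)[of True i] by (simp add: xgen_def)
next
  case (GenF i)
  then show ?thesis using that(2)[of False i] by (simp add: xgen_def)
qed (use that in auto)

section \<open>Triangular decomposition of the presented algebra\<close>

context contragredient_model
begin

abbreviation mon where "mon t \<equiv> single t (1 :: 'k)"

lemmas PI_subspace = pq.subspace_I
lemmas PI_ideal = pq.ideal

lemma mono_FP: "mon t \<in> FP (magma_eval gpar (\<noteq>) t)"
  by (simp add: FP_def)

lemma relations_mod:
  "gen (GenH (x + y)) - (gen (GenH x) + gen (GenH y)) \<in> PI"
  "gen (GenH (hscale R c x)) - pscale c (gen (GenH x)) \<in> PI"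
  "fbracket (gen (GenE i)) (gen (GenF j)) - (if i = j then gen (GenH (coroot R i)) else 0) \<in> PI"
  "fbracket (gen (GenH x)) (gen (GenE j)) - pscale (simple_root R j x) (gen (GenE j)) \<in> PI"
  "fbracket (gen (GenH x)) (gen (GenF j)) + pscale (simple_root R j x) (gen (GenF j)) \<in> PI"
  "fbracket (gen (GenH x)) (gen (GenH y)) \<in> PI"
  by (rule Rel_PI, unfold chevalley_relations_def fscale_eq, blast)+

text \<open>Eigenvalues add along brackets by the Jacobi identity. The eigenvalue stays existential:
  for the decomposition, bracketing with a Cartan element only has to rescale a monomial.\<close>

lemma cartan_acts_diagonally: "\<exists>c. fbracket (gen (GenH x)) (mon t) - pscale c (mon t) \<in> PI"
proof (induction t)
  case (Gen g)
  show ?case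
  proof (cases g)
    case (GenH y)
    then show ?thesis using relations_mod(6)[of x y] by (intro exI[of _ 0]) (simp add: gen_eq)
  next
    case (GenE j)
    then show ?thesis using relations_mod(4)[of x j] by (auto simp add: gen_eq)
  next
    case (GenF j)
    then show ?thesis using relations_mod(5)[of x j]
      by (intro exI[of _ "- simple_root R j x"]) (simp add: gen_eq single_uminus)
  qed
next
  case (Br t u)
  let ?h = "gen (GenH x)"
  obtain c d where c: "fbracket ?h (mon t) - pscale c (mon t) \<in> PI"
    and d: "fbracket ?h (mon u) - pscale d (mon u) \<in> PI" using Br by blast
  have h: "?h \<in> FP False" by (simp add: FP_def gen_eq)
  have tu: "mon (Br t u) = fbracket (mon t) (mon u)" by (simp add: fbracket_single)
  have 1: "fbracket (fbracket ?h (mon t)) (mon u) - pscale c (mon (Br t u)) \<in> PI"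
    using PI_ideal(2)[OF c, of "mon u"] by (simp only: fb.linear_simps tu)
  have 2: "fbracket (mon t) (fbracket ?h (mon u)) - pscale d (mon (Br t u)) \<in> PI"
    using PI_ideal(1)[OF d, of "mon t"] by (simp only: fb.linear_simps tu)
  have "fbracket ?h (mon (Br t u)) - (fbracket (fbracket ?h (mon t)) (mon u)
      + fbracket (mon t) (fbracket ?h (mon u))) \<in> PI"
    using PI_jacobi[OF h mono_FP mono_FP, of t u] by (simp add: koszul_def tu)
  from pm.subspace_add[OF PI_subspace pm.subspace_add[OF PI_subspace this 1] 2]
  have "fbracket ?h (mon (Br t u)) - pscale (c + d) (mon (Br t u)) \<in> PI"
    by (simp only: pm.scale_left_distrib) (simp add: algebra_simps)
  then show ?case by blast
qed

text \<open>
  \<open>level k\<close> contains \<open>PI\<close>, so it describes a subspace of the presented algebra.  The triangular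
  decomposition enters in the form: every monomial of height \<open>k\<close> lies in \<open>level k\<close>.
\<close>

definition level :: "int \<Rightarrow> (('h, 'n) generator magma \<Rightarrow>\<^sub>0 'k) set" where
  "level k = pm.span (PI \<union> {mon t |t s. pure s t \<and> height t = k} \<union> {gen (GenH x) |x. k = 0})"

lemma level_subspace: "pm.subspace (level k)"
  by (simp add: level_def)

lemma PI_level: "a \<in> PI \<Longrightarrow> a \<in> level k"
  by (auto simp: level_def intro: pm.span_base)

lemma pure_level: "pure s t \<Longrightarrow> height t = k \<Longrightarrow> mon t \<in> level k"
  unfolding level_def by (intro pm.span_base) blast

lemma gen_H_level: "gen (GenH x) \<in> level 0"
  unfolding level_def by (intro pm.span_base) blast

lemma level_mod: "a - b \<in> PI \<Longrightarrow> a \<in> level k \<longleftrightarrow> b \<in> level k"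
  by (intro subspace_diff_iff level_subspace PI_level)

lemma level_induct [consumes 1, case_names subspace PI pure cartan]:
  assumes "a \<in> level k" "pm.subspace {a. Q a}" "\<And>a. a \<in> PI \<Longrightarrow> Q a"
    "\<And>t s. pure s t \<Longrightarrow> height t = k \<Longrightarrow> Q (mon t)"
    "\<And>x. k = 0 \<Longrightarrow> Q (gen (GenH x))"
  shows "Q a"
  using assms(1) unfolding level_def
  by (rule pm.span_induct[OF _ assms(2)]) (use assms(3-5) in auto)

lemma skew_level:
  assumes "a \<in> FP p" "b \<in> FP q" "fbracket a b \<in> level k"
  shows "fbracket b a \<in> level k"
proof -
  have "fbracket b a - (- pscale (koszul q p) (fbracket a b)) \<in> PI"
    using PI_skew[OF assms(2,1)] by simp
  then show ?thesis
    using assms(3) level_mod pm.subspace_neg[OF level_subspace] pm.subspace_scale[OF level_subspace]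
    by blast
qed

lemma cartan_level:
  assumes "mon t \<in> level k"
  shows "fbracket (gen (GenH x)) (mon t) \<in> level k" "fbracket (mon t) (gen (GenH x)) \<in> level k"
proof -
  show *: "fbracket (gen (GenH x)) (mon t) \<in> level k"
    using cartan_acts_diagonally[of x t] level_mod pm.subspace_scale[OF level_subspace assms] by blast
  show "fbracket (mon t) (gen (GenH x)) \<in> level k"
    using skew_level[OF _ mono_FP *, of False] by (simp add: FP_def gen_eq)
qed

text \<open>The sign condition on \<open>k\<close> excludes monomials of sign \<open>s\<close> from
  \<open>level k\<close>. Modulo \<open>PI\<close> its elements are then combinations of Cartan
  elements and monomials of the sign of \<open>v\<close>, and both kinds can be bracketed with
  \<open>v\<close>.\<close>

lemma level_pure:
  assumes m: "m \<in> level k" and v: "pure (\<not> s) v" and k: "xsign s * k \<le> 0"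
  shows "fbracket m (mon v) \<in> level (k + height v)" "fbracket (mon v) m \<in> level (k + height v)"
proof -
  have "fbracket m (mon v) \<in> level (k + height v) \<and> fbracket (mon v) m \<in> level (k + height v)"
    using m
  proof (induction rule: level_induct)
    case subspace
    show ?case
      using pm.subspace_inter[OF fb.subspace_left[OF level_subspace] fb.subspace_right[OF level_subspace]]
      by (simp add: Int_def)
  next
    case (PI a)
    then show ?case by (auto intro: PI_level PI_ideal)
  next
    case (pure t s')
    have "s' \<noteq> s"
    proof
      assume "s' = s"
      then show False using pure_height[OF pure(1)] pure(2) k by simp
    qed
    then have "pure (\<not> s) t" using pure by (cases s; cases s') auto
    then show ?case using pure v by (auto simp: fbracket_single intro!: pure_level[of "\<not> s"])
  next
    case (cartan x)
    then show ?case using cartan_level[OF pure_level[OF v refl]] by simp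
  qed
  then show "fbracket m (mon v) \<in> level (k + height v)" "fbracket (mon v) m \<in> level (k + height v)"
    by auto
qed

text \<open>Induction with the generator acting as a superderivation. The base case is [e_i, f_j] =
  \<delta>_ij h_i. In the step, the generator moves the height of one factor by one towards 0
  without passing it, so that \<open>level_pure\<close> absorbs the other factor.\<close>

lemma xgen_level_opposite:
  assumes "pure (\<not> s) t"
  shows "fbracket (mon (Gen (xgen s i))) (mon t) \<in> level (xsign s + height t)"
  using assms
proof (induction t)
  case (Gen g)
  then obtain j where g: "g = xgen (\<not> s) j" by auto
  have ef: "fbracket (gen (GenE i)) (gen (GenF j)) \<in> level 0" for i j
    using relations_mod(3)[of i j] level_mod gen_H_level pm.subspace_0[OF level_subspace]
    by (cases "i = j") (auto intro: PI_level)
  have "fbracket (mon (Gen (xgen s i))) (mon (Gen (xgen (\<not> s) j))) \<in> level 0"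
    using ef[of i j] skew_level[OF mono_FP mono_FP, of "Gen (GenE j)" "Gen (GenF i)" 0] ef[of j i]
    by (cases s) (simp_all add: xgen_def gen_eq)
  then show ?case by (cases s) (simp_all add: g xgen_def xsign_def)
next
  case (Br t u)
  let ?x = "mon (Gen (xgen s i))"
  let ?k = "xsign s + height (Br t u)"
  have pu: "pure (\<not> s) t" "pure (\<not> s) u" using Br.prems by auto
  have neg: "xsign s * (xsign s + height w) \<le> 0" if "pure (\<not> s) w" for w :: "('h, 'n) generator magma"
    using pure_height[OF that] by (cases s) (auto simp: xsign_def)
  have 1: "fbracket (fbracket ?x (mon t)) (mon u) \<in> level ?k"
    using level_pure(1)[OF Br.IH(1)[OF pu(1)] pu(2) neg[OF pu(1)]] by (simp add: add.assoc)
  have 2: "fbracket (mon t) (fbracket ?x (mon u)) \<in> level ?k"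
    using level_pure(2)[OF Br.IH(2)[OF pu(2)] pu(1) neg[OF pu(2)]] by (simp add: ac_simps)
  have "fbracket ?x (fbracket (mon t) (mon u)) \<in> level ?k"
    using PI_jacobi[OF mono_FP mono_FP mono_FP, of "Gen (xgen s i)" t u] level_mod
      pm.subspace_add[OF level_subspace 1 pm.subspace_scale[OF level_subspace 2]] by blast
  then show ?case by (simp add: fbracket_single)
qed

lemma gen_level:
  assumes "m \<in> level k"
  shows "fbracket (mon (Gen g)) m \<in> level (k + height (Gen g))"
  using assms
proof (induction rule: level_induct)
  case subspace
  show ?case by (rule fb.subspace_right[OF level_subspace])
next
  case (PI a)
  then show ?case by (auto intro: PI_level PI_ideal)
next
  case (pure t s)
  consider x where "g = GenH x" | i where "g = xgen s i" | i where "g = xgen (\<not> s) i"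
    by (cases g; cases s) (auto simp: xgen_def)
  then show ?case
  proof cases
    case (1 x)
    then show ?thesis using cartan_level(1)[OF pure_level[OF pure]] by (simp add: gen_eq)
  next
    case (2 i)
    then have "pure s (Br (Gen g) t)" using pure by auto
    then show ?thesis using pure 2 by (auto simp: fbracket_single intro!: pure_level[of s])
  next
    case (3 i)
    then show ?thesis using xgen_level_opposite[of "\<not> s" t i] pure by (simp add: add.commute)
  qed
next
  case (cartan x)
  consider y where "g = GenH y" | i s where "g = xgen s i"
    by (rule generator_cases)
  then show ?case
  proof cases
    case (1 y)
    then show ?thesis using PI_level[OF relations_mod(6)] by (simp add: gen_eq)
  next
    case (2 i s)
    have "mon (Gen g) \<in> level (height (Gen g))" by (rule pure_level[of s]) (auto simp: 2)
    then show ?thesis using cartan_level(2)[of "Gen g"] cartan by simp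
  qed
qed

text \<open>The Jacobi identity trades [[t,u],m] for [t,[u,m]] and [u,[t,m]], which reduces
  everything to generators. It needs \<open>m\<close> of definite parity, hence the detour through
  the spanning set of \<open>level k\<close>.\<close>

lemma mono_bracket_level: "m \<in> level k \<Longrightarrow> fbracket (mon t) m \<in> level (k + height t)"
proof (induction t arbitrary: m k)
  case (Br t u)
  have step: "fbracket (mon (Br t u)) m \<in> level (k + height (Br t u))"
    if m: "m \<in> level k" "m \<in> FP r" for m r
  proof -
    have 1: "fbracket (mon t) (fbracket (mon u) m) \<in> level (k + height (Br t u))"
      using Br.IH(1)[OF Br.IH(2)[OF m(1)]] by (simp add: ac_simps)
    have 2: "fbracket (mon u) (fbracket (mon t) m) \<in> level (k + height (Br t u))"
      using Br.IH(2)[OF Br.IH(1)[OF m(1)]] by (simp add: ac_simps)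
    define \<kappa> :: 'k where "\<kappa> = koszul (magma_eval gpar (\<noteq>) t) (magma_eval gpar (\<noteq>) u)"
    let ?A = "fbracket (mon t) (fbracket (mon u) m)"
    let ?B = "fbracket (fbracket (mon t) (mon u)) m"
    let ?D = "fbracket (mon u) (fbracket (mon t) m)"
    have "?A - (?B + pscale \<kappa> ?D) \<in> PI"
      using PI_jacobi[OF mono_FP mono_FP m(2)] by (simp add: \<kappa>_def)
    then have "?B - (?A - pscale \<kappa> ?D) \<in> PI"
      using pm.subspace_neg[OF PI_subspace] by (fastforce simp: algebra_simps)
    moreover have "?A - pscale \<kappa> ?D \<in> level (k + height (Br t u))"
      using 1 2 by (intro pm.subspace_diff pm.subspace_scale level_subspace)
    ultimately have "?B \<in> level (k + height (Br t u))" using level_mod by blast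
    then show ?thesis by (simp add: fbracket_single)
  qed
  from Br.prems show ?case
  proof (induction rule: level_induct)
    case subspace
    show ?case by (rule fb.subspace_right[OF level_subspace])
  next
    case (PI a)
    then show ?case by (auto intro: PI_level PI_ideal)
  next
    case (pure t' s)
    then show ?case using step[OF pure_level mono_FP] by blast
  next
    case (cartan x)
    then show ?case using step[of "gen (GenH x)" False] gen_H_level by (simp add: FP_def gen_eq)
  qed
qed (rule gen_level)

lemma mono_level: "mon t \<in> level (height t)"
proof (induction t)
  case (Gen g)
  consider y where "g = GenH y" | i s where "g = xgen s i"
    by (rule generator_cases)
  then show ?case
  proof cases
    case (1 y)
    then show ?thesis using gen_H_level[of y] by (simp add: gen_eq)
  next
    case (2 i s)
    then show ?thesis by (intro pure_level[of s]) auto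
  qed
next
  case (Br t u)
  then show ?case using mono_bracket_level[OF Br.IH(2), of t] by (simp add: fbracket_single add.commute)
qed

text \<open>Weight 0 implies height 0, where no pure monomials exist; what remains of
  \<open>level 0\<close> is the Cartan part and \<open>PI\<close>. Without this bound an ideal could
  avoid the Cartan subalgebra and still have weight 0 elements.\<close>

lemma weight_0_cartan:
  assumes "a \<in> supported {t. magma_eval gen_weight (+) t = 0}"
  obtains x where "a - gen (GenH x) \<in> PI"
proof -
  have "mon t \<in> level 0" if "t \<in> keys a" for t
  proof -
    have "height t = 0" using assms that by (auto simp: supported_def height_def)
    then show ?thesis using mono_level[of t] by simp
  qed
  then have "lext (\<lambda>t. mon t) a \<in> level 0"
    by (rule lext_in_subspace[OF level_subspace])
  then have "a \<in> level 0" by (simp add: lext_identity)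
  then have "\<exists>x. a - gen (GenH x) \<in> PI"
  proof (induction rule: level_induct)
    case subspace
    \<comment> \<open>The additivity relation for 0 + 0 is, up to sign, the generator of 0
      itself.\<close>
    have 0: "gen (GenH 0) \<in> PI"
      using relations_mod(1)[of 0 0] pm.subspace_neg[OF PI_subspace] by fastforce
    show ?case
    proof (rule pm.subspaceI)
      show "0 \<in> {a. \<exists>x. a - gen (GenH x) \<in> PI}"
        using pm.subspace_neg[OF PI_subspace 0] by (auto intro!: exI[of _ 0])
    next
      fix a b assume "a \<in> {a. \<exists>x. a - gen (GenH x) \<in> PI}" "b \<in> {a. \<exists>x. a - gen (GenH x) \<in> PI}"
      then obtain x y where "a - gen (GenH x) \<in> PI" "b - gen (GenH y) \<in> PI" by blast
      from pm.subspace_diff[OF PI_subspace pm.subspace_add[OF PI_subspace this] relations_mod(1)[of x y]]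
      have "a + b - gen (GenH (x + y)) \<in> PI" by (simp add: algebra_simps)
      then show "a + b \<in> {a. \<exists>x. a - gen (GenH x) \<in> PI}" by blast
    next
      fix c a assume "a \<in> {a. \<exists>x. a - gen (GenH x) \<in> PI}"
      then obtain x where "a - gen (GenH x) \<in> PI" by blast
      from pm.subspace_diff[OF PI_subspace pm.subspace_scale[OF PI_subspace this, of c] relations_mod(2)[of c x]]
      have "pscale c a - gen (GenH (hscale R c x)) \<in> PI" by (simp add: algebra_simps pm.scale_right_diff_distrib)
      then show "pscale c a \<in> {a. \<exists>x. a - gen (GenH x) \<in> PI}" by blast
    qed
    case (PI a)
    then show ?case using pm.subspace_diff[OF PI_subspace _ 0] by blast
  next
    case (pure t s)
    then show ?case using pure_height_0 by blast
  next
    case (cartan x)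
    then show ?case using pm.subspace_0[OF PI_subspace] by (intro exI[of _ x]) simp
  qed
  then show thesis using that by blast
qed

end

lemma fbracket_supported:
  assumes a: "a \<in> supported {t. magma_eval g (+) t = \<beta>}" and b: "b \<in> supported {t. magma_eval g (+) t = \<gamma>}"
  shows "fbracket a b \<in> supported {t. magma_eval g (+) t = \<beta> + \<gamma>}"
  using a
proof (induction rule: supported_induct)
  case zero
  then show ?case by (simp add: pm.subspace_0[OF subspace_supported])
next
  case (add a a')
  then show ?case by (simp add: fb.add_left pm.subspace_add[OF subspace_supported])
next
  case (single s c)
  from b show ?case
  proof (induction rule: supported_induct)
    case zero
    then show ?case by (simp add: pm.subspace_0[OF subspace_supported])
  next
    case (add b b')
    then show ?case by (simp add: fb.add_right pm.subspace_add[OF subspace_supported])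
  next
    case (single t d)
    then show ?case using \<open>s \<in> _\<close> by (simp add: fbracket_single)
  qed
qed

section \<open>The largest graded ideal that misses the Cartan subalgebra\<close>

context contragredient_model
begin

definition wcomp :: "int ^ 'n \<Rightarrow> (('h, 'n) generator magma \<Rightarrow>\<^sub>0 'k) \<Rightarrow> (('h, 'n) generator magma \<Rightarrow>\<^sub>0 'k)"
  where "wcomp \<beta> = prj {t. magma_eval gen_weight (+) t = \<beta>}"

lemma wcomp_supported: "wcomp \<beta> a \<in> supported {t. magma_eval gen_weight (+) t = \<beta>}"
  unfolding wcomp_def by (rule prj_supported)

lemma sum_wcomp:
  assumes "finite B" "magma_eval gen_weight (+) ` keys a \<subseteq> B"
  shows "(\<Sum>\<beta>\<in>B. wcomp \<beta> a) = a"
proof (rule poly_mapping_eqI)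
  fix t
  have "lookup (\<Sum>\<beta>\<in>B. wcomp \<beta> a) t =
      (\<Sum>\<beta>\<in>B. if \<beta> = magma_eval gen_weight (+) t then lookup a t else 0)"
    unfolding lookup_sum wcomp_def by (intro sum.cong) auto
  also have "\<dots> = lookup a t"
  proof -
    have "magma_eval gen_weight (+) t \<in> B" if "lookup a t \<noteq> 0"
      using assms(2) that by (auto simp: in_keys_iff)
    then show ?thesis using assms(1) by auto
  qed
  finally show "lookup (\<Sum>\<beta>\<in>B. wcomp \<beta> a) t = lookup a t" .
qed

text \<open>The weight components of \<open>a\<close> map into independent spaces. Subtracting
  \<open>phi a\<close> in weight \<gamma> makes their images sum to 0, so each term, in particular
  the one of weight \<gamma>, is 0.\<close>

lemma phi_wcomp_eq:
  assumes "phi a \<in> W \<gamma>"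
  shows "phi (wcomp \<gamma> a) = phi a"
proof -
  let ?B = "insert \<gamma> (magma_eval gen_weight (+) ` keys a)"
  let ?u = "\<lambda>\<beta>. phi (wcomp \<beta> a) - (if \<beta> = \<gamma> then phi a else 0)"
  have "(\<Sum>\<beta>\<in>?B. ?u \<beta>) = phi (\<Sum>\<beta>\<in>?B. wcomp \<beta> a) - phi a"
    by (simp only: sum_subtractf phi_linear) simp
  also have "\<dots> = 0" by (subst sum_wcomp) auto
  finally have sum: "(\<Sum>\<beta>\<in>?B. ?u \<beta>) = 0" .
  have "?u \<beta> \<in> W \<beta>" for \<beta>
    using assms pm.subspace_diff[OF W_subspace phi_W[OF wcomp_supported], of "phi a" \<beta> a]
      phi_W[OF wcomp_supported, of \<beta> a]
    by (cases "\<beta> = \<gamma>") auto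
  then have "?u \<gamma> = 0" using sum by (intro W_indep[of ?B ?u \<gamma>]) simp_all
  then show ?thesis by simp
qed

lemma phi_wcomp_0: "phi a = 0 \<Longrightarrow> phi (wcomp \<beta> a) = 0"
  using phi_wcomp_eq[of a \<beta>] pm.subspace_0[OF W_subspace] by simp

definition phit :: "(('h, 'n) generator magma \<Rightarrow>\<^sub>0 'k) set \<Rightarrow> ('j \<Rightarrow>\<^sub>0 'k)" where
  "phit A = the_elem (phi ` A)"

lemma phit_coset: "phit (coset PI a) = phi a"
proof -
  have "phi ` coset PI a = {phi a}"
    using pm.subspace_0[OF PI_subspace] by (auto simp: coset_def image_image phi_linear phi_PI)
  then show ?thesis by (simp add: phit_def)
qed

sublocale tepi: super_epi_lie phit pq.Q "model_alg C br P"
proof (intro super_epi_lie.intro lie super_epi.intro)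
  fix x y assume "x \<in> carrier pq.Q" "y \<in> carrier pq.Q"
  then obtain a b where "x = coset PI a" "y = coset PI b" by (auto simp: pq.carrier_Q)
  then show "\<exists>i\<in>carrier pq.Q. i \<oplus>\<^bsub>pq.Q\<^esub> y = x"
    by (intro bexI[of _ "coset PI (a - b)"]) (simp_all add: pq.add_Q pq.carrier_Q)
next
  show "phit ` carrier pq.Q = carrier (model_alg C br P)"
    using range_phi by (simp add: pq.carrier_Q image_image phit_coset)
next
  fix p
  show "phit ` part pq.Q p = part (model_alg C br P) p"
    using phi_part by (simp add: pq.part_Q image_image phit_coset)
  show "part pq.Q p \<subseteq> carrier pq.Q" by (auto simp: pq.part_Q pq.carrier_Q)
qed (auto simp: pq.carrier_Q pq.add_Q pq.mult_Q pq.smult_Q pq.zero_Q phit_coset phi_linear phi_br)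

lemma tilde_eq: "contragredient_tilde par R = pq.Q"
  by (simp only: contragredient_tilde_def presented_lie_superalgebra_def PI_def free_superalgebra_eq FP_def)

lemma tilde_class_eq: "tilde_class par R a = coset PI a"
  by (simp add: tilde_class_def presented_class_def free_superalgebra_eq PI_def)

lemma tilde_cartan_eq: "tilde_cartan par R = range (\<lambda>x. coset PI (gen (GenH x)))"
  by (simp add: tilde_cartan_def tilde_class_eq)

lemma tilde_weight_space_eq:
  "tilde_weight_space par R \<beta> = coset PI ` supported {t. magma_eval gen_weight (+) t = \<beta>}"
  by (auto simp: tilde_weight_space_def tilde_class_eq supported_def)

lemma coset_in_ker_iff: "coset PI a \<in> tepi.ker \<longleftrightarrow> phi a = 0"
  by (simp add: tepi.ker_def pq.carrier_Q phit_coset)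

lemma ker_cosetE:
  assumes "x \<in> tepi.ker"
  obtains a where "x = coset PI a" "phi a = 0"
  using assms by (auto simp: tepi.ker_def pq.carrier_Q phit_coset)

lemma bracket_ideal_tepi_ker: "bracket_ideal pq.Q tepi.ker"
proof -
  have "submodule tepi.ker scalars pq.Q"
  proof (intro submodule.intro subgroup.intro submodule_axioms.intro)
    show "tepi.ker \<subseteq> carrier (add_monoid pq.Q)" by (auto simp: tepi.ker_def)
  next
    fix x assume "x \<in> tepi.ker"
    then obtain a where a: "x = coset PI a" "phi a = 0" by (rule ker_cosetE)
    have "inv\<^bsub>add_monoid pq.Q\<^esub> x = coset PI (- a)"
      using pq.a_inv_Q[of a] by (simp add: a a_inv_def)
    then show "inv\<^bsub>add_monoid pq.Q\<^esub> x \<in> tepi.ker" using a by (simp add: coset_in_ker_iff phi_linear)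
  qed (auto elim!: ker_cosetE simp: pq.add_Q pq.smult_Q pq.zero_Q coset_in_ker_iff phi_linear)
  then show ?thesis
    by (auto simp: bracket_ideal_def pq.carrier_Q pq.mult_Q coset_in_ker_iff phi_br elim!: ker_cosetE)
qed

lemma weight_graded_ker: "weight_graded par R tepi.ker"
  unfolding weight_graded_def
proof
  fix x assume "x \<in> tepi.ker"
  then obtain a where a: "x = coset PI a" "phi a = 0" by (rule ker_cosetE)
  let ?B = "magma_eval gen_weight (+) ` keys a"
  let ?y = "\<lambda>\<beta>. coset PI (wcomp \<beta> a)"
  have "?y \<in> (\<Pi> \<beta>\<in>?B. tepi.ker \<inter> tilde_weight_space par R \<beta>)"
    using wcomp_supported a(2) by (auto simp: coset_in_ker_iff phi_wcomp_0 tilde_weight_space_eq)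
  moreover have "x = finsum (contragredient_tilde par R) ?y ?B"
    by (simp add: tilde_eq pq.finsum_Q sum_wcomp a)
  ultimately have "finite ?B \<and> ?y \<in> (\<Pi> \<beta>\<in>?B. tepi.ker \<inter> tilde_weight_space par R \<beta>) \<and>
      x = finsum (contragredient_tilde par R) ?y ?B"
    by (intro conjI finite_imageI finite_keys)
  then show "\<exists>B y. finite B \<and> y \<in> (\<Pi> \<beta>\<in>B. tepi.ker \<inter> tilde_weight_space par R \<beta>) \<and>
      x = finsum (contragredient_tilde par R) y B"
    by (intro exI)
qed

lemma ker_Int_cartan: "tepi.ker \<inter> tilde_cartan par R = {\<zero>\<^bsub>contragredient_tilde par R\<^esub>}"
proof (intro equalityI subsetI)
  fix x assume "x \<in> tepi.ker \<inter> tilde_cartan par R"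
  then obtain h where x: "x = coset PI (gen (GenH h))" and "coset PI (gen (GenH h)) \<in> tepi.ker"
    by (auto simp: tilde_cartan_eq)
  then have "hm h = 0" by (simp add: coset_in_ker_iff phi_gen gval_def)
  moreover have "hm 0 = 0" using hm_add[of 0 0] by simp
  ultimately have "h = 0" using inj_hm by (metis injD)
  then have "gen (GenH h) \<in> PI"
    using relations_mod(1)[of 0 0] pm.subspace_neg[OF PI_subspace] by fastforce
  then show "x \<in> {\<zero>\<^bsub>contragredient_tilde par R\<^esub>}" by (simp add: x tilde_eq pq.zero_Q pq.cl_eq)
next
  have "gen (GenH 0) \<in> PI"
    using relations_mod(1)[of 0 0] pm.subspace_neg[OF PI_subspace] by fastforce
  then have "coset PI 0 = coset PI (gen (GenH 0))"
    using pm.subspace_neg[OF PI_subspace] by (simp add: pq.cl_eq)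
  then show "x \<in> tepi.ker \<inter> tilde_cartan par R" if "x \<in> {\<zero>\<^bsub>contragredient_tilde par R\<^esub>}" for x
    using that phi_PI[OF \<open>gen (GenH 0) \<in> PI\<close>]
    by (auto simp: tilde_eq pq.zero_Q tilde_cartan_eq coset_in_ker_iff)
qed

text \<open>Suppose a homogeneous element of \<open>J\<close> has nonzero image. If its weight is 0,
  it is a Cartan element by \<open>weight_0_cartan\<close>, hence 0. Otherwise nondegeneracy yields
  a partner of opposite weight whose bracket with it lies in \<open>J\<close>, has weight 0 and
  nonzero image, which is the first case.\<close>

lemma ideal_subset_ker:
  assumes J: "bracket_ideal (contragredient_tilde par R) J" "weight_graded par R J"
    "J \<inter> tilde_cartan par R = {\<zero>\<^bsub>contragredient_tilde par R\<^esub>}"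
  shows "J \<subseteq> tepi.ker"
proof
  have cartan: "phi a = 0"
    if a: "coset PI a \<in> J" "a \<in> supported {t. magma_eval gen_weight (+) t = 0}" for a
  proof -
    obtain x where "a - gen (GenH x) \<in> PI" using weight_0_cartan[OF a(2)] .
    then have "coset PI a = coset PI (gen (GenH x))" by (simp add: pq.cl_eq)
    then have "coset PI a \<in> J \<inter> tilde_cartan par R" using a(1) by (simp add: tilde_cartan_eq)
    then have "a \<in> PI" using J(3) by (simp add: tilde_eq pq.zero_Q pq.cl_eq)
    then show ?thesis by (rule phi_PI)
  qed
  have homogeneous: "phi a = 0"
    if a: "coset PI a \<in> J" "a \<in> supported {t. magma_eval gen_weight (+) t = \<beta>}" for a \<beta>
  proof (rule ccontr)
    assume nz: "phi a \<noteq> 0"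
    then have "\<beta> \<noteq> 0" using cartan a by blast
    then obtain z where z: "z \<in> W (- \<beta>)" "br z (phi a) \<noteq> 0"
      using nondegenerate[OF phi_W[OF a(2)] nz] by blast
    then obtain b where b: "z = phi b" using W_C range_phi by blast
    \<comment> \<open>The preimage \<open>b\<close> of \<open>z\<close> is arbitrary; cutting it
      down to weight - \<beta> keeps its image and makes the bracket homogeneous.\<close>
    have "phi (fbracket (wcomp (- \<beta>) b) a) = br z (phi a)"
      using phi_wcomp_eq[of b "- \<beta>"] z(1) by (simp add: phi_br b)
    moreover have "coset PI (fbracket (wcomp (- \<beta>) b) a) \<in> J"
      using J(1) a(1) unfolding bracket_ideal_def tilde_eq
      by (auto simp: pq.carrier_Q simp flip: pq.mult_Q)
    moreover have "fbracket (wcomp (- \<beta>) b) a \<in> supported {t. magma_eval gen_weight (+) t = 0}"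
      using fbracket_supported[OF wcomp_supported a(2), of "- \<beta>" b] by simp
    ultimately show False using cartan[of "fbracket (wcomp (- \<beta>) b) a"] z(2) by simp
  qed
  fix x assume "x \<in> J"
  then obtain B y where B: "finite B" and y: "y \<in> (\<Pi> \<beta>\<in>B. J \<inter> tilde_weight_space par R \<beta>)"
    and x: "x = finsum pq.Q y B"
    using J(2)[unfolded weight_graded_def tilde_eq, rule_format, OF \<open>x \<in> J\<close>] by (elim exE conjE)
  have "\<forall>\<beta>\<in>B. \<exists>a. a \<in> supported {t. magma_eval gen_weight (+) t = \<beta>} \<and> y \<beta> = coset PI a \<and> coset PI a \<in> J"
  proof
    fix \<beta> assume "\<beta> \<in> B"
    then have "y \<beta> \<in> J" "y \<beta> \<in> tilde_weight_space par R \<beta>" using y by (auto simp: Pi_iff)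
    then show "\<exists>a. a \<in> supported {t. magma_eval gen_weight (+) t = \<beta>} \<and> y \<beta> = coset PI a \<and> coset PI a \<in> J"
      unfolding tilde_weight_space_eq by force
  qed
  from bchoice[OF this] obtain a where a: "\<And>\<beta>. \<beta> \<in> B \<Longrightarrow> a \<beta> \<in> supported {t. magma_eval gen_weight (+) t = \<beta>}"
    "\<And>\<beta>. \<beta> \<in> B \<Longrightarrow> y \<beta> = coset PI (a \<beta>)" "\<And>\<beta>. \<beta> \<in> B \<Longrightarrow> coset PI (a \<beta>) \<in> J"
    by blast
  interpret Q: abelian_group pq.Q by (rule pq.abelian_group_Q)
  have "x = finsum pq.Q (\<lambda>\<beta>. coset PI (a \<beta>)) B"
    unfolding x by (intro Q.finsum_cong') (auto simp: a(2) pq.carrier_Q)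
  then have "x = coset PI (\<Sum>\<beta>\<in>B. a \<beta>)" by (simp add: pq.finsum_Q B)
  moreover have "phi (\<Sum>\<beta>\<in>B. a \<beta>) = 0"
    using homogeneous[OF a(3) a(1)] by (simp add: phi_linear)
  ultimately show "x \<in> tepi.ker" by (simp add: coset_in_ker_iff)
qed

lemma maximal_ideal_r_eq: "maximal_ideal_r par R = tepi.ker"
  unfolding maximal_ideal_r_def
proof (rule Greatest_equality)
  show "bracket_ideal (contragredient_tilde par R) tepi.ker \<and> weight_graded par R tepi.ker \<and>
      tepi.ker \<inter> tilde_cartan par R = {\<zero>\<^bsub>contragredient_tilde par R\<^esub>}"
  proof (intro conjI weight_graded_ker ker_Int_cartan)
    show "bracket_ideal (contragredient_tilde par R) tepi.ker"
      unfolding tilde_eq by (rule bracket_ideal_tepi_ker)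
  qed
next
  fix J
  assume J: "bracket_ideal (contragredient_tilde par R) J \<and> weight_graded par R J \<and>
      J \<inter> tilde_cartan par R = {\<zero>\<^bsub>contragredient_tilde par R\<^esub>}"
  show "J \<subseteq> tepi.ker"
    by (rule ideal_subset_ker[OF J[THEN conjunct1] J[THEN conjunct2, THEN conjunct1]
          J[THEN conjunct2, THEN conjunct2]])
qed

lemma contragredient_eq: "contragredient par R = tepi.Q"
  unfolding contragredient_def by (rule arg_cong2[where f = superquotient, OF tilde_eq maximal_ideal_r_eq])

lemma super_iso_contragredient:
  "super_iso tepi.quotient_map (contragredient par R) (model_alg C br P)"
  unfolding contragredient_eq by (rule tepi.super_iso_quotient_map)

lemma chevalley_e_mem: "chevalley_e par R i \<in> carrier (contragredient par R)"
proof -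
  have "coset PI (gen (GenE i)) \<in> carrier pq.Q" unfolding pq.carrier_Q by (rule rangeI)
  then show ?thesis
    unfolding contragredient_eq chevalley_e_def maximal_ideal_r_eq tilde_eq tilde_class_eq tepi.carrier_Q
    by (rule imageI)
qed

lemma quotient_map_chevalley_e: "tepi.quotient_map (chevalley_e par R i) = e i"
proof -
  have "chevalley_e par R i = tepi.cl (coset PI (gen (GenE i)))"
    by (simp only: chevalley_e_def maximal_ideal_r_eq tilde_eq tilde_class_eq)
  moreover have "coset PI (gen (GenE i)) \<in> carrier pq.Q" unfolding pq.carrier_Q by (rule rangeI)
  ultimately have "tepi.quotient_map (chevalley_e par R i) = phit (coset PI (gen (GenE i)))"
    by (simp only: tepi.quotient_map_cl)
  then show ?thesis by (simp add: phit_coset phi_gen gval_def)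
qed

text \<open>The position of \<open>chevalley_e\<close> is recorded because the semisimplification is
  taken along ad e_1.\<close>

theorem contragredient_iso:
  obtains \<psi> where "super_iso \<psi> (contragredient par R) (model_alg C br P)"
    "\<And>i. chevalley_e par R i \<in> carrier (contragredient par R)"
    "\<And>i. \<psi> (chevalley_e par R i) = e i"
  by (rule that[OF super_iso_contragredient chevalley_e_mem quotient_map_chevalley_e])

end

section \<open>The Lie algebra of a simply laced root lattice\<close>

lemma (in bilinear_bracket) skew_from_basis:
  assumes "\<And>i j. br (single i 1) (single j 1) = - br (single j 1) (single i 1)"
  shows "br x y = - br y x"
proof -
  have "x \<in> supported UNIV" "y \<in> supported UNIV" by simp_all
  from this(1) show ?thesis
  proof (induction rule: supported_induct)
    case (single i c)
    from \<open>y \<in> supported UNIV\<close> show ?case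
    proof (induction rule: supported_induct)
      case (single j d)
      have "br (pscale c (single i 1)) (pscale d (single j 1)) =
          - br (pscale d (single j 1)) (pscale c (single i 1))"
        unfolding scale_left scale_right assms[of i j]
        by (simp only: pm.scale_minus_right pm.scale_scale mult.commute)
      then show ?case by simp
    qed (simp_all add: linear_simps)
  qed (simp_all add: linear_simps)
qed

text \<open>The cyclic form is invariant under rotation, so that the cases of the Jacobi identity
  can be reduced to one arrangement of the arguments.\<close>

definition (in bilinear_bracket) jac where
  "jac x y z = br x (br y z) + br y (br z x) + br z (br x y)"

lemma (in bilinear_bracket) jacobi_from_basis:
  assumes "\<And>i j k. jac (single i 1) (single j 1) (single k 1) = 0"
  shows "jac x y z = 0"
proof -
  have "x \<in> supported UNIV" "y \<in> supported UNIV" "z \<in> supported UNIV" by simp_all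
  from this(1) show ?thesis
  proof (induction rule: supported_induct)
    case (single i c)
    from \<open>y \<in> supported UNIV\<close> show ?case
    proof (induction rule: supported_induct)
      case (single j d)
      from \<open>z \<in> supported UNIV\<close> show ?case
      proof (induction rule: supported_induct)
        case (single k l)
        have "jac (pscale c (single i 1)) (pscale d (single j 1)) (pscale l (single k 1)) =
            pscale (c * d * l) (jac (single i 1) (single j 1) (single k 1))"
          unfolding jac_def scale_left scale_right pm.scale_right_distrib pm.scale_scale
          by (simp only: ac_simps)
        then show ?case using assms by simp
      qed (simp add: jac_def, simp add: jac_def linear_simps add_eq_0_iff algebra_simps)
    qed (simp add: jac_def, simp add: jac_def linear_simps add_eq_0_iff algebra_simps)
  qed (simp add: jac_def, simp add: jac_def linear_simps add_eq_0_iff algebra_simps)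
qed

lemma bext_supported:
  assumes "a \<in> supported S" "b \<in> supported T" "\<And>i j. i \<in> S \<Longrightarrow> j \<in> T \<Longrightarrow> m i j \<in> supported U"
  shows "bext m a b \<in> supported U"
  unfolding bext_def
  by (intro lext_in_subspace subspace_supported assms(3)) (use assms in \<open>auto simp: supported_def\<close>)

definition lform :: "('n::finite \<Rightarrow> 'n \<Rightarrow> int) \<Rightarrow> int ^ 'n \<Rightarrow> int ^ 'n \<Rightarrow> int" where
  "lform M a b = (\<Sum>i\<in>UNIV. \<Sum>j\<in>UNIV. a $ i * b $ j * M i j)"

lemma lform_add_left: "lform M (a + b) c = lform M a c + lform M b c"
  by (simp add: lform_def algebra_simps sum.distrib)

lemma lform_add_right: "lform M c (a + b) = lform M c a + lform M c b"
  by (simp add: lform_def algebra_simps sum.distrib)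

lemma lform_uminus_left [simp]: "lform M (- a) c = - lform M a c"
  by (simp add: lform_def sum_negf)

lemma lform_uminus_right [simp]: "lform M c (- a) = - lform M c a"
  by (simp add: lform_def sum_negf)

lemma lform_diff_left: "lform M (a - b) c = lform M a c - lform M b c"
  using lform_add_left[of M a "- b" c] by simp

lemma lform_diff_right: "lform M c (a - b) = lform M c a - lform M c b"
  using lform_add_right[of M c a "- b"] by simp

lemma lform_zero [simp]: "lform M 0 a = 0" "lform M a 0 = 0"
  by (simp_all add: lform_def)

lemma lform_smult: "lform M (k *s a) (l *s b) = k * l * lform M a b"
  by (simp add: lform_def sum_distrib_left ac_simps)

lemma lform_axis_left: "lform M (axis i 1) b = (\<Sum>j\<in>UNIV. b $ j * M i j)"
proof -
  have "lform M (axis i 1) b = (\<Sum>i'\<in>UNIV. if i' = i then (\<Sum>j\<in>UNIV. b $ j * M i' j) else 0)"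
    unfolding lform_def by (intro sum.cong) (auto simp: axis_def)
  then show ?thesis by simp
qed

lemma lform_axis_right: "lform M a (axis j 1) = (\<Sum>i\<in>UNIV. a $ i * M i j)"
proof -
  have "lform M a (axis j 1) = (\<Sum>i\<in>UNIV. \<Sum>j'\<in>UNIV. if j' = j then a $ i * M i j' else 0)"
    unfolding lform_def by (intro sum.cong) (auto simp: axis_def)
  then show ?thesis by simp
qed

lemma lform_axis_axis [simp]: "lform M (axis i 1) (axis j 1) = M i j"
proof -
  have "lform M (axis i 1) (axis j 1) = (\<Sum>j'\<in>UNIV. if j' = j then M i j' else 0)"
    unfolding lform_axis_left by (intro sum.cong) (auto simp: axis_def)
  then show ?thesis by simp
qed

text \<open>Every lattice vector gets an index, root or not, so that no type of roots has to be
  built. Products with a non-root are set to 0 in \<open>lmult\<close>, and \<open>bidx\<close>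
  later selects the actual basis.\<close>

datatype ('n::finite) lidx = Hb 'n | Eb "int ^ 'n"

text \<open>\<open>M\<close> is in general not symmetric: its symmetrization plays the role of the
  Cartan matrix, and \<open>lform M a a\<close> is half the norm of \<open>a\<close>. The asymmetry
  is what yields a sign cocycle.\<close>

locale root_lattice =
  fixes M :: "'n::finite \<Rightarrow> 'n \<Rightarrow> int"
  assumes posdef: "a \<noteq> 0 \<Longrightarrow> lform M a a > 0"
    and diag: "M i i = 1" and offdiag: "i \<noteq> j \<Longrightarrow> M i j + M j i \<le> 0"
begin

abbreviation B where "B \<equiv> lform M"

definition ip :: "int ^ 'n \<Rightarrow> int ^ 'n \<Rightarrow> int" where "ip a b = B a b + B b a"

definition root :: "int ^ 'n \<Rightarrow> bool" where "root a \<longleftrightarrow> B a a = 1"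

text \<open>The Frenkel-Kac cocycle: bimultiplicative, equal to -1 on (a, a) for a root a, and with
  \<open>eps a b * eps b a\<close> equal to -1 to the power \<open>ip a b\<close>, as skew symmetry
  of the bracket requires.\<close>

definition eps :: "int ^ 'n \<Rightarrow> int ^ 'n \<Rightarrow> 'k::field" where
  "eps a b = (if even (B a b) then 1 else - 1)"

lemma ip_simps: "ip (a + b) c = ip a c + ip b c" "ip c (a + b) = ip c a + ip c b"
  "ip (a - b) c = ip a c - ip b c" "ip c (a - b) = ip c a - ip c b"
  "ip (- a) c = - ip a c" "ip c (- a) = - ip c a" "ip 0 a = 0" "ip a 0 = 0"
  by (simp_all add: ip_def lform_add_left lform_add_right lform_diff_left lform_diff_right)

lemma ip_commute: "ip a b = ip b a" by (simp add: ip_def)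

lemma ip_self: "ip a a = 2 * B a a" by (simp add: ip_def)

lemma ip_root_self: "root a \<Longrightarrow> ip a a = 2" by (simp add: ip_def root_def)

lemma ip_axis: "ip (axis i 1) (axis j 1) = M i j + M j i"
  by (simp add: ip_def)

lemma ip_expand: "ip a b = (\<Sum>i\<in>UNIV. a $ i * ip (axis i 1) b)"
  unfolding ip_def lform_axis_left lform_axis_right
  unfolding lform_def
  by (simp add: distrib_left sum.distrib sum_distrib_left ac_simps) (rule sum.swap)

lemma B_nonneg: "B a a \<ge> 0"
  using posdef[of a] by (cases "a = 0") auto

lemma B_eq_0_iff: "B a a = 0 \<longleftrightarrow> a = 0"
  using posdef[of a] by (cases "a = 0") auto

lemma quad_add: "B (a + b) (a + b) = B a a + ip a b + B b b"
  by (simp add: lform_add_left lform_add_right ip_def)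

lemma quad_diff: "B (a - b) (a - b) = B a a - ip a b + B b b"
  by (simp add: lform_diff_left lform_diff_right ip_def)

lemma root_uminus [simp]: "root (- a) \<longleftrightarrow> root a" by (simp add: root_def)

lemma root_axis [simp]: "root (axis i 1)" by (simp add: root_def diag)

lemma root_nonzero: "root a \<Longrightarrow> a \<noteq> 0" by (auto simp: root_def)

lemma root_add_iff: "root a \<Longrightarrow> root b \<Longrightarrow> root (a + b) \<longleftrightarrow> ip a b = - 1"
  by (auto simp: root_def quad_add)

lemma root_diff_iff: "root a \<Longrightarrow> root b \<Longrightarrow> root (a - b) \<longleftrightarrow> ip a b = 1"
  by (auto simp: root_def quad_diff)

text \<open>Positivity on a + b and a - b replaces the Cauchy-Schwarz inequality; the extreme values
  -2 and 2 occur only for b = -a and b = a.\<close>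

lemma ip_lower: "root a \<Longrightarrow> root b \<Longrightarrow> ip a b \<ge> - 2"
  using B_nonneg[of "a + b"] by (simp add: quad_add root_def)

lemma ip_upper: "root a \<Longrightarrow> root b \<Longrightarrow> ip a b \<le> 2"
  using B_nonneg[of "a - b"] by (simp add: quad_diff root_def)

lemma ip_eq_minus_2: "root a \<Longrightarrow> root b \<Longrightarrow> ip a b = - 2 \<longleftrightarrow> b = - a"
  using B_eq_0_iff[of "a + b"] by (auto simp: quad_add root_def ip_simps ip_self add_eq_0_iff)

lemma ip_eq_2: "root a \<Longrightarrow> root b \<Longrightarrow> ip a b = 2 \<longleftrightarrow> a = b"
  using B_eq_0_iff[of "a - b"] by (auto simp: quad_diff root_def ip_simps ip_self)

lemma eps_add: "eps a (b + c) = eps a b * (eps a c :: 'k::field)" "eps (a + b) c = eps a c * (eps b c :: 'k)"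
  by (auto simp: eps_def lform_add_left lform_add_right)

lemma eps_uminus [simp]: "eps a (- b) = eps a b" "eps (- a) b = eps a b"
  by (simp_all add: eps_def)

lemma eps_self: "root a \<Longrightarrow> eps a a = - 1"
  by (simp add: eps_def root_def)

lemma eps_square [simp]: "eps a b * eps a b = (1 :: 'k::field)" "eps a b * (eps a b * x) = (x :: 'k)"
  by (auto simp: eps_def)

lemma eps_nonzero [simp]: "eps a b \<noteq> (0 :: 'k::field)"
  by (auto simp: eps_def)

lemma eps_swap_odd: "odd (ip a b) \<Longrightarrow> eps b a = - (eps a b :: 'k::field)"
  by (auto simp: eps_def ip_def)

lemma eps_swap_even: "even (ip a b) \<Longrightarrow> eps b a = (eps a b :: 'k::field)"
  by (auto simp: eps_def ip_def)

definition Hv :: "int ^ 'n \<Rightarrow> 'n lidx \<Rightarrow>\<^sub>0 'k::field" where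
  "Hv a = (\<Sum>i\<in>UNIV. single (Hb i) (of_int (a $ i)))"

lemma lookup_sum_Hb: "lookup (\<Sum>i\<in>UNIV. single (Hb i) (c i)) x = (case x of Hb i \<Rightarrow> c i | Eb a \<Rightarrow> 0)"
  unfolding lookup_sum by (cases x) (auto simp: lookup_single when_def)

lemma lookup_Hv [simp]: "lookup (Hv a) (Hb i) = of_int (a $ i)" "lookup (Hv a) (Eb b) = 0"
  by (simp_all add: Hv_def lookup_sum_Hb)

lemma Hv_add: "Hv (a + b) = Hv a + Hv b"
  by (simp add: Hv_def single_add sum.distrib)

lemma Hv_uminus: "Hv (- a) = - Hv a"
  by (simp add: Hv_def single_uminus sum_negf)

lemma Hv_zero [simp]: "Hv 0 = 0" by (simp add: Hv_def)

lemma Hv_axis: "Hv (axis i 1) = single (Hb i) 1"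
proof (rule poly_mapping_eqI)
  fix x
  show "lookup (Hv (axis i 1)) x = lookup (single (Hb i) 1) x"
    by (cases x) (auto simp: lookup_single when_def axis_def)
qed

abbreviation EE :: "int ^ 'n \<Rightarrow> 'n lidx \<Rightarrow>\<^sub>0 'k::field" where "EE a \<equiv> single (Eb a) 1"

text \<open>On opposite roots the value is \<open>- Hv a\<close>, because \<open>eps a (- a)\<close>
  is -1; the lowering Chevalley generators will therefore be the negatives of root vectors. For
  other roots, a + b is a root exactly when \<open>ip a b\<close> is -1, and the structure constant
  is a sign.\<close>

fun lmult :: "'n lidx \<Rightarrow> 'n lidx \<Rightarrow> ('n lidx \<Rightarrow>\<^sub>0 'k::field)" where
  "lmult (Hb i) (Hb j) = 0"
| "lmult (Hb i) (Eb a) = (if root a then single (Eb a) (of_int (ip (axis i 1) a)) else 0)"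
| "lmult (Eb a) (Hb i) = (if root a then single (Eb a) (- of_int (ip (axis i 1) a)) else 0)"
| "lmult (Eb a) (Eb b) = (if root a \<and> root b then
     if ip a b = - 2 then - Hv a else if ip a b = - 1 then single (Eb (a + b)) (eps a b) else 0
   else 0)"

definition lbr :: "('n lidx \<Rightarrow>\<^sub>0 'k::field) \<Rightarrow> ('n lidx \<Rightarrow>\<^sub>0 'k) \<Rightarrow> ('n lidx \<Rightarrow>\<^sub>0 'k)" where
  "lbr = bext lmult"

sublocale l: bilinear_bracket lbr
  unfolding lbr_def by (rule bilinear_bext)

lemma lbr_single [simp]: "lbr (single i c) (single j d) = pscale (c * d) (lmult i j)"
  by (simp add: lbr_def)

lemma lbr_Hv_EE: "root b \<Longrightarrow> lbr (Hv a) (EE b) = single (Eb b) (of_int (ip a b))"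
  by (simp add: Hv_def l.sum_left single_uminus ip_expand[of a b])
    (intro poly_mapping_eqI; simp add: lookup_sum lookup_single when_def)

lemma lbr_EE_Hv: "root b \<Longrightarrow> lbr (EE b) (Hv a) = single (Eb b) (- of_int (ip a b))"
  by (simp add: Hv_def l.sum_right single_uminus ip_expand[of a b])
    (intro poly_mapping_eqI; simp add: lookup_sum lookup_single when_def sum_negf)

lemma lbr_Hb_Hv: "lbr (single (Hb i) c) (Hv a) = 0" "lbr (Hv a) (single (Hb i) c) = 0"
  by (simp_all add: Hv_def l.sum_right l.sum_left)

lemma lbr_skew: "lbr x y = - lbr y (x :: 'n lidx \<Rightarrow>\<^sub>0 'k::field)"
proof (rule l.skew_from_basis)
  fix i j :: "'n lidx"
  show "lbr (single i 1) (single j 1) = - lbr (single j 1) (single i (1 :: 'k))"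
  proof (cases i)
    case (Hb h)
    then show ?thesis by (cases j) (simp_all add: single_uminus)
  next
    case i: (Eb a)
    show ?thesis
    proof (cases j)
      case (Hb h)
      then show ?thesis using i by (simp add: single_uminus)
    next
      case j: (Eb b)
      show ?thesis
      proof (cases "root a \<and> root b")
        case True
        consider "b = - a" | "ip a b = - 1" | "ip a b \<noteq> - 1" "ip a b \<noteq> - 2"
          using True ip_eq_minus_2 by blast
        then show ?thesis
        proof cases
          case 1
          have "ip a b = - 2" "ip b a = - 2" using 1 True by (simp_all add: ip_simps ip_root_self)
          then show ?thesis using True by (simp add: i j) (simp add: 1 Hv_uminus)
        next
          case 2
          then have "ip b a = - 1" "eps b a = - (eps a b :: 'k)"
            using ip_commute[of a b] eps_swap_odd[of a b] by simp_all
          then show ?thesis using 2 True by (simp add: i j single_uminus add.commute)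
        next
          case 3
          then show ?thesis using ip_commute[of a b] by (simp add: i j)
        qed
      qed (auto simp: i j)
    qed
  qed
qed

lemma jac_rotate: "l.jac x y z = l.jac y z x"
  by (simp add: l.jac_def ac_simps)

text \<open>With double brackets expressed by inner products and signs, the Jacobi identity for root
  vectors becomes a case distinction on three integers.\<close>

lemma lbr_EE_EE_EE:
  assumes "root a" "root b" "root c"
  shows "lbr (EE a) (lbr (EE b) (EE c)) =
    (if ip b c = - 2 then single (Eb a) (of_int (ip a b))
     else if ip b c = - 1 then
       if ip a b + ip a c = - 2 then pscale (- eps b c) (Hv a)
       else if ip a b + ip a c = - 1 then single (Eb (a + b + c)) (eps b c * eps a b * eps a c)
       else 0
     else 0)"
proof -
  have bc: "root (b + c)" if "ip b c = - 1" using that assms root_add_iff by blast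
  show ?thesis
    using assms bc
    by (simp add: lbr_EE_Hv[where a = b] l.uminus_right ip_simps eps_add ip_commute[of b a] single_uminus
        ac_simps)
qed

lemma jac_opposite:
  assumes a: "root a" and c: "root c"
  shows "l.jac (EE a) (EE (- a)) (EE c) = (0 :: 'n lidx \<Rightarrow>\<^sub>0 'k::field)"
proof -
  note ra = a root_uminus[THEN iffD2, OF a]
  have s: "ip a a = 2" "ip c a = ip a c" "ip a (- a) = - 2" "ip (- a) c = - ip a c" "ip (- a) a = - 2"
    "ip c (- a) = - ip a c"
    using ip_root_self[OF a] ip_commute[of c a] by (simp_all add: ip_simps)
  consider "ip a c = - 2" | "ip a c = - 1" | "ip a c = 0" | "ip a c = 1" | "ip a c = 2"
    using ip_lower[OF a c] ip_upper[OF a c] by linarith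
  then show ?thesis
  proof cases
    case 1
    then have "c = - a" using ip_eq_minus_2 a c by blast
    then show ?thesis unfolding l.jac_def
      by (simp del: lbr_single add: lbr_EE_EE_EE ra s ip_simps single_uminus[symmetric] flip: single_add)
  next
    case 2
    have "eps c a = - (eps a c :: 'k)" using eps_swap_odd[of a c] 2 by simp
    then show ?thesis unfolding l.jac_def
      by (simp del: lbr_single add: lbr_EE_EE_EE ra c s 2 eps_self[OF a] flip: single_add)
  next
    case 3
    then show ?thesis unfolding l.jac_def by (simp del: lbr_single add: lbr_EE_EE_EE ra c s)
  next
    case 4
    then show ?thesis unfolding l.jac_def
      by (simp del: lbr_single add: lbr_EE_EE_EE ra c s eps_self[OF a] flip: single_add)
  next
    case 5
    then have "c = a" using ip_eq_2 a c by blast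
    then show ?thesis unfolding l.jac_def
      by (simp del: lbr_single add: lbr_EE_EE_EE ra s ip_simps flip: single_add)
  qed
qed

text \<open>The roots form a chain a - b - c. One double bracket vanishes and the other two give the
  root vector of a + b + c with opposite signs, since \<open>eps\<close> is skew across an edge and
  symmetric on an orthogonal pair.\<close>

lemma jac_two_edges:
  assumes r: "root a" "root b" "root c" and i: "ip a b = - 1" "ip b c = - 1" "ip c a = 0"
  shows "l.jac (EE a) (EE b) (EE c) = (0 :: 'n lidx \<Rightarrow>\<^sub>0 'k::field)"
proof -
  have s: "ip b a = - 1" "ip c b = - 1" "ip a c = 0" using i ip_commute by metis+
  have "eps c b = - (eps b c :: 'k)" "eps c a = (eps a c :: 'k)"
    using eps_swap_odd[of b c] eps_swap_even[of a c] i s by simp_all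
  moreover have "c + a + b = a + b + c" by (simp add: ac_simps)
  ultimately show ?thesis unfolding l.jac_def
    by (simp del: lbr_single add: lbr_EE_EE_EE r i s ac_simps flip: single_add)
qed

text \<open>Three inner products -1 force a + b + c = 0, since that vector has norm 0. The double
  brackets are then one and the same multiple of H_a, H_b and H_c, which add up to 0.\<close>

lemma jac_triangle:
  assumes r: "root a" "root b" "root c" and i: "ip a b = - 1" "ip b c = - 1" "ip c a = - 1"
  shows "l.jac (EE a) (EE b) (EE c) = (0 :: 'n lidx \<Rightarrow>\<^sub>0 'k::field)"
proof -
  have s: "ip b a = - 1" "ip c b = - 1" "ip a c = - 1" using i ip_commute by metis+
  have "B (a + b + c) (a + b + c) = 0"
    using r i s by (simp add: quad_add ip_simps root_def)
  then have abc: "a + b + c = 0" using B_eq_0_iff by blast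
  then have c: "c = - (a + b)" by (simp add: add_eq_0_iff)
  have "eps b a = - (eps a b :: 'k)" using eps_swap_odd[of a b] i by simp
  then have e: "eps b c = (eps a b :: 'k)" "eps c a = (eps a b :: 'k)"
    unfolding c by (simp_all only: eps_uminus eps_add eps_self[OF r(1)] eps_self[OF r(2)]) simp_all
  have "Hv a + Hv b + Hv c = (0 :: 'n lidx \<Rightarrow>\<^sub>0 'k)" using abc by (simp flip: Hv_add)
  then have "pscale (- eps a b) (Hv a + Hv b + Hv c) = (0 :: 'n lidx \<Rightarrow>\<^sub>0 'k)" by simp
  then show ?thesis unfolding l.jac_def
    by (simp del: lbr_single add: lbr_EE_EE_EE r i s e pm.scale_right_distrib)
qed

lemma jac_EE: "l.jac (EE a) (EE b) (EE c) = (0 :: 'n lidx \<Rightarrow>\<^sub>0 'k::field)"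
proof (cases "root a \<and> root b \<and> root c")
  case False
  have z: "lbr (EE a) x = 0" "lbr x (EE a) = 0" if "\<not> root a" for a and x :: "'n lidx \<Rightarrow>\<^sub>0 'k"
  proof -
    have "x \<in> supported UNIV" by simp
    then have "lbr (EE a) x = 0"
    proof (induction rule: supported_induct)
      case (single i c)
      then show ?case using that by (cases i rule: lidx.exhaust) auto
    qed (simp_all add: l.add_right)
    then show "lbr (EE a) x = 0" "lbr x (EE a) = 0" using lbr_skew[of x "EE a"] by simp_all
  qed
  show ?thesis using False unfolding l.jac_def by (elim de_Morgan_conj[THEN iffD1, THEN disjE] ; auto simp del: lbr_single simp: z)
next
  case True
  then have r: "root a" "root b" "root c" by auto
  let ?p = "ip a b" and ?q = "ip b c" and ?r = "ip c a"
  have s: "ip b a = ?p" "ip c b = ?q" "ip a c = ?r" by (simp_all add: ip_commute)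
  have lower: "?p \<ge> - 2" "?q \<ge> - 2" "?r \<ge> - 2" using ip_lower r by auto
  \<comment> \<open>\<open>B\<close> of a + b + c is 3 plus the three inner products. With no
    opposite pair each of these is at least -1, so only the sums -3 and -2 allow a nonzero double
    bracket.\<close>
  have total: "?p + ?q + ?r \<ge> - 3"
    using B_nonneg[of "a + b + c"] r by (simp add: quad_add ip_simps root_def s)
  consider "b = - a" | "c = - b" | "a = - c" |
    "?p \<ge> - 1" "?q \<ge> - 1" "?r \<ge> - 1" "?p + ?q + ?r = - 3" |
    "?p \<ge> - 1" "?q \<ge> - 1" "?r \<ge> - 1" "?p + ?q + ?r = - 2" |
    "?p \<ge> - 1" "?q \<ge> - 1" "?r \<ge> - 1" "?p + ?q + ?r \<ge> - 1"
    using lower total ip_eq_minus_2[OF r(1,2)] ip_eq_minus_2[OF r(2,3)] ip_eq_minus_2[OF r(3,1)]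
    by linarith
  then show ?thesis
  proof cases
    case 1
    then show ?thesis using jac_opposite r by simp
  next
    case 2
    then show ?thesis using jac_opposite[of b a] r jac_rotate by metis
  next
    case 3
    then show ?thesis using jac_opposite[of c b] r jac_rotate by metis
  next
    case 4
    then have "?p = - 1" "?q = - 1" "?r = - 1" by linarith+
    then show ?thesis using jac_triangle r by blast
  next
    case 5
    then consider "?p = - 1" "?q = - 1" "?r = 0" | "?p = - 1" "?q = 0" "?r = - 1" | "?p = 0" "?q = - 1" "?r = - 1"
      by linarith
    then show ?thesis
    proof cases
      case 1
      then show ?thesis using jac_two_edges r by blast
    next
      case 2
      then show ?thesis using jac_two_edges[of c a b] r jac_rotate by metis
    next
      case 3
      then show ?thesis using jac_two_edges[of b c a] r jac_rotate by metis
    qed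
  next
    case 6
    then show ?thesis unfolding l.jac_def by (simp only: lbr_EE_EE_EE[OF r] lbr_EE_EE_EE[OF r(2,3,1)] lbr_EE_EE_EE[OF r(3,1,2)] s) auto
  qed
qed

text \<open>Cartan elements act diagonally, and the bracket of two root vectors has the sum of their
  eigenvalues.\<close>

lemma jac_H_EE:
  "l.jac (single (Hb h) 1) (EE a) (EE b) = (0 :: 'n lidx \<Rightarrow>\<^sub>0 'k::field)"
proof (cases "root a \<and> root b")
  case True
  then have r: "root a" "root b" by auto
  define c d where "c = (of_int (ip (axis h 1) a) :: 'k)" and "d = (of_int (ip (axis h 1) b) :: 'k)"
  have 1: "lbr (EE b) (single (Hb h) 1) = pscale (- d) (EE b)"
    "lbr (single (Hb h) 1) (EE a) = pscale c (EE a)" using r by (simp_all add: c_def d_def)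
  have 2: "lbr (single (Hb h) 1) (lbr (EE a) (EE b)) = pscale (c + d) (lbr (EE a) (EE b))"
  proof -
    consider "b = - a" | "ip a b = - 1" | "ip a b \<noteq> - 1" "ip a b \<noteq> - 2"
      using r ip_eq_minus_2 by blast
    then show ?thesis
    proof cases
      case 1
      then show ?thesis using r
        by (simp add: ip_simps ip_root_self l.uminus_right lbr_Hb_Hv c_def d_def)
    next
      case 2
      then have "root (a + b)" using r root_add_iff by blast
      then show ?thesis using r 2 by (simp add: c_def d_def ip_simps algebra_simps)
    qed (use r in simp)
  qed
  have "l.jac (single (Hb h) 1) (EE a) (EE b) =
      pscale (c + d) (lbr (EE a) (EE b)) - pscale d (lbr (EE a) (EE b)) - pscale c (lbr (EE a) (EE b))"
    unfolding l.jac_def 1 2 l.scale_right lbr_skew[of "EE b" "EE a"] by simp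
  also have "\<dots> = 0" by (simp only: pm.scale_left_distrib) simp
  finally show ?thesis .
qed (auto simp: l.jac_def)

lemma lbr_jacobi: "l.jac x y z = (0 :: 'n lidx \<Rightarrow>\<^sub>0 'k::field)"
proof (rule l.jacobi_from_basis)
  fix i j k :: "'n lidx"
  have HHx: "l.jac (single (Hb h) 1) (single (Hb h') 1) (single k 1) = (0 :: 'n lidx \<Rightarrow>\<^sub>0 'k)" for h h' k
    by (cases k) (auto simp: l.jac_def mult.commute single_uminus l.uminus_right)
  have Hxx: "l.jac (single (Hb h) 1) (single j 1) (single k 1) = (0 :: 'n lidx \<Rightarrow>\<^sub>0 'k)" for h j k
  proof (cases j)
    case (Hb h')
    then show ?thesis using HHx by simp
  next
    case j: (Eb a)
    show ?thesis
    proof (cases k)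
      case (Hb h')
      then show ?thesis using HHx[of h' h j] jac_rotate by metis
    qed (simp only: j jac_H_EE)
  qed
  show "l.jac (single i 1) (single j 1) (single k 1) = (0 :: 'n lidx \<Rightarrow>\<^sub>0 'k)"
  proof (cases "\<exists>h. i = Hb h \<or> j = Hb h \<or> k = Hb h")
    case True
    then show ?thesis using Hxx jac_rotate by metis
  next
    case False
    then obtain a b c where "i = Eb a" "j = Eb b" "k = Eb c" by (metis lidx.exhaust)
    then show ?thesis by (simp only: jac_EE)
  qed
qed

lemma lbr_jacobi': "lbr x (lbr y z) = lbr (lbr x y) z + lbr y (lbr x z)"
proof -
  have "lbr x (lbr y z) + lbr y (lbr z x) + lbr z (lbr x y) = 0"
    using lbr_jacobi[of x y z] by (simp only: l.jac_def)
  moreover have "lbr y (lbr z x) = - lbr y (lbr x z)" using lbr_skew[of z x] by (simp add: l.uminus_right)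
  moreover have "lbr z (lbr x y) = - lbr (lbr x y) z" by (rule lbr_skew)
  ultimately show ?thesis by (simp add: algebra_simps)
qed

end

text \<open>With full rank n the realization space has dimension 2n - n = n, so the independent
  coroots form a basis and the simple roots are determined by the Cartan matrix.\<close>

lemma realization_coordinates:
  fixes R :: "('k::field, 'h::ab_group_add, 'n::finite) realization"
  assumes R: "is_realization A R"
    and rank: "rank (\<chi> i j. of_int (A $ i $ j) :: 'k ^ 'n ^ 'n) = CARD('n)"
  obtains coord :: "'h \<Rightarrow> 'n \<Rightarrow> 'k" where
    "\<And>x y i. coord (x + y) i = coord x i + coord y i"
    "\<And>c x i. coord (hscale R c x) i = c * coord x i"
    "inj coord" "surj coord"
    "\<And>i j. coord (coroot R i) j = (if i = j then 1 else 0)"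
    "\<And>j x. simple_root R j x = (\<Sum>i\<in>UNIV. coord x i * of_int (A $ i $ j))"
proof -
  interpret vs: vector_space "hscale R" using R by (simp add: is_realization_def)
  let ?B = "range (coroot R)"
  have inj: "inj (coroot R)" and ind: "vs.independent ?B"
    using R by (simp_all add: is_realization_def)
  have cardB: "card ?B = CARD('n)" using inj by (simp add: card_image)
  obtain T where T: "vs.independent T" "vs.span T = UNIV" "card T = vs.dim UNIV"
    using vs.basis_exists[of UNIV] by (metis top.extremum_uniqueI)
  have cardT: "card T = CARD('n)" using T(3) R rank by (simp add: is_realization_def)
  then have "finite T" by (metis card.infinite zero_less_card_finite less_irrefl)
  have span: "vs.span ?B = UNIV"
  proof (rule ccontr)
    assume "vs.span ?B \<noteq> UNIV"
    then obtain x where x: "x \<notin> vs.span ?B" by blast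
    then have "vs.independent (insert x ?B)" using ind by (rule vs.independent_insertI)
    then have "card (insert x ?B) \<le> card T"
      using vs.independent_span_bound[OF \<open>finite T\<close>, of "insert x ?B"] T(2) by auto
    moreover have "x \<notin> ?B" using x vs.span_base by blast
    ultimately show False using cardB cardT by simp
  qed
  define coord where "coord x i = vs.representation ?B x (coroot R i)" for x i
  have expand: "x = (\<Sum>i\<in>UNIV. hscale R (coord x i) (coroot R i))" for x
  proof -
    have "x = (\<Sum>b\<in>?B. hscale R (vs.representation ?B x b) b)"
      using vs.sum_representation_eq[OF ind, of x ?B] span by simp
    also have "\<dots> = (\<Sum>i\<in>UNIV. hscale R (coord x i) (coroot R i))"
      using inj by (simp add: sum.reindex coord_def)
    finally show ?thesis .
  qed
  have coord_add: "coord (x + y) i = coord x i + coord y i" for x y i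
    using vs.representation_add[OF ind] span by (simp add: coord_def)
  have coord_scale: "coord (hscale R c x) i = c * coord x i" for c x i
    using vs.representation_scale[OF ind] span by (simp add: coord_def)
  have coord_0: "coord 0 i = 0" for i using coord_scale[of 0 0 i] by simp
  have coord_sum: "coord (\<Sum>j\<in>S. g j) i = (\<Sum>j\<in>S. coord (g j) i)" for S and g :: "'n \<Rightarrow> 'h" and i
    by (induction S rule: infinite_finite_induct) (simp_all add: coord_0 coord_add)
  have coord_coroot: "coord (coroot R i) j = (if i = j then 1 else 0)" for i j
    using vs.representation_basis[OF ind, of "coroot R i"] inj by (auto simp: coord_def inj_eq)
  have "inj coord"
    by (rule injI) (metis expand)
  moreover have "surj coord"
  proof (rule surjI)
    show "coord (\<Sum>i\<in>UNIV. hscale R (c i) (coroot R i)) = c" for c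
    proof
      fix j
      have "(\<Sum>i\<in>UNIV. c i * (if i = j then 1 else 0)) = (\<Sum>i\<in>UNIV. if i = j then c j else 0)"
        by (intro sum.cong) auto
      then show "coord (\<Sum>i\<in>UNIV. hscale R (c i) (coroot R i)) j = c j"
        by (simp add: coord_sum coord_scale coord_coroot)
    qed
  qed
  moreover have "simple_root R j x = (\<Sum>i\<in>UNIV. coord x i * of_int (A $ i $ j))" for j x
  proof -
    interpret lin: Vector_Spaces.linear "hscale R" "(*)" "simple_root R j"
      using R by (simp add: is_realization_def)
    have "simple_root R j x = simple_root R j (\<Sum>i\<in>UNIV. hscale R (coord x i) (coroot R i))"
      using expand by metis
    also have "\<dots> = (\<Sum>i\<in>UNIV. coord x i * simple_root R j (coroot R i))"
      by (simp add: lin.sum lin.scale)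
    also have "\<dots> = (\<Sum>i\<in>UNIV. coord x i * of_int (A $ i $ j))"
      using R by (simp add: is_realization_def)
    finally show ?thesis .
  qed
  ultimately show thesis using that coord_add coord_scale coord_coroot by blast
qed

lemma of_int_eq_0_iff_dvd:
  assumes "CHAR('k::field) = 3"
  shows "of_int n = (0 :: 'k) \<longleftrightarrow> 3 dvd n"
proof -
  have *: "(3 :: int) dvd int m \<longleftrightarrow> 3 dvd m" for m by presburger
  show ?thesis using assms
    by (cases n rule: int_cases2) (simp_all add: of_nat_eq_0_iff_char_dvd *)
qed

lemma supported_weight_indep:
  assumes "finite B" "\<And>\<beta>. \<beta> \<in> B \<Longrightarrow> u \<beta> \<in> supported {i. w i = \<beta>}" "(\<Sum>\<beta>\<in>B. u \<beta>) = 0" "\<beta> \<in> B"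
  shows "u \<beta> = (0 :: 'i \<Rightarrow>\<^sub>0 'k::field)"
proof (rule poly_mapping_eqI)
  fix i
  show "lookup (u \<beta>) i = lookup 0 i"
  proof (cases "w i = \<beta>")
    case True
    have "0 = lookup (\<Sum>\<beta>\<in>B. u \<beta>) i" using assms(3) by simp
    also have "\<dots> = (\<Sum>\<gamma>\<in>B. if \<gamma> = \<beta> then lookup (u \<beta>) i else 0)"
      unfolding lookup_sum using assms(2) True by (intro sum.cong) (auto simp: supported_iff)
    also have "\<dots> = lookup (u \<beta>) i" using assms(1,4) by simp
    finally show ?thesis by simp
  qed (use assms(2)[OF assms(4)] in \<open>simp add: supported_iff\<close>)
qed

section \<open>The lattice Lie algebra as a contragredient Lie algebra\<close>

context root_lattice
begin

definition bidx :: "'n lidx set" where "bidx = range Hb \<union> Eb ` {a. root a}"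

lemma bidx_simps [simp]: "Hb i \<in> bidx" "Eb a \<in> bidx \<longleftrightarrow> root a"
  by (auto simp: bidx_def)

lemma root_add: "root a \<Longrightarrow> root b \<Longrightarrow> ip a b = - 1 \<Longrightarrow> root (a + b)"
  by (simp add: root_add_iff)

lemma root_diff: "root a \<Longrightarrow> root b \<Longrightarrow> ip a b = 1 \<Longrightarrow> root (a - b)"
  by (simp add: root_diff_iff)

text \<open>Reduction modulo 3 is injective on roots: if a - b = 3c with c nonzero, then
  \<open>B\<close> of a - b is at least 9, whereas for roots it is 2 - \<open>ip a b\<close>, at
  most 4.\<close>

lemma finite_roots: "finite {a. root a}"
proof -
  let ?f = "\<lambda>a :: int ^ 'n. \<lambda>i. a $ i mod 3"
  have "inj_on ?f {a. root a}"
  proof (rule inj_onI, rule ccontr)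
    fix a b assume ab: "a \<in> {a. root a}" "b \<in> {a. root a}" and eq: "?f a = ?f b" and ne: "a \<noteq> b"
    define c where "c = (\<chi> i. (a $ i - b $ i) div 3)"
    have "3 dvd a $ i - b $ i" for i using fun_cong[OF eq, of i] by (simp add: mod_eq_dvd_iff)
    then have c: "a - b = 3 *s c" by (simp add: vec_eq_iff c_def)
    then have "c \<noteq> 0" using ne by auto
    then have "B c c \<ge> 1" using posdef[of c] by simp
    then have "B (a - b) (a - b) \<ge> 9" by (simp add: c lform_smult)
    moreover have "B (a - b) (a - b) \<le> 4" using ab ip_lower[of a b] by (simp add: quad_diff root_def)
    ultimately show False by simp
  qed
  moreover have "?f ` {a. root a} \<subseteq> (\<Pi>\<^sub>E i\<in>UNIV. {0..2})"
  proof
    fix g assume "g \<in> ?f ` {a. root a}"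
    then obtain a where "g = (\<lambda>i. a $ i mod 3)" by blast
    moreover have "0 \<le> x mod 3 \<and> x mod 3 \<le> 2" for x :: int by presburger
    ultimately show "g \<in> (\<Pi>\<^sub>E i\<in>UNIV. {0..2})" by auto
  qed
  then have "finite (?f ` {a. root a})" by (rule finite_subset) (simp add: finite_PiE)
  ultimately show ?thesis by (rule finite_imageD[rotated])
qed

lemma finite_bidx: "finite bidx"
  using finite_roots by (simp add: bidx_def)

lemma Hv_supported: "range Hb \<subseteq> S \<Longrightarrow> Hv a \<in> supported S"
  unfolding Hv_def by (intro pm.subspace_sum subspace_supported single_in_supported) blast

lemma lmult_bidx: "lmult i j \<in> supported bidx"
proof -
  have H: "- Hv a \<in> supported bidx" for a
    by (intro pm.subspace_neg subspace_supported Hv_supported) auto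
  show ?thesis
    by (cases i; cases j) (auto simp: H root_add pm.subspace_0[OF subspace_supported])
qed

lemma lbr_bidx: "lbr x y \<in> supported bidx"
  unfolding lbr_def by (rule bext_supported[of _ UNIV _ UNIV]) (simp_all add: lmult_bidx)

definition lwt :: "'n lidx \<Rightarrow> int ^ 'n" where
  "lwt x = (case x of Hb i \<Rightarrow> 0 | Eb a \<Rightarrow> a)"

lemma lwt_simps [simp]: "lwt (Hb i) = 0" "lwt (Eb a) = a"
  by (simp_all add: lwt_def)

lemma lmult_lwt: "lmult i j \<in> supported {x. lwt x = lwt i + lwt j}"
proof (cases "\<exists>a b. i = Eb a \<and> j = Eb b \<and> root a \<and> root b \<and> ip a b = - 2")
  case True
  then obtain a where "i = Eb a" "j = Eb (- a)" "root a" using ip_eq_minus_2 by blast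
  moreover have "- Hv a \<in> supported {x. lwt x = 0}"
    by (intro pm.subspace_neg subspace_supported Hv_supported) auto
  ultimately show ?thesis by (simp add: ip_simps ip_root_self)
next
  case False
  then show ?thesis by (cases i; cases j) (auto simp: pm.subspace_0[OF subspace_supported])
qed

definition gspace :: "'n lidx set \<Rightarrow> ('n lidx \<Rightarrow>\<^sub>0 'k::field) set" where
  "gspace S = supported (S \<inter> bidx)"

lemma gspace_subspace: "pm.subspace (gspace S)"
  by (simp add: gspace_def subspace_supported)

lemma EE_gspace [simp]: "single (Eb a) c \<in> gspace S" if "root a" "Eb a \<in> S"
  using that by (simp add: gspace_def)

text \<open>Any additive function on the lattice grades the bracket, as \<open>lmult\<close>
  respects lattice weights. This serves the weight grading, the grading by pairing with a simple
  root, and the projected weights of the reduced algebra.\<close>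

lemma lbr_gspace:
  fixes w :: "'n lidx \<Rightarrow> 'w::ab_group_add"
  assumes w: "\<And>i. w (Hb i) = 0" "\<And>a b. w (Eb (a + b)) = w (Eb a) + w (Eb b)"
    and x: "x \<in> gspace {i. w i = j}" and y: "y \<in> gspace {i. w i = k}"
  shows "lbr x y \<in> gspace {i. w i = j + k}"
proof -
  have w0: "w (Eb 0) = 0" using w(2)[of 0 0] by simp
  have w_lwt: "w i = w (Eb (lwt i))" for i by (cases i) (simp_all add: w(1) w0)
  have "lmult s t \<in> supported ({i. w i = w s + w t})" for s t :: "'n lidx"
  proof -
    have "w i = w s + w t" if "lwt i = lwt s + lwt t" for i
      using w_lwt[of i] w_lwt[of s] w_lwt[of t] w(2) that by simp
    then show ?thesis using lmult_lwt[of s t] by (auto simp: supported_iff)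
  qed
  then have "lbr x y \<in> supported {i. w i = j + k}"
    using x y unfolding lbr_def gspace_def
    by (intro bext_supported[of _ "{i. w i = j} \<inter> bidx" _ "{i. w i = k} \<inter> bidx"]) auto
  then show ?thesis using lbr_bidx[of x y] unfolding gspace_def supported_iff by blast
qed

text \<open>The terms \<open>a $ i * ip (axis i 1) a\<close> add up to \<open>ip a a\<close>, which
  is 2, so one of them is positive. At such an index the root can be moved towards 0 by a simple
  root.\<close>

lemma simple_reflection_step:
  assumes a: "root a"
  obtains i where "a $ i * ip (axis i 1) a > 0"
proof -
  have "(\<Sum>i\<in>UNIV. a $ i * ip (axis i 1) a) > 0"
    using ip_expand[of a a] ip_root_self[OF a] by simp
  then have "\<not> (\<forall>i. a $ i * ip (axis i 1) a \<le> 0)"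
    by (meson sum_nonpos not_less)
  then show ?thesis using that by (meson not_less)
qed

lemma EE_from_bracket:
  assumes r: "root a" "root b" "ip a b = - 1" and T: "pm.subspace T"
    and m: "lbr (EE a) (EE b) \<in> T"
  shows "EE (a + b) \<in> (T :: ('n lidx \<Rightarrow>\<^sub>0 'k::field) set)"
proof -
  have "EE (a + b) = pscale (eps a b) (lbr (EE a) (EE b) :: 'n lidx \<Rightarrow>\<^sub>0 'k)" using r by simp
  then show ?thesis using pm.subspace_scale[OF T m] by simp
qed

text \<open>Descent on the sum of the absolute values of the coordinates. At the index from
  \<open>simple_reflection_step\<close> coordinate and inner product have the same sign, so
  subtracting or adding the simple root gives a smaller root, unless \<open>a\<close> is that simple
  root up to sign. Positive and negative roots are treated together.\<close>

lemma generated_roots: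
  fixes T :: "('n lidx \<Rightarrow>\<^sub>0 'k::field) set"
  assumes T: "pm.subspace T" and e: "\<And>i. EE (axis i 1) \<in> T" and f: "\<And>i. EE (- axis i 1) \<in> T"
    and closed: "\<And>v w. v \<in> T \<Longrightarrow> w \<in> T \<Longrightarrow> lbr v w \<in> T"
  shows "root a \<Longrightarrow> EE a \<in> T"
proof (induction "nat (\<Sum>i\<in>UNIV. \<bar>a $ i\<bar>)" arbitrary: a rule: less_induct)
  case less
  note a = \<open>root a\<close>
  obtain i where i: "a $ i * ip (axis i 1) a > 0" using simple_reflection_step[OF a] .
  have smaller: "nat (\<Sum>j\<in>UNIV. \<bar>b $ j\<bar>) < nat (\<Sum>j\<in>UNIV. \<bar>a $ j\<bar>)"
    if "\<And>j. j \<noteq> i \<Longrightarrow> b $ j = a $ j" "\<bar>b $ i\<bar> < \<bar>a $ i\<bar>" for b :: "int ^ 'n"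
  proof -
    have "(\<Sum>j\<in>UNIV. \<bar>b $ j\<bar>) < (\<Sum>j\<in>UNIV. \<bar>a $ j\<bar>)"
    proof (rule sum_strict_mono_ex1)
      show "\<forall>j\<in>UNIV. \<bar>b $ j\<bar> \<le> \<bar>a $ j\<bar>" using that by (metis less_le order.refl)
    qed (use that in auto)
    moreover from this have "(\<Sum>j\<in>UNIV. \<bar>a $ j\<bar>) > 0"
      using sum_nonneg[of UNIV "\<lambda>j. \<bar>b $ j\<bar>"] by linarith
    ultimately show ?thesis by simp
  qed
  have ai: "ip a (axis i 1) = ip (axis i 1) a" by (rule ip_commute)
  show ?case
  proof (cases "a $ i > 0")
    case True
    then have "ip (axis i 1) a = 1 \<or> ip (axis i 1) a = 2"
      using i ip_upper[OF root_axis a, of i] by (auto simp: zero_less_mult_iff)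
    then show ?thesis
    proof
      assume 1: "ip (axis i 1) a = 1"
      then have b: "root (a - axis i 1)" using a by (intro root_diff) (simp_all add: ai)
      have "EE (a - axis i 1) \<in> T"
        by (rule less.hyps[OF smaller b]) (use True in \<open>auto simp: axis_def\<close>)
      then have "EE (axis i 1 + (a - axis i 1)) \<in> T"
        using 1 b by (intro EE_from_bracket T closed e) (simp_all add: ip_simps ip_root_self)
      then show ?thesis by simp
    next
      assume "ip (axis i 1) a = 2"
      then show ?thesis using ip_eq_2[OF root_axis a] e by metis
    qed
  next
    case False
    then have neg: "a $ i < 0" using i by (cases "a $ i = 0") auto
    then have "ip (axis i 1) a = - 1 \<or> ip (axis i 1) a = - 2"
      using i ip_lower[OF root_axis a, of i] by (auto simp: zero_less_mult_iff)
    then show ?thesis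
    proof
      assume 1: "ip (axis i 1) a = - 1"
      then have b: "root (a + axis i 1)" using a by (intro root_add) (simp_all add: ai)
      have "EE (a + axis i 1) \<in> T"
        by (rule less.hyps[OF smaller b]) (use neg in \<open>auto simp: axis_def\<close>)
      from EE_from_bracket[OF _ b _ T closed[OF f[of i] this]]
      have "EE (- axis i 1 + (a + axis i 1)) \<in> T"
        using 1 by (simp add: ip_simps ip_root_self)
      then show ?thesis by simp
    next
      assume "ip (axis i 1) a = - 2"
      then show ?thesis using ip_eq_minus_2[OF root_axis a] f by metis
    qed
  qed
qed

lemma Hv_eq_0_dvd:
  assumes "CHAR('k::field) = 3" "Hv a = (0 :: 'n lidx \<Rightarrow>\<^sub>0 'k)"
  obtains c where "a = 3 *s c"
proof -
  have "3 dvd a $ i" for i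
    using arg_cong[OF assms(2), of "\<lambda>v. lookup v (Hb i)"] of_int_eq_0_iff_dvd[OF assms(1)] by simp
  then have "a = 3 *s (\<chi> i. a $ i div 3)" by (simp add: vec_eq_iff)
  then show ?thesis by (rule that)
qed

text \<open>If \<open>Hv a\<close> vanishes, then 3 divides every coordinate of \<open>a\<close>, so
  9 divides \<open>B a a\<close>. The test covers both uses: roots, of value 1, and the vectors of
  value 3 that come from odd brackets.\<close>

lemma Hv_nonzero:
  assumes "CHAR('k::field) = 3" "\<not> 9 dvd B a a"
  shows "Hv a \<noteq> (0 :: 'n lidx \<Rightarrow>\<^sub>0 'k)"
proof
  assume "Hv a = (0 :: 'n lidx \<Rightarrow>\<^sub>0 'k)"
  then obtain c where "a = 3 *s c" using Hv_eq_0_dvd[OF assms(1)] by blast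
  then show False using assms(2) by (simp add: lform_smult)
qed

lemma supported_Hb_expand:
  fixes v :: "'n lidx \<Rightarrow>\<^sub>0 'k::field"
  assumes "v \<in> supported (range Hb)"
  shows "v = (\<Sum>i\<in>UNIV. single (Hb i) (lookup v (Hb i)))"
proof (rule poly_mapping_eqI)
  fix x :: "'n lidx"
  have "x \<in> range Hb" if "x = Hb i" for i using that by simp
  then show "lookup v x = lookup (\<Sum>i\<in>UNIV. single (Hb i) (lookup v (Hb i))) x"
    using assms by (cases x) (auto simp: lookup_sum_Hb supported_iff)
qed

definition gpart :: "bool \<Rightarrow> ('n lidx \<Rightarrow>\<^sub>0 'k::field) set" where
  "gpart p = (if p then {0} else gspace UNIV)"

lemma lie_superalgebra_lattice: "lie_superalgebra (model_alg (gspace UNIV) lbr gpart)"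
proof (rule l.lie_superalgebra_model_alg)
  fix x y :: "'n lidx \<Rightarrow>\<^sub>0 'a" and p q assume xy: "x \<in> gpart p" "y \<in> gpart q"
  then show "lbr x y \<in> gpart (p \<noteq> q)" using lbr_bidx[of x y] by (auto simp: gpart_def gspace_def split: if_splits)
  show "lbr x y = - pscale (koszul p q) (lbr y x)"
    using xy lbr_skew[of x y] by (auto simp: gpart_def koszul_def split: if_splits)
next
  fix x y z :: "'n lidx \<Rightarrow>\<^sub>0 'a" and p q r
  assume "x \<in> gpart p" "y \<in> gpart q"
  then show "lbr x (lbr y z) = lbr (lbr x y) z + pscale (koszul p q) (lbr y (lbr x z))"
    using lbr_jacobi'[of x y z] by (auto simp: gpart_def koszul_def split: if_splits)
qed (auto simp: gpart_def gspace_subspace pm.subspace_0)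

lemma contragredient_model_lattice:
  fixes R :: "('k::field, 'h::ab_group_add, 'n) realization" and coord :: "'h \<Rightarrow> 'n \<Rightarrow> 'k"
  assumes char: "CHAR('k) = 3"
    and add: "\<And>x y i. coord (x + y) i = coord x i + coord y i"
    and scale: "\<And>c x i. coord (hscale R c x) i = c * coord x i"
    and inj: "inj coord" and surj: "surj coord"
    and coroot: "\<And>i j. coord (coroot R i) j = (if i = j then 1 else 0)"
    and root: "\<And>j x. simple_root R j x = (\<Sum>i\<in>UNIV. coord x i * of_int (ip (axis i 1) (axis j 1)))"
  shows "contragredient_model lbr (\<lambda>_. False) R (gspace UNIV) gpart (\<lambda>\<beta>. gspace {x. lwt x = \<beta>})
    (\<lambda>x. \<Sum>i\<in>UNIV. single (Hb i) (coord x i)) (\<lambda>i. EE (axis i 1)) (\<lambda>i. - EE (- axis i 1))"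
    (is "contragredient_model _ _ _ _ _ ?W ?hm ?e ?f")
proof (intro contragredient_model.intro contragredient_model_axioms.intro
    l.bilinear_bracket_axioms lie_superalgebra_lattice gspace_subspace)
  have W0: "gspace {x. lwt x = 0} = supported (range Hb)"
  proof -
    have "{x. lwt x = 0} \<inter> bidx = range Hb"
    proof (intro equalityI subsetI)
      fix x assume "x \<in> {x. lwt x = 0} \<inter> bidx"
      then show "x \<in> range Hb" using root_nonzero by (cases x) auto
    qed auto
    then show ?thesis by (simp add: gspace_def)
  qed
  have lookup_hm: "lookup (?hm x) (Hb i) = coord x i" for x i by (simp add: lookup_sum_Hb)
  show "?W 0 = range ?hm"
  proof (intro equalityI subsetI)
    fix v assume "v \<in> ?W 0"
    then have "v = (\<Sum>i\<in>UNIV. single (Hb i) (lookup v (Hb i)))"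
      using supported_Hb_expand W0 by blast
    moreover obtain x where "coord x = (\<lambda>i. lookup v (Hb i))" using surj by (metis surjD)
    ultimately have "v = ?hm x" by simp
    then show "v \<in> range ?hm" by blast
  next
    fix v assume "v \<in> range ?hm"
    then show "v \<in> ?W 0" unfolding W0 by (auto intro!: pm.subspace_sum subspace_supported)
  qed
  show "inj ?hm"
  proof (rule injI)
    fix x y assume "?hm x = ?hm y"
    then have "coord x i = coord y i" for i using lookup_hm by metis
    then show "x = y" using inj by (metis injD ext)
  qed
  fix x y c i j
  show "?hm (x + y) = ?hm x + ?hm y" by (simp add: add single_add sum.distrib)
  show "?hm (hscale R c x) = pscale c (?hm x)" by (simp add: scale pm.scale_sum_right)
  show "?e i \<in> ?W (axis i 1)" by simp
  show "?f i \<in> ?W (- axis i 1)" by (intro pm.subspace_neg gspace_subspace) simp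
  show "?e i \<in> gpart False" by (simp add: gpart_def)
  show "?f i \<in> gpart False" unfolding gpart_def by (simp add: pm.subspace_neg[OF gspace_subspace])
  show "?hm x \<in> gpart False"
    by (auto simp: gpart_def gspace_def intro!: pm.subspace_sum subspace_supported)
  have ij: "ip (axis i 1) (axis j 1) = (if i = j then 2 else M i j + M j i)" for i j
    by (simp add: ip_axis diag)
  show "lbr (?e i) (?f j) = (if i = j then ?hm (coroot R i) else 0)"
  proof (cases "i = j")
    case True
    then have "ip (axis i 1) (- axis j 1) = - 2" by (simp add: ip_simps ij)
    moreover have "?hm (coroot R i) = Hv (axis i 1)"
      by (simp add: Hv_def coroot axis_def) (intro sum.cong; simp)
    ultimately show ?thesis using True by (simp add: l.uminus_right)
  next
    case False
    then have "ip (axis i 1) (- axis j 1) \<ge> 0" using offdiag[of i j] by (simp add: ip_simps ij)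
    then show ?thesis using False by (simp add: l.uminus_right)
  qed
  show "lbr (?hm x) (?e j) = pscale (simple_root R j x) (?e j)"
    by (simp add: l.sum_left root)
      (intro poly_mapping_eqI; simp add: lookup_sum lookup_single when_def)
  show "lbr (?hm x) (?f j) = - pscale (simple_root R j x) (?f j)"
    by (simp add: l.sum_left root l.uminus_right ip_simps single_uminus sum_negf)
      (intro poly_mapping_eqI; simp add: lookup_sum lookup_single when_def)
  show "lbr (?hm x) (?hm y) = 0" by (simp add: l.sum_left l.sum_right)
next
  fix T :: "('n lidx \<Rightarrow>\<^sub>0 'k) set"
  assume T: "pm.subspace T" and h: "\<And>x. ?hm x \<in> T" and e: "\<And>i. ?e i \<in> T" and f: "\<And>i. ?f i \<in> T"
    and closed: "\<And>v w. v \<in> T \<Longrightarrow> w \<in> T \<Longrightarrow> lbr v w \<in> T"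
  have f': "EE (- axis i 1) \<in> T" for i using pm.subspace_neg[OF T f[of i]] by simp
  have EE: "EE a \<in> T" if "root a" for a by (rule generated_roots[OF T e f' closed that])
  show "gspace UNIV \<subseteq> T"
  proof
    fix v :: "'n lidx \<Rightarrow>\<^sub>0 'k" assume "v \<in> gspace UNIV"
    then have "v \<in> supported bidx" by (simp add: gspace_def)
    then show "v \<in> T"
    proof (induction rule: supported_induct)
      case zero
      show ?case by (rule pm.subspace_0[OF T])
    next
      case (add a b)
      then show ?case by (rule pm.subspace_add[OF T])
    next
      case (single i c)
      have "single i 1 \<in> T"
      proof (cases i)
        case (Hb k)
        have "?hm (coroot R k) = single (Hb k) 1"
          by (rule poly_mapping_eqI) (auto simp: lookup_sum_Hb coroot lookup_single when_def split: lidx.splits)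
        then show ?thesis using h[of "coroot R k"] Hb by simp
      qed (use single EE in auto)
      then show ?case using pm.subspace_scale[OF T, of _ c] by fastforce
    qed
  qed
next
  fix v :: "'n lidx \<Rightarrow>\<^sub>0 'k" and \<beta> :: "int ^ 'n"
  assume v: "v \<in> ?W \<beta>" "v \<noteq> 0" "\<beta> \<noteq> 0"
  \<comment> \<open>A nonzero weight space is at most a line: only the index of the root \<beta>
    carries that weight.\<close>
  have "x = Eb \<beta> \<and> root \<beta>" if "lookup v x \<noteq> 0" for x
  proof -
    have "x \<in> {x. lwt x = \<beta>} \<inter> bidx" using v(1) that by (auto simp: gspace_def supported_iff)
    then show ?thesis using v(3) by (cases x) auto
  qed
  then have *: "root \<beta>" "v = single (Eb \<beta>) (lookup v (Eb \<beta>))" "lookup v (Eb \<beta>) \<noteq> 0"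
    using v(2) by (auto intro!: poly_mapping_eqI simp: lookup_single when_def) (metis lookup_zero poly_mapping_eqI)+
  have "lbr (EE (- \<beta>)) v = pscale (lookup v (Eb \<beta>)) (Hv \<beta>)"
    using *(1) by (subst *(2)) (simp add: ip_simps ip_root_self Hv_uminus)
  moreover have "Hv \<beta> \<noteq> (0 :: 'n lidx \<Rightarrow>\<^sub>0 'k)"
    using *(1) by (intro Hv_nonzero char) (simp add: root_def)
  ultimately show "\<exists>z\<in>?W (- \<beta>). lbr z v \<noteq> 0"
    using *(1,3) by (intro bexI[of _ "EE (- \<beta>)"]) simp_all
next
  fix B :: "(int ^ 'n) set" and u :: "int ^ 'n \<Rightarrow> 'n lidx \<Rightarrow>\<^sub>0 'k" and \<beta>
  assume "finite B" "\<And>\<beta>. \<beta> \<in> B \<Longrightarrow> u \<beta> \<in> ?W \<beta>" "sum u B = 0" "\<beta> \<in> B"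
  then show "u \<beta> = 0"
    by (intro supported_weight_indep[of B u lwt \<beta>]) (auto simp: gspace_def supported_iff)
next
  fix v w :: "'n lidx \<Rightarrow>\<^sub>0 'k" and \<beta> \<gamma>
  assume "v \<in> ?W \<beta>" "w \<in> ?W \<gamma>"
  then show "lbr v w \<in> ?W (\<beta> + \<gamma>)" by (intro lbr_gspace) simp_all
qed (auto simp: gspace_def supported_iff)

end

section \<open>The superalgebra attached to a simple root\<close>

lemma prj_uminus: "prj S (- a) = - prj S a"
  by (intro poly_mapping_eqI) simp

lemma prj_zero [simp]: "prj S 0 = 0"
  by (intro poly_mapping_eqI) simp

text \<open>The argument \<open>ch\<close> carries the field type, which the lattice data do not
  mention.\<close>

locale root_reduction = root_lattice M for M :: "'n::finite \<Rightarrow> 'n \<Rightarrow> int" +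
  fixes node :: 'n and ch :: "'k::field itself"
  assumes char3: "CHAR('k) = 3"
begin

definition th :: "int ^ 'n" where "th = axis node 1"

definition ldeg :: "'n lidx \<Rightarrow> int" where
  "ldeg x = (case x of Hb i \<Rightarrow> 0 | Eb a \<Rightarrow> ip th a)"

lemma ldeg_simps [simp]: "ldeg (Hb i) = 0" "ldeg (Eb a) = ip th a"
  by (simp_all add: ldeg_def)

definition d :: "('n lidx \<Rightarrow>\<^sub>0 'k) \<Rightarrow> ('n lidx \<Rightarrow>\<^sub>0 'k)" where "d x = lbr (EE th) x"

definition gr :: "int \<Rightarrow> ('n lidx \<Rightarrow>\<^sub>0 'k) set" where "gr k = gspace {x. ldeg x = k}"

definition comp :: "int \<Rightarrow> ('n lidx \<Rightarrow>\<^sub>0 'k) \<Rightarrow> ('n lidx \<Rightarrow>\<^sub>0 'k)" where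
  "comp k = prj {x. ldeg x = k}"

text \<open>Although only \<open>d\<close> is mentioned, this is the centralizer of the whole sl_2:
  lowering such an element gives a vector of degree -2 killed by \<open>d\<close>, and
  \<open>d\<close> is injective there (\<open>d_lower\<close>, \<open>d_inj\<close>).\<close>

definition cent :: "('n lidx \<Rightarrow>\<^sub>0 'k) set" where "cent = {x \<in> gr 0. d x = 0}"

text \<open>The bracket -[x, y'] + [x', y] of two odd elements of the semisimplification, where x' =
  d x and y' = d y complete the blocks of size 2.\<close>

definition qb :: "('n lidx \<Rightarrow>\<^sub>0 'k) \<Rightarrow> ('n lidx \<Rightarrow>\<^sub>0 'k) \<Rightarrow> ('n lidx \<Rightarrow>\<^sub>0 'k)" where
  "qb x y = lbr (d x) y - lbr x (d y)"

text \<open>Projecting to the degrees 0 and -1 first makes the bracket bilinear on the whole space,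
  as \<open>bilinear_bracket\<close> demands.\<close>

definition rbr :: "('n lidx \<Rightarrow>\<^sub>0 'k) \<Rightarrow> ('n lidx \<Rightarrow>\<^sub>0 'k) \<Rightarrow> ('n lidx \<Rightarrow>\<^sub>0 'k)" where
  "rbr x y = lbr (comp 0 x) (comp 0 y) + lbr (comp 0 x) (comp (- 1) y) +
     lbr (comp (- 1) x) (comp 0 y) + qb (comp (- 1) x) (comp (- 1) y)"

definition rpart :: "bool \<Rightarrow> ('n lidx \<Rightarrow>\<^sub>0 'k) set" where
  "rpart p = (if p then gr (- 1) else cent)"

definition rcarrier :: "('n lidx \<Rightarrow>\<^sub>0 'k) set" where
  "rcarrier = {x + y |x y. x \<in> cent \<and> y \<in> gr (- 1)}"

lemma root_th [simp]: "root th" by (simp add: th_def)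

lemma ip_th_th [simp]: "ip th th = 2" by (simp add: ip_root_self)

lemma three_eq_0: "(3 :: 'k) = 0"
  using of_nat_eq_0_iff_char_dvd[where 'a = 'k, of 3] by (simp add: char3)

lemma two_eq: "(2 :: 'k) = - 1"
  using three_eq_0 by (simp add: eq_neg_iff_add_eq_0)

lemma triple_eq_0: "v + (v + v) = (0 :: 'n lidx \<Rightarrow>\<^sub>0 'k)"
proof -
  have "v + (v + v) = pscale (1 + (1 + 1)) v" by (simp only: pm.scale_left_distrib pm.scale_one)
  also have "\<dots> = 0" using three_eq_0 by simp
  finally show ?thesis .
qed

lemma d_linear: "d (x + y) = d x + d y" "d (x - y) = d x - d y" "d (- x) = - d x" "d 0 = 0"
  "d (pscale c x) = pscale c (d x)" "d (\<Sum>i\<in>S. g i) = (\<Sum>i\<in>S. d (g i))"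
  by (simp_all add: d_def l.linear_simps l.sum_right)

lemma d_derivation: "d (lbr x y) = lbr (d x) y + lbr x (d y)"
  unfolding d_def by (rule lbr_jacobi')

lemma comp_linear: "comp k (x + y) = comp k x + comp k y" "comp k (pscale c x) = pscale c (comp k x)"
  "comp k (- x) = - comp k x" "comp k 0 = 0" "comp k (x - y) = comp k x - comp k y"
  using prj_add[of _ x "- y"] by (simp_all add: comp_def prj_add prj_scale prj_uminus)

lemma gr_subspace: "pm.subspace (gr k)" by (simp add: gr_def gspace_subspace)

lemma gr_lbr: "x \<in> gr j \<Longrightarrow> y \<in> gr k \<Longrightarrow> lbr x y \<in> gr (j + k)"
  unfolding gr_def by (intro lbr_gspace) (simp_all add: ip_simps)

lemma EE_gr: "root a \<Longrightarrow> ip th a = k \<Longrightarrow> single (Eb a) c \<in> gr k"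
  by (simp add: gr_def)

lemma Hb_gr: "supported (range Hb) \<subseteq> gr 0"
proof -
  have "range Hb \<subseteq> {x. ldeg x = 0} \<inter> bidx" by auto
  then show ?thesis unfolding gr_def gspace_def supported_def by blast
qed

lemma gr_d: "x \<in> gr k \<Longrightarrow> d x \<in> gr (2 + k)"
  unfolding d_def by (intro gr_lbr EE_gr) simp_all

lemma gr_eq_0:
  assumes "x \<in> gr k" "\<bar>k\<bar> > 2"
  shows "x = 0"
proof (rule poly_mapping_eqI)
  fix i
  have "i \<notin> {x. ldeg x = k} \<inter> bidx"
  proof
    assume i: "i \<in> {x. ldeg x = k} \<inter> bidx"
    then show False using assms(2) ip_lower[OF root_th] ip_upper[OF root_th] by (cases i) force+
  qed
  then show "lookup x i = lookup 0 i" using assms(1) unfolding gr_def gspace_def supported_iff by auto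
qed

lemma comp_gr: "x \<in> gr j \<Longrightarrow> comp k x = (if j = k then x else 0)"
  unfolding comp_def gr_def gspace_def
  by (intro poly_mapping_eqI) (auto simp: supported_iff)

lemma comp_in_gr: "x \<in> gspace UNIV \<Longrightarrow> comp k x \<in> gr k"
  unfolding comp_def gr_def gspace_def by (auto simp: supported_iff)

lemma cent_gr: "x \<in> cent \<Longrightarrow> x \<in> gr 0" and cent_d: "x \<in> cent \<Longrightarrow> d x = 0"
  by (simp_all add: cent_def)

lemma cent_subspace: "pm.subspace cent"
  using gr_subspace[of 0] by (auto simp: cent_def pm.subspace_def d_linear)

lemma gr_gspace: "gr k \<subseteq> gspace UNIV"
  by (auto simp: gr_def gspace_def supported_iff)

lemma lbr_cent: "x \<in> cent \<Longrightarrow> y \<in> cent \<Longrightarrow> lbr x y \<in> cent"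
  using gr_lbr[of x 0 y 0] by (simp add: cent_def d_derivation)

lemma lbr_cent_odd: "x \<in> cent \<Longrightarrow> y \<in> gr (- 1) \<Longrightarrow> lbr x y \<in> gr (- 1)"
  using gr_lbr[of x 0 y "- 1"] by (simp add: cent_def)

lemma lbr_odd_cent: "x \<in> gr (- 1) \<Longrightarrow> y \<in> cent \<Longrightarrow> lbr x y \<in> gr (- 1)"
  using gr_lbr[of x "- 1" y 0] by (simp add: cent_def)

lemma dd_odd: "x \<in> gr (- 1) \<Longrightarrow> d (d x) = 0"
  using gr_d[OF gr_d[of x "- 1"]] by (intro gr_eq_0[of _ 3]) simp_all

lemma qb_cent: "x \<in> gr (- 1) \<Longrightarrow> y \<in> gr (- 1) \<Longrightarrow> qb x y \<in> cent"
  using gr_lbr[of "d x" 1 y "- 1"] gr_lbr[of x "- 1" "d y" 1] gr_d[of x "- 1"] gr_d[of y "- 1"]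
  by (simp add: cent_def qb_def d_linear d_derivation dd_odd pm.subspace_diff[OF gr_subspace])

lemma qb_commute: "qb x y = qb y x"
  unfolding qb_def lbr_skew[of y "d x"] lbr_skew[of "d y" x] by (simp add: lbr_skew[of "d x" y])

lemma qb_linear: "qb (x + y) z = qb x z + qb y z" "qb z (x + y) = qb z x + qb z y"
  "qb (pscale c x) z = pscale c (qb x z)" "qb z (pscale c x) = pscale c (qb z x)"
  by (simp_all add: qb_def d_linear l.linear_simps pm.scale_right_diff_distrib)

sublocale r: bilinear_bracket rbr
  by unfold_locales
    (simp_all add: rbr_def comp_linear l.linear_simps qb_linear pm.scale_right_distrib)

lemma rbr_simps:
  "x \<in> gr 0 \<Longrightarrow> y \<in> gr 0 \<Longrightarrow> rbr x y = lbr x y"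
  "x \<in> gr 0 \<Longrightarrow> y \<in> gr (- 1) \<Longrightarrow> rbr x y = lbr x y"
  "x \<in> gr (- 1) \<Longrightarrow> y \<in> gr 0 \<Longrightarrow> rbr x y = lbr x y"
  "x \<in> gr (- 1) \<Longrightarrow> y \<in> gr (- 1) \<Longrightarrow> rbr x y = qb x y"
  by (simp_all add: rbr_def comp_gr qb_def d_linear)

text \<open>
  With \<open>T x y z = [[d x, y], z]\<close> and \<open>W x y z = [d [x, y], z]\<close> the Jacobi identity makes \<open>T\<close>
  symmetric up to \<open>W\<close>, so that the cyclic sum is a multiple of 3.
\<close>

lemma qb_cyclic:
  assumes "x \<in> gr (- 1)" "y \<in> gr (- 1)" "z \<in> gr (- 1)"
  shows "lbr (qb x y) z + lbr (qb y z) x + lbr (qb z x) y = 0"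
proof -
  define T where "T x y z = lbr (lbr (d x) y) z" for x y z :: "'n lidx \<Rightarrow>\<^sub>0 'k"
  define W where "W x y z = lbr (d (lbr x y)) z" for x y z :: "'n lidx \<Rightarrow>\<^sub>0 'k"
  have 1: "T x z y = T x y z - W y z x"
    if "x \<in> gr (- 1)" "y \<in> gr (- 1)" "z \<in> gr (- 1)" for x y z
  proof -
    \<comment> \<open>Degree -3 is zero, so [[y,z],x] = 0; applying \<open>d\<close> to this
      equation relates \<open>W\<close> to \<open>T\<close>.\<close>
    have "lbr (lbr y z) x \<in> gr (- 3)"
      using gr_lbr[OF gr_lbr[OF that(2,3)] that(1)] by simp
    then have "lbr (lbr y z) x = 0" by (rule gr_eq_0) simp
    then have "lbr (d (lbr y z)) x + lbr (lbr y z) (d x) = 0"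
      using d_derivation[of "lbr y z" x] by (simp add: d_linear)
    moreover have "lbr (lbr y z) (d x) = - lbr (d x) (lbr y z)" by (rule lbr_skew)
    ultimately have "W y z x = lbr (d x) (lbr y z)" by (simp add: W_def)
    also have "\<dots> = T x y z + lbr y (lbr (d x) z)" unfolding T_def by (rule lbr_jacobi')
    also have "lbr y (lbr (d x) z) = - T x z y" unfolding T_def by (rule lbr_skew)
    finally show ?thesis by (simp add: algebra_simps)
  qed
  have 2: "T y x z = T x y z - W x y z" for x y z
  proof -
    have "W x y z = T x y z + lbr (lbr x (d y)) z" by (simp add: W_def T_def d_derivation l.add_left)
    also have "lbr (lbr x (d y)) z = - T y x z"
      using lbr_skew[of x "d y"] by (simp add: T_def l.uminus_left)
    finally show ?thesis by (simp add: algebra_simps)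
  qed
  have 3: "lbr (qb x y) z = T x y z + T y x z" for x y z
    using lbr_skew[of x "d y"] by (simp add: qb_def T_def l.linear_simps)
  let ?t = "T x y z" and ?a = "W x y z" and ?b = "W y z x" and ?c = "W x z y"
  have e1: "T y x z = ?t - ?a" by (rule 2)
  have e2: "T x z y = ?t - ?b" by (rule 1[OF assms])
  have e3: "T y z x = ?t - ?a - ?c" using 1[OF assms(2,1,3)] by (simp only: e1)
  have e4: "T z x y = ?t - ?b - ?c" using 2[of z x y] by (simp only: e2)
  have e5: "T z y x = ?t - ?b - ?c - ?a" using 1[OF assms(3,1,2)] by (simp only: e4)
  have "lbr (qb x y) z + lbr (qb y z) x + lbr (qb z x) y =
      (?t + (?t + ?t)) + (?t + (?t + ?t)) - (?a + (?a + ?a)) - (?b + (?b + ?b)) - (?c + (?c + ?c))"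
    unfolding 3 e1 e2 e3 e4 e5 by (simp add: algebra_simps)
  then show ?thesis by (simp only: triple_eq_0) simp
qed

text \<open>Setting x = y = z in \<open>qb_cyclic\<close> only gives 3 [[x,x],x] = 0, which is void
  here. The cube is therefore checked on root vectors, where already \<open>qb x x\<close> is 0
  because th + a and a have inner product 1; the mixed terms of a sum are instances of
  \<open>qb_cyclic\<close>.\<close>

lemma qb_cube:
  assumes "x \<in> gr (- 1)"
  shows "lbr (qb x x) x = 0"
proof -
  have "x \<in> supported ({x. ldeg x = - 1} \<inter> bidx)" using assms by (simp add: gr_def gspace_def)
  then have "x \<in> gr (- 1) \<and> lbr (qb x x) x = 0"
  proof (induction rule: supported_induct)
    case zero
    show ?case by (simp add: pm.subspace_0[OF gr_subspace])
  next
    case (add x y)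
    then have x: "x \<in> gr (- 1)" "lbr (qb x x) x = 0" and y: "y \<in> gr (- 1)" "lbr (qb y y) y = 0" by auto
    have "lbr (qb (x + y) (x + y)) (x + y) = lbr (qb x x) x + lbr (qb y y) y
        + (lbr (qb x x) y + lbr (qb x y) x + lbr (qb y x) x)
        + (lbr (qb y y) x + lbr (qb y x) y + lbr (qb x y) y)"
      unfolding qb_linear l.linear_simps by (simp add: algebra_simps qb_commute[of y x])
    also have "\<dots> = 0" using qb_cyclic[OF x(1) x(1) y(1)] qb_cyclic[OF y(1) y(1) x(1)] x(2) y(2) by simp
    finally show ?case using pm.subspace_add[OF gr_subspace x(1) y(1)] by blast
  next
    case (single i c)
    then obtain a where i: "i = Eb a" and a: "root a" "ip th a = - 1" by (cases i) auto
    have "d (single i c) = pscale c (single (Eb (th + a)) (eps th a))"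
      using a by (simp add: d_def i)
    moreover have "root (th + a)" "ip (th + a) a = 1" "ip a (th + a) = 1"
      using a by (auto simp: root_add_iff ip_simps ip_root_self ip_commute[of a th])
    ultimately have "qb (single i c) (single i c) = 0" using a by (simp add: qb_def i)
    then show ?case using a by (simp add: i EE_gr)
  qed
  then show ?thesis by blast
qed

lemma rcarrier_iff: "x \<in> rcarrier \<longleftrightarrow> (\<exists>a\<in>cent. \<exists>b\<in>gr (- 1). x = a + b)"
  by (auto simp: rcarrier_def)

lemma rcarrier_subspace: "pm.subspace rcarrier"
  unfolding rcarrier_def by (intro pm.subspace_sums cent_subspace gr_subspace)

lemma cent_rcarrier: "cent \<subseteq> rcarrier" and odd_rcarrier: "gr (- 1) \<subseteq> rcarrier"
  using pm.subspace_0[OF cent_subspace] pm.subspace_0[OF gr_subspace]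
  by (force simp: rcarrier_iff)+

lemma comp_rcarrier: "x \<in> rcarrier \<Longrightarrow> comp 0 x \<in> cent" "x \<in> rcarrier \<Longrightarrow> comp (- 1) x \<in> gr (- 1)"
  "x \<in> rcarrier \<Longrightarrow> x = comp 0 x + comp (- 1) x"
  by (auto simp: rcarrier_iff comp_linear comp_gr comp_gr[OF cent_gr])

lemma rpart_rbr: "x \<in> rpart p \<Longrightarrow> y \<in> rpart q \<Longrightarrow> rbr x y \<in> rpart (p \<noteq> q)"
  by (cases p; cases q)
    (auto simp: rpart_def rbr_simps cent_gr lbr_cent lbr_cent_odd lbr_odd_cent qb_cent)

lemma rbr_rcarrier: "x \<in> rcarrier \<Longrightarrow> y \<in> rcarrier \<Longrightarrow> rbr x y \<in> rcarrier"
proof -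
  assume x: "x \<in> rcarrier" and y: "y \<in> rcarrier"
  have "rbr x y = (lbr (comp 0 x) (comp 0 y) + qb (comp (- 1) x) (comp (- 1) y)) +
      (lbr (comp 0 x) (comp (- 1) y) + lbr (comp (- 1) x) (comp 0 y))"
    by (simp add: rbr_def)
  then show ?thesis unfolding rcarrier_iff
    using lbr_cent[OF comp_rcarrier(1)[OF x] comp_rcarrier(1)[OF y]]
      qb_cent[OF comp_rcarrier(2)[OF x] comp_rcarrier(2)[OF y]]
      lbr_cent_odd[OF comp_rcarrier(1)[OF x] comp_rcarrier(2)[OF y]]
      lbr_odd_cent[OF comp_rcarrier(2)[OF x] comp_rcarrier(1)[OF y]]
      pm.subspace_add[OF cent_subspace] pm.subspace_add[OF gr_subspace] by blast
qed

text \<open>An element killed by \<open>d\<close> acts by a derivation that commutes with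
  \<open>d\<close>, hence by a derivation of \<open>qb\<close>.\<close>

lemma lbr_qb: "x \<in> cent \<Longrightarrow> lbr x (qb y z) = qb (lbr x y) z + qb y (lbr x z)"
  using lbr_jacobi'[of x "d y" z] lbr_jacobi'[of x y "d z"]
  by (simp add: qb_def l.diff_right d_derivation cent_d)

text \<open>The Jacobi identity goes by the number of odd arguments: with at most one it is that of
  \<open>lbr\<close>, with two it is \<open>lbr_qb\<close> rearranged by skew symmetry, with three
  it is \<open>qb_cyclic\<close>.\<close>

lemma lie_superalgebra_reduction: "lie_superalgebra (model_alg rcarrier rbr rpart)"
proof (rule r.lie_superalgebra_model_alg[OF rcarrier_subspace])
  show "pm.subspace (rpart p)" for p by (simp add: rpart_def gr_subspace cent_subspace)
  show "rpart False \<inter> rpart True \<subseteq> {0}"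
  proof
    fix x assume "x \<in> rpart False \<inter> rpart True"
    then have "x \<in> gr 0" "x \<in> gr (- 1)" by (auto simp: rpart_def cent_gr)
    from comp_gr[OF this(1), of 0] comp_gr[OF this(2), of 0] show "x \<in> {0}" by simp
  qed
  show "x \<in> rcarrier \<longleftrightarrow> (\<exists>a\<in>rpart False. \<exists>b\<in>rpart True. x = a + b)" for x
    by (simp add: rpart_def rcarrier_iff)
next
  fix x y p q assume "x \<in> rpart p" "y \<in> rpart q"
  then show "rbr x y \<in> rpart (p \<noteq> q)" by (rule rpart_rbr)
  show "rbr x y = - pscale (koszul p q) (rbr y x)"
    using \<open>x \<in> rpart p\<close> \<open>y \<in> rpart q\<close> lbr_skew[of x y] qb_commute[of x y]
    by (cases p; cases q) (simp_all add: rpart_def koszul_def rbr_simps cent_gr)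
next
  fix x y z p q s assume xyz: "x \<in> rpart p" "y \<in> rpart q" "z \<in> rpart s"
  note mem = rpart_def cent_gr lbr_cent lbr_cent_odd lbr_odd_cent qb_cent
  have skew: "lbr y x = - lbr x y" "lbr z x = - lbr x z" "lbr z y = - lbr y z"
    by (rule lbr_skew)+
  show "rbr x (rbr y z) = rbr (rbr x y) z + pscale (koszul p q) (rbr y (rbr x z))"
  proof (cases "p \<and> q \<or> p \<and> s \<or> q \<and> s")
    case False
    then show ?thesis using xyz lbr_jacobi'[of x y z]
      by (cases p; cases q; cases s) (simp_all add: mem koszul_def rbr_simps)
  next
    case True
    then consider "\<not> p" "q" "s" | "p" "\<not> q" "s" | "p" "q" "\<not> s" | "p" "q" "s" by blast
    then show ?thesis
    proof cases
      case 1
      then show ?thesis using xyz lbr_qb[of x y z] by (simp add: mem koszul_def rbr_simps)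
    next
      case 2
      have "lbr y (qb x z) = qb (lbr y x) z + qb x (lbr y z)"
        using xyz 2 by (intro lbr_qb) (simp add: rpart_def)
      moreover have "qb (lbr y x) z = - qb (lbr x y) z"
        unfolding skew using qb_linear(3)[of "- 1"] by simp
      ultimately show ?thesis using xyz 2 by (simp add: mem koszul_def rbr_simps)
    next
      case 3
      have "lbr z (qb x y) = qb (lbr z x) y + qb x (lbr z y)"
        using xyz 3 by (intro lbr_qb) (simp add: rpart_def)
      moreover have "qb (lbr z x) y = - qb y (lbr x z)" "qb x (lbr z y) = - qb x (lbr y z)"
        unfolding skew using qb_linear(3)[of "- 1"] qb_linear(4)[of _ "- 1"]
        by (simp_all add: qb_commute[of "lbr x z" y])
      moreover have "lbr (qb x y) z = - lbr z (qb x y)" by (rule lbr_skew)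
      ultimately have "lbr (qb x y) z = qb y (lbr x z) + qb x (lbr y z)" by simp
      then show ?thesis using xyz 3 by (simp add: mem koszul_def rbr_simps)
    next
      case 4
      then have odd: "x \<in> gr (- 1)" "y \<in> gr (- 1)" "z \<in> gr (- 1)" using xyz by (simp_all add: rpart_def)
      have "lbr x (qb y z) = - lbr (qb y z) x" "lbr y (qb x z) = - lbr (qb x z) y"
        by (rule lbr_skew)+
      moreover have "lbr (qb y z) x = - (lbr (qb x y) z + lbr (qb x z) y)"
        using qb_cyclic[OF odd] qb_commute[of z x] by (simp only: eq_neg_iff_add_eq_0 ac_simps)
      ultimately have "lbr x (qb y z) = lbr (qb x y) z - lbr y (qb x z)" by simp
      then show ?thesis using odd 4 by (simp add: mem koszul_def rbr_simps)
    qed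
  qed
next
  fix x assume "x \<in> rpart True"
  then have x: "x \<in> gr (- 1)" by (simp add: rpart_def)
  then show "rbr x (rbr x x) = 0"
    using qb_cube[OF x] lbr_skew[of x "qb x x"] by (simp add: rbr_simps qb_cent cent_gr)
qed

lemma d_EE: "root a \<Longrightarrow> d (EE a) = (if ip th a = - 2 then - Hv th
    else if ip th a = - 1 then single (Eb (th + a)) (eps th a) else 0)"
  by (simp add: d_def)

lemma EE_cent: "root a \<Longrightarrow> ip th a = 0 \<Longrightarrow> EE a \<in> cent"
  by (simp add: cent_def d_EE EE_gr)

lemma EE_from_rbr:
  assumes r: "root a" "root b" "ip a b = - 1"
    and deg: "ip th a = 0 \<and> ip th b \<in> {0, - 1} \<or> ip th a = - 1 \<and> ip th b = 0"
    and T: "pm.subspace T" and m: "rbr (EE a) (EE b) \<in> T"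
  shows "EE (a + b) \<in> T"
proof -
  have "rbr (EE a) (EE b) = lbr (EE a) (EE b)"
  proof -
    consider "ip th a = 0" "ip th b = 0" | "ip th a = 0" "ip th b = - 1" | "ip th a = - 1" "ip th b = 0"
      using deg by auto
    then show ?thesis
    proof cases
      case 1
      then show ?thesis using r by (intro rbr_simps(1) EE_gr)
    next
      case 2
      then show ?thesis using r by (intro rbr_simps(2) EE_gr)
    next
      case 3
      then show ?thesis using r by (intro rbr_simps(3) EE_gr)
    qed
  qed
  then show ?thesis using EE_from_bracket[OF r T] m by simp
qed

text \<open>Both terms of \<open>qb\<close> contribute the same multiple of the root vector of th +
  a + b, and 2 = -1 merges them into a sign. Two odd root vectors thus reach an even one although a
  + b is not a root.\<close>

lemma rbr_EE_odd:
  assumes r: "root a" "root b" "ip a b = 0" and deg: "ip th a = - 1" "ip th b = - 1"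
  shows "rbr (EE a) (EE b) = single (Eb (th + a + b)) (- (eps th a * eps th b * eps a b))"
proof -
  have s: "ip a th = - 1" "ip b a = 0" using r deg by (simp_all add: ip_commute)
  have "root (th + a)" "root (th + b)" using r deg by (auto simp: root_add_iff)
  moreover have "eps a th = - (eps th a :: 'k)" using eps_swap_odd[of th a] deg by simp
  ultimately have "qb (EE a) (EE b) =
      single (Eb (th + a + b)) (eps th a * eps th b * eps a b + eps th a * eps th b * eps a b)"
    using r deg s
    by (simp add: qb_def d_EE ip_simps eps_add ac_simps single_add[symmetric] flip: single_diff)
  moreover have "c + c = - c" for c :: 'k using two_eq by (metis mult_2 mult_minus1)
  ultimately show ?thesis using r deg by (simp add: rbr_simps EE_gr)
qed

lemma EE_from_rbr_odd:
  assumes r: "root a" "root b" "ip a b = 0" and deg: "ip th a = - 1" "ip th b = - 1"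
    and T: "pm.subspace T" and m: "rbr (EE a) (EE b) \<in> T"
  shows "EE (th + a + b) \<in> T"
proof -
  let ?c = "- (eps th a * eps th b * eps a b) :: 'k"
  have "?c * ?c = 1" by (simp add: ac_simps)
  then have "EE (th + a + b) = pscale ?c (rbr (EE a) (EE b))"
    unfolding rbr_EE_odd[OF r deg] by (simp only: pscale_single)
  then show ?thesis using pm.subspace_scale[OF T m, of ?c] by (simp only:)
qed

end

section \<open>Roots and weights modulo the chosen simple root\<close>

locale reduction_nodes = root_reduction M node ch
  for M :: "'n::finite \<Rightarrow> 'n \<Rightarrow> int" and node :: 'n and ch :: "'k::field itself" +
  fixes nd :: "'m::finite \<Rightarrow> 'n" and j0 :: 'm
  assumes inj_nd: "inj nd" and range_nd: "range nd = - {node}"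
    and adjacent: "ip th (axis (nd j) 1) = (if j = j0 then - 1 else 0)"
begin

abbreviation al :: "'m \<Rightarrow> int ^ 'n" where "al j \<equiv> axis (nd j) 1"

lemma nd_node [simp]: "nd j \<noteq> node" "node \<noteq> nd j"
  using range_nd by auto

lemma node_cases: obtains "i = node" | j where "i = nd j"
  using range_nd by (metis ComplI image_iff singletonD)

lemma th_nd [simp]: "th $ nd j = 0" by (simp add: th_def axis_def)

lemma al_nd: "al j $ nd k = (if k = j then 1 else 0)"
  by (auto simp: axis_def dest!: injD[OF inj_nd])

text \<open>Passes to the lattice modulo \<open>th\<close>. Since \<open>d\<close> shifts roots by
  \<open>th\<close>, weights add under the odd bracket only after \<open>th\<close> is divided
  out.\<close>

definition pwt :: "int ^ 'n \<Rightarrow> int ^ 'm" where "pwt a = (\<chi> j. a $ nd j)"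

lemma pwt_simps: "pwt (a + b) = pwt a + pwt b" "pwt (- a) = - pwt a" "pwt th = 0" "pwt 0 = 0"
  "pwt (al j) = axis j 1"
  by (simp_all add: pwt_def vec_eq_iff al_nd) (simp add: axis_def)

lemma pwt_eq_iff: "pwt a = pwt b \<longleftrightarrow> (\<exists>k. a = b + k *s th)"
proof
  assume eq: "pwt a = pwt b"
  have "a $ i = (b + (a $ node - b $ node) *s th) $ i" for i
  proof (cases i rule: node_cases)
    case 1
    then show ?thesis by (simp add: th_def axis_def)
  next
    case (2 j)
    then show ?thesis using eq by (simp add: pwt_def vec_eq_iff)
  qed
  then show "\<exists>k. a = b + k *s th" by (metis vec_eq_iff)
qed (auto simp: pwt_def vec_eq_iff)

lemma ip_smult_th: "ip a (k *s th) = k * ip a th" "ip (k *s th) a = k * ip th a"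
  using lform_smult[of M 1 a k th] lform_smult[of M k th 1 a]
  by (simp_all add: ip_def algebra_simps)

text \<open>Moving by \<open>k *s th\<close> changes the degree by 2k, and the values 0 and -1 do
  not differ by a nonzero even number. Hence nonzero weight spaces of the reduced algebra are at
  most lines.\<close>

lemma root_pwt_inj:
  assumes "root a" "root b" "ip th a \<in> {0, - 1}" "ip th b \<in> {0, - 1}" "pwt a = pwt b"
  shows "a = b"
proof -
  obtain k where k: "a = b + k *s th" using assms(5) pwt_eq_iff by blast
  have "B (k *s th) (k *s th) = k * k"
    using lform_smult[of M k th k th] root_th by (simp add: root_def)
  then have "k * (ip th b + k) = 0"
    using assms(1,2) ip_commute[of b th] by (simp add: root_def k quad_add ip_smult_th algebra_simps)
  moreover have "ip th a = ip th b + 2 * k" by (simp add: k ip_simps ip_smult_th)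
  ultimately have "k = 0" using assms(3,4) by auto
  then show ?thesis using k by simp
qed

text \<open>A multiple of \<open>th\<close> has even degree, so degree 0 or -1 leaves only the zero
  vector, which is not a root.\<close>

lemma pwt_nonzero:
  assumes "root a" "ip th a \<in> {0, - 1}"
  shows "pwt a \<noteq> 0"
proof
  assume "pwt a = 0"
  then have "pwt a = pwt 0" by (simp add: pwt_simps)
  then obtain k where k: "a = k *s th" using pwt_eq_iff[of a 0] by auto
  have "B a a = k * k" using lform_smult[of M k th k th] root_th by (simp add: k root_def)
  moreover have "ip th a = 2 * k" by (simp add: k ip_smult_th)
  then have "2 * k = 0 \<or> 2 * k = - 1" using assms(2) by simp
  then have "k = 0" by presburger
  ultimately show False using assms(1) by (simp add: root_def)
qed

text \<open>The descent of \<open>generated_roots\<close>, run on the projection a - (t/2) th away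
  from \<open>th\<close>, whose norm is positive. A step across the neighbour \<open>j0\<close>
  changes the degree; where it would leave {0, -1}, \<open>th\<close> is added or subtracted as
  well.\<close>

lemma reduction_generated_roots:
  fixes T :: "('n lidx \<Rightarrow>\<^sub>0 'k) set"
  assumes T: "pm.subspace T" and e: "\<And>j. EE (al j) \<in> T"
    and f: "\<And>j. j \<noteq> j0 \<Longrightarrow> EE (- al j) \<in> T" and f0: "EE (- al j0 - th) \<in> T"
    and closed: "\<And>v w. v \<in> T \<Longrightarrow> w \<in> T \<Longrightarrow> rbr v w \<in> T"
  shows "root a \<Longrightarrow> ip th a \<in> {0, - 1} \<Longrightarrow> EE a \<in> T"
proof (induction "nat (\<Sum>j\<in>UNIV. \<bar>a $ nd j\<bar>)" arbitrary: a rule: less_induct)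
  case less
  note a = \<open>root a\<close>
  define t where "t = ip th a"
  have t: "t = 0 \<or> t = - 1" using less.prems by (auto simp: t_def)
  have at: "ip a th = t" by (simp add: t_def ip_commute)
  \<comment> \<open>The coordinate times twice the pairing of the i-th simple root with the
    projection of \<open>a\<close>. The sum is 4 - t^2 > 0, and the term at \<open>node\<close>
    vanishes because the projection is orthogonal to \<open>th\<close>.\<close>
  let ?c = "\<lambda>i. a $ i * (2 * ip (axis i 1) a - ip (axis i 1) th * t)"
  have "(\<Sum>i\<in>UNIV. ?c i) = 2 * ip a a - ip a th * t"
    unfolding ip_expand[of a a] ip_expand[of a th]
    by (simp add: sum_distrib_left sum_distrib_right sum_subtractf algebra_simps)
  also have "\<dots> > 0" using t by (auto simp: at ip_root_self[OF a])
  finally have "\<not> (\<forall>i. ?c i \<le> 0)" by (meson sum_nonpos not_less)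
  then obtain i where i: "?c i > 0" by (meson not_less)
  have "i \<noteq> node"
  proof
    assume "i = node"
    then have "?c i = 0" by (simp add: t_def th_def[symmetric])
    then show False using i by linarith
  qed
  then obtain j where "i = nd j" by (metis node_cases)
  then have pos: "a $ nd j * (2 * ip (al j) a - ip (al j) th * t) > 0" using i by simp
  have smaller: "nat (\<Sum>k\<in>UNIV. \<bar>b $ nd k\<bar>) < nat (\<Sum>k\<in>UNIV. \<bar>a $ nd k\<bar>)"
    if "\<And>k. k \<noteq> j \<Longrightarrow> b $ nd k = a $ nd k" "\<bar>b $ nd j\<bar> < \<bar>a $ nd j\<bar>" for b :: "int ^ 'n"
  proof -
    have "(\<Sum>k\<in>UNIV. \<bar>b $ nd k\<bar>) < (\<Sum>k\<in>UNIV. \<bar>a $ nd k\<bar>)"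
    proof (rule sum_strict_mono_ex1)
      show "\<forall>k\<in>UNIV. \<bar>b $ nd k\<bar> \<le> \<bar>a $ nd k\<bar>" using that by (metis less_le order.refl)
    qed (use that in auto)
    moreover from this have "(\<Sum>k\<in>UNIV. \<bar>a $ nd k\<bar>) > 0"
      using sum_nonneg[of UNIV "\<lambda>k. \<bar>b $ nd k\<bar>"] by linarith
    ultimately show ?thesis by simp
  qed
  have adj: "ip (al k) th = (if k = j0 then - 1 else 0)" for k
    using adjacent[of k] ip_commute[of th "al k"] by simp
  have aa: "ip a (al k) = ip (al k) a" for k by (rule ip_commute)
  have selfa: "ip (al k) (al k) = 2" for k by (simp add: ip_root_self)
  have IH: "EE b \<in> T"
    if "root b" "ip th b \<in> {0, - 1}" "\<And>k. k \<noteq> j \<Longrightarrow> b $ nd k = a $ nd k" "\<bar>b $ nd j\<bar> < \<bar>a $ nd j\<bar>" for b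
    by (rule less.hyps[OF smaller]) (use that in auto)
  \<comment> \<open>The odd root that plays the role of the negative of \<open>al j0\<close>:
    \<open>- al j0\<close> itself has degree 1, and subtracting \<open>th\<close> brings it to
    -1.\<close>
  define ph where "ph = - al j0 - th"
  have "root (al j0 + th)" by (simp add: root_add_iff adj)
  then have ph: "root ph" using root_uminus[of "al j0 + th"] by (simp add: ph_def)
  have ph_th: "ip th ph = - 1" by (simp add: ph_def ip_simps adjacent)
  have up: "ip b c \<le> 2" and lo: "ip b c \<ge> - 2" if "root b" "root c" for b c
    using ip_upper ip_lower that by auto
  show ?case
  proof (cases "a $ nd j > 0")
    case True
    then have pos': "2 * ip (al j) a - ip (al j) th * t > 0" using pos by (simp add: zero_less_mult_iff)
    then have "ip (al j) a = 1 \<or> ip (al j) a = 2"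
      using t up[OF root_axis a, of "nd j"] by (auto simp: adj split: if_splits)
    then show ?thesis
    proof
      assume "ip (al j) a = 2"
      then show ?thesis using ip_eq_2[OF root_axis a] e by metis
    next
      assume 1: "ip (al j) a = 1"
      have b: "root (a - al j)" using a 1 by (intro root_diff) (simp_all add: aa)
      show ?thesis
      \<comment> \<open>Exactly in this case \<open>a - al j\<close> has degree 1, outside the
        admissible range.\<close>
      proof (cases "j = j0 \<and> t = 0")
        case False
        have deg: "ip th (a - al j) = t - ip th (al j)" by (simp add: ip_simps t_def)
        have "EE (a - al j) \<in> T"
          by (rule IH[OF b]) (use True t False in \<open>auto simp: al_nd deg adjacent\<close>)
        from EE_from_rbr[OF _ b _ _ T closed[OF e[of j] this]]
        have "EE (al j + (a - al j)) \<in> T"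
          using 1 False t by (auto simp: ip_simps selfa adjacent t_def[symmetric] split: if_splits)
        then show ?thesis by simp
      next
        case odd: True
        have "ip (a - al j) th = 1" using odd by (simp add: ip_simps at adj)
        then have b': "root (a - al j - th)" by (rule root_diff[OF b root_th])
        have deg: "ip th (a - al j - th) = - 1" using odd by (simp add: ip_simps t_def[symmetric] adjacent)
        have "EE (a - al j - th) \<in> T"
          by (rule IH[OF b']) (use True deg in \<open>auto simp: al_nd\<close>)
        from EE_from_rbr_odd[OF _ b' _ _ deg T closed[OF e[of j] this]]
        have "EE (th + al j + (a - al j - th)) \<in> T"
          using odd 1 by (simp add: ip_simps selfa adj adjacent)
        then show ?thesis by (simp add: algebra_simps)
      qed
    qed
  next
    case False
    then have neg: "a $ nd j < 0" using pos by (cases "a $ nd j = 0") auto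
    then have neg': "2 * ip (al j) a - ip (al j) th * t < 0" using pos by (simp add: zero_less_mult_iff)
    show ?thesis
    proof (cases "j = j0")
      case False
      then have "ip (al j) a = - 1 \<or> ip (al j) a = - 2"
        using neg' lo[OF root_axis a, of "nd j"] by (auto simp: adj)
      then show ?thesis
      proof
        assume "ip (al j) a = - 2"
        then show ?thesis using ip_eq_minus_2[OF root_axis a] f[OF False] by metis
      next
        assume 1: "ip (al j) a = - 1"
        have b: "root (a + al j)" using a 1 by (intro root_add) (simp_all add: aa)
        have deg: "ip th (a + al j) = t" using False by (simp add: ip_simps t_def adjacent)
        have "EE (a + al j) \<in> T"
          by (rule IH[OF b]) (use neg t deg in \<open>auto simp: al_nd\<close>)
        from EE_from_rbr[OF _ b _ _ T closed[OF f[OF False] this]]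
        have "EE (- al j + (a + al j)) \<in> T"
          using 1 False t by (auto simp: ip_simps selfa adjacent t_def[symmetric])
        then show ?thesis by simp
      qed
    next
      case j: True
      show ?thesis
      proof (cases "t = 0")
        case t0: True
        have "ip (al j) a \<noteq> - 2"
        proof
          assume "ip (al j) a = - 2"
          then have "a = - al j" using ip_eq_minus_2[OF root_axis a] by blast
          then show False using t0 j by (simp add: t_def ip_simps adjacent)
        qed
        then have 1: "ip (al j) a = - 1"
          using neg' lo[OF root_axis a, of "nd j"] t0 by auto
        have b: "root (a + al j)" using a 1 by (intro root_add) (simp_all add: aa)
        have deg: "ip th (a + al j) = - 1" using t0 j by (simp add: ip_simps t_def adjacent)
        have "EE (a + al j) \<in> T"
          by (rule IH[OF b]) (use neg deg in \<open>auto simp: al_nd\<close>)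
        from EE_from_rbr_odd[OF ph b _ ph_th deg T closed[OF f0[folded ph_def] this]]
        have "EE (th + ph + (a + al j)) \<in> T"
          using 1 j t0 by (simp add: ph_def ip_simps selfa adj adjacent t_def)
        then show ?thesis by (simp add: ph_def j algebra_simps)
      next
        case False
        then have t1: "t = - 1" using t by blast
        have "ip a ph = 1 - ip (al j) a" using t1 j by (simp add: ph_def ip_simps at aa)
        moreover have "ip (al j) a \<le> 0" using neg' t1 j by (simp add: adj)
        ultimately have "ip a ph = 1 \<or> ip a ph = 2" using up[OF a ph] by auto
        then show ?thesis
        proof
          assume "ip a ph = 2"
          then show ?thesis using ip_eq_2[OF a ph] f0 by (simp add: ph_def)
        next
          assume 1: "ip a ph = 1"
          have b: "root (a - ph)" by (rule root_diff[OF a ph 1])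
          have deg: "ip th (a - ph) = 0" using t1 by (simp add: ip_simps t_def ph_th)
          have "EE (a - ph) \<in> T"
            by (rule IH[OF b]) (use neg deg j in \<open>auto simp: al_nd ph_def\<close>)
          from EE_from_rbr[OF ph b _ _ T closed[OF f0[folded ph_def] this]]
          have "EE (ph + (a - ph)) \<in> T"
            using 1 deg ph_th ip_root_self[OF ph] ip_commute[of ph a] by (simp add: ip_simps)
          then show ?thesis by simp
        qed
      qed
    qed
  qed
qed

text \<open>The coroot of node \<open>i\<close> projected away from \<open>th\<close>: half of
  \<open>ip (axis i 1) th\<close> times the coroot of \<open>th\<close> is to be subtracted, and
  -1/2 = 1 modulo 3. The correction makes it commute with \<open>EE th\<close>.\<close>

definition hc :: "'n \<Rightarrow> ('n lidx \<Rightarrow>\<^sub>0 'k)" where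
  "hc i = Hv (axis i 1) + pscale (of_int (ip (axis i 1) th)) (Hv th)"

lemma hc_supported: "hc i \<in> supported (range Hb)"
  unfolding hc_def
  by (intro pm.subspace_add pm.subspace_scale subspace_supported Hv_supported order.refl)

lemma hc_EE: "root a \<Longrightarrow> lbr (hc i) (EE a) =
    single (Eb a) (of_int (ip (axis i 1) a + ip (axis i 1) th * ip th a))"
  by (simp add: hc_def l.add_left l.scale_left lbr_Hv_EE single_add)

lemma d_Hv: "d (Hv a) = single (Eb th) (- of_int (ip a th))"
  by (simp add: d_def lbr_EE_Hv)

lemma hc_cent: "hc i \<in> cent"
proof -
  have "d (hc i) = single (Eb th) (- (3 * of_int (ip (axis i 1) th)))"
    by (simp add: hc_def d_linear d_Hv algebra_simps flip: single_add single_diff)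
  then show ?thesis using hc_supported Hb_gr three_eq_0 by (auto simp: cent_def)
qed

lemma lookup_hc: "lookup (hc i) (Hb (nd j)) = (if nd j = i then 1 else 0)"
  by (simp add: hc_def lookup_add) (auto simp: axis_def)

lemma lbr_Hb_Hb:
  assumes "x \<in> supported (range Hb)" "y \<in> supported (range Hb)"
  shows "lbr x y = 0"
proof -
  have "lbr x y \<in> supported {}"
    unfolding lbr_def by (rule bext_supported[OF assms]) (auto simp: supported_iff)
  then show ?thesis by (simp add: supported_def)
qed

text \<open>The \<open>hc (nd j)\<close> account for all coordinates away from \<open>node\<close>.
  The remainder is c times the basis element at \<open>node\<close>, which \<open>d\<close> sends to
  -2c E_th, so c = 0.\<close>

lemma cent_Hb_expand:
  assumes "v \<in> supported (range Hb)" "d v = 0"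
  shows "v = (\<Sum>j\<in>UNIV. pscale (lookup v (Hb (nd j))) (hc (nd j)))"
proof -
  let ?w = "\<Sum>j\<in>UNIV. pscale (lookup v (Hb (nd j))) (hc (nd j))"
  let ?u = "v - ?w"
  have u: "?u \<in> supported (range Hb)"
    by (intro pm.subspace_diff pm.subspace_sum pm.subspace_scale subspace_supported hc_supported assms)
  have zero: "lookup ?u (Hb (nd j)) = 0" for j
  proof -
    have "lookup ?w (Hb (nd j)) = (\<Sum>k\<in>UNIV. if k = j then lookup v (Hb (nd j)) else 0)"
      unfolding lookup_sum by (intro sum.cong) (use inj_nd in \<open>auto simp: lookup_hc inj_eq\<close>)
    then show ?thesis by (simp add: lookup_minus)
  qed
  define c where "c = lookup ?u (Hb node)"
  have u_eq: "?u = single (Hb node) c"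
  proof (rule poly_mapping_eqI)
    fix x
    show "lookup ?u x = lookup (single (Hb node) c) x"
    proof (cases x)
      case (Hb i)
      then show ?thesis using zero
        by (cases i rule: node_cases) (simp_all add: lookup_single when_def c_def)
    next
      case (Eb a)
      then have "lookup ?u x = 0" using u unfolding supported_iff by blast
      then show ?thesis by (simp add: Eb lookup_single when_def)
    qed
  qed
  have "d ?u = 0" using assms(2) hc_cent by (simp add: d_linear cent_d)
  then have "d (single (Hb node) c) = 0" by (simp only: u_eq)
  moreover have "d (single (Hb node) c) = single (Eb th) (- (c * 2))"
    by (simp add: d_def th_def[symmetric])
  ultimately have "lookup (single (Eb th) (- (c * 2))) (Eb th) = 0" by simp
  then have "c = 0" by (simp add: two_eq)
  then have "?u = 0" by (simp only: u_eq single_zero)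
  then show ?thesis by simp
qed

definition mwt :: "'n lidx \<Rightarrow> int ^ 'm" where
  "mwt x = (case x of Hb i \<Rightarrow> 0 | Eb a \<Rightarrow> pwt a)"

lemma mwt_simps [simp]: "mwt (Hb i) = 0" "mwt (Eb a) = pwt a"
  by (simp_all add: mwt_def)

definition rweight :: "int ^ 'm \<Rightarrow> ('n lidx \<Rightarrow>\<^sub>0 'k) set" where
  "rweight \<beta> = rcarrier \<inter> gspace {x. mwt x = \<beta>}"

lemma comp_mwt: "x \<in> gspace {x. mwt x = \<beta>} \<Longrightarrow> comp k x \<in> gspace {x. mwt x = \<beta>}"
  by (auto simp: gspace_def supported_iff comp_def)

lemma lbr_mwt: "x \<in> gspace {x. mwt x = \<beta>} \<Longrightarrow> y \<in> gspace {x. mwt x = \<gamma>} \<Longrightarrow>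
    lbr x y \<in> gspace {x. mwt x = \<beta> + \<gamma>}"
  by (intro lbr_gspace) (simp_all add: pwt_simps)

lemma d_mwt: "x \<in> gspace {x. mwt x = \<beta>} \<Longrightarrow> d x \<in> gspace {x. mwt x = \<beta>}"
  using lbr_mwt[of "EE th" 0 x \<beta>] by (simp add: d_def pwt_simps)

lemma rbr_rweight:
  assumes "v \<in> rweight \<beta>" "w \<in> rweight \<gamma>"
  shows "rbr v w \<in> rweight (\<beta> + \<gamma>)"
proof -
  have "rbr v w \<in> gspace {x. mwt x = \<beta> + \<gamma>}"
    unfolding rbr_def qb_def using assms
    by (intro pm.subspace_add pm.subspace_diff gspace_subspace lbr_mwt comp_mwt d_mwt)
      (simp_all add: rweight_def)
  then show ?thesis using assms rbr_rcarrier by (simp add: rweight_def)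
qed

lemma EE_rweight:
  assumes "root a" "ip th a \<in> {0, - 1}"
  shows "single (Eb a) c \<in> rweight (pwt a)"
proof -
  have "single (Eb a) c = pscale c (EE a)" by simp
  also have "EE a \<in> rcarrier"
    using assms EE_cent[OF assms(1)] EE_gr[OF assms(1)] cent_rcarrier odd_rcarrier by blast
  then have "pscale c (EE a) \<in> rcarrier" by (rule pm.subspace_scale[OF rcarrier_subspace])
  finally show ?thesis using assms(1) by (simp add: rweight_def)
qed

lemma gspace_support: "x \<in> gspace S \<Longrightarrow> lookup x i \<noteq> 0 \<Longrightarrow> i \<in> S \<and> i \<in> bidx"
  by (auto simp: gspace_def supported_def in_keys_iff)

lemma rcarrier_support:
  assumes "v \<in> rcarrier" "lookup v (Eb a) \<noteq> 0"
  shows "root a \<and> ip th a \<in> {0, - 1}"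
proof -
  obtain x y where "x \<in> gr 0" "y \<in> gr (- 1)" "v = x + y"
    using assms(1) cent_gr unfolding rcarrier_iff by blast
  then show ?thesis using assms(2) gspace_support[of x "{x. ldeg x = 0}" "Eb a"]
      gspace_support[of y "{x. ldeg x = - 1}" "Eb a"]
    by (cases "lookup x (Eb a) = 0") (auto simp: lookup_add gr_def)
qed

text \<open>No root of degree 0 or -1 projects to 0, by \<open>pwt_nonzero\<close>, so weight 0 is
  left with Cartan elements.\<close>

lemma rweight_0: "rweight 0 = {v \<in> supported (range Hb). d v = 0}"
proof (intro equalityI subsetI)
  fix v assume v: "v \<in> rweight 0"
  have Hb: "v \<in> supported (range Hb)"
  proof (unfold supported_iff, intro allI impI)
    fix x :: "'n lidx" assume "x \<notin> range Hb"
    then obtain a where a: "x = Eb a" by (cases x) auto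
    show "lookup v x = 0"
    proof (rule ccontr)
      assume nz: "lookup v x \<noteq> 0"
      then have "pwt a = 0" using v gspace_support[of v "{x. mwt x = 0}" "Eb a"] by (auto simp: a rweight_def)
      moreover have "root a \<and> ip th a \<in> {0, - 1}"
        using v nz by (intro rcarrier_support[of v]) (auto simp: rweight_def a)
      ultimately show False using pwt_nonzero by blast
    qed
  qed
  then have "v = comp 0 v" using comp_gr[of v 0 0] Hb_gr by auto
  then have "v \<in> cent" using v comp_rcarrier(1)[of v] by (simp add: rweight_def)
  then show "v \<in> {v \<in> supported (range Hb). d v = 0}" using Hb by (simp add: cent_d)
next
  fix v assume v: "v \<in> {v \<in> supported (range Hb). d v = 0}"
  then have "v \<in> cent" using Hb_gr by (auto simp: cent_def)
  then have "v \<in> rcarrier" using cent_rcarrier by blast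
  moreover have "v \<in> gspace {x. mwt x = 0}"
  proof -
    have "range Hb \<subseteq> {x. mwt x = 0} \<inter> bidx" by auto
    then show ?thesis using v unfolding gspace_def supported_def by blast
  qed
  ultimately show "v \<in> rweight 0" by (simp add: rweight_def)
qed

lemma rweight_single:
  assumes v: "v \<in> rweight \<beta>" "v \<noteq> 0" "\<beta> \<noteq> 0"
  obtains a c where "root a" "ip th a \<in> {0, - 1}" "pwt a = \<beta>" "v = single (Eb a) c" "c \<noteq> 0"
proof -
  have supp: "\<exists>a. x = Eb a \<and> root a \<and> ip th a \<in> {0, - 1} \<and> pwt a = \<beta>" if "lookup v x \<noteq> 0" for x
  proof -
    have x: "mwt x = \<beta>" using v(1) gspace_support[OF _ that] by (auto simp: rweight_def)
    then obtain a where a: "x = Eb a" using v(3) by (cases x) auto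
    then show ?thesis using rcarrier_support[of v a] that x v(1) by (auto simp: rweight_def)
  qed
  obtain x where x: "lookup v x \<noteq> 0" using v(2) by (metis lookup_zero poly_mapping_eqI)
  then obtain a where a: "x = Eb a" "root a" "ip th a \<in> {0, - 1}" "pwt a = \<beta>" using supp by blast
  have "v = single (Eb a) (lookup v (Eb a))"
  proof (rule poly_mapping_eqI)
    fix y
    show "lookup v y = lookup (single (Eb a) (lookup v (Eb a))) y"
    proof (cases "lookup v y = 0")
      case False
      then obtain b where "y = Eb b" "root b" "ip th b \<in> {0, - 1}" "pwt b = \<beta>" using supp by blast
      moreover from this have "b = a" using root_pwt_inj a by blast
      ultimately show ?thesis by simp
    qed (use x a in \<open>auto simp: lookup_single when_def\<close>)
  qed
  then show thesis using that a x by blast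
qed

text \<open>For an even root the partner is its negative. For an odd root a it is - a - th, the odd
  root of opposite projected weight; the odd bracket is up to sign \<open>Hv\<close> of 2a + th,
  where \<open>B\<close> takes the value 3, so it is nonzero modulo 3.\<close>

lemma rweight_nondegenerate:
  assumes v: "v \<in> rweight \<beta>" "v \<noteq> 0" "\<beta> \<noteq> 0"
  shows "\<exists>z\<in>rweight (- \<beta>). rbr z v \<noteq> 0"
proof -
  obtain a c where a: "root a" "ip th a \<in> {0, - 1}" "pwt a = \<beta>" "v = single (Eb a) c" "c \<noteq> 0"
    using rweight_single[OF v] .
  have v': "v = pscale c (EE a)" by (simp add: a)
  show ?thesis
  proof (cases "ip th a = 0")
    case True
    have "rbr (EE (- a)) (EE a) = Hv a"
      using a(1) True by (subst rbr_simps(1)) (auto simp: EE_gr ip_simps ip_root_self Hv_uminus)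
    moreover have "Hv a \<noteq> (0 :: 'n lidx \<Rightarrow>\<^sub>0 'k)"
      using a(1) by (intro Hv_nonzero char3) (simp add: root_def)
    ultimately have "rbr (EE (- a)) v \<noteq> 0" using a(5) by (simp add: v' r.scale_right del: pscale_single)
    moreover have "EE (- a) \<in> rweight (- \<beta>)"
      using EE_rweight[of "- a" 1] a True by (simp add: ip_simps pwt_simps)
    ultimately show ?thesis by blast
  next
    case False
    then have t: "ip th a = - 1" "ip a th = - 1" using a(2) ip_commute[of a th] by auto
    let ?z = "- a - th"
    have ra: "root (th + a)" "root (a + th)" using a(1) t by (simp_all add: root_add_iff)
    then have z: "root ?z" using root_uminus[of "a + th"] by simp
    have zt: "ip th ?z = - 1" using t by (simp add: ip_simps)
    have ez: "eps th ?z = - (eps th a :: 'k)"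
      using eps_add(1)[of th "- a" "- th", where 'k = 'k] by (simp add: eps_self)
    have "d (EE ?z) = single (Eb (- a)) (- eps th a)"
      using z zt by (simp add: d_EE ez)
    moreover have "d (EE a) = single (Eb (th + a)) (eps th a)" using a(1) t by (simp add: d_EE)
    moreover have "ip ?z (th + a) = - 2" using a(1) t by (simp add: ip_simps ip_root_self)
    ultimately have "qb (EE ?z) (EE a) = pscale (- eps th a) (Hv a) + pscale (eps th a) (Hv ?z)"
      using a(1) z ra by (simp add: qb_def ip_simps ip_root_self Hv_uminus)
    also have "\<dots> = pscale (- eps th a) (Hv (a - ?z))"
    proof -
      have "Hv (x - y) = (Hv x - Hv y :: 'n lidx \<Rightarrow>\<^sub>0 'k)" for x y using Hv_add[of x "- y"] by (simp add: Hv_uminus)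
      then show ?thesis by (simp only:) (simp add: pm.scale_right_diff_distrib)
    qed
    finally have eq: "rbr (EE ?z) (EE a) = pscale (- eps th a) (Hv (a - ?z))"
      using a(1) t z zt by (subst rbr_simps(4)) (simp_all add: EE_gr)
    have "B (a - ?z) (a - ?z) = 3"
      using a(1) z t by (simp only: quad_diff) (simp add: root_th[unfolded root_def] root_def ip_simps ip_root_self[OF a(1)])
    then have "Hv (a - ?z) \<noteq> (0 :: 'n lidx \<Rightarrow>\<^sub>0 'k)" by (intro Hv_nonzero char3) simp
    then have "rbr (EE ?z) (EE a) \<noteq> 0" unfolding eq by simp
    then have "rbr (EE ?z) v \<noteq> 0" using a(5) by (simp add: v' r.scale_right del: pscale_single)
    moreover have "EE ?z \<in> rweight (- \<beta>)"
      using EE_rweight[OF z, of 1] zt a(3) pwt_simps(1)[of "- a" "- th"] by (simp add: pwt_simps)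
    ultimately show ?thesis by blast
  qed
qed

end

section \<open>Chevalley generators of the reduced superalgebra\<close>

context reduction_nodes
begin

definition hmap :: "('m \<Rightarrow> 'k) \<Rightarrow> ('n lidx \<Rightarrow>\<^sub>0 'k)" where
  "hmap c = (\<Sum>j\<in>UNIV. pscale (c j) (hc (nd j)))"

text \<open>For the odd node the opposite generator sits at \<open>- al j0 - th\<close>, which has
  degree -1; the sign \<open>eps th (al j0)\<close> normalises its bracket with
  \<open>EE (al j0)\<close> to \<open>hc (nd j0)\<close>. For the even nodes the minus sign
  compensates [E_a, E_-a] = - H_a.\<close>

definition rf :: "'m \<Rightarrow> ('n lidx \<Rightarrow>\<^sub>0 'k)" where
  "rf j = (if j = j0 then single (Eb (- al j0 - th)) (eps th (al j0)) else - EE (- al j))"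

lemma hmap_supported: "hmap c \<in> supported (range Hb)"
  unfolding hmap_def by (intro pm.subspace_sum pm.subspace_scale subspace_supported hc_supported)

lemma hmap_cent: "hmap c \<in> cent"
  unfolding hmap_def by (intro pm.subspace_sum pm.subspace_scale cent_subspace hc_cent)

lemma lookup_hmap: "lookup (hmap c) (Hb (nd j)) = c j"
proof -
  have "lookup (hmap c) (Hb (nd j)) = (\<Sum>k\<in>UNIV. if k = j then c j else 0)"
    unfolding hmap_def lookup_sum
    by (intro sum.cong) (auto simp: lookup_hc dest!: injD[OF inj_nd])
  then show ?thesis by simp
qed

lemma sum_single: "(\<Sum>j\<in>S. single i (g j)) = single i (\<Sum>j\<in>S. g j)"
  by (induction S rule: infinite_finite_induct) (simp_all add: single_add)

lemma rbr_hmap_EE: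
  assumes "root a" "ip th a \<in> {0, - 1}"
  shows "rbr (hmap c) (EE a) =
    single (Eb a) (\<Sum>j\<in>UNIV. c j * of_int (ip (al j) a + ip (al j) th * ip th a))"
proof -
  have "hmap c \<in> gr 0" by (intro cent_gr hmap_cent)
  then have "rbr (hmap c) (EE a) = lbr (hmap c) (EE a)"
    using assms EE_gr[OF assms(1)] rbr_simps(1,2) by blast
  also have "\<dots> = (\<Sum>j\<in>UNIV. single (Eb a) (c j * of_int (ip (al j) a + ip (al j) th * ip th a)))"
    using assms(1) by (simp add: hmap_def l.sum_left l.scale_left hc_EE)
  finally show ?thesis by (simp only: sum_single)
qed

lemma al_th: "ip (al j) th = (if j = j0 then - 1 else 0)"
  using adjacent[of j] ip_commute[of th "al j"] by simp

lemma al_deg: "ip th (al j) \<in> {0, - 1}" by (simp add: adjacent)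

lemma ph_root: "root (- al j0 - th)"
proof -
  have "root (al j0 + th)" by (simp add: root_add_iff al_th)
  then show ?thesis using root_uminus[of "al j0 + th"] by simp
qed

lemma ph_deg: "ip th (- al j0 - th) = - 1" by (simp add: ip_simps adjacent)

text \<open>The two terms of the odd bracket give -2 H_al - H_th. With -2 = 1 this is H_al - H_th,
  which is \<open>hc (nd j0)\<close> because \<open>al j0\<close> and \<open>th\<close> have inner
  product -1.\<close>

lemma rbr_e_f_same: "rbr (EE (al j0)) (rf j0) = hc (nd j0)"
proof -
  define s where "s = (eps th (al j0) :: 'k)"
  let ?ph = "- al j0 - th"
  have ss: "s * s = 1" by (simp add: s_def)
  have sum: "root (th + al j0)" by (simp add: root_add_iff adjacent)
  have "eps th ?ph = (eps th (- al j0) * eps th (- th) :: 'k)"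
    by (simp only: diff_conv_add_uminus eps_add)
  then have eph: "eps th ?ph = - s" by (simp add: s_def eps_self)
  have "th + ?ph = - al j0" by simp
  then have "d (EE ?ph) = single (Eb (- al j0)) (- s)"
    using d_EE[OF ph_root] ph_deg by (simp add: eph)
  moreover have "d (EE (al j0)) = single (Eb (th + al j0)) s" by (simp add: d_EE adjacent s_def)
  moreover have "ip (th + al j0) ?ph = - 2" by (simp add: ip_simps adjacent al_th ip_root_self)
  ultimately have "qb (EE (al j0)) (EE ?ph) = - pscale s (Hv (th + al j0)) - pscale s (Hv (al j0))"
    using sum ph_root by (simp add: qb_def ip_simps ip_root_self)
  then have "rbr (EE (al j0)) (EE ?ph) = - pscale s (Hv (th + al j0)) - pscale s (Hv (al j0))"
    using ph_root ph_deg by (subst rbr_simps(4)) (simp_all add: EE_gr adjacent)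
  then have "rbr (EE (al j0)) (pscale s (EE ?ph)) =
      - pscale (s * s) (Hv (th + al j0)) - pscale (s * s) (Hv (al j0))"
    by (simp only: r.scale_right pm.scale_right_diff_distrib pm.scale_minus_right pm.scale_scale)
  then have "rbr (EE (al j0)) (rf j0) = - Hv (th + al j0) - Hv (al j0)"
    by (simp add: rf_def s_def[symmetric] ss)
  also have "\<dots> = - pscale 2 (Hv (al j0)) - Hv th"
  proof -
    have "pscale (1 + 1) v = v + v" for v :: "'n lidx \<Rightarrow>\<^sub>0 'k"
      by (simp only: pm.scale_left_distrib pm.scale_one)
    then show ?thesis by (simp add: Hv_add)
  qed
  finally show ?thesis unfolding two_eq by (simp add: hc_def al_th)
qed

lemma rbr_e_f:
  assumes off: "i \<noteq> j"
  shows "rbr (EE (al i)) (rf j) = 0"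
proof -
  have ij: "ip (al i) (al j) \<le> 0"
    using offdiag[of "nd i" "nd j"] injD[OF inj_nd] off by (auto simp: ip_axis)
  show ?thesis
  proof (cases "j = j0")
    case True
    then have "ip (al i) (- al j0 - th) \<ge> 0" "ip th (al i) = 0"
      using ij off by (simp_all add: ip_simps al_th adjacent)
    then have "rbr (EE (al i)) (EE (- al j0 - th)) = 0"
      using ph_root ph_deg by (subst rbr_simps(2)) (simp_all add: EE_gr)
    then have "rbr (EE (al i)) (pscale (eps th (al j0)) (EE (- al j0 - th))) = 0"
      by (simp only: r.scale_right pm.scale_zero_right)
    then show ?thesis using True by (simp add: rf_def)
  next
    case False
    then have j: "EE (- al j) \<in> gr 0" by (intro EE_gr) (simp_all add: ip_simps adjacent)
    have "rbr (EE (al i)) (EE (- al j)) = lbr (EE (al i)) (EE (- al j))"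
      using j EE_gr[OF root_axis refl, of "nd i" 1] rbr_simps(1)[OF _ j] rbr_simps(3)[OF _ j]
      by (simp add: adjacent split: if_splits)
    also have "\<dots> = 0" using ij by (simp add: ip_simps)
    finally show ?thesis using False by (simp add: rf_def r.uminus_right)
  qed
qed

lemma rbr_e_f_even:
  assumes "j \<noteq> j0"
  shows "rbr (EE (al j)) (rf j) = hc (nd j)"
proof -
  have "rbr (EE (al j)) (EE (- al j)) = - Hv (al j)"
    using assms by (subst rbr_simps(1)) (simp_all add: EE_gr ip_simps adjacent ip_root_self)
  then show ?thesis using assms by (simp add: rf_def r.uminus_right hc_def al_th)
qed

lemma rbr_hmap_rf:
  "rbr (hmap c) (rf j) = - pscale (\<Sum>i\<in>UNIV. c i * of_int (ip (al i) (al j) + ip (al i) th * ip th (al j))) (rf j)"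
proof (cases "j = j0")
  case True
  let ?ph = "- al j0 - th"
  \<comment> \<open>The integers on the two sides differ by 3 times \<open>ip (al i) th\<close>, so
    they agree modulo 3.\<close>
  have *: "(of_int (ip (al i) ?ph + ip (al i) th * ip th ?ph) :: 'k) =
      - of_int (ip (al i) (al j) + ip (al i) th * ip th (al j))" for i
    using True by (simp add: ip_simps adjacent al_th two_eq three_eq_0)
  have "rbr (hmap c) (EE ?ph) =
      pscale (- (\<Sum>i\<in>UNIV. c i * of_int (ip (al i) (al j) + ip (al i) th * ip th (al j)))) (EE ?ph)"
  proof -
    have "ip th ?ph \<in> {0, - 1}" by (simp add: ph_deg)
    from rbr_hmap_EE[OF ph_root this, of c] show ?thesis
      by (simp only: * mult_minus_right sum_negf pscale_single mult_1_right)
  qed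
  then have "rbr (hmap c) (pscale (eps th (al j0)) (EE ?ph)) =
      - pscale (\<Sum>i\<in>UNIV. c i * of_int (ip (al i) (al j) + ip (al i) th * ip th (al j)))
         (pscale (eps th (al j0)) (EE ?ph))"
    unfolding r.scale_right by (simp only: pm.scale_scale pm.scale_minus_left pm.scale_minus_right mult.commute)
  then show ?thesis using True by (simp add: rf_def)
next
  case False
  have "rbr (hmap c) (EE (- al j)) =
      single (Eb (- al j)) (- (\<Sum>i\<in>UNIV. c i * of_int (ip (al i) (al j) + ip (al i) th * ip th (al j))))"
    using rbr_hmap_EE[of "- al j" c] False by (simp add: ip_simps adjacent sum_negf)
  then show ?thesis using False by (simp add: rf_def r.uminus_right single_uminus)
qed

lemma rpart_e: "EE (al j) \<in> rpart (j = j0)"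
  using EE_cent[OF root_axis, of "nd j"] EE_gr[OF root_axis, of "nd j" "- 1"] adjacent[of j]
  by (cases "j = j0") (simp_all add: rpart_def)

lemma rpart_f: "rf j \<in> rpart (j = j0)"
proof (cases "j = j0")
  case True
  then show ?thesis using EE_gr[OF ph_root ph_deg] by (simp add: rpart_def rf_def)
next
  case False
  then have "EE (- al j) \<in> cent" by (intro EE_cent) (simp_all add: ip_simps adjacent)
  then show ?thesis using False pm.subspace_neg[OF cent_subspace] by (simp add: rpart_def rf_def)
qed

lemma rweight_subspace: "pm.subspace (rweight \<beta>)"
  unfolding rweight_def by (intro pm.subspace_inter rcarrier_subspace gspace_subspace)

lemma rweight_f: "rf j \<in> rweight (- axis j 1)"
proof (cases "j = j0")
  case True
  have "pwt (- al j0 - th) = - axis j0 1"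
    using pwt_simps(1)[of "- al j0" "- th"] by (simp add: pwt_simps)
  then show ?thesis using EE_rweight[OF ph_root, of "eps th (al j0)"] True ph_deg by (simp add: rf_def)
next
  case False
  then have "EE (- al j) \<in> rweight (- axis j 1)"
    using EE_rweight[of "- al j" 1] by (simp add: ip_simps adjacent pwt_simps)
  then show ?thesis using False pm.subspace_neg[OF rweight_subspace] by (simp add: rf_def)
qed

text \<open>Root vectors are reached by \<open>reduction_generated_roots\<close>. The Cartan part
  \<open>w\<close> of \<open>v\<close> is killed by \<open>d\<close>, because the degree 0 part of
  \<open>v\<close> is and so are root vectors of degree 0; hence \<open>w\<close> is some
  \<open>hmap c\<close>.\<close>

lemma rcarrier_generated:
  fixes T :: "('n lidx \<Rightarrow>\<^sub>0 'k) set"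
  assumes T: "pm.subspace T" and h: "\<And>c. hmap c \<in> T" and e: "\<And>j. EE (al j) \<in> T" and f: "\<And>j. rf j \<in> T"
    and closed: "\<And>v w. v \<in> T \<Longrightarrow> w \<in> T \<Longrightarrow> rbr v w \<in> T"
  shows "rcarrier \<subseteq> T"
proof
  have f': "EE (- al j) \<in> T" if "j \<noteq> j0" for j
    using pm.subspace_neg[OF T f[of j]] that by (simp add: rf_def)
  have f0: "EE (- al j0 - th) \<in> T"
    using pm.subspace_scale[OF T f[of j0], of "eps th (al j0)"] by (simp add: rf_def)
  have root_in: "single (Eb a) c \<in> T" if "root a" "ip th a \<in> {0, - 1}" for a c
    using pm.subspace_scale[OF T reduction_generated_roots[OF T e f' f0 closed that], of c] by simp
  fix v assume v: "v \<in> rcarrier"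
  have "v \<in> supported bidx"
    using v cent_gr gr_gspace pm.subspace_add[OF gspace_subspace, of _ UNIV]
    unfolding rcarrier_iff gspace_def by fastforce
  define w where "w = prj (range Hb) v"
  have "v - w \<in> T"
  proof -
    have "lext (\<lambda>i. single i 1) (v - w) \<in> T"
    proof (rule lext_in_subspace[OF T])
      fix i assume "i \<in> keys (v - w)"
      then have nz: "lookup (v - w) i \<noteq> 0" by (simp add: in_keys_iff)
      show "single i 1 \<in> T"
      proof (cases i)
        case (Hb k)
        then show ?thesis using nz by (simp add: w_def lookup_minus)
      next
        case (Eb a)
        then have "lookup v (Eb a) \<noteq> 0" using nz by (auto simp: w_def lookup_minus split: if_splits)
        then show ?thesis using rcarrier_support[OF v] root_in Eb by blast
      qed
    qed
    then show ?thesis by (simp only: lext_identity)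
  qed
  moreover have "w \<in> T"
  proof -
    have w: "w \<in> supported (range Hb)" by (simp add: w_def prj_supported)
    have "d (prj (- range Hb) (comp 0 v)) = 0"
    proof -
      have "d (lext (\<lambda>i. single i 1) (prj (- range Hb) (comp 0 v))) \<in> {0}"
      proof -
        have "lext (\<lambda>i. single i 1) (prj (- range Hb) (comp 0 v)) \<in> {x. d x = 0}"
        proof (rule lext_in_subspace)
          show "pm.subspace {x. d x = 0}" by (auto simp: pm.subspace_def d_linear)
          fix i assume "i \<in> keys (prj (- range Hb) (comp 0 v))"
          then have i: "i \<notin> range Hb" "ldeg i = 0" "lookup v i \<noteq> 0"
            by (auto simp: in_keys_iff comp_def split: if_splits)
          then obtain a where a: "i = Eb a" by (cases i) auto
          then have "root a" using i rcarrier_support[OF v] by blast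
          then show "single i 1 \<in> {x. d x = 0}" using i by (simp add: a d_EE)
        qed
        then show ?thesis by simp
      qed
      then show ?thesis by (simp add: lext_identity)
    qed
    moreover have "comp 0 v = w + prj (- range Hb) (comp 0 v)"
      by (rule poly_mapping_eqI) (auto simp: w_def comp_def lookup_add)
    moreover have "d (comp 0 v) = 0" using comp_rcarrier(1)[OF v] by (rule cent_d)
    ultimately have "d w = 0" by (metis d_linear(1) add.right_neutral)
    then have "w = hmap (\<lambda>j. lookup w (Hb (nd j)))"
      using cent_Hb_expand[OF w] by (simp add: hmap_def)
    then show ?thesis using h by metis
  qed
  ultimately show "v \<in> T" using pm.subspace_add[OF T, of "v - w" w] by simp
qed

lemma contragredient_model_reduction:
  fixes S :: "('k, 'u::ab_group_add, 'm) realization" and coord :: "'u \<Rightarrow> 'm \<Rightarrow> 'k"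
  assumes add: "\<And>x y i. coord (x + y) i = coord x i + coord y i"
    and scale: "\<And>c x i. coord (hscale S c x) i = c * coord x i"
    and inj: "inj coord" and surj: "surj coord"
    and coroot: "\<And>i j. coord (coroot S i) j = (if i = j then 1 else 0)"
    and root: "\<And>j x. simple_root S j x =
      (\<Sum>i\<in>UNIV. coord x i * of_int (ip (al i) (al j) + ip (al i) th * ip th (al j)))"
  shows "contragredient_model rbr (\<lambda>j. j = j0) S rcarrier rpart rweight
    (\<lambda>x. hmap (coord x)) (\<lambda>j. EE (al j)) rf"
proof (intro contragredient_model.intro contragredient_model_axioms.intro
    r.bilinear_bracket_axioms lie_superalgebra_reduction rcarrier_subspace rweight_subspace
    rweight_f rpart_e rpart_f rbr_rweight rweight_nondegenerate rcarrier_generated)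
  show "rweight 0 = range (\<lambda>x. hmap (coord x))"
  proof (intro equalityI subsetI)
    fix v assume "v \<in> rweight 0"
    then have "v = hmap (\<lambda>j. lookup v (Hb (nd j)))"
      unfolding rweight_0 hmap_def using cent_Hb_expand by blast
    moreover obtain x where "coord x = (\<lambda>j. lookup v (Hb (nd j)))" using surj by (metis surjD)
    ultimately have "v = hmap (coord x)" by simp
    then show "v \<in> range (\<lambda>x. hmap (coord x))" by blast
  next
    fix v assume "v \<in> range (\<lambda>x. hmap (coord x))"
    then show "v \<in> rweight 0" using hmap_supported hmap_cent cent_d by (auto simp: rweight_0)
  qed
  show "inj (\<lambda>x. hmap (coord x))"
  proof (rule injI)
    fix x y assume "hmap (coord x) = hmap (coord y)"
    then have "coord x j = coord y j" for j using lookup_hmap by metis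
    then show "x = y" using inj by (metis injD ext)
  qed
  fix x y c i j
  show "hmap (coord (x + y)) = hmap (coord x) + hmap (coord y)"
    by (simp add: hmap_def add pm.scale_left_distrib sum.distrib)
  show "hmap (coord (hscale S c x)) = pscale c (hmap (coord x))"
    by (simp add: hmap_def scale pm.scale_sum_right)
  show "EE (al i) \<in> rweight (axis i 1)"
    using EE_rweight[OF root_axis al_deg, of i 1] by (simp add: pwt_simps)
  show "hmap (coord x) \<in> rpart False" by (simp add: rpart_def hmap_cent)
  have "hmap (coord (coroot S i)) = hc (nd i)"
  proof -
    have "hmap (coord (coroot S i)) = (\<Sum>j\<in>UNIV. if j = i then hc (nd i) else 0)"
      unfolding hmap_def by (intro sum.cong) (auto simp: coroot)
    then show ?thesis by simp
  qed
  then show "rbr (EE (al i)) (rf j) = (if i = j then hmap (coord (coroot S i)) else 0)"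
    using rbr_e_f[of i j] rbr_e_f_even[of i] rbr_e_f_same by (cases "i = j0") auto
  show "rbr (hmap (coord x)) (EE (al j)) = pscale (simple_root S j x) (EE (al j))"
    using rbr_hmap_EE[OF root_axis al_deg, of "coord x" j] by (simp add: root)
  show "rbr (hmap (coord x)) (rf j) = - pscale (simple_root S j x) (rf j)"
    by (simp only: rbr_hmap_rf root)
  show "rbr (hmap (coord x)) (hmap (coord y)) = 0"
    using rbr_simps(1)[OF cent_gr[OF hmap_cent] cent_gr[OF hmap_cent]]
      lbr_Hb_Hb[OF hmap_supported hmap_supported] by simp
next
  show "rweight \<beta> \<subseteq> rcarrier" for \<beta> by (auto simp: rweight_def)
next
  fix B :: "(int ^ 'm) set" and u :: "int ^ 'm \<Rightarrow> 'n lidx \<Rightarrow>\<^sub>0 'k" and \<beta>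
  assume "finite B" "\<And>\<beta>. \<beta> \<in> B \<Longrightarrow> u \<beta> \<in> rweight \<beta>" "sum u B = 0" "\<beta> \<in> B"
  then show "u \<beta> = 0"
    by (intro supported_weight_indep[of B u mwt \<beta>]) (auto simp: rweight_def gspace_def supported_iff)
next
  fix T :: "('n lidx \<Rightarrow>\<^sub>0 'k) set" and c
  assume "\<And>x. hmap (coord x) \<in> T"
  moreover obtain x where "coord x = c" using surj by (metis surjD)
  ultimately show "hmap c \<in> T" by metis
qed

end

section \<open>Negligible morphisms out of Jordan blocks\<close>

definition lfun :: "('k::field, 'a, 'm) module_scheme \<Rightarrow> ('a \<Rightarrow> 'k) \<Rightarrow> bool" where
  "lfun V g \<longleftrightarrow> (\<forall>x\<in>carrier V. \<forall>y\<in>carrier V. g (x \<oplus>\<^bsub>V\<^esub> y) = g x + g y) \<and>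
     (\<forall>c. \<forall>x\<in>carrier V. g (c \<odot>\<^bsub>V\<^esub> x) = c * g x)"

lemma jordan_simps [simp]:
  "carrier (jordan n) = {v. \<forall>i\<ge>n. v i = 0}" "\<zero>\<^bsub>jordan n\<^esub> = (\<lambda>_. 0)"
  "v \<oplus>\<^bsub>jordan n\<^esub> w = (\<lambda>i. v i + w i)" "c \<odot>\<^bsub>jordan n\<^esub> v = (\<lambda>i. c * v i)"
  by (simp_all add: jordan_def)

lemma jvec_simps [simp]: "jvec i i = 1" "i \<noteq> j \<Longrightarrow> jvec i j = 0"
  by (simp_all add: jvec_def)

lemma linear_mapsI:
  assumes "\<And>x. x \<in> carrier V \<Longrightarrow> u x \<in> carrier W" "u \<in> extensional (carrier V)"
    "\<And>x y. x \<in> carrier V \<Longrightarrow> y \<in> carrier V \<Longrightarrow> u (x \<oplus>\<^bsub>V\<^esub> y) = u x \<oplus>\<^bsub>W\<^esub> u y"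
    "\<And>c x. x \<in> carrier V \<Longrightarrow> u (c \<odot>\<^bsub>V\<^esub> x) = c \<odot>\<^bsub>W\<^esub> u x"
  shows "u \<in> linear_maps V W"
  using assms by (simp add: linear_maps_def PiE_def)

lemma linear_mapsD:
  assumes "u \<in> linear_maps V W"
  shows "x \<in> carrier V \<Longrightarrow> u x \<in> carrier W" "x \<notin> carrier V \<Longrightarrow> u x = undefined"
    "x \<in> carrier V \<Longrightarrow> y \<in> carrier V \<Longrightarrow> u (x \<oplus>\<^bsub>V\<^esub> y) = u x \<oplus>\<^bsub>W\<^esub> u y"
    "x \<in> carrier V \<Longrightarrow> u (c \<odot>\<^bsub>V\<^esub> x) = c \<odot>\<^bsub>W\<^esub> u x"
proof -
  have P: "u \<in> carrier V \<rightarrow>\<^sub>E carrier W" using assms unfolding linear_maps_def by blast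
  show "x \<in> carrier V \<Longrightarrow> u x \<in> carrier W" by (rule PiE_mem[OF P])
  show "x \<notin> carrier V \<Longrightarrow> u x = undefined" by (rule PiE_arb[OF P])
  show "x \<in> carrier V \<Longrightarrow> y \<in> carrier V \<Longrightarrow> u (x \<oplus>\<^bsub>V\<^esub> y) = u x \<oplus>\<^bsub>W\<^esub> u y"
    "x \<in> carrier V \<Longrightarrow> u (c \<odot>\<^bsub>V\<^esub> x) = c \<odot>\<^bsub>W\<^esub> u x"
    using assms unfolding linear_maps_def by blast+
qed

lemma rep_homD:
  assumes "u \<in> rep_hom V t W s"
  shows "u \<in> linear_maps V W" "x \<in> carrier V \<Longrightarrow> u (t x) = s (u x)"
  using assms unfolding rep_hom_def by blast+

lemma lfun_coordinate:
  assumes "v \<in> linear_maps V (jordan n)"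
  shows "lfun V (\<lambda>y. v y i)"
  unfolding lfun_def using linear_mapsD(3,4)[OF assms] by simp

locale rep_module = Module.module "scalars :: 'k ring" V
  for V :: "('k::field, 'a, 'm) module_scheme" +
  fixes t :: "'a \<Rightarrow> 'a"
  assumes t_closed: "x \<in> carrier V \<Longrightarrow> t x \<in> carrier V"
    and t_add: "\<lbrakk>x \<in> carrier V; y \<in> carrier V\<rbrakk> \<Longrightarrow> t (x \<oplus>\<^bsub>V\<^esub> y) = t x \<oplus>\<^bsub>V\<^esub> t y"
    and t_smult: "x \<in> carrier V \<Longrightarrow> t (c \<odot>\<^bsub>V\<^esub> x) = c \<odot>\<^bsub>V\<^esub> t x"
    and fin: "finite_dim V"
begin

lemma smult_0 [simp]: "x \<in> carrier V \<Longrightarrow> 0 \<odot>\<^bsub>V\<^esub> x = \<zero>\<^bsub>V\<^esub>"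
  using smult_l_null[of x] by simp

lemma smult_zero [simp]: "c \<odot>\<^bsub>V\<^esub> \<zero>\<^bsub>V\<^esub> = \<zero>\<^bsub>V\<^esub>"
  using smult_r_null[of c] by simp

lemma lfun_zero: "lfun V g \<Longrightarrow> g \<zero>\<^bsub>V\<^esub> = 0"
proof -
  assume g: "lfun V g"
  have "g (0 \<odot>\<^bsub>V\<^esub> \<zero>\<^bsub>V\<^esub>) = 0 * g \<zero>\<^bsub>V\<^esub>" using g unfolding lfun_def by blast
  then show ?thesis by simp
qed

lemma lfun_finsum:
  assumes "lfun V g" "finite A" "\<And>i. i \<in> A \<Longrightarrow> f i \<in> carrier V"
  shows "g (finsum V f A) = (\<Sum>i\<in>A. g (f i))"
  using assms(2,3)
proof (induction A rule: finite_induct)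
  case empty
  then show ?case by (simp add: lfun_zero[OF assms(1)])
next
  case (insert a A)
  then have f: "f \<in> A \<rightarrow> carrier V" "f a \<in> carrier V" by auto
  then have "g (f a \<oplus>\<^bsub>V\<^esub> finsum V f A) = g (f a) + g (finsum V f A)"
    using assms(1) M.finsum_closed[OF f(1)] unfolding lfun_def by blast
  then show ?case using insert f by (simp add: M.finsum_insert)
qed

lemma lfun_expand:
  assumes "dual_bases V n b \<xi>" "lfun V g" "x \<in> carrier V"
  shows "g x = (\<Sum>i<n. \<xi> i x * g (b i))"
proof -
  have b: "b i \<in> carrier V" if "i < n" for i using assms(1) that by (simp add: dual_bases_def)
  have x: "x = finsum V (\<lambda>i. \<xi> i x \<odot>\<^bsub>V\<^esub> b i) {..<n}" using assms(1,3) unfolding dual_bases_def by blast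
  have "g x = g (finsum V (\<lambda>i. \<xi> i x \<odot>\<^bsub>V\<^esub> b i) {..<n})" by (rule arg_cong[OF x])
  also have "\<dots> = (\<Sum>i<n. g (\<xi> i x \<odot>\<^bsub>V\<^esub> b i))"
    using b by (intro lfun_finsum assms(2)) auto
  also have "\<dots> = (\<Sum>i<n. \<xi> i x * g (b i))"
    using b assms(2) by (intro sum.cong) (auto simp: lfun_def)
  finally show ?thesis .
qed

lemma dual_bases_lfun: "dual_bases V n b \<xi> \<Longrightarrow> i < n \<Longrightarrow> lfun V (\<xi> i)"
  by (simp add: dual_bases_def lfun_def)

text \<open>Expanding one basis in the other and swapping the sums shows independence of the dual
  bases, so that the definite description in \<open>lin_trace\<close> denotes.\<close>

lemma lin_trace_eq:
  assumes n: "dual_bases V n b \<xi>"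
    and u: "\<And>x. x \<in> carrier V \<Longrightarrow> u x \<in> carrier V"
      "\<And>x y. x \<in> carrier V \<Longrightarrow> y \<in> carrier V \<Longrightarrow> u (x \<oplus>\<^bsub>V\<^esub> y) = u x \<oplus>\<^bsub>V\<^esub> u y"
      "\<And>c x. x \<in> carrier V \<Longrightarrow> u (c \<odot>\<^bsub>V\<^esub> x) = c \<odot>\<^bsub>V\<^esub> u x"
  shows "lin_trace V u = (\<Sum>i<n. \<xi> i (u (b i)))"
proof -
  have unique: "(\<Sum>i<m. \<eta> i (u (c i))) = (\<Sum>i<n. \<xi> i (u (b i)))" if m: "dual_bases V m c \<eta>" for m c \<eta>
  proof -
    have b: "b i \<in> carrier V" if "i < n" for i using n that by (simp add: dual_bases_def)
    have c: "c j \<in> carrier V" if "j < m" for j using m that by (simp add: dual_bases_def)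
    have xu: "lfun V (\<lambda>x. \<xi> i (u x))" if "i < n" for i
      using dual_bases_lfun[OF n that] u by (simp add: lfun_def)
    have "(\<Sum>i<n. \<xi> i (u (b i))) = (\<Sum>i<n. \<Sum>j<m. \<eta> j (b i) * \<xi> i (u (c j)))"
      by (intro sum.cong refl lfun_expand[OF m xu]) (auto simp: b)
    also have "\<dots> = (\<Sum>j<m. \<Sum>i<n. \<xi> i (u (c j)) * \<eta> j (b i))"
      by (subst sum.swap) (simp add: mult.commute)
    also have "\<dots> = (\<Sum>j<m. \<eta> j (u (c j)))"
      by (intro sum.cong refl lfun_expand[OF n, symmetric] dual_bases_lfun[OF m]) (auto simp: c u)
    finally show ?thesis by simp
  qed
  show ?thesis unfolding lin_trace_def
    by (rule the_equality) (use n unique in blast)+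
qed

text \<open>Endomorphisms that factor through J_1 or J_2 have rank at most 2, and this formula for
  their trace decides negligibility.\<close>

lemma lin_trace_two:
  assumes w: "\<And>y. y \<in> carrier V \<Longrightarrow> w y = g y \<odot>\<^bsub>V\<^esub> a \<oplus>\<^bsub>V\<^esub> h y \<odot>\<^bsub>V\<^esub> a'"
    and gh: "lfun V g" "lfun V h" and a: "a \<in> carrier V" "a' \<in> carrier V"
  shows "lin_trace V w = g a + h a'"
proof -
  obtain n b \<xi> where n: "dual_bases V n b \<xi>" using fin unfolding finite_dim_def by blast
  have b: "b i \<in> carrier V" if "i < n" for i using n that by (simp add: dual_bases_def)
  have g: "g (x \<oplus>\<^bsub>V\<^esub> y) = g x + g y" "g (c \<odot>\<^bsub>V\<^esub> x) = c * g x"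
    "h (x \<oplus>\<^bsub>V\<^esub> y) = h x + h y" "h (c \<odot>\<^bsub>V\<^esub> x) = c * h x"
    if "x \<in> carrier V" "y \<in> carrier V" for c x y using gh that unfolding lfun_def by blast+
  have assoc: "(c * e) \<odot>\<^bsub>V\<^esub> x = c \<odot>\<^bsub>V\<^esub> (e \<odot>\<^bsub>V\<^esub> x)" if "x \<in> carrier V" for c e x
    using smult_assoc1[of c e x] that by simp
  have ldist: "(c + e) \<odot>\<^bsub>V\<^esub> x = c \<odot>\<^bsub>V\<^esub> x \<oplus>\<^bsub>V\<^esub> e \<odot>\<^bsub>V\<^esub> x" if "x \<in> carrier V" for c e x
    using smult_l_distr[of c e x] that by simp
  have rdist: "c \<odot>\<^bsub>V\<^esub> (x \<oplus>\<^bsub>V\<^esub> y) = c \<odot>\<^bsub>V\<^esub> x \<oplus>\<^bsub>V\<^esub> c \<odot>\<^bsub>V\<^esub> y" if "x \<in> carrier V" "y \<in> carrier V" for c x y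
    using smult_r_distr[of c x y] that by simp
  have "lin_trace V w = (\<Sum>i<n. \<xi> i (w (b i)))"
  proof (rule lin_trace_eq[OF n])
    fix x y assume "x \<in> carrier V" "y \<in> carrier V"
    then show "w (x \<oplus>\<^bsub>V\<^esub> y) = w x \<oplus>\<^bsub>V\<^esub> w y"
      using a by (simp add: w g ldist M.a_ac)
  qed (use a in \<open>simp_all add: w g(2,4) assoc rdist\<close>)
  also have "\<dots> = (\<Sum>i<n. \<xi> i a * g (b i)) + (\<Sum>i<n. \<xi> i a' * h (b i))"
    unfolding sum.distrib[symmetric]
  proof (intro sum.cong refl)
    fix i assume "i \<in> {..<n}"
    then have i: "i < n" by simp
    then show "\<xi> i (w (b i)) = \<xi> i a * g (b i) + \<xi> i a' * h (b i)"
      using dual_bases_lfun[OF n i] b[OF i] a by (simp add: w lfun_def mult.commute)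
  qed
  finally show ?thesis using lfun_expand[OF n gh(1) a(1)] lfun_expand[OF n gh(2) a(2)] by simp
qed

text \<open>A morphism from J_1 or J_2 is determined by the image of \<open>jvec 0\<close>, a vector
  killed by \<open>t\<close> or by its square; \<open>hom1\<close> and \<open>hom2\<close> recover
  the morphism from that vector.\<close>

definition hom1 :: "'a \<Rightarrow> (nat \<Rightarrow> 'k) \<Rightarrow> 'a" where
  "hom1 a = (\<lambda>v\<in>carrier (jordan 1). v 0 \<odot>\<^bsub>V\<^esub> a)"

definition hom2 :: "'a \<Rightarrow> (nat \<Rightarrow> 'k) \<Rightarrow> 'a" where
  "hom2 a = (\<lambda>v\<in>carrier (jordan 2). v 0 \<odot>\<^bsub>V\<^esub> a \<oplus>\<^bsub>V\<^esub> v 1 \<odot>\<^bsub>V\<^esub> t a)"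

abbreviation Hom1 where "Hom1 \<equiv> rep_hom (jordan 1) (jordan_shift 1) V t"
abbreviation Hom2 where "Hom2 \<equiv> rep_hom (jordan 2) (jordan_shift 2) V t"

lemma smult_dist:
  "x \<in> carrier V \<Longrightarrow> (c + e) \<odot>\<^bsub>V\<^esub> x = c \<odot>\<^bsub>V\<^esub> x \<oplus>\<^bsub>V\<^esub> e \<odot>\<^bsub>V\<^esub> x"
  "x \<in> carrier V \<Longrightarrow> y \<in> carrier V \<Longrightarrow> c \<odot>\<^bsub>V\<^esub> (x \<oplus>\<^bsub>V\<^esub> y) = c \<odot>\<^bsub>V\<^esub> x \<oplus>\<^bsub>V\<^esub> c \<odot>\<^bsub>V\<^esub> y"
  "x \<in> carrier V \<Longrightarrow> (c * e) \<odot>\<^bsub>V\<^esub> x = c \<odot>\<^bsub>V\<^esub> (e \<odot>\<^bsub>V\<^esub> x)"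
  "x \<in> carrier V \<Longrightarrow> 1 \<odot>\<^bsub>V\<^esub> x = x"
  using smult_l_distr[of c e x] smult_r_distr[of c x y] smult_assoc1[of c e x] smult_one[of x] by simp_all

lemma hom1_jvec: "a \<in> carrier V \<Longrightarrow> hom1 a (jvec 0) = a"
  by (simp add: hom1_def smult_dist)

lemma hom2_jvec: "a \<in> carrier V \<Longrightarrow> hom2 a (jvec 0) = a" "a \<in> carrier V \<Longrightarrow> hom2 a (jvec 1) = t a"
  by (simp_all add: hom2_def smult_dist t_closed)

lemma hom1_mem:
  assumes "a \<in> carrier V" "t a = \<zero>\<^bsub>V\<^esub>"
  shows "hom1 a \<in> Hom1"
  unfolding rep_hom_def mem_Collect_eq
proof (intro conjI linear_mapsI ballI)
  show "hom1 a \<in> extensional (carrier (jordan 1))" by (simp add: hom1_def)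
qed (use assms in \<open>simp_all add: hom1_def smult_dist t_smult jordan_shift_def\<close>)

lemma hom2_mem:
  assumes "a \<in> carrier V" "t (t a) = \<zero>\<^bsub>V\<^esub>"
  shows "hom2 a \<in> Hom2"
  unfolding rep_hom_def mem_Collect_eq
proof (intro conjI linear_mapsI ballI)
  show "hom2 a \<in> extensional (carrier (jordan 2))" by (simp add: hom2_def)
qed (use assms t_closed[OF assms(1)] in
    \<open>simp_all add: hom2_def smult_dist t_smult t_add jordan_shift_def M.a_ac\<close>)

lemma Hom1E:
  assumes "f \<in> Hom1"
  obtains a where "a \<in> carrier V" "t a = \<zero>\<^bsub>V\<^esub>" "f = hom1 a"
proof -
  have lin: "f \<in> linear_maps (jordan 1) V" and com: "\<And>v. v \<in> carrier (jordan 1) \<Longrightarrow> f (jordan_shift 1 v) = t (f v)"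
    using rep_homD[OF assms] by blast+
  have sm: "f (c \<odot>\<^bsub>jordan 1\<^esub> v) = c \<odot>\<^bsub>V\<^esub> f v" if "v \<in> carrier (jordan 1)" for c v
    using linear_mapsD(4)[OF lin that] .
  have a: "f (jvec 0) \<in> carrier V" by (rule linear_mapsD(1)[OF lin]) simp
  have "f (jordan_shift 1 (jvec 0)) = f (0 \<odot>\<^bsub>jordan 1\<^esub> jvec 0)"
    by (rule arg_cong[where f = f]) (auto simp: jordan_shift_def fun_eq_iff)
  then have "t (f (jvec 0)) = \<zero>\<^bsub>V\<^esub>" using com[of "jvec 0"] sm[of "jvec 0" 0] a by simp
  moreover have "f = hom1 (f (jvec 0))"
  proof
    fix v
    show "f v = hom1 (f (jvec 0)) v"
    proof (cases "v \<in> carrier (jordan 1)")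
      case True
      then have "v = v 0 \<odot>\<^bsub>jordan 1\<^esub> jvec 0"
        by (auto simp: jvec_def fun_eq_iff)
      then have "f v = v 0 \<odot>\<^bsub>V\<^esub> f (jvec 0)" using sm[of "jvec 0" "v 0"] by simp
      then show ?thesis using True by (simp add: hom1_def)
    next
      case False
      then show ?thesis unfolding hom1_def using linear_mapsD(2)[OF lin] by (simp only: restrict_apply if_False)
    qed
  qed
  ultimately show thesis using that a by blast
qed

lemma Hom2E:
  assumes "f \<in> Hom2"
  obtains a where "a \<in> carrier V" "t (t a) = \<zero>\<^bsub>V\<^esub>" "f = hom2 a"
proof -
  have lin: "f \<in> linear_maps (jordan 2) V" and com: "\<And>v. v \<in> carrier (jordan 2) \<Longrightarrow> f (jordan_shift 2 v) = t (f v)"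
    using rep_homD[OF assms] by blast+
  have sm: "f (c \<odot>\<^bsub>jordan 2\<^esub> v) = c \<odot>\<^bsub>V\<^esub> f v" if "v \<in> carrier (jordan 2)" for c v
    using linear_mapsD(4)[OF lin that] .
  have ad: "f (v \<oplus>\<^bsub>jordan 2\<^esub> w) = f v \<oplus>\<^bsub>V\<^esub> f w" if "v \<in> carrier (jordan 2)" "w \<in> carrier (jordan 2)" for v w
    using linear_mapsD(3)[OF lin that] .
  have j: "jvec 0 \<in> carrier (jordan 2)" "jvec 1 \<in> carrier (jordan 2)" by simp_all
  have a: "f (jvec 0) \<in> carrier V" "f (jvec 1) \<in> carrier V"
    using linear_mapsD(1)[OF lin] j by blast+
  have "jordan_shift 2 (jvec 0) = jvec 1" by (auto simp: jordan_shift_def jvec_def fun_eq_iff)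
  from com[OF j(1), unfolded this] have a1: "f (jvec 1) = t (f (jvec 0))" .
  have "f (jordan_shift 2 (jvec 1)) = f (0 \<odot>\<^bsub>jordan 2\<^esub> jvec 0)"
    by (rule arg_cong[where f = f]) (auto simp: jordan_shift_def jvec_def fun_eq_iff)
  then have "t (t (f (jvec 0))) = \<zero>\<^bsub>V\<^esub>" using com[OF j(2)] sm[OF j(1), of 0] a
    by (simp add: a1 del: One_nat_def)
  moreover have "f = hom2 (f (jvec 0))"
  proof
    fix v
    show "f v = hom2 (f (jvec 0)) v"
    proof (cases "v \<in> carrier (jordan 2)")
      case True
      then have "v i = ((v 0 \<odot>\<^bsub>jordan 2\<^esub> jvec 0) \<oplus>\<^bsub>jordan 2\<^esub> (v 1 \<odot>\<^bsub>jordan 2\<^esub> jvec 1)) i" for i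
        by (cases "i = 0"; cases "i = 1") (auto simp: jvec_def)
      then have "f v = f ((v 0 \<odot>\<^bsub>jordan 2\<^esub> jvec 0) \<oplus>\<^bsub>jordan 2\<^esub> (v 1 \<odot>\<^bsub>jordan 2\<^esub> jvec 1))"
        by (intro arg_cong[where f = f] ext)
      also have "\<dots> = f (v 0 \<odot>\<^bsub>jordan 2\<^esub> jvec 0) \<oplus>\<^bsub>V\<^esub> f (v 1 \<odot>\<^bsub>jordan 2\<^esub> jvec 1)"
        by (rule ad) simp_all
      also have "\<dots> = v 0 \<odot>\<^bsub>V\<^esub> f (jvec 0) \<oplus>\<^bsub>V\<^esub> v 1 \<odot>\<^bsub>V\<^esub> f (jvec 1)"
        by (simp only: sm[OF j(1)] sm[OF j(2)])
      finally show ?thesis using True by (simp add: hom2_def a1 del: One_nat_def)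
    next
      case False
      then show ?thesis unfolding hom2_def using linear_mapsD(2)[OF lin] by (simp only: restrict_apply if_False)
    qed
  qed
  ultimately show thesis using that a by blast
qed

text \<open>A morphism back to J_1 is a functional that vanishes on the image of \<open>t\<close>,
  and the trace of the composite is its value at \<open>a\<close>. The criterion says by duality
  that \<open>a\<close> lies in the image of \<open>t\<close>.\<close>

lemma negligible_hom1:
  assumes a: "a \<in> carrier V" "t a = \<zero>\<^bsub>V\<^esub>"
  shows "negligible (jordan 1) (jordan_shift 1) V t (hom1 a) \<longleftrightarrow>
    (\<forall>g. lfun V g \<and> (\<forall>y\<in>carrier V. g (t y) = 0) \<longrightarrow> g a = 0)"
proof -
  have trace: "lin_trace V (\<lambda>y. hom1 a (v y)) = v a 0"
    if "v \<in> linear_maps V (jordan 1)" for v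
  proof -
    have v: "v y \<in> carrier (jordan 1)" if "y \<in> carrier V" for y
      using linear_mapsD(1)[OF \<open>v \<in> linear_maps _ _\<close> that] .
    have g: "lfun V (\<lambda>y. v y 0)" using that by (rule lfun_coordinate)
    have "lin_trace V (\<lambda>y. hom1 a (v y)) = v a 0 + (\<lambda>_. 0) a"
      by (rule lin_trace_two[OF _ g]) (use v a in \<open>auto simp: hom1_def lfun_def\<close>)
    then show ?thesis by simp
  qed
  show ?thesis
  proof
    assume neg: "negligible (jordan 1) (jordan_shift 1) V t (hom1 a)"
    show "\<forall>g. lfun V g \<and> (\<forall>y\<in>carrier V. g (t y) = 0) \<longrightarrow> g a = 0"
    proof (intro allI impI)
      fix g assume g: "lfun V g \<and> (\<forall>y\<in>carrier V. g (t y) = 0)"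
      define v where "v = (\<lambda>y\<in>carrier V. \<lambda>i::nat. if i = 0 then g y else 0)"
      have "v \<in> rep_hom V t (jordan 1) (jordan_shift 1)"
        unfolding rep_hom_def mem_Collect_eq
      proof (intro conjI linear_mapsI ballI)
        show "v \<in> extensional (carrier V)" by (simp add: v_def)
      qed (use g t_closed in \<open>simp_all add: v_def lfun_def jordan_shift_def fun_eq_iff\<close>)
      then have tr: "lin_trace V (\<lambda>y. hom1 a (v y)) = 0" and lin: "v \<in> linear_maps V (jordan 1)"
        using neg rep_homD(1) by (simp_all add: negligible_def)
      have "v a 0 = 0" using trace[OF lin] tr by (simp only:)
      then show "g a = 0" using a by (simp add: v_def)
    qed
  next
    assume *: "\<forall>g. lfun V g \<and> (\<forall>y\<in>carrier V. g (t y) = 0) \<longrightarrow> g a = 0"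
    show "negligible (jordan 1) (jordan_shift 1) V t (hom1 a)"
      unfolding negligible_def
    proof (intro conjI ballI hom1_mem a)
      fix v assume v: "v \<in> rep_hom V t (jordan 1) (jordan_shift 1)"
      have "lfun V (\<lambda>y. v y 0)" by (rule lfun_coordinate[OF rep_homD(1)[OF v]])
      moreover have "v (t y) 0 = 0" if "y \<in> carrier V" for y
        using rep_homD(2)[OF v that] by (simp add: jordan_shift_def)
      ultimately have "v a 0 = 0" using * by blast
      then show "lin_trace V (\<lambda>y. hom1 a (v y)) = 0" using trace[OF rep_homD(1)[OF v]] by simp
    qed
  qed
qed

text \<open>A morphism back to J_2 sends y to the pair (g (t y), g y) for a functional g that kills
  the image of the square of \<open>t\<close>. The composite has trace 2 g (t a), one summand from
  each coordinate.\<close>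

lemma negligible_hom2:
  assumes a: "a \<in> carrier V" "t (t a) = \<zero>\<^bsub>V\<^esub>"
  shows "negligible (jordan 2) (jordan_shift 2) V t (hom2 a) \<longleftrightarrow>
    (\<forall>g. lfun V g \<and> (\<forall>y\<in>carrier V. g (t (t y)) = 0) \<longrightarrow> g (t a) + g (t a) = 0)"
proof -
  have trace: "lin_trace V (\<lambda>y. hom2 a (v y)) = v a 0 + v (t a) 1"
    if "v \<in> linear_maps V (jordan 2)" for v
  proof -
    have v: "v y \<in> carrier (jordan 2)" if "y \<in> carrier V" for y
      using linear_mapsD(1)[OF \<open>v \<in> linear_maps _ _\<close> that] .
    have g: "lfun V (\<lambda>y. v y 0)" "lfun V (\<lambda>y. v y 1)"
      using that by (auto intro: lfun_coordinate)
    show ?thesis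
      by (rule lin_trace_two[OF _ g]) (use v a t_closed in \<open>auto simp: hom2_def\<close>)
  qed
  show ?thesis
  proof
    assume neg: "negligible (jordan 2) (jordan_shift 2) V t (hom2 a)"
    show "\<forall>g. lfun V g \<and> (\<forall>y\<in>carrier V. g (t (t y)) = 0) \<longrightarrow> g (t a) + g (t a) = 0"
    proof (intro allI impI)
      fix g assume g: "lfun V g \<and> (\<forall>y\<in>carrier V. g (t (t y)) = 0)"
      \<comment> \<open>Coordinate 0 has to be \<open>g (t y)\<close>: \<open>jordan_shift 2\<close>
        moves coordinate 0 to coordinate 1, where commuting with \<open>t\<close> demands
        \<open>g (t y)\<close>.\<close>
      define v where "v = (\<lambda>y\<in>carrier V. \<lambda>i::nat. if i = 0 then g (t y) else if i = 1 then g y else 0)"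
      have "v \<in> rep_hom V t (jordan 2) (jordan_shift 2)"
        unfolding rep_hom_def mem_Collect_eq
      proof (intro conjI linear_mapsI ballI)
        show "v \<in> extensional (carrier V)" by (simp add: v_def)
      qed (use g t_closed in \<open>simp_all add: v_def lfun_def jordan_shift_def fun_eq_iff t_add t_smult\<close>)
      then have tr: "lin_trace V (\<lambda>y. hom2 a (v y)) = 0" and lin: "v \<in> linear_maps V (jordan 2)"
        using neg rep_homD(1) by (simp_all add: negligible_def)
      have "v a 0 + v (t a) 1 = 0" using trace[OF lin] tr by (simp only:)
      then show "g (t a) + g (t a) = 0" using a t_closed[OF a(1)] by (simp add: v_def)
    qed
  next
    assume *: "\<forall>g. lfun V g \<and> (\<forall>y\<in>carrier V. g (t (t y)) = 0) \<longrightarrow> g (t a) + g (t a) = 0"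
    show "negligible (jordan 2) (jordan_shift 2) V t (hom2 a)"
      unfolding negligible_def
    proof (intro conjI ballI hom2_mem a)
      fix v assume v: "v \<in> rep_hom V t (jordan 2) (jordan_shift 2)"
      have "lfun V (\<lambda>y. v y 1)" by (rule lfun_coordinate[OF rep_homD(1)[OF v]])
      moreover have sh: "v (t y) = jordan_shift 2 (v y)" if "y \<in> carrier V" for y
        using rep_homD(2)[OF v that] .
      then have "v (t (t y)) 1 = 0" if "y \<in> carrier V" for y
        using that t_closed by (simp add: jordan_shift_def)
      ultimately have "v (t a) 1 + v (t a) 1 = 0" using * by blast
      moreover have "v (t a) 1 = v a 0" using sh[OF a(1)] by (simp add: jordan_shift_def)
      ultimately show "lin_trace V (\<lambda>y. hom2 a (v y)) = 0" using trace[OF rep_homD(1)[OF v]] by simp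
    qed
  qed
qed

end

section \<open>Semisimplification\<close>

context root_reduction
begin

lemma single_gr: "i \<in> bidx \<Longrightarrow> single i c \<in> gr (ldeg i)"
  by (simp add: gr_def gspace_def)

lemma comp_d: "v \<in> gspace UNIV \<Longrightarrow> comp (2 + k) (d v) = d (comp k v)"
proof -
  assume "v \<in> gspace UNIV"
  then have "v \<in> supported bidx" by (simp add: gspace_def)
  then show ?thesis
  proof (induction rule: supported_induct)
    case (single i c)
    then have i: "single i c \<in> gr (ldeg i)" by (rule single_gr)
    show ?case by (simp add: comp_gr[OF i] comp_gr[OF gr_d[OF i]] d_linear)
  qed (simp_all add: comp_linear d_linear)
qed

lemma d_gspace: "d v \<in> gspace UNIV"
  using lbr_bidx[of "EE th" v] by (simp add: d_def gspace_def)

lemma lbr_gspace_UNIV: "lbr v w \<in> gspace UNIV"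
  using lbr_bidx[of v w] by (simp add: gspace_def)

lemma ddd_eq_0: "v \<in> gspace UNIV \<Longrightarrow> d (d (d v)) = 0"
proof -
  assume "v \<in> gspace UNIV"
  then have "v \<in> supported bidx" by (simp add: gspace_def)
  then show ?thesis
  proof (induction rule: supported_induct)
    case (single i c)
    then have "single i c \<in> gr (ldeg i)" by (rule single_gr)
    then have "d (d (d (single i c))) \<in> gr (2 + (2 + (2 + ldeg i)))" by (intro gr_d)
    moreover have "ldeg i \<ge> - 2" using single ip_lower[OF root_th] by (cases i) auto
    ultimately show ?case by (intro gr_eq_0) auto
  qed (simp_all add: d_linear)
qed

lemma comp_decompose:
  assumes "v \<in> gspace UNIV"
  shows "v = comp (- 2) v + comp (- 1) v + comp 0 v + comp 1 v + comp 2 v"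
proof (rule poly_mapping_eqI)
  fix i
  show "lookup v i = lookup (comp (- 2) v + comp (- 1) v + comp 0 v + comp 1 v + comp 2 v) i"
  proof (cases "lookup v i = 0")
    case False
    then have "i \<in> bidx" using assms by (auto simp: gspace_def supported_iff)
    then have "ldeg i \<ge> - 2 \<and> ldeg i \<le> 2"
      using ip_lower[OF root_th] ip_upper[OF root_th] by (cases i) auto
    then consider "ldeg i = - 2" | "ldeg i = - 1" | "ldeg i = 0" | "ldeg i = 1" | "ldeg i = 2" by linarith
    then show ?thesis by cases (simp_all add: comp_def lookup_add)
  qed (simp add: comp_def lookup_add)
qed

lemma Hv_th_gr: "x \<in> gr k \<Longrightarrow> lbr (Hv th) x = pscale (of_int k) x"
proof -
  assume "x \<in> gr k"
  then have "x \<in> supported ({x. ldeg x = k} \<inter> bidx)" by (simp add: gr_def gspace_def)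
  then show ?thesis
  proof (induction rule: supported_induct)
    case (single i c)
    show ?case
    proof (cases i)
      case (Hb h)
      then show ?thesis using single by (auto simp: lbr_Hb_Hv)
    next
      case (Eb a)
      then have "lbr (Hv th) (pscale c (EE a)) = pscale c (single (Eb a) (of_int k))"
        using single by (simp only: l.scale_right) (auto simp: lbr_Hv_EE)
      then show ?thesis by (simp add: Eb mult.commute)
    qed
  qed (simp_all add: l.add_right pm.scale_right_distrib)
qed

definition lower :: "('n lidx \<Rightarrow>\<^sub>0 'k) \<Rightarrow> ('n lidx \<Rightarrow>\<^sub>0 'k)" where
  "lower x = lbr (EE (- th)) x"

lemma lower_gr: "x \<in> gr k \<Longrightarrow> lower x \<in> gr (k - 2)"
  using gr_lbr[OF EE_gr[of "- th" "- 2" 1], of x k] by (simp add: lower_def ip_simps)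

text \<open>The sl_2 relation in degree k, with the sign coming from [E_th, E_-th] = - H_th.\<close>

lemma d_lower: "x \<in> gr k \<Longrightarrow> d (lower x) = lower (d x) - pscale (of_int k) x"
proof -
  assume x: "x \<in> gr k"
  have "lbr (EE th) (EE (- th)) = (- Hv th :: 'n lidx \<Rightarrow>\<^sub>0 'k)" by (simp add: ip_simps)
  then have "d (lower x) = lbr (- Hv th) x + lower (d x)"
    unfolding d_def lower_def using lbr_jacobi'[of "EE th" "EE (- th)" x] by simp
  then show ?thesis using Hv_th_gr[OF x] by (simp add: l.uminus_left)
qed

lemma lower_zero: "lower 0 = 0" by (simp add: lower_def)

text \<open>Vectors of degree -1 and -2 are lowest weight vectors, as the degrees -3 and -4 are
  zero. Lowering after raising multiplies them by k, which is nonzero modulo 3.\<close>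

lemma d_inj:
  assumes x: "x \<in> gr k" and k: "k = - 1 \<or> k = - 2" and "d x = 0"
  shows "x = 0"
proof -
  have "lower x \<in> gr (k - 2)" by (rule lower_gr[OF x])
  then have "lower x = 0" using k by (intro gr_eq_0) auto
  then have "pscale (of_int k) x = 0" using d_lower[OF x] assms(3) by (simp add: d_linear lower_zero)
  then show ?thesis using k by (auto simp: two_eq)
qed

lemma dd_inj:
  assumes x: "x \<in> gr (- 2)" and "d (d x) = 0"
  shows "x = 0"
proof -
  have dx: "d x \<in> gr 0" using gr_d[OF x] by simp
  have "lower x = 0" using lower_gr[OF x] by (intro gr_eq_0) auto
  then have "lower (d x) = x" using d_lower[OF x] by (simp add: d_linear two_eq)
  moreover have "d (lower (d x)) = 0" using d_lower[OF dx] assms(2) by (simp add: lower_zero)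
  ultimately show ?thesis using d_inj[OF x] by simp
qed

text \<open>Dually to \<open>d_inj\<close>, vectors of degree 1 and 2 are highest weight vectors;
  applying \<open>lower\<close> once or twice gives, up to sign, preimages under \<open>d\<close> or
  its square.\<close>

lemma gr_1_image: "y \<in> gr 1 \<Longrightarrow> \<exists>w\<in>gspace UNIV. y = d w"
proof -
  assume y: "y \<in> gr 1"
  have "d y = 0" using gr_d[OF y] by (intro gr_eq_0) auto
  then have "d (lower y) = - y" using d_lower[OF y] by (simp add: lower_zero)
  then have "y = d (- lower y)" by (simp add: d_linear)
  then show ?thesis using lbr_gspace_UNIV pm.subspace_neg[OF gspace_subspace] unfolding lower_def by blast
qed

lemma gr_2_image: "y \<in> gr 2 \<Longrightarrow> \<exists>w\<in>gspace UNIV. y = d (d w)"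
proof -
  assume y: "y \<in> gr 2"
  have "d y = 0" using gr_d[OF y] by (intro gr_eq_0) auto
  then have 1: "d (lower y) = y" using d_lower[OF y] by (simp add: lower_zero two_eq)
  have "lower y \<in> gr 0" using lower_gr[OF y] by simp
  then have "d (lower (lower y)) = lower y" using d_lower[of "lower y" 0] 1 by simp
  then have "y = d (d (lower (lower y)))" using 1 by simp
  then show ?thesis using lbr_gspace_UNIV unfolding lower_def by blast
qed

lemma ker_low_comps:
  assumes v: "v \<in> gspace UNIV" and "d v = 0"
  shows "comp (- 2) v = 0" "comp (- 1) v = 0" "comp 0 v \<in> cent"
proof -
  have *: "d (comp k v) = 0" for k using comp_d[OF v, of k] assms(2) by (simp add: comp_linear)
  show "comp (- 2) v = 0" "comp (- 1) v = 0"
    by (rule d_inj[OF comp_in_gr[OF v]]; simp add: *)+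
  show "comp 0 v \<in> cent" using * comp_in_gr[OF v] by (simp add: cent_def)
qed

text \<open>A kernel element has components in degrees 0, 1 and 2 only, and degrees 1 and 2 lie in
  the image of \<open>d\<close>. So modulo the image it is determined by its degree 0
  component.\<close>

lemma ker_image:
  assumes v: "v \<in> gspace UNIV" and "d v = 0" "comp 0 v = 0"
  shows "\<exists>w\<in>gspace UNIV. v = d w"
proof -
  obtain w1 w2 where w: "w1 \<in> gspace UNIV" "comp 1 v = d w1" "w2 \<in> gspace UNIV" "comp 2 v = d (d w2)"
    using gr_1_image[OF comp_in_gr[OF v]] gr_2_image[OF comp_in_gr[OF v]] by blast
  have "v = comp 1 v + comp 2 v"
    using comp_decompose[OF v] ker_low_comps[OF v assms(2)] assms(3) by simp
  then have "v = d (w1 + d w2)" by (simp only: w d_linear)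
  moreover have "w1 + d w2 \<in> gspace UNIV" by (intro pm.subspace_add gspace_subspace w d_gspace)
  ultimately show ?thesis by blast
qed

lemma ker_dd_low_comp:
  assumes v: "v \<in> gspace UNIV" and "d (d v) = 0"
  shows "comp (- 2) v = 0"
proof -
  have "d (d (comp (- 2) v)) = 0"
    using comp_d[OF v, of "- 2"] comp_d[OF d_gspace[of v], of 0] assms(2) by (simp add: comp_linear)
  then show ?thesis by (rule dd_inj[OF comp_in_gr[OF v]])
qed

text \<open>Since \<open>d\<close> kills degrees 1 and 2, \<open>d v\<close> comes from the degree 0
  component; it then has degree 2, where everything is in the image of the square of
  \<open>d\<close>.\<close>

lemma ker_dd_image:
  assumes v: "v \<in> gspace UNIV" and "d (d v) = 0" "comp (- 1) v = 0"
  shows "\<exists>w\<in>gspace UNIV. d v = d (d w)"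
proof -
  have "v = comp 0 v + comp 1 v + comp 2 v"
    using comp_decompose[OF v] ker_dd_low_comp[OF v assms(2)] assms(3) by simp
  then have "d v = d (comp 0 v) + d (comp 1 v) + d (comp 2 v)" by (metis d_linear(1))
  moreover have "d (comp 1 v) = 0" "d (comp 2 v) = 0"
    using gr_eq_0[OF gr_d[OF comp_in_gr[OF v, of 1]]] gr_eq_0[OF gr_d[OF comp_in_gr[OF v, of 2]]]
    by simp_all
  ultimately have "d v = d (comp 0 v)" by simp
  moreover have "d (comp 0 v) \<in> gr 2" using gr_d[OF comp_in_gr[OF v], of 0] by simp
  ultimately show ?thesis using gr_2_image by auto
qed

lemma lookup_comp: "ldeg i = k \<Longrightarrow> lookup (comp k v) i = lookup v i"
  by (simp add: comp_def)

text \<open>In degree 0 the image of \<open>d\<close> is spanned by H_th, the basis vector at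
  \<open>node\<close>. The other coordinates of degree 0 are therefore functionals vanishing on the
  image of \<open>d\<close>, ready to test negligibility.\<close>

lemma lookup_d_deg_0:
  assumes v: "v \<in> gspace UNIV" and i: "ldeg i = 0" "i \<noteq> Hb node"
  shows "lookup (d v) i = 0"
proof -
  define w where "w = comp (- 2) v"
  have "w \<in> supported ({x. ldeg x = - 2} \<inter> bidx)"
    using comp_in_gr[OF v, of "- 2"] by (simp add: w_def gr_def gspace_def)
  then have "lookup (d w) i = 0"
  proof (induction rule: supported_induct)
    case (single j c)
    then obtain a where a: "j = Eb a" "root a" "ip th a = - 2" by (cases j) auto
    then have "d (pscale c (EE a)) = pscale c (- Hv th)" by (simp only: d_linear) (simp add: d_EE)
    moreover have "lookup (Hv th :: 'n lidx \<Rightarrow>\<^sub>0 'k) i = 0"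
      using i(2) by (simp add: th_def Hv_axis lookup_single when_def)
    ultimately show ?case by (simp add: a)
  qed (simp_all add: d_linear lookup_add)
  moreover have "lookup (d v) i = lookup (comp (2 + - 2) (d v)) i" using i(1) by (simp add: lookup_comp)
  ultimately show ?thesis unfolding comp_d[OF v] w_def by simp
qed

text \<open>The one coordinate of degree 0 that the test functionals miss is that of
  \<open>Hb node\<close>, and \<open>d\<close> is injective on its multiples because -2 is
  nonzero.\<close>

lemma comp_0_from_lookups:
  assumes v: "v \<in> gspace UNIV" and "d v = 0"
    and *: "\<And>i. ldeg i = 0 \<Longrightarrow> i \<noteq> Hb node \<Longrightarrow> lookup v i = 0"
  shows "comp 0 v = 0"
proof -
  define c where "c = lookup v (Hb node)"
  have eq: "comp 0 v = single (Hb node) c"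
    by (rule poly_mapping_eqI) (auto simp: comp_def lookup_single when_def c_def intro!: *)
  have "d (single (Hb node) c) = 0" using cent_d[OF ker_low_comps(3)[OF v assms(2)]] by (simp only: eq)
  moreover have "d (single (Hb node) c) = single (Eb th) (- (c * 2))"
    by (simp add: d_def th_def[symmetric])
  ultimately have "lookup (single (Eb th) (- (c * 2))) (Eb th) = 0" by simp
  then have "c = 0" by (simp add: two_eq)
  then show ?thesis by (simp add: eq)
qed

lemma lookup_dd_deg_1:
  assumes v: "v \<in> gspace UNIV" and i: "ldeg i = 1"
  shows "lookup (d (d v)) i = 0"
proof -
  have "comp (- 3) v = 0" using comp_in_gr[OF v] by (intro gr_eq_0[of _ "- 3"]) auto
  then have "comp (2 + (2 + - 3)) (d (d v)) = 0"
    unfolding comp_d[OF d_gspace] comp_d[OF v] by (simp add: d_linear)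
  then show ?thesis using lookup_comp[OF i, of "d (d v)"] by simp
qed

text \<open>\<open>d\<close> is injective on degree -1, so the degree 1 coordinates of
  \<open>d v\<close> detect that component; by \<open>lookup_dd_deg_1\<close> they vanish on the
  image of the square of \<open>d\<close>.\<close>

lemma comp_odd_from_lookups:
  assumes v: "v \<in> gspace UNIV" and *: "\<And>i. ldeg i = 1 \<Longrightarrow> lookup (d v) i = 0"
  shows "comp (- 1) v = 0"
proof -
  have "comp 1 (d v) = 0" by (rule poly_mapping_eqI) (auto simp: comp_def *)
  then have "d (comp (- 1) v) = 0" using comp_d[OF v, of "- 1"] by simp
  then show ?thesis by (intro d_inj[OF comp_in_gr[OF v]]) simp_all
qed

text \<open>Vectors representing morphisms need not be homogeneous and may carry components of
  higher degree. The filtration keeps track of the lowest one.\<close>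

definition filt :: "int \<Rightarrow> ('n lidx \<Rightarrow>\<^sub>0 'k) set" where "filt k = gspace {x. ldeg x \<ge> k}"

lemma lbr_filt:
  assumes "x \<in> filt j" "y \<in> filt k"
  shows "lbr x y \<in> filt (j + k)"
proof -
  have "(lmult s t :: 'n lidx \<Rightarrow>\<^sub>0 'k) \<in> supported ({x. ldeg x \<ge> j + k} \<inter> bidx)"
    if "s \<in> {x. ldeg x \<ge> j} \<inter> bidx" "t \<in> {x. ldeg x \<ge> k} \<inter> bidx" for s t
  proof -
    have "lbr (single s 1) (single t 1) \<in> gr (ldeg s + ldeg t)"
      using that by (intro gr_lbr single_gr) auto
    then have "keys (lmult s t :: 'n lidx \<Rightarrow>\<^sub>0 'k) \<subseteq> {x. ldeg x = ldeg s + ldeg t} \<inter> bidx"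
      by (simp add: gr_def gspace_def supported_def)
    also have "\<dots> \<subseteq> {x. ldeg x \<ge> j + k} \<inter> bidx" using that by auto
    finally show ?thesis by (simp only: supported_def mem_Collect_eq)
  qed
  then show ?thesis using assms unfolding lbr_def filt_def gspace_def by (rule bext_supported[rotated 2])
qed

text \<open>Passage to the associated graded algebra: every other contribution to the bracket has
  degree above j + k.\<close>

lemma comp_lbr_filt:
  assumes x: "x \<in> filt j" and y: "y \<in> filt k"
  shows "comp (j + k) (lbr x y) = lbr (comp j x) (comp k y)"
proof -
  have rest: "z - comp j z \<in> filt (j + 1)" if "z \<in> filt j" for z j
    using that by (auto simp: filt_def gspace_def supported_iff comp_def lookup_minus)
  have c: "comp j z \<in> gr j" if "z \<in> filt j" for z j
    using that by (intro comp_in_gr) (auto simp: filt_def gspace_def supported_iff)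
  have vanish: "comp l z = 0" if "z \<in> filt (l + 1)" for z l
    using that by (intro poly_mapping_eqI) (auto simp: comp_def filt_def gspace_def supported_iff)
  have fc: "comp j z \<in> filt j" if "z \<in> filt j" for z j
    using that by (auto simp: filt_def gspace_def supported_iff comp_def)
  have "lbr x y = lbr (comp j x) (comp k y) + lbr (comp j x) (y - comp k y) + lbr (x - comp j x) y"
    by (simp add: l.linear_simps)
  moreover have "comp (j + k) (lbr (comp j x) (y - comp k y)) = 0"
    using lbr_filt[OF fc[OF x] rest[OF y]] by (intro vanish) (simp add: add.assoc)
  moreover have "comp (j + k) (lbr (x - comp j x) y) = 0"
    using lbr_filt[OF rest[OF x] y] by (intro vanish) (simp add: ac_simps)
  moreover have "comp (j + k) (lbr (comp j x) (comp k y)) = lbr (comp j x) (comp k y)"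
    using gr_lbr[OF c[OF x] c[OF y]] by (simp add: comp_gr)
  ultimately show ?thesis by (simp add: comp_linear)
qed

lemma filt_from_comps:
  assumes v: "v \<in> gspace UNIV"
  shows "comp (- 2) v = 0 \<Longrightarrow> v \<in> filt (- 1)"
    and "comp (- 2) v = 0 \<Longrightarrow> comp (- 1) v = 0 \<Longrightarrow> v \<in> filt 0"
proof -
  have low: "ldeg i \<ge> - 2" if "i \<in> bidx" for i using that ip_lower[OF root_th] by (cases i) auto
  have z: "lookup v i = 0" if "comp k v = 0" "ldeg i = k" for i k
    using lookup_comp[OF that(2), of v] that(1) by simp
  have bidx: "i \<in> bidx" if "lookup v i \<noteq> 0" for i using v that by (auto simp: gspace_def supported_iff)
  have "ldeg i \<ge> - 1" if "comp (- 2) v = 0" "lookup v i \<noteq> 0" for i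
    using low[OF bidx[OF that(2)]] z[OF that(1), of i] that(2) by (cases "ldeg i = - 2") auto
  moreover have "ldeg i \<ge> 0" if "comp (- 2) v = 0" "comp (- 1) v = 0" "lookup v i \<noteq> 0" for i
    using low[OF bidx[OF that(3)]] z[OF that(1), of i] z[OF that(2), of i] that(3)
    by (cases "ldeg i = - 2"; cases "ldeg i = - 1") auto
  ultimately show "comp (- 2) v = 0 \<Longrightarrow> v \<in> filt (- 1)"
    "comp (- 2) v = 0 \<Longrightarrow> comp (- 1) v = 0 \<Longrightarrow> v \<in> filt 0"
    unfolding filt_def gspace_def supported_iff using bidx by blast+
qed

end

text \<open>The semisimplification is formed for the contragredient algebra itself, not for its
  lattice model, so the computations in the model are carried over along \<open>psi\<close>.\<close>

locale lattice_copy = root_reduction M node ch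
  for M :: "'n::finite \<Rightarrow> 'n \<Rightarrow> int" and node :: 'n and ch :: "'k::field itself" +
  fixes psi :: "'a \<Rightarrow> 'n lidx \<Rightarrow>\<^sub>0 'k" and L :: "('k, 'a) superalgebra" and x0 :: 'a
  assumes iso: "super_iso psi L (model_alg (gspace UNIV) lbr gpart)"
    and x0: "x0 \<in> carrier L" "psi x0 = EE th"
begin

lemma epi: "super_epi psi L (model_alg (gspace UNIV) lbr gpart)"
  by (rule super_epi_lie.axioms(1)[OF super_iso.axioms(1)[OF iso]])

lemma lie_L: "lie_superalgebra L" by (rule super_iso.lie_superalgebra_D[OF iso])

lemma module_L: "Module.module scalars L" by (rule super_iso.module_D[OF iso])

lemma L_closed:
  "\<zero>\<^bsub>L\<^esub> \<in> carrier L" "x \<in> carrier L \<Longrightarrow> y \<in> carrier L \<Longrightarrow> x \<oplus>\<^bsub>L\<^esub> y \<in> carrier L"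
  "x \<in> carrier L \<Longrightarrow> y \<in> carrier L \<Longrightarrow> x \<otimes>\<^bsub>L\<^esub> y \<in> carrier L"
  "x \<in> carrier L \<Longrightarrow> c \<odot>\<^bsub>L\<^esub> x \<in> carrier L" "x \<in> carrier L \<Longrightarrow> \<ominus>\<^bsub>L\<^esub> x \<in> carrier L"
proof -
  interpret m: Module.module "scalars :: 'k ring" L by (rule module_L)
  show "x \<in> carrier L \<Longrightarrow> \<ominus>\<^bsub>L\<^esub> x \<in> carrier L" by (rule m.M.a_inv_closed)
  show "\<zero>\<^bsub>L\<^esub> \<in> carrier L" by (rule super_epi.zero_mem[OF epi])
  show "x \<in> carrier L \<Longrightarrow> y \<in> carrier L \<Longrightarrow> x \<oplus>\<^bsub>L\<^esub> y \<in> carrier L"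
    by (rule super_epi.add_closed[OF epi])
  show "x \<in> carrier L \<Longrightarrow> y \<in> carrier L \<Longrightarrow> x \<otimes>\<^bsub>L\<^esub> y \<in> carrier L"
    by (rule super_epi.mult_closed[OF epi])
  show "x \<in> carrier L \<Longrightarrow> c \<odot>\<^bsub>L\<^esub> x \<in> carrier L"
    by (rule super_epi.scale_closed[OF epi])
qed

lemma psi_in: "x \<in> carrier L \<Longrightarrow> psi x \<in> gspace UNIV"
  by (rule super_epi.map_in[OF epi, unfolded model_alg_simps])

lemma psi_simps:
  "psi \<zero>\<^bsub>L\<^esub> = 0" "x \<in> carrier L \<Longrightarrow> y \<in> carrier L \<Longrightarrow> psi (x \<oplus>\<^bsub>L\<^esub> y) = psi x + psi y"
  "x \<in> carrier L \<Longrightarrow> y \<in> carrier L \<Longrightarrow> psi (x \<otimes>\<^bsub>L\<^esub> y) = lbr (psi x) (psi y)"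
  "x \<in> carrier L \<Longrightarrow> psi (c \<odot>\<^bsub>L\<^esub> x) = pscale c (psi x)"
  "x \<in> carrier L \<Longrightarrow> psi (\<ominus>\<^bsub>L\<^esub> x) = - psi x"
proof -
  show "psi \<zero>\<^bsub>L\<^esub> = 0" by (rule super_epi.map_zero[OF epi, unfolded model_alg_simps])
  show "x \<in> carrier L \<Longrightarrow> y \<in> carrier L \<Longrightarrow> psi (x \<oplus>\<^bsub>L\<^esub> y) = psi x + psi y"
    by (rule super_epi.map_add[OF epi, unfolded model_alg_simps])
  show "x \<in> carrier L \<Longrightarrow> y \<in> carrier L \<Longrightarrow> psi (x \<otimes>\<^bsub>L\<^esub> y) = lbr (psi x) (psi y)"
    by (rule super_epi.map_mult[OF epi, unfolded model_alg_simps])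
  show "x \<in> carrier L \<Longrightarrow> psi (c \<odot>\<^bsub>L\<^esub> x) = pscale c (psi x)"
    by (rule super_epi.map_smult[OF epi, unfolded model_alg_simps])
  assume "x \<in> carrier L"
  from super_iso.map_a_inv[OF iso this] a_inv_model_alg[OF gspace_subspace psi_in[OF this]]
  show "psi (\<ominus>\<^bsub>L\<^esub> x) = - psi x" by (rule trans)
qed

lemma psi_eqI: "\<lbrakk>x \<in> carrier L; y \<in> carrier L; psi x = psi y\<rbrakk> \<Longrightarrow> x = y"
  by (rule super_iso.eq_iff[OF iso, THEN iffD2])

lemma psi_obtain:
  assumes "v \<in> gspace UNIV"
  obtains a where "a \<in> carrier L" "psi a = v"
proof -
  have "v \<in> psi ` carrier L" using assms by (simp only: super_epi.map_carrier[OF epi] model_alg_simps)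
  then show thesis using that by (elim imageE) simp
qed

abbreviation dL where "dL \<equiv> ad L x0"

lemma dL_in: "x \<in> carrier L \<Longrightarrow> dL x \<in> carrier L"
  unfolding ad_def by (intro L_closed x0)

lemma psi_dL:
  assumes "x \<in> carrier L"
  shows "psi (dL x) = d (psi x)"
  unfolding ad_def d_def psi_simps(3)[OF x0(1) assms] x0(2) by (rule refl)

lemmas L_in = L_closed dL_in
lemmas L_psi = psi_simps psi_dL

lemma finsum_in_psi:
  assumes "finite A" "\<And>i. i \<in> A \<Longrightarrow> f i \<in> carrier L"
  shows "finsum L f A \<in> carrier L \<and> psi (finsum L f A) = (\<Sum>i\<in>A. psi (f i))"
proof -
  interpret m: Module.module "scalars :: 'k ring" L by (rule module_L)
  show ?thesis using assms
  proof (induction A rule: finite_induct)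
    case empty
    then show ?case by (simp add: L_psi L_in)
  next
    case (insert a A)
    then have "f \<in> A \<rightarrow> carrier L" "f a \<in> carrier L" by auto
    then have "finsum L f (insert a A) = f a \<oplus>\<^bsub>L\<^esub> finsum L f A"
      using insert by (intro m.M.finsum_insert) auto
    then show ?case using insert by (simp add: L_psi L_in)
  qed
qed

lemma finite_dim_L: "finite_dim L"
proof -
  obtain en where en: "bij_betw en {0..<card bidx} bidx"
    using ex_bij_betw_nat_finite[OF finite_bidx] by blast
  let ?n = "card bidx"
  have en_in: "en i \<in> bidx" if "i < ?n" for i using en that by (auto simp: bij_betw_def)
  define b where "b i = (SOME a. a \<in> carrier L \<and> psi a = single (en i) 1)" for i
  have b: "b i \<in> carrier L \<and> psi (b i) = single (en i) 1" if "i < ?n" for i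
  proof -
    have "single (en i) 1 \<in> gspace UNIV" using en_in[OF that] by (simp add: gspace_def)
    then show ?thesis unfolding b_def by (metis (mono_tags, lifting) psi_obtain someI_ex)
  qed
  define \<xi> where "\<xi> i a = lookup (psi a) (en i)" for i a
  have inj: "en i = en j \<longleftrightarrow> i = j" if "i < ?n" "j < ?n" for i j
    using bij_betw_imp_inj_on[OF en] that by (auto simp: inj_on_def)
  have "dual_bases L ?n b \<xi>"
    unfolding dual_bases_def
  proof (intro conjI allI impI ballI)
    fix x assume x: "x \<in> carrier L"
    have fs: "finsum L (\<lambda>i. \<xi> i x \<odot>\<^bsub>L\<^esub> b i) {..<?n} \<in> carrier L"
      "psi (finsum L (\<lambda>i. \<xi> i x \<odot>\<^bsub>L\<^esub> b i) {..<?n}) = (\<Sum>i<?n. psi (\<xi> i x \<odot>\<^bsub>L\<^esub> b i))"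
      using finsum_in_psi[of "{..<?n}" "\<lambda>i. \<xi> i x \<odot>\<^bsub>L\<^esub> b i"] b by (auto simp: L_in)
    have "(\<Sum>i<?n. psi (\<xi> i x \<odot>\<^bsub>L\<^esub> b i)) = (\<Sum>i<?n. single (en i) (lookup (psi x) (en i)))"
      using b by (intro sum.cong) (simp_all add: L_psi \<xi>_def)
    also have "\<dots> = (\<Sum>j\<in>bidx. single j (lookup (psi x) j))"
      using sum.reindex_bij_betw[OF en, of "\<lambda>j. single j (lookup (psi x) j)"]
      by (simp add: atLeast0LessThan)
    also have "\<dots> = psi x"
      using pm_expand[OF finite_bidx, of "psi x"] psi_in[OF x] by (simp add: gspace_def)
    finally show "x = finsum L (\<lambda>i. \<xi> i x \<odot>\<^bsub>L\<^esub> b i) {..<?n}"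
      using fs by (intro psi_eqI x) simp_all
  next
    fix i j assume "i < ?n" "j < ?n"
    then show "\<xi> i (b j) = (if i = j then 1 else 0)"
      using b[of j] inj[of i j] by (auto simp: \<xi>_def lookup_single when_def)
  qed (use b in \<open>auto simp: \<xi>_def L_psi lookup_add\<close>)
  then show ?thesis unfolding finite_dim_def by blast
qed

lemma rep_module_L: "rep_module L dL"
proof (intro rep_module.intro rep_module_axioms.intro module_L finite_dim_L dL_in)
  show "dL (x \<oplus>\<^bsub>L\<^esub> y) = dL x \<oplus>\<^bsub>L\<^esub> dL y" if "x \<in> carrier L" "y \<in> carrier L" for x y
    using that by (intro psi_eqI) (simp_all add: L_in L_psi d_linear)
  show "dL (c \<odot>\<^bsub>L\<^esub> x) = c \<odot>\<^bsub>L\<^esub> dL x" if "x \<in> carrier L" for c x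
    using that by (intro psi_eqI) (simp_all add: L_in L_psi d_linear)
qed

theorem lie_algebra_in_Rep: "lie_algebra_in_Rep_alpha3 L dL"
  unfolding lie_algebra_in_Rep_alpha3_def
proof (intro conjI ballI lie_L finite_dim_L)
  have img: "psi ` part L True = {0}" using super_epi.map_part[OF epi, of True] by (simp add: gpart_def)
  have zero: "x = \<zero>\<^bsub>L\<^esub>" if "x \<in> part L True" for x
  proof (rule psi_eqI[OF _ L_closed(1)])
    show "x \<in> carrier L" using super_epi.part_subset[OF epi] that by blast
    show "psi x = psi \<zero>\<^bsub>L\<^esub>" using img that unfolding psi_simps(1) by blast
  qed
  obtain y where "y \<in> part L True" using img by blast
  then show "part L True = {\<zero>\<^bsub>L\<^esub>}" using zero by blast
  show "restrict dL (carrier L) \<in> linear_maps L L"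
  proof (intro linear_mapsI)
    show "restrict dL (carrier L) \<in> extensional (carrier L)" by simp
    show "restrict dL (carrier L) (x \<oplus>\<^bsub>L\<^esub> y) = restrict dL (carrier L) x \<oplus>\<^bsub>L\<^esub> restrict dL (carrier L) y"
      if "x \<in> carrier L" "y \<in> carrier L" for x y
      using that by (intro psi_eqI) (simp_all add: L_in L_psi d_linear)
    show "restrict dL (carrier L) (c \<odot>\<^bsub>L\<^esub> x) = c \<odot>\<^bsub>L\<^esub> restrict dL (carrier L) x"
      if "x \<in> carrier L" for c x
      using that by (intro psi_eqI) (simp_all add: L_in L_psi d_linear)
  qed (simp add: L_in)
  show "dL (x \<otimes>\<^bsub>L\<^esub> y) = (dL x \<otimes>\<^bsub>L\<^esub> y) \<oplus>\<^bsub>L\<^esub> (x \<otimes>\<^bsub>L\<^esub> dL y)"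
    if "x \<in> carrier L" "y \<in> carrier L" for x y
    using that by (intro psi_eqI) (simp_all add: L_in L_psi d_derivation)
  show "dL (dL (dL x)) = \<zero>\<^bsub>L\<^esub>" if "x \<in> carrier L" for x
    using that by (intro psi_eqI) (simp_all add: L_in L_psi ddd_eq_0 psi_in)
qed

sublocale rm: rep_module L dL by (rule rep_module_L)

lemma lookup_lfun: "lfun L (\<lambda>y. lookup (psi y) i)"
  by (simp add: lfun_def L_psi lookup_add)

lemma dL_eq_0_iff:
  assumes "a \<in> carrier L"
  shows "dL a = \<zero>\<^bsub>L\<^esub> \<longleftrightarrow> d (psi a) = 0"
proof
  assume "dL a = \<zero>\<^bsub>L\<^esub>"
  then have "psi (dL a) = psi \<zero>\<^bsub>L\<^esub>" by (rule arg_cong)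
  then show "d (psi a) = 0" by (simp only: psi_dL[OF assms] psi_simps)
next
  assume "d (psi a) = 0"
  then have "psi (dL a) = psi \<zero>\<^bsub>L\<^esub>" by (simp only: psi_dL[OF assms] psi_simps)
  then show "dL a = \<zero>\<^bsub>L\<^esub>" by (rule psi_eqI[OF dL_in[OF assms] L_closed(1)])
qed

lemma dLdL_eq_0_iff:
  assumes "a \<in> carrier L"
  shows "dL (dL a) = \<zero>\<^bsub>L\<^esub> \<longleftrightarrow> d (d (psi a)) = 0"
  unfolding dL_eq_0_iff[OF dL_in[OF assms]] psi_dL[OF assms] by (rule refl)

text \<open>One direction tests with the coordinates of degree 0 other than \<open>Hb node\<close>;
  the other writes \<open>a\<close> as a value of \<open>dL\<close>.\<close>

lemma negligible_1_iff:
  assumes a: "a \<in> carrier L" "dL a = \<zero>\<^bsub>L\<^esub>"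
  shows "negligible (jordan 1) (jordan_shift 1) L dL (rm.hom1 a) \<longleftrightarrow> comp 0 (psi a) = 0"
  unfolding rm.negligible_hom1[OF a]
proof
  have da: "d (psi a) = 0" using a dL_eq_0_iff by blast
  {
    assume *: "\<forall>g. lfun L g \<and> (\<forall>y\<in>carrier L. g (dL y) = 0) \<longrightarrow> g a = 0"
    show "comp 0 (psi a) = 0"
    proof (rule comp_0_from_lookups[OF psi_in[OF a(1)] da])
      fix i assume "ldeg i = 0" "i \<noteq> Hb node"
      then have "\<forall>y\<in>carrier L. lookup (psi (dL y)) i = 0"
        using lookup_d_deg_0 psi_in by (simp add: psi_dL)
      then show "lookup (psi a) i = 0" using * lookup_lfun by blast
    qed
  next
    assume "comp 0 (psi a) = 0"
    then obtain w where "w \<in> gspace UNIV" "psi a = d w" using ker_image[OF psi_in[OF a(1)] da] by blast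
    then obtain b where "b \<in> carrier L" "psi a = d (psi b)" using psi_obtain by metis
    then have "a = dL b" using a by (intro psi_eqI) (simp_all add: L_in L_psi)
    then show "\<forall>g. lfun L g \<and> (\<forall>y\<in>carrier L. g (dL y) = 0) \<longrightarrow> g a = 0"
      using \<open>b \<in> carrier L\<close> by blast
  }
qed

lemma negligible_2_iff:
  assumes a: "a \<in> carrier L" "dL (dL a) = \<zero>\<^bsub>L\<^esub>"
  shows "negligible (jordan 2) (jordan_shift 2) L dL (rm.hom2 a) \<longleftrightarrow> comp (- 1) (psi a) = 0"
  unfolding rm.negligible_hom2[OF a]
proof
  have dda: "d (d (psi a)) = 0" using a dLdL_eq_0_iff by blast
  {
    assume *: "\<forall>g. lfun L g \<and> (\<forall>y\<in>carrier L. g (dL (dL y)) = 0) \<longrightarrow> g (dL a) + g (dL a) = 0"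
    show "comp (- 1) (psi a) = 0"
    proof (rule comp_odd_from_lookups[OF psi_in[OF a(1)]])
      fix i assume "ldeg i = 1"
      then have "\<forall>y\<in>carrier L. lookup (psi (dL (dL y))) i = 0"
        using lookup_dd_deg_1 psi_in dL_in by (simp add: psi_dL)
      then have "lookup (psi (dL a)) i + lookup (psi (dL a)) i = 0" using * lookup_lfun by blast
      then have "2 * lookup (d (psi a)) i = 0" using a by (simp add: psi_dL)
      then show "lookup (d (psi a)) i = 0" unfolding two_eq by simp
    qed
  next
    assume "comp (- 1) (psi a) = 0"
    then obtain w where "w \<in> gspace UNIV" "d (psi a) = d (d w)"
      using ker_dd_image[OF psi_in[OF a(1)] dda] by blast
    then obtain b where "b \<in> carrier L" "d (psi a) = d (d (psi b))" using psi_obtain by metis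
    then have "dL a = dL (dL b)" using a by (intro psi_eqI) (simp_all add: L_in L_psi)
    then show "\<forall>g. lfun L g \<and> (\<forall>y\<in>carrier L. g (dL (dL y)) = 0) \<longrightarrow> g (dL a) + g (dL a) = 0"
      using \<open>b \<in> carrier L\<close> by simp
  }
qed

end

section \<open>The superalgebra of morphisms and its map to the reduced superalgebra\<close>

context lattice_copy
begin

abbreviation HL where "HL \<equiv> hom_superalgebra L dL"

definition hpair :: "'a \<Rightarrow> 'a \<Rightarrow> ((nat \<Rightarrow> 'k) \<Rightarrow> 'a) \<times> ((nat \<Rightarrow> 'k) \<Rightarrow> 'a)" where
  "hpair a b = (rm.hom1 a, rm.hom2 b)"

text \<open>Describes the morphism superalgebra by images of generators: \<open>a\<close> for J_1
  and \<open>b\<close> for J_2. The conditions are those under which \<open>hom1 a\<close> and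
  \<open>hom2 b\<close> are morphisms, read in the model.\<close>

definition adm :: "'a \<Rightarrow> 'a \<Rightarrow> bool" where
  "adm a b \<longleftrightarrow> a \<in> carrier L \<and> b \<in> carrier L \<and> d (psi a) = 0 \<and> d (d (psi b)) = 0"

lemma admD:
  assumes "adm a b"
  shows "a \<in> carrier L" "b \<in> carrier L" "d (psi a) = 0" "d (d (psi b)) = 0"
    "dL a = \<zero>\<^bsub>L\<^esub>" "dL (dL b) = \<zero>\<^bsub>L\<^esub>"
  using assms dL_eq_0_iff[of a] dLdL_eq_0_iff[of b] by (simp_all only: adm_def)

lemma HL_simps:
  "carrier HL = rm.Hom1 \<times> rm.Hom2"
  "\<zero>\<^bsub>HL\<^esub> = (\<lambda>x\<in>carrier (jordan 1). \<zero>\<^bsub>L\<^esub>, \<lambda>x\<in>carrier (jordan 2). \<zero>\<^bsub>L\<^esub>)"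
  "(f, u) \<oplus>\<^bsub>HL\<^esub> (g, w) = (\<lambda>x\<in>carrier (jordan 1). f x \<oplus>\<^bsub>L\<^esub> g x,
      \<lambda>x\<in>carrier (jordan 2). u x \<oplus>\<^bsub>L\<^esub> w x)"
  "c \<odot>\<^bsub>HL\<^esub> (f, u) = (\<lambda>x\<in>carrier (jordan 1). c \<odot>\<^bsub>L\<^esub> f x,
      \<lambda>x\<in>carrier (jordan 2). c \<odot>\<^bsub>L\<^esub> u x)"
  "(f, u) \<otimes>\<^bsub>HL\<^esub> (g, w) = (\<lambda>x\<in>carrier (jordan 1). x 0 \<odot>\<^bsub>L\<^esub>
      ((f (jvec 0) \<otimes>\<^bsub>L\<^esub> g (jvec 0)) \<oplus>\<^bsub>L\<^esub>
      ((\<ominus>\<^bsub>L\<^esub> (u (jvec 0) \<otimes>\<^bsub>L\<^esub> w (jvec 1))) \<oplus>\<^bsub>L\<^esub> (u (jvec 1) \<otimes>\<^bsub>L\<^esub> w (jvec 0)))),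
      \<lambda>x\<in>carrier (jordan 2). (f (jvec 0) \<otimes>\<^bsub>L\<^esub> w x) \<oplus>\<^bsub>L\<^esub> (u x \<otimes>\<^bsub>L\<^esub> g (jvec 0)))"
  "part HL p = (if p then {\<lambda>x\<in>carrier (jordan 1). \<zero>\<^bsub>L\<^esub>} \<times> rm.Hom2
      else rm.Hom1 \<times> {\<lambda>x\<in>carrier (jordan 2). \<zero>\<^bsub>L\<^esub>})"
  by (simp_all only: hom_superalgebra_def Let_def partial_object.simps monoid.simps ring.simps
      module.simps superalgebra.simps prod.case)

lemma hpair_mem: "adm a b \<Longrightarrow> hpair a b \<in> carrier HL"
  unfolding hpair_def HL_simps
  by (intro SigmaI rm.hom1_mem rm.hom2_mem admD)

lemma HL_E:
  assumes "x \<in> carrier HL"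
  obtains a b where "adm a b" "x = hpair a b"
proof -
  obtain f u where x: "x = (f, u)" "f \<in> rm.Hom1" "u \<in> rm.Hom2"
    using assms unfolding HL_simps by (elim SigmaE)
  obtain a where a: "a \<in> carrier L" "dL a = \<zero>\<^bsub>L\<^esub>" "f = rm.hom1 a" using x(2) by (rule rm.Hom1E)
  obtain b where b: "b \<in> carrier L" "dL (dL b) = \<zero>\<^bsub>L\<^esub>" "u = rm.hom2 b" using x(3) by (rule rm.Hom2E)
  have "adm a b"
    using a(1,2) b(1,2) dL_eq_0_iff[OF a(1)] dLdL_eq_0_iff[OF b(1)] by (simp only: adm_def)
  then show thesis by (rule that) (simp only: hpair_def x(1) a(3) b(3))
qed

lemma adm_zero: "adm \<zero>\<^bsub>L\<^esub> \<zero>\<^bsub>L\<^esub>"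
  by (simp add: adm_def L_closed psi_simps d_linear)

lemma HL_zero: "\<zero>\<^bsub>HL\<^esub> = hpair \<zero>\<^bsub>L\<^esub> \<zero>\<^bsub>L\<^esub>"
  and hom_zero: "rm.hom1 \<zero>\<^bsub>L\<^esub> = (\<lambda>x\<in>carrier (jordan 1). \<zero>\<^bsub>L\<^esub>)"
    "rm.hom2 \<zero>\<^bsub>L\<^esub> = (\<lambda>x\<in>carrier (jordan 2). \<zero>\<^bsub>L\<^esub>)"
proof -
  show 1: "rm.hom1 \<zero>\<^bsub>L\<^esub> = (\<lambda>x\<in>carrier (jordan 1). \<zero>\<^bsub>L\<^esub>)"
    unfolding rm.hom1_def
    by (rule restrict_ext, rule psi_eqI) (simp_all add: L_in L_psi)
  show 2: "rm.hom2 \<zero>\<^bsub>L\<^esub> = (\<lambda>x\<in>carrier (jordan 2). \<zero>\<^bsub>L\<^esub>)"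
    unfolding rm.hom2_def
    by (rule restrict_ext, rule psi_eqI) (simp_all add: L_in L_psi d_linear)
  show "\<zero>\<^bsub>HL\<^esub> = hpair \<zero>\<^bsub>L\<^esub> \<zero>\<^bsub>L\<^esub>" by (simp only: HL_simps hpair_def 1 2)
qed

lemma HL_add:
  assumes "adm a b" "adm a' b'"
  shows "hpair a b \<oplus>\<^bsub>HL\<^esub> hpair a' b' = hpair (a \<oplus>\<^bsub>L\<^esub> a') (b \<oplus>\<^bsub>L\<^esub> b')"
proof -
  note [simp] = admD(1,2)[OF assms(1)] admD(1,2)[OF assms(2)]
  have "(\<lambda>x\<in>carrier (jordan 1). rm.hom1 a x \<oplus>\<^bsub>L\<^esub> rm.hom1 a' x) = rm.hom1 (a \<oplus>\<^bsub>L\<^esub> a')"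
    unfolding rm.hom1_def
    by (rule restrict_ext, simp only: restrict_apply', rule psi_eqI)
      (simp_all add: L_in L_psi pm.scale_right_distrib)
  moreover have "(\<lambda>x\<in>carrier (jordan 2). rm.hom2 b x \<oplus>\<^bsub>L\<^esub> rm.hom2 b' x) = rm.hom2 (b \<oplus>\<^bsub>L\<^esub> b')"
    unfolding rm.hom2_def
    by (rule restrict_ext, simp only: restrict_apply', rule psi_eqI)
      (simp_all add: L_in L_psi pm.scale_right_distrib d_linear)
  ultimately show ?thesis by (simp only: hpair_def HL_simps)
qed

lemma HL_smult:
  assumes "adm a b"
  shows "c \<odot>\<^bsub>HL\<^esub> hpair a b = hpair (c \<odot>\<^bsub>L\<^esub> a) (c \<odot>\<^bsub>L\<^esub> b)"
proof -
  note [simp] = admD(1,2)[OF assms(1)]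
  have "(\<lambda>x\<in>carrier (jordan 1). c \<odot>\<^bsub>L\<^esub> rm.hom1 a x) = rm.hom1 (c \<odot>\<^bsub>L\<^esub> a)"
    unfolding rm.hom1_def
    by (rule restrict_ext, simp only: restrict_apply', rule psi_eqI)
      (simp_all add: L_in L_psi mult.commute)
  moreover have "(\<lambda>x\<in>carrier (jordan 2). c \<odot>\<^bsub>L\<^esub> rm.hom2 b x) = rm.hom2 (c \<odot>\<^bsub>L\<^esub> b)"
    unfolding rm.hom2_def
    by (rule restrict_ext, simp only: restrict_apply', rule psi_eqI)
      (simp_all add: L_in L_psi pm.scale_right_distrib d_linear mult.commute)
  ultimately show ?thesis by (simp only: hpair_def HL_simps)
qed

definition even_product :: "'a \<Rightarrow> 'a \<Rightarrow> 'a \<Rightarrow> 'a \<Rightarrow> 'a" where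
  "even_product a b a' b' = (a \<otimes>\<^bsub>L\<^esub> a') \<oplus>\<^bsub>L\<^esub> ((\<ominus>\<^bsub>L\<^esub> (b \<otimes>\<^bsub>L\<^esub> dL b')) \<oplus>\<^bsub>L\<^esub> (dL b \<otimes>\<^bsub>L\<^esub> b'))"

definition odd_product :: "'a \<Rightarrow> 'a \<Rightarrow> 'a \<Rightarrow> 'a \<Rightarrow> 'a" where
  "odd_product a b a' b' = (a \<otimes>\<^bsub>L\<^esub> b') \<oplus>\<^bsub>L\<^esub> (b \<otimes>\<^bsub>L\<^esub> a')"

lemma HL_mult:
  assumes "adm a b" "adm a' b'"
  shows "hpair a b \<otimes>\<^bsub>HL\<^esub> hpair a' b' = hpair (even_product a b a' b') (odd_product a b a' b')"
proof -
  note [simp] = admD[OF assms(1)] admD[OF assms(2)]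
  have "(\<lambda>x\<in>carrier (jordan 2). (a \<otimes>\<^bsub>L\<^esub> rm.hom2 b' x) \<oplus>\<^bsub>L\<^esub> (rm.hom2 b x \<otimes>\<^bsub>L\<^esub> a')) =
      rm.hom2 (odd_product a b a' b')"
    unfolding rm.hom2_def odd_product_def
    by (rule restrict_ext, simp only: restrict_apply', rule psi_eqI)
      (simp_all add: L_in L_psi pm.scale_right_distrib d_linear d_derivation l.linear_simps)
  moreover have "rm.hom1 a (jvec 0) = a" "rm.hom1 a' (jvec 0) = a'" "rm.hom2 b (jvec 0) = b"
    "rm.hom2 b' (jvec 0) = b'" "rm.hom2 b (jvec 1) = dL b" "rm.hom2 b' (jvec 1) = dL b'"
    by (intro rm.hom1_jvec rm.hom2_jvec admD[OF assms(1)] admD[OF assms(2)])+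
  ultimately show ?thesis
    by (simp only: hpair_def HL_simps even_product_def rm.hom1_def[of "even_product a b a' b'", unfolded even_product_def])
qed

lemma psi_even_product:
  assumes "adm a b" "adm a' b'"
  shows "even_product a b a' b' \<in> carrier L"
    "psi (even_product a b a' b') = lbr (psi a) (psi a') + qb (psi b) (psi b')"
  using admD(1,2)[OF assms(1)] admD(1,2)[OF assms(2)]
  by (simp_all add: even_product_def L_in L_psi qb_def)

lemma psi_odd_product:
  assumes "adm a b" "adm a' b'"
  shows "odd_product a b a' b' \<in> carrier L"
    "psi (odd_product a b a' b') = lbr (psi a) (psi b') + lbr (psi b) (psi a')"
  using admD(1,2)[OF assms(1)] admD(1,2)[OF assms(2)]
  by (simp_all add: odd_product_def L_in L_psi)

lemma adm_product:
  assumes "adm a b" "adm a' b'"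
  shows "adm (even_product a b a' b') (odd_product a b a' b')"
  unfolding adm_def psi_even_product(2)[OF assms] psi_odd_product(2)[OF assms] qb_def
  using psi_even_product(1)[OF assms] psi_odd_product(1)[OF assms]
    admD(3,4)[OF assms(1)] admD(3,4)[OF assms(2)]
  by (simp add: d_linear d_derivation)

lemma adm_add: "adm a b \<Longrightarrow> adm a' b' \<Longrightarrow> adm (a \<oplus>\<^bsub>L\<^esub> a') (b \<oplus>\<^bsub>L\<^esub> b')"
  by (simp add: adm_def L_closed psi_simps d_linear)

lemma adm_smult: "adm a b \<Longrightarrow> adm (c \<odot>\<^bsub>L\<^esub> a) (c \<odot>\<^bsub>L\<^esub> b)"
  by (simp add: adm_def L_closed psi_simps d_linear)

text \<open>Keeps the components that survive modulo negligible morphisms: degree 0 of the even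
  vector and degree -1 of the odd one.\<close>

definition red :: "((nat \<Rightarrow> 'k) \<Rightarrow> 'a) \<times> ((nat \<Rightarrow> 'k) \<Rightarrow> 'a) \<Rightarrow> ('n lidx \<Rightarrow>\<^sub>0 'k)" where
  "red x = comp 0 (psi (fst x (jvec 0))) + comp (- 1) (psi (snd x (jvec 0)))"

lemma red_hpair:
  assumes "adm a b"
  shows "red (hpair a b) = comp 0 (psi a) + comp (- 1) (psi b)"
  by (simp only: red_def hpair_def fst_conv snd_conv rm.hom1_jvec[OF admD(1)[OF assms]]
      rm.hom2_jvec(1)[OF admD(2)[OF assms]])

lemma adm_comps:
  assumes "adm a b"
  shows "comp 0 (psi a) \<in> cent" "comp (- 1) (psi b) \<in> gr (- 1)" "psi a \<in> filt 0" "psi b \<in> filt (- 1)"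
    "d (psi b) \<in> filt 1"
proof -
  note a = psi_in[OF admD(1)[OF assms]] and b = psi_in[OF admD(2)[OF assms]]
  show "comp 0 (psi a) \<in> cent" by (rule ker_low_comps(3)[OF a admD(3)[OF assms]])
  show "comp (- 1) (psi b) \<in> gr (- 1)" by (rule comp_in_gr[OF b])
  show "psi a \<in> filt 0"
    by (rule filt_from_comps(2)[OF a ker_low_comps(1,2)[OF a admD(3)[OF assms]]])
  show fb: "psi b \<in> filt (- 1)"
    by (rule filt_from_comps(1)[OF b ker_dd_low_comp[OF b admD(4)[OF assms]]])
  have "EE th \<in> filt 2" by (simp add: filt_def)
  then show "d (psi b) \<in> filt 1" using lbr_filt[OF _ fb, of "EE th" 2] by (simp add: d_def)
qed

lemma cent_Int_odd:
  assumes "u \<in> cent" "w \<in> gr (- 1)" "u + w = 0"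
  shows "u = 0" "w = 0"
proof -
  have "comp 0 (u + w) = u" using comp_gr[OF cent_gr[OF assms(1)], of 0] comp_gr[OF assms(2), of 0]
    by (simp add: comp_linear)
  then show "u = 0" using assms(3) by (simp add: comp_linear)
  then show "w = 0" using assms(3) by simp
qed

text \<open>By \<open>adm_comps\<close> no components lie below those kept, so
  \<open>comp_lbr_filt\<close> lets the bracket be computed on them; in the odd bracket
  \<open>d\<close> raises the lowest degree from -1 to 1.\<close>

lemma red_mult:
  assumes "adm a b" "adm a' b'"
  shows "red (hpair a b \<otimes>\<^bsub>HL\<^esub> hpair a' b') = rbr (red (hpair a b)) (red (hpair a' b'))"
proof -
  let ?a = "comp 0 (psi a)" and ?b = "comp (- 1) (psi b)"
  let ?a' = "comp 0 (psi a')" and ?b' = "comp (- 1) (psi b')"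
  note A = adm_comps[OF assms(1)] and A' = adm_comps[OF assms(2)]
  have db: "comp 1 (d (psi b)) = d ?b" "comp 1 (d (psi b')) = d ?b'"
    using comp_d[OF psi_in[OF admD(2)[OF assms(1)]], of "- 1"]
      comp_d[OF psi_in[OF admD(2)[OF assms(2)]], of "- 1"] by simp_all
  have "comp 0 (lbr (psi a) (psi a')) = lbr ?a ?a'"
    using comp_lbr_filt[OF A(3) A'(3)] by simp
  moreover have "comp 0 (qb (psi b) (psi b')) = qb ?b ?b'"
    using comp_lbr_filt[OF A(5) A'(4)] comp_lbr_filt[OF A(4) A'(5)]
    by (simp add: qb_def comp_linear db)
  moreover have "comp (- 1) (lbr (psi a) (psi b')) = lbr ?a ?b'"
    using comp_lbr_filt[OF A(3) A'(4)] by simp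
  moreover have "comp (- 1) (lbr (psi b) (psi a')) = lbr ?b ?a'"
    using comp_lbr_filt[OF A(4) A'(3)] by simp
  ultimately have "red (hpair a b \<otimes>\<^bsub>HL\<^esub> hpair a' b') = (lbr ?a ?a' + qb ?b ?b') + (lbr ?a ?b' + lbr ?b ?a')"
    unfolding HL_mult[OF assms] red_hpair[OF adm_product[OF assms]] psi_even_product(2)[OF assms]
      psi_odd_product(2)[OF assms]
    by (simp add: comp_linear)
  also have "\<dots> = rbr ?a ?a' + rbr ?a ?b' + (rbr ?b ?a' + rbr ?b ?b')"
    using cent_gr[OF A(1)] cent_gr[OF A'(1)] A(2) A'(2) by (simp add: rbr_simps)
  also have "\<dots> = rbr (?a + ?b) (?a' + ?b')"
    by (simp add: r.linear_simps algebra_simps)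
  finally show ?thesis by (simp only: red_hpair[OF assms(1)] red_hpair[OF assms(2)])
qed

lemma red_surj:
  assumes "u \<in> cent" "w \<in> gr (- 1)"
  obtains a b where "adm a b" "psi a = u" "psi b = w" "red (hpair a b) = u + w"
proof -
  obtain a where a: "a \<in> carrier L" "psi a = u"
    using assms(1) cent_gr gr_gspace by (metis psi_obtain subsetD)
  obtain b where b: "b \<in> carrier L" "psi b = w"
    using assms(2) gr_gspace by (metis psi_obtain subsetD)
  have adm: "adm a b" using a b assms cent_d dd_odd by (simp add: adm_def)
  moreover have "red (hpair a b) = u + w"
    using comp_gr[OF cent_gr[OF assms(1)], of 0] comp_gr[OF assms(2), of "- 1"]
    by (simp add: red_hpair[OF adm] a b)
  ultimately show thesis using that a b by blast
qed

lemma super_epi_red: "super_epi red HL (model_alg rcarrier rbr rpart)"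
proof (rule super_epi.intro; (unfold model_alg_simps)?)
  show "\<zero>\<^bsub>HL\<^esub> \<in> carrier HL" unfolding HL_zero by (rule hpair_mem[OF adm_zero])
  show "red \<zero>\<^bsub>HL\<^esub> = 0" unfolding HL_zero red_hpair[OF adm_zero] by (simp add: psi_simps comp_linear)
next
  fix x y assume "x \<in> carrier HL" "y \<in> carrier HL"
  then obtain a b a' b' where x: "adm a b" "x = hpair a b" and y: "adm a' b'" "y = hpair a' b'"
    by (metis HL_E)
  show "x \<oplus>\<^bsub>HL\<^esub> y \<in> carrier HL"
    unfolding x(2) y(2) HL_add[OF x(1) y(1)] by (rule hpair_mem[OF adm_add[OF x(1) y(1)]])
  show "red (x \<oplus>\<^bsub>HL\<^esub> y) = red x + red y"
    unfolding x(2) y(2) HL_add[OF x(1) y(1)] red_hpair[OF x(1)] red_hpair[OF y(1)]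
      red_hpair[OF adm_add[OF x(1) y(1)]]
    using admD(1,2)[OF x(1)] admD(1,2)[OF y(1)] by (simp add: psi_simps comp_linear)
  show "x \<otimes>\<^bsub>HL\<^esub> y \<in> carrier HL"
    unfolding x(2) y(2) HL_mult[OF x(1) y(1)] by (rule hpair_mem[OF adm_product[OF x(1) y(1)]])
  show "red (x \<otimes>\<^bsub>HL\<^esub> y) = rbr (red x) (red y)"
    unfolding x(2) y(2) by (rule red_mult[OF x(1) y(1)])
  obtain i where i: "i \<in> carrier L" "i \<oplus>\<^bsub>L\<^esub> a' = a"
    using super_epi.solvable[OF epi admD(1)[OF x(1)] admD(1)[OF y(1)]] by (elim bexE)
  obtain j where j: "j \<in> carrier L" "j \<oplus>\<^bsub>L\<^esub> b' = b"
    using super_epi.solvable[OF epi admD(2)[OF x(1)] admD(2)[OF y(1)]] by (elim bexE)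
  have "psi a = psi i + psi a'" "psi b = psi j + psi b'"
    using psi_simps(2)[OF i(1) admD(1)[OF y(1)]] psi_simps(2)[OF j(1) admD(2)[OF y(1)]]
    by (simp_all only: i(2) j(2))
  then have "psi i = psi a - psi a'" "psi j = psi b - psi b'" by simp_all
  then have adm: "adm i j"
    using i j admD(3,4)[OF x(1)] admD(3,4)[OF y(1)] by (simp add: adm_def d_linear)
  have "hpair i j \<oplus>\<^bsub>HL\<^esub> y = x" unfolding x(2) y(2) HL_add[OF adm y(1)] i(2) j(2) by (rule refl)
  then show "\<exists>i\<in>carrier HL. i \<oplus>\<^bsub>HL\<^esub> y = x" using hpair_mem[OF adm] by blast
next
  fix x c assume "x \<in> carrier HL"
  then obtain a b where x: "adm a b" "x = hpair a b" by (rule HL_E)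
  show "c \<odot>\<^bsub>HL\<^esub> x \<in> carrier HL"
    unfolding x(2) HL_smult[OF x(1)] by (rule hpair_mem[OF adm_smult[OF x(1)]])
  show "red (c \<odot>\<^bsub>HL\<^esub> x) = pscale c (red x)"
    unfolding x(2) HL_smult[OF x(1)] red_hpair[OF x(1)] red_hpair[OF adm_smult[OF x(1)]]
    using admD(1,2)[OF x(1)] by (simp add: psi_simps comp_linear pm.scale_right_distrib)
next
  show "red ` carrier HL = rcarrier"
  proof (intro equalityI subsetI)
    fix v assume "v \<in> red ` carrier HL"
    then obtain x where "x \<in> carrier HL" "v = red x" by blast
    then obtain a b where x: "adm a b" "v = red (hpair a b)" by (metis HL_E)
    show "v \<in> rcarrier" unfolding x(2) red_hpair[OF x(1)] rcarrier_iff
      using adm_comps(1,2)[OF x(1)] by blast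
  next
    fix v assume "v \<in> rcarrier"
    then obtain u w where "u \<in> cent" "w \<in> gr (- 1)" "v = u + w" unfolding rcarrier_iff by blast
    then obtain a b where "adm a b" "v = red (hpair a b)" by (metis red_surj)
    then show "v \<in> red ` carrier HL" using hpair_mem by blast
  qed
next
  fix p
  have adm_even: "adm a \<zero>\<^bsub>L\<^esub>" if "a \<in> carrier L" "dL a = \<zero>\<^bsub>L\<^esub>" for a
    using that dL_eq_0_iff[OF that(1)] by (simp add: adm_def L_closed psi_simps d_linear)
  have adm_odd: "adm \<zero>\<^bsub>L\<^esub> b" if "b \<in> carrier L" "dL (dL b) = \<zero>\<^bsub>L\<^esub>" for b
    using that dLdL_eq_0_iff[OF that(1)] by (simp add: adm_def L_closed psi_simps d_linear)
  have H1: "rm.Hom1 = rm.hom1 ` {a. adm a \<zero>\<^bsub>L\<^esub>}"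
  proof (intro equalityI subsetI)
    fix f assume "f \<in> rm.Hom1"
    then obtain a where "a \<in> carrier L" "dL a = \<zero>\<^bsub>L\<^esub>" "f = rm.hom1 a" by (rule rm.Hom1E)
    then show "f \<in> rm.hom1 ` {a. adm a \<zero>\<^bsub>L\<^esub>}" using adm_even by blast
  next
    fix f assume "f \<in> rm.hom1 ` {a. adm a \<zero>\<^bsub>L\<^esub>}"
    then obtain a where a: "adm a \<zero>\<^bsub>L\<^esub>" "f = rm.hom1 a" by blast
    show "f \<in> rm.Hom1" unfolding a(2) by (rule rm.hom1_mem[OF admD(1,5)[OF a(1)]])
  qed
  have H2: "rm.Hom2 = rm.hom2 ` {b. adm \<zero>\<^bsub>L\<^esub> b}"
  proof (intro equalityI subsetI)
    fix f assume "f \<in> rm.Hom2"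
    then obtain b where "b \<in> carrier L" "dL (dL b) = \<zero>\<^bsub>L\<^esub>" "f = rm.hom2 b" by (rule rm.Hom2E)
    then show "f \<in> rm.hom2 ` {b. adm \<zero>\<^bsub>L\<^esub> b}" using adm_odd by blast
  next
    fix f assume "f \<in> rm.hom2 ` {b. adm \<zero>\<^bsub>L\<^esub> b}"
    then obtain b where b: "adm \<zero>\<^bsub>L\<^esub> b" "f = rm.hom2 b" by blast
    show "f \<in> rm.Hom2" unfolding b(2) by (rule rm.hom2_mem[OF admD(2,6)[OF b(1)]])
  qed
  have part: "part HL p = {hpair a b |a b. adm a b \<and> (if p then a = \<zero>\<^bsub>L\<^esub> else b = \<zero>\<^bsub>L\<^esub>)}"
    unfolding HL_simps(6) hom_zero[symmetric] hpair_def H1 H2 by (cases p) auto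
  show "part HL p \<subseteq> carrier HL" unfolding part using hpair_mem by blast
  show "red ` part HL p = rpart p"
  proof (intro equalityI subsetI)
    fix v assume "v \<in> red ` part HL p"
    then obtain a b where ab: "adm a b" "if p then a = \<zero>\<^bsub>L\<^esub> else b = \<zero>\<^bsub>L\<^esub>" "v = red (hpair a b)"
      unfolding part by blast
    then show "v \<in> rpart p" using adm_comps(1,2)[OF ab(1)] red_hpair[OF ab(1)]
      by (cases p) (simp_all add: rpart_def psi_simps comp_linear)
  next
    fix v assume v: "v \<in> rpart p"
    have z: "0 \<in> cent" "0 \<in> gr (- 1)"
      using pm.subspace_0[OF cent_subspace] pm.subspace_0[OF gr_subspace] by blast+
    have zero: "a = \<zero>\<^bsub>L\<^esub>" if "a \<in> carrier L" "psi a = 0" for a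
      using that psi_simps(1) L_closed(1) by (intro psi_eqI) simp_all
    show "v \<in> red ` part HL p"
    proof (cases p)
      case True
      then have "v \<in> gr (- 1)" using v by (simp add: rpart_def)
      from red_surj[OF z(1) this] obtain a b where "adm a b" "psi a = 0" "red (hpair a b) = 0 + v"
        by metis
      moreover from this have "a = \<zero>\<^bsub>L\<^esub>" using zero admD(1) by blast
      ultimately show ?thesis unfolding part using True by force
    next
      case False
      then have "v \<in> cent" using v by (simp add: rpart_def)
      from red_surj[OF this z(2)] obtain a b where "adm a b" "psi b = 0" "red (hpair a b) = v + 0"
        by metis
      moreover from this have "b = \<zero>\<^bsub>L\<^esub>" using zero admD(2) by blast
      ultimately show ?thesis unfolding part using False by force
    qed
  qed
qed

lemma super_epi_lie_red: "super_epi_lie red HL (model_alg rcarrier rbr rpart)"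
  by (intro super_epi_lie.intro super_epi_red lie_superalgebra_reduction)

text \<open>\<open>red\<close> vanishes only if both components do, because \<open>cent\<close> and
  degree -1 meet in 0; by \<open>negligible_1_iff\<close> and \<open>negligible_2_iff\<close> this
  is negligibility of both morphisms.\<close>

lemma ker_red: "super_epi.ker red HL (model_alg rcarrier rbr rpart) =
  {(f, u). negligible (jordan 1) (jordan_shift 1) L dL f \<and> negligible (jordan 2) (jordan_shift 2) L dL u}"
  (is "?K = ?N")
proof -
  have K: "x \<in> ?K \<longleftrightarrow> x \<in> carrier HL \<and> red x = 0" for x
    unfolding super_epi.ker_def[OF super_epi_red] by simp
  have N: "x \<in> carrier HL" if "x \<in> ?N" for x
    using that unfolding HL_simps(1) negligible_def by blast
  have "x \<in> ?K \<longleftrightarrow> x \<in> ?N" if mem: "x \<in> carrier HL" for x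
  proof -
    from mem obtain a b where x: "adm a b" "x = hpair a b" by (rule HL_E)
    note ab = admD[OF x(1)]
    have "x \<in> ?N \<longleftrightarrow> comp 0 (psi a) = 0 \<and> comp (- 1) (psi b) = 0"
      unfolding x(2) hpair_def mem_Collect_eq prod.case
        negligible_1_iff[OF ab(1,5)] negligible_2_iff[OF ab(2,6)] by (rule refl)
    also have "\<dots> \<longleftrightarrow> red x = 0"
      unfolding x(2) red_hpair[OF x(1)] using cent_Int_odd[OF adm_comps(1,2)[OF x(1)]] by auto
    finally show ?thesis unfolding K using mem by blast
  qed
  then show ?thesis using K N by blast
qed

theorem semisimplification_iso:
  obtains \<theta> where "super_iso \<theta> (semisimplification L dL) (model_alg rcarrier rbr rpart)"
proof -
  have "super_iso (super_epi.quotient_map red) (semisimplification L dL) (model_alg rcarrier rbr rpart)"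
    using super_epi_lie.super_iso_quotient_map[OF super_epi_lie_red]
    unfolding semisimplification_def ker_red .
  then show thesis by (rule that)
qed

end

section \<open>The root lattice of type E7\<close>

text \<open>Take \<open>f\<close> followed by the inverse of \<open>g\<close>; each identity is
  checked after applying the injective \<open>g\<close>.\<close>

lemma super_iso_comp:
  assumes f: "super_iso f D Y" and g: "super_iso g D' Y"
  shows "D \<cong>\<^sub>s D'"
proof -
  interpret f: super_iso f D Y by (rule f)
  interpret g: super_iso g D' Y by (rule g)
  let ?h = "\<lambda>x. inv_into (carrier D') g (f x)"
  have gh: "g (?h x) = f x" and h_in: "?h x \<in> carrier D'" if "x \<in> carrier D" for x
  proof -
    have "f x \<in> g ` carrier D'" using f.map_in[OF that] by (simp only: g.map_carrier)
    then show "g (?h x) = f x" "?h x \<in> carrier D'" by (rule f_inv_into_f inv_into_into)+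
  qed
  have eq: "?h x = y" if "x \<in> carrier D" "y \<in> carrier D'" "f x = g y" for x y
    using g.eq_iff[OF h_in[OF that(1)] that(2)] gh[OF that(1)] that(3) by simp
  have surj: "\<exists>x\<in>carrier D. f x = g y" if "y \<in> carrier D'" for y
  proof -
    have "g y \<in> f ` carrier D" using g.map_in[OF that] by (simp only: f.map_carrier)
    then show ?thesis by (metis imageE)
  qed
  have part: "?h ` part D p = part D' p" for p
  proof (intro equalityI subsetI)
    fix y assume "y \<in> ?h ` part D p"
    then obtain x where x: "x \<in> part D p" "y = ?h x" by blast
    then have xD: "x \<in> carrier D" using f.part_subset by blast
    have "g y \<in> part Y p" unfolding x(2) gh[OF xD] using f.mem_part_iff[OF xD] x(1) by blast
    then show "y \<in> part D' p" using g.mem_part_iff h_in[OF xD] x(2) by blast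
  next
    fix y assume y: "y \<in> part D' p"
    then have yD: "y \<in> carrier D'" using g.part_subset by blast
    obtain x where x: "x \<in> carrier D" "f x = g y" using surj[OF yD] by blast
    have "f x \<in> part Y p" unfolding x(2) using g.mem_part_iff[OF yD] y by blast
    then have "x \<in> part D p" using f.mem_part_iff[OF x(1)] by blast
    then show "y \<in> ?h ` part D p" using eq[OF x(1) yD x(2)] by blast
  qed
  have "bij_betw ?h (carrier D) (carrier D')"
  proof (rule bij_betwI')
    fix x y assume "x \<in> carrier D" "y \<in> carrier D"
    then show "?h x = ?h y \<longleftrightarrow> x = y" using gh f.eq_iff by metis
  next
    fix y assume y: "y \<in> carrier D'"
    obtain x where x: "x \<in> carrier D" "f x = g y" using surj[OF y] by blast
    then show "\<exists>x\<in>carrier D. y = ?h x" using eq[OF x(1) y x(2)] by blast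
  qed (rule h_in)
  moreover have "?h (x \<oplus>\<^bsub>D\<^esub> y) = ?h x \<oplus>\<^bsub>D'\<^esub> ?h y" "?h (x \<otimes>\<^bsub>D\<^esub> y) = ?h x \<otimes>\<^bsub>D'\<^esub> ?h y"
    if xy: "x \<in> carrier D" "y \<in> carrier D" for x y
  proof -
    show "?h (x \<oplus>\<^bsub>D\<^esub> y) = ?h x \<oplus>\<^bsub>D'\<^esub> ?h y"
      by (rule eq[OF f.add_closed[OF xy] g.add_closed[OF h_in[OF xy(1)] h_in[OF xy(2)]]])
        (simp only: f.map_add[OF xy] g.map_add[OF h_in[OF xy(1)] h_in[OF xy(2)]] gh[OF xy(1)] gh[OF xy(2)])
    show "?h (x \<otimes>\<^bsub>D\<^esub> y) = ?h x \<otimes>\<^bsub>D'\<^esub> ?h y"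
      by (rule eq[OF f.mult_closed[OF xy] g.mult_closed[OF h_in[OF xy(1)] h_in[OF xy(2)]]])
        (simp only: f.map_mult[OF xy] g.map_mult[OF h_in[OF xy(1)] h_in[OF xy(2)]] gh[OF xy(1)] gh[OF xy(2)])
  qed
  moreover have "?h (c \<odot>\<^bsub>D\<^esub> x) = c \<odot>\<^bsub>D'\<^esub> ?h x" if x: "x \<in> carrier D" for c x
    by (rule eq[OF f.scale_closed[OF x] g.scale_closed[OF h_in[OF x]]])
      (simp only: f.map_smult[OF x] g.map_smult[OF h_in[OF x]] gh[OF x])
  ultimately show ?thesis unfolding superalgebra_iso_def using part by (intro exI[of _ ?h]) blast
qed

lemma exhaust_7: fixes x :: 7 shows "x = 1 \<or> x = 2 \<or> x = 3 \<or> x = 4 \<or> x = 5 \<or> x = 6 \<or> x = 7"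
proof (induct x)
  case (of_int z)
  then have "0 \<le> z" "z < 7" by simp_all
  then have "z = 0 \<or> z = 1 \<or> z = 2 \<or> z = 3 \<or> z = 4 \<or> z = 5 \<or> z = 6" by arith
  then show ?case by auto
qed

lemma exhaust_6: fixes x :: 6 shows "x = 1 \<or> x = 2 \<or> x = 3 \<or> x = 4 \<or> x = 5 \<or> x = 6"
proof (induct x)
  case (of_int z)
  then have "0 \<le> z" "z < 6" by simp_all
  then have "z = 0 \<or> z = 1 \<or> z = 2 \<or> z = 3 \<or> z = 4 \<or> z = 5" by arith
  then show ?case by auto
qed

lemma UNIV_7: "UNIV = {1, 2, 3, 4, 5, 6, 7 :: 7}"
proof (rule UNIV_eq_I)
  show "x \<in> {1, 2, 3, 4, 5, 6, 7}" for x :: 7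
    using exhaust_7[of x] by (simp only: insert_iff empty_iff simp_thms)
qed

lemma UNIV_6: "UNIV = {1, 2, 3, 4, 5, 6 :: 6}"
proof (rule UNIV_eq_I)
  show "x \<in> {1, 2, 3, 4, 5, 6}" for x :: 6
    using exhaust_6[of x] by (simp only: insert_iff empty_iff simp_thms)
qed

lemma forall_7: "(\<forall>i::7. P i) \<longleftrightarrow> P 1 \<and> P 2 \<and> P 3 \<and> P 4 \<and> P 5 \<and> P 6 \<and> P 7"
proof -
  have "(\<forall>i::7. P i) \<longleftrightarrow> (\<forall>i\<in>UNIV. P i)" by (simp only: ball_UNIV)
  then show ?thesis unfolding UNIV_7 by (simp only: ball_simps simp_thms)
qed

lemma forall_6: "(\<forall>i::6. P i) \<longleftrightarrow> P 1 \<and> P 2 \<and> P 3 \<and> P 4 \<and> P 5 \<and> P 6"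
proof -
  have "(\<forall>i::6. P i) \<longleftrightarrow> (\<forall>i\<in>UNIV. P i)" by (simp only: ball_UNIV)
  then show ?thesis unfolding UNIV_6 by (simp only: ball_simps simp_thms)
qed

lemma sum_7: "sum f (UNIV :: 7 set) = f 1 + f 2 + f 3 + f 4 + f 5 + f 6 + f 7"
  unfolding UNIV_7 by (simp add: ac_simps)

lemma sum_6: "sum f (UNIV :: 6 set) = f 1 + f 2 + f 3 + f 4 + f 5 + f 6"
  unfolding UNIV_6 by (simp add: ac_simps)

lemma vector_7 [simp]:
  "(vector [a, b, c, d, e, f, g] :: 'a::zero ^ 7) $ 1 = a"
  "(vector [a, b, c, d, e, f, g] :: 'a::zero ^ 7) $ 2 = b"
  "(vector [a, b, c, d, e, f, g] :: 'a::zero ^ 7) $ 3 = c"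
  "(vector [a, b, c, d, e, f, g] :: 'a::zero ^ 7) $ 4 = d"
  "(vector [a, b, c, d, e, f, g] :: 'a::zero ^ 7) $ 5 = e"
  "(vector [a, b, c, d, e, f, g] :: 'a::zero ^ 7) $ 6 = f"
  "(vector [a, b, c, d, e, f, g] :: 'a::zero ^ 7) $ 7 = g"
  unfolding vector_def by simp_all

lemma vector_6 [simp]:
  "(vector [a, b, c, d, e, f] :: 'a::zero ^ 6) $ 1 = a"
  "(vector [a, b, c, d, e, f] :: 'a::zero ^ 6) $ 2 = b"
  "(vector [a, b, c, d, e, f] :: 'a::zero ^ 6) $ 3 = c"
  "(vector [a, b, c, d, e, f] :: 'a::zero ^ 6) $ 4 = d"
  "(vector [a, b, c, d, e, f] :: 'a::zero ^ 6) $ 5 = e"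
  "(vector [a, b, c, d, e, f] :: 'a::zero ^ 6) $ 6 = f"
  unfolding vector_def by simp_all

text \<open>The form counts each edge of the Dynkin diagram in one direction only, so that its parity is
  a bimultiplicative cocycle and its symmetrization is the Cartan matrix.\<close>
definition e7_form :: "7 \<Rightarrow> 7 \<Rightarrow> int" where
  "e7_form i j = (vector
    [vector [ 1,  0,  0,  0,  0,  0,  0],
     vector [ 0,  1,  0,  0,  0,  0,  0],
     vector [-1,  0,  1,  0,  0,  0,  0],
     vector [ 0, -1, -1,  1,  0,  0,  0],
     vector [ 0,  0,  0, -1,  1,  0,  0],
     vector [ 0,  0,  0,  0, -1,  1,  0],
     vector [ 0,  0,  0,  0,  0, -1,  1]] :: int ^ 7 ^ 7) $ i $ j"

lemma e7_form_rows:
  "e7_form 1 j = (vector [ 1,  0,  0,  0,  0,  0,  0] :: int ^ 7) $ j"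
  "e7_form 2 j = (vector [ 0,  1,  0,  0,  0,  0,  0] :: int ^ 7) $ j"
  "e7_form 3 j = (vector [-1,  0,  1,  0,  0,  0,  0] :: int ^ 7) $ j"
  "e7_form 4 j = (vector [ 0, -1, -1,  1,  0,  0,  0] :: int ^ 7) $ j"
  "e7_form 5 j = (vector [ 0,  0,  0, -1,  1,  0,  0] :: int ^ 7) $ j"
  "e7_form 6 j = (vector [ 0,  0,  0,  0, -1,  1,  0] :: int ^ 7) $ j"
  "e7_form 7 j = (vector [ 0,  0,  0,  0,  0, -1,  1] :: int ^ 7) $ j"
  unfolding e7_form_def vector_7 by (rule refl)+

lemma cartan_e7_rows:
  "cartan_e7 $ 1 = vector [ 2,  0, -1,  0,  0,  0,  0]"
  "cartan_e7 $ 2 = vector [ 0,  2,  0, -1,  0,  0,  0]"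
  "cartan_e7 $ 3 = vector [-1,  0,  2, -1,  0,  0,  0]"
  "cartan_e7 $ 4 = vector [ 0, -1, -1,  2, -1,  0,  0]"
  "cartan_e7 $ 5 = vector [ 0,  0,  0, -1,  2, -1,  0]"
  "cartan_e7 $ 6 = vector [ 0,  0,  0,  0, -1,  2, -1]"
  "cartan_e7 $ 7 = vector [ 0,  0,  0,  0,  0, -1,  2]"
  unfolding cartan_e7_def by (rule vector_7)+

lemma cartan_g46_rows:
  "cartan_g46 $ 1 = vector [ 2,  0, -1,  0,  0,  0]"
  "cartan_g46 $ 2 = vector [ 0,  0, -1,  0,  0,  0]"
  "cartan_g46 $ 3 = vector [-1, -1,  2, -1,  0,  0]"
  "cartan_g46 $ 4 = vector [ 0,  0, -1,  2, -1,  0]"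
  "cartan_g46 $ 5 = vector [ 0,  0,  0, -1,  2, -1]"
  "cartan_g46 $ 6 = vector [ 0,  0,  0,  0, -1,  2]"
  unfolding cartan_g46_def by (rule vector_6)+

lemma e7_form_cartan: "e7_form i j + e7_form j i = cartan_e7 $ i $ j"
proof -
  have "\<forall>i j. e7_form i j + e7_form j i = cartan_e7 $ i $ j"
    unfolding forall_7 cartan_e7_rows e7_form_rows vector_7 by simp
  then show ?thesis by blast
qed

lemma sum_e7_form:
  fixes x :: "7 \<Rightarrow> int"
  shows "(\<Sum>j\<in>UNIV. x j * e7_form 1 j) = x 1"
    "(\<Sum>j\<in>UNIV. x j * e7_form 2 j) = x 2"
    "(\<Sum>j\<in>UNIV. x j * e7_form 3 j) = x 3 - x 1"
    "(\<Sum>j\<in>UNIV. x j * e7_form 4 j) = x 4 - x 2 - x 3"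
    "(\<Sum>j\<in>UNIV. x j * e7_form 5 j) = x 5 - x 4"
    "(\<Sum>j\<in>UNIV. x j * e7_form 6 j) = x 6 - x 5"
    "(\<Sum>j\<in>UNIV. x j * e7_form 7 j) = x 7 - x 6"
  unfolding sum_7 e7_form_rows vector_7 by simp_all

lemma lform_e7: "lform e7_form a a = a$1 * a$1 + a$2 * a$2 + (a$3 * a$3 - a$3 * a$1) +
    (a$4 * a$4 - a$4 * a$2 - a$4 * a$3) + (a$5 * a$5 - a$5 * a$4) + (a$6 * a$6 - a$6 * a$5) +
    (a$7 * a$7 - a$7 * a$6)"
  unfolding lform_def by (subst sum_7) (simp only: sum_e7_form)

lemma e7_posdef:
  fixes a :: "int ^ 7"
  assumes "a \<noteq> 0"
  shows "lform e7_form a a > 0"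
proof (rule ccontr)
  assume "\<not> lform e7_form a a > 0"
  \<comment> \<open>Completing squares along the three arms of the Dynkin diagram, from their ends
    to the branch node 4. The factor 24 clears denominators, and 24 - 8 - 6 - 9 = 1 is left for the
    square at node 4.\<close>
  moreover have "24 * lform e7_form a a = 6 * (2 * a$1 - a$3)\<^sup>2 + 2 * (3 * a$3 - 2 * a$4)\<^sup>2 +
      6 * (2 * a$2 - a$4)\<^sup>2 + 6 * (2 * a$7 - a$6)\<^sup>2 + 2 * (3 * a$6 - 2 * a$5)\<^sup>2 +
      (4 * a$5 - 3 * a$4)\<^sup>2 + (a$4)\<^sup>2"
    unfolding lform_e7 power2_eq_square
    by (simp only: ring_distribs) (simp only: mult.assoc mult.commute mult.left_commute)
  ultimately have sum: "6 * (2 * a$1 - a$3)\<^sup>2 + 2 * (3 * a$3 - 2 * a$4)\<^sup>2 +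
      6 * (2 * a$2 - a$4)\<^sup>2 + 6 * (2 * a$7 - a$6)\<^sup>2 + 2 * (3 * a$6 - 2 * a$5)\<^sup>2 +
      (4 * a$5 - 3 * a$4)\<^sup>2 + (a$4)\<^sup>2 \<le> 0" by linarith
  note nonneg = zero_le_power2[of "2 * a$1 - a$3"] zero_le_power2[of "3 * a$3 - 2 * a$4"]
    zero_le_power2[of "2 * a$2 - a$4"] zero_le_power2[of "2 * a$7 - a$6"]
    zero_le_power2[of "3 * a$6 - 2 * a$5"] zero_le_power2[of "4 * a$5 - 3 * a$4"] zero_le_power2[of "a$4"]
  have "(2 * a$1 - a$3)\<^sup>2 = 0" "(3 * a$3 - 2 * a$4)\<^sup>2 = 0" "(2 * a$2 - a$4)\<^sup>2 = 0"
    "(2 * a$7 - a$6)\<^sup>2 = 0" "(3 * a$6 - 2 * a$5)\<^sup>2 = 0" "(4 * a$5 - 3 * a$4)\<^sup>2 = 0" "(a$4)\<^sup>2 = 0"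
    using sum nonneg by linarith+
  then have "a$4 = 0 \<and> a$5 = 0 \<and> a$3 = 0 \<and> a$6 = 0 \<and> a$7 = 0 \<and> a$2 = 0 \<and> a$1 = 0" by simp
  then have "a = 0" by (simp add: vec_eq_iff forall_7)
  then show False using assms by simp
qed

lemma root_lattice_e7: "root_lattice e7_form"
proof
  have "\<forall>i. e7_form i i = 1" unfolding forall_7 e7_form_rows vector_7 by simp
  then show "e7_form i i = 1" for i by blast
  have "\<forall>i j. i \<noteq> j \<longrightarrow> e7_form i j + e7_form j i \<le> 0"
    unfolding forall_7 e7_form_rows vector_7 by simp
  then show "e7_form i j + e7_form j i \<le> 0" if "i \<noteq> j" for i j
    using that by blast
qed (rule e7_posdef)

section \<open>Ranks of the two Cartan matrices in characteristic 3\<close>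

lemma rank_full:
  fixes A :: "'k::field ^ 'n::finite ^ 'n"
  assumes "\<And>v. A *v v = 0 \<Longrightarrow> v = 0"
  shows "rank A = CARD('n)"
proof -
  have "inj ((*v) A)"
    using assms by (simp add: vec.linear_inj_iff_eq_0)
  then have "\<exists>B. B ** A = mat 1" by (simp add: matrix_left_invertible_injective)
  then have "vec.span (rows A) = UNIV" by (simp add: matrix_left_invertible_span_rows_gen)
  then have "vec.dim (rows A) = vec.dim (UNIV :: ('k ^ 'n) set)" by (metis vec.dim_span)
  then show ?thesis by (simp only: row_rank_def_gen vec_dim_card)
qed

lemma rank_e7:
  assumes "(2 :: 'k::field) = - 1"
  shows "rank (\<chi> i j. of_int (cartan_e7 $ i $ j) :: 'k ^ 7 ^ 7) = CARD(7)"
proof (rule rank_full)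
  fix v :: "'k ^ 7"
  assume "(\<chi> i j. of_int (cartan_e7 $ i $ j) :: 'k ^ 7 ^ 7) *v v = 0"
  then have "\<forall>i. (\<Sum>j\<in>UNIV. of_int (cartan_e7 $ i $ j) * v $ j) = 0"
    by (simp add: matrix_vector_mult_def vec_eq_iff)
  then have "- v$1 - v$3 = 0 \<and> - v$2 - v$4 = 0 \<and> - v$1 - v$3 - v$4 = 0 \<and>
    - v$2 - v$3 - v$4 - v$5 = 0 \<and> - v$4 - v$5 - v$6 = 0 \<and> - v$5 - v$6 - v$7 = 0 \<and> - v$6 - v$7 = 0"
    unfolding forall_7 sum_7 by (simp (no_asm_use) add: cartan_e7_rows assms)
  then have e: "- v$1 - v$3 = 0" "- v$2 - v$4 = 0" "- v$1 - v$3 - v$4 = 0"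
    "- v$2 - v$3 - v$4 - v$5 = 0" "- v$4 - v$5 - v$6 = 0" "- v$5 - v$6 - v$7 = 0" "- v$6 - v$7 = 0"
    by - (elim conjE, assumption)+
  have "v$4 = 0" using e(1,3) by simp
  moreover from this have "v$2 = 0" using e(2) by simp
  moreover have "v$5 = 0"
  proof -
    \<comment> \<open>Row 7 minus row 6.\<close>
    have "v$5 = (- v$6 - v$7) - (- v$5 - v$6 - v$7)" by simp
    then show ?thesis unfolding e(6,7) by simp
  qed
  ultimately have "v$3 = 0" "v$6 = 0" using e(4,5) by simp_all
  then have "v$1 = 0" "v$7 = 0" using e(1,7) by simp_all
  then show "v = 0" using \<open>v$4 = 0\<close> \<open>v$2 = 0\<close> \<open>v$5 = 0\<close> \<open>v$3 = 0\<close> \<open>v$6 = 0\<close>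
    by (simp add: vec_eq_iff forall_7)
qed

lemma rank_g46:
  assumes "(2 :: 'k::field) = - 1"
  shows "rank (\<chi> i j. of_int (cartan_g46 $ i $ j) :: 'k ^ 6 ^ 6) = CARD(6)"
proof (rule rank_full)
  fix v :: "'k ^ 6"
  assume "(\<chi> i j. of_int (cartan_g46 $ i $ j) :: 'k ^ 6 ^ 6) *v v = 0"
  then have "\<forall>i. (\<Sum>j\<in>UNIV. of_int (cartan_g46 $ i $ j) * v $ j) = 0"
    by (simp add: matrix_vector_mult_def vec_eq_iff)
  then have "- v$1 - v$3 = 0 \<and> v$3 = 0 \<and> - v$1 - v$2 - v$3 - v$4 = 0 \<and>
    - v$3 - v$4 - v$5 = 0 \<and> - v$4 - v$5 - v$6 = 0 \<and> - v$5 - v$6 = 0"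
    unfolding forall_6 sum_6 by (simp (no_asm_use) add: cartan_g46_rows assms)
  then have e: "- v$1 - v$3 = 0" "v$3 = 0" "- v$1 - v$2 - v$3 - v$4 = 0"
    "- v$3 - v$4 - v$5 = 0" "- v$4 - v$5 - v$6 = 0" "- v$5 - v$6 = 0"
    by - (elim conjE, assumption)+
  have "v$1 = 0" using e(1,2) by simp
  moreover have "v$6 = 0"
  proof -
    \<comment> \<open>Row 4 minus row 5 is v_6 - v_3.\<close>
    have "v$6 = (- v$3 - v$4 - v$5) + v$3 - (- v$4 - v$5 - v$6)" by simp
    then have "v$6 = 0 + v$3 - 0" by (simp only: e(4,5))
    then show ?thesis using e(2) by simp
  qed
  moreover from this have "v$5 = 0" using e(6) by simp
  moreover from this have "v$4 = 0" using e(2,4) by simp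
  ultimately show "v = 0" using e(2,3) by (simp add: vec_eq_iff forall_6)
qed

definition e7_node :: "6 \<Rightarrow> 7" where
  "e7_node j = (vector [2, 3, 4, 5, 6, 7] :: 7 ^ 6) $ j"

lemma e7_node_simps [simp]: "e7_node 1 = 2" "e7_node 2 = 3" "e7_node 3 = 4" "e7_node 4 = 5"
  "e7_node 5 = 6" "e7_node 6 = 7"
  by (simp_all add: e7_node_def)

text \<open>Node 1 is an end of the E7 diagram with single neighbour 3, which is
  \<open>e7_node 2\<close>. Hence the odd index 2.\<close>

lemma reduction_nodes_e7:
  assumes "CHAR('k::field) = 3"
  shows "reduction_nodes TYPE('k) e7_form 1 e7_node 2"
proof -
  interpret red: root_reduction e7_form 1 "TYPE('k)"
    by (intro root_reduction.intro root_lattice_e7 root_reduction_axioms.intro assms)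
  show ?thesis
  proof (intro reduction_nodes.intro red.root_reduction_axioms reduction_nodes_axioms.intro)
    have "\<forall>i j. e7_node i = e7_node j \<longrightarrow> i = j" unfolding forall_6 by simp
    then show "inj e7_node" by (simp add: inj_def)
    show "range e7_node = - {1}" unfolding UNIV_6 Compl_eq_Diff_UNIV UNIV_7 by auto
    have "\<forall>j. red.ip red.th (axis (e7_node j) 1) = (if j = 2 then - 1 else 0)"
      unfolding forall_6 red.th_def red.ip_axis e7_node_simps e7_form_rows vector_7 by simp
    then show "red.ip red.th (axis (e7_node j) 1) = (if j = 2 then - 1 else 0)" for j by blast
  qed
qed

text \<open>The correction term is nonzero only at the index pair (2, 2), where it turns 2 into 3;
  elsewhere the two sides agree as integers.\<close>

lemma g46_entries:
  assumes "CHAR('k::field) = 3"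
  shows "(of_int (cartan_g46 $ i $ j) :: 'k) =
    of_int (root_lattice.ip e7_form (axis (e7_node i) 1) (axis (e7_node j) 1) +
      root_lattice.ip e7_form (axis (e7_node i) 1) (axis 1 1) * root_lattice.ip e7_form (axis 1 1) (axis (e7_node j) 1))"
proof -
  have "\<forall>i j. 3 dvd cartan_g46 $ i $ j - (root_lattice.ip e7_form (axis (e7_node i) 1) (axis (e7_node j) 1) +
      root_lattice.ip e7_form (axis (e7_node i) 1) (axis 1 1) * root_lattice.ip e7_form (axis 1 1) (axis (e7_node j) 1))"
    unfolding forall_6 root_lattice.ip_axis[OF root_lattice_e7] cartan_g46_rows vector_6 e7_node_simps e7_form_rows vector_7 by simp
  then have "(of_int (cartan_g46 $ i $ j - (root_lattice.ip e7_form (axis (e7_node i) 1) (axis (e7_node j) 1) +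
      root_lattice.ip e7_form (axis (e7_node i) 1) (axis 1 1) * root_lattice.ip e7_form (axis 1 1) (axis (e7_node j) 1))) :: 'k) = 0"
    using of_int_eq_0_iff_dvd[OF assms] by blast
  then show ?thesis by simp
qed

theorem corollary4p5p3:
  fixes R :: "('k::alg_closed_field, 'h::ab_group_add, 7) realization"
    and S :: "('k, 'u::ab_group_add, 6) realization"
  assumes "CHAR('k) = 3"
    and "is_realization cartan_e7 R"
    and "is_realization cartan_g46 S"
  shows "lie_algebra_in_Rep_alpha3 (contragredient (\<lambda>_. False) R)
           (ad (contragredient (\<lambda>_. False) R) (chevalley_e (\<lambda>_. False) R 1)) \<and>
         semisimplification (contragredient (\<lambda>_. False) R)
           (ad (contragredient (\<lambda>_. False) R) (chevalley_e (\<lambda>_. False) R 1))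
         \<cong>\<^sub>s contragredient (\<lambda>i. i = 2) S"
proof -
  interpret red: reduction_nodes e7_form 1 "TYPE('k)" e7_node 2
    by (rule reduction_nodes_e7[OF assms(1)])
  obtain c7 :: "'h \<Rightarrow> 7 \<Rightarrow> 'k" where c7:
    "\<And>x y i. c7 (x + y) i = c7 x i + c7 y i" "\<And>c x i. c7 (hscale R c x) i = c * c7 x i"
    "inj c7" "surj c7" "\<And>i j. c7 (coroot R i) j = (if i = j then 1 else 0)"
    "\<And>j x. simple_root R j x = (\<Sum>i\<in>UNIV. c7 x i * of_int (cartan_e7 $ i $ j))"
    by (rule realization_coordinates[OF assms(2) rank_e7[OF red.two_eq]]) (rule that)
  obtain c6 :: "'u \<Rightarrow> 6 \<Rightarrow> 'k" where c6:
    "\<And>x y i. c6 (x + y) i = c6 x i + c6 y i" "\<And>c x i. c6 (hscale S c x) i = c * c6 x i"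
    "inj c6" "surj c6" "\<And>i j. c6 (coroot S i) j = (if i = j then 1 else 0)"
    "\<And>j x. simple_root S j x = (\<Sum>i\<in>UNIV. c6 x i * of_int (cartan_g46 $ i $ j))"
    by (rule realization_coordinates[OF assms(3) rank_g46[OF red.two_eq]]) (rule that)
  have "contragredient_model red.lbr (\<lambda>_. False) R (red.gspace UNIV) red.gpart
      (\<lambda>\<beta>. red.gspace {x. red.lwt x = \<beta>}) (\<lambda>x. \<Sum>i\<in>UNIV. single (Hb i) (c7 x i))
      (\<lambda>i. red.EE (axis i 1)) (\<lambda>i. - red.EE (- axis i 1))"
    by (rule red.contragredient_model_lattice[OF assms(1) c7(1-5)])
      (simp only: c7(6) red.ip_axis e7_form_cartan)
  then obtain psi where psi:
    "super_iso psi (contragredient (\<lambda>_. False) R) (model_alg (red.gspace UNIV) red.lbr red.gpart)"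
    "\<And>i. chevalley_e (\<lambda>_. False) R i \<in> carrier (contragredient (\<lambda>_. False) R)"
    "\<And>i. psi (chevalley_e (\<lambda>_. False) R i) = red.EE (axis i 1)"
    by (rule contragredient_model.contragredient_iso) (rule that)
  have "lattice_copy e7_form 1 psi (contragredient (\<lambda>_. False) R) (chevalley_e (\<lambda>_. False) R 1)"
    by (intro lattice_copy.intro red.root_reduction_axioms lattice_copy_axioms.intro psi(1,2))
      (simp only: psi(3) red.th_def)
  then interpret copy: lattice_copy e7_form 1 "TYPE('k)" psi "contragredient (\<lambda>_. False) R"
      "chevalley_e (\<lambda>_. False) R 1" .
  have "contragredient_model red.rbr (\<lambda>i. i = 2) S red.rcarrier red.rpart red.rweight
      (\<lambda>x. red.hmap (c6 x)) (\<lambda>j. red.EE (axis (e7_node j) 1)) red.rf"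
    by (rule red.contragredient_model_reduction[OF c6(1-5)])
      (simp only: c6(6) g46_entries[OF assms(1)] red.th_def)
  then obtain phi where phi:
    "super_iso phi (contragredient (\<lambda>i. i = 2) S) (model_alg red.rcarrier red.rbr red.rpart)"
    by (rule contragredient_model.contragredient_iso) (rule that)
  obtain theta where "super_iso theta (semisimplification (contragredient (\<lambda>_. False) R)
      (ad (contragredient (\<lambda>_. False) R) (chevalley_e (\<lambda>_. False) R 1)))
      (model_alg red.rcarrier red.rbr red.rpart)"
    by (rule copy.semisimplification_iso) (rule that)
  \<comment> \<open>Both superalgebras have been identified with the same model on
    \<open>red.rcarrier\<close>.\<close>
  from copy.lie_algebra_in_Rep super_iso_comp[OF this phi] show ?thesis by (rule conjI)
qed

end
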